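(* For $(k,s)\in(0,\infty)^2$ let $z=k/s$ and set $u(z):=v(1,k/s)$. Then $u\in\mathcal A_1^+$ and $u$ is the unique solution (in $\mathcal A_1^+$) of $u=\tilde\Gamma u$, i.e. of $$u(z)=\sup_{\tau\in\mathcal T}\mathsf E_z\left[e^{-(r-\mu_1)\tau}\max\{1,(\Pi u)(Z_\tau)\}\right],\qquad z>0.$$
   Context: $B^1,B^2$ are independent Brownian motions on $(\Omega,\mathcal F,\mathsf P)$, $\mathbb F$ their completed natural filtration, $\mathcal T$ the set of $\mathbb F$-stopping times with values in $[0,\infty]$. Constants: $\mu_1,\mu_2\in\mathbb R$, $\sigma_1,\sigma_2>0$, $\nu\in[-1,1]$, $p\in(0,1)$, $r>0$ with $r>\mu_i+\sigma_i^2/2$ for $i=1,2$. $F$ is the cumulative distribution function of a non-negative random variable (integrals against $F(\mathrm dt)$ include a possible atom at $0$). $$\mathrm dS_t=\mu_1S_t\,\mathrm dt+\sigma_1S_t\,\mathrm dB^1_t,\ S_0=s>0;\qquad \mathrm dK_t=\mu_2K_t\,\mathrm dt+\sigma_2K_t(\nu\,\mathrm dB^1_t+\sqrt{1-\nu^2}\,\mathrm dB^2_t),\ K_0=k>0.$$ For $m=1,2$, $\mathcal A_m^+$ is the set of continuous $f:(0,\infty)^m\to[0,\infty)$ with $\|f\|^2_{\mathcal A_m^+}=\sup_{x\in(0,\infty)^m}|f(x)|^2/(1+|x|^2)<\infty$ ($|\cdot|$ Euclidean norm). For $f\in\mathcal A_2^+$ let $(\Lambda f)(s,k)=\int_0^\infty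 e^{-rt}\mathsf E_{s,k}[p(S_t+K_t)+(1-p)f(S_t,K_t)]F(\mathrm dt)$. $v$ denotes the unique function in $\mathcal A_2^+$ (it exists) with $$v(s,k)=\sup_{\tau\in\mathcal T}\mathsf E_{s,k}[e^{-r\tau}\max\{S_\tau,(\Lambda v)(S_\tau,K_\tau)\}].$$ Let $\beta_1=\sigma_2\nu-\sigma_1$, $\beta_2=\sigma_2\sqrt{1-\nu^2}$, assume $\beta_1^2+\beta_2^2>0$, let $\tilde B=(\beta_1B^1+\beta_2B^2)/\sqrt{\beta_1^2+\beta_2^2}$ and let $Z$ solve $\mathrm dZ_t=(\mu_2-\mu_1)Z_t\,\mathrm dt+\sqrt{\beta_1^2+\beta_2^2}\,Z_t\,\mathrm d\tilde B_t$, with $Z_0=z>0$ under $\mathsf P_z$. For $g\in\mathcal A_1^+$, $$(\Pi g)(z)=\int_0^\infty e^{-(r-\mu_1)t}\mathsf E_z[p(1+Z_t)+(1-p)g(Z_t)]F(\mathrm dt),\qquad(\tilde\Gamma g)(z)=\sup_{\tau\in\mathcal T}\mathsf E_z[e^{-(r-\mu_1)\tau}\max\{1,(\Pi g)(Z_\tau)\}].$$ Discounted payoffs are taken to be $0$ on $\{\tau=\infty\}$ (this coincides with their $\limsup$ as $t\to\infty$). *)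

theory Defs
  imports "HOL-Probability.Probability"
begin

section \<open>Brownian motion and its completed filtration\<close>

text \<open>Processes are indexed by real numbers; only times \<open>t \<ge> 0\<close> are ever used.\<close>

definition brownian_motion :: "'a measure \<Rightarrow> (real \<Rightarrow> 'a \<Rightarrow> real) \<Rightarrow> bool" where
  "brownian_motion M B \<longleftrightarrow>
     (\<forall>t\<ge>0. B t \<in> borel_measurable M) \<and>
     (AE \<omega> in M. B 0 \<omega> = 0) \<and>
     (\<forall>s t. 0 \<le> s \<and> s < t \<longrightarrow>
        distributed M lborel (\<lambda>\<omega>. B t \<omega> - B s \<omega>) (normal_density 0 (sqrt (t - s)))) \<and>
     (\<forall>(n::nat) (p::nat \<Rightarrow> real). 0 \<le> p 0 \<and> mono p \<longrightarrow>
        prob_space.indep_vars M (\<lambda>_. borel) (\<lambda>i \<omega>. B (p (Suc i)) \<omega> - B (p i) \<omega>) {..<n}) \<and>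
     (AE \<omega> in M. continuous_on {0..} (\<lambda>t. B t \<omega>))"

definition independent_processes ::
    "'a measure \<Rightarrow> (real \<Rightarrow> 'a \<Rightarrow> real) \<Rightarrow> (real \<Rightarrow> 'a \<Rightarrow> real) \<Rightarrow> bool" where
  "independent_processes M X Y \<longleftrightarrow>
     prob_space.indep_var M
       (Pi\<^sub>M {0..} (\<lambda>_. borel)) (\<lambda>\<omega>. \<lambda>t\<in>{0..}. X t \<omega>)
       (Pi\<^sub>M {0..} (\<lambda>_. borel)) (\<lambda>\<omega>. \<lambda>t\<in>{0..}. Y t \<omega>)"

text \<open>The filtration is indexed by \<open>[0,\<infinity>]\<close>, so that \<open>stopping_time\<close> applies directly to times
  with values in \<open>[0,\<infinity>]\<close>; at \<open>\<infinity>\<close> it is generated by the whole paths. Completing means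
  adjoining all subsets of null events, which is why the expectations below are taken
  with respect to \<open>completion M\<close>.\<close>

definition completed_filtration ::
    "'a measure \<Rightarrow> (real \<Rightarrow> 'a \<Rightarrow> real) \<Rightarrow> (real \<Rightarrow> 'a \<Rightarrow> real) \<Rightarrow> ennreal \<Rightarrow> 'a measure" where
  "completed_filtration M B1 B2 t = sigma (space M)
     ({B1 u -` A \<inter> space M | u A. 0 \<le> u \<and> ennreal u \<le> t \<and> A \<in> sets borel} \<union>
      {B2 u -` A \<inter> space M | u A. 0 \<le> u \<and> ennreal u \<le> t \<and> A \<in> sets borel} \<union>
      null_sets (completion M))"

section \<open>Ito integral and stochastic differential equations\<close>

text \<open>A simple integrand \<open>(n, p, \<xi>)\<close> stands for the process
  \<open>\<Sum>i<n. \<xi>\<^sub>i 1\<^bsub>(p\<^sub>i, p\<^sub>i\<^sub>+\<^sub>1]\<^esub>\<close> with \<open>\<xi>\<^sub>i\<close> bounded and known at time \<open>p\<^sub>i\<close>.\<close>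

definition simple_integrand ::
    "(ennreal \<Rightarrow> 'a measure) \<Rightarrow> nat \<Rightarrow> (nat \<Rightarrow> real) \<Rightarrow> (nat \<Rightarrow> 'a \<Rightarrow> real) \<Rightarrow> bool" where
  "simple_integrand \<FF> n p \<xi> \<longleftrightarrow>
     0 \<le> p 0 \<and> (\<forall>i<n. p i \<le> p (Suc i)) \<and>
     (\<forall>i<n. \<xi> i \<in> borel_measurable (\<FF> (ennreal (p i))) \<and>
            (\<exists>C. \<forall>\<omega>\<in>space (\<FF> (ennreal (p i))). \<bar>\<xi> i \<omega>\<bar> \<le> C))"

definition simple_process ::
    "nat \<Rightarrow> (nat \<Rightarrow> real) \<Rightarrow> (nat \<Rightarrow> 'a \<Rightarrow> real) \<Rightarrow> real \<Rightarrow> 'a \<Rightarrow> real" where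
  "simple_process n p \<xi> u \<omega> = (\<Sum>i<n. \<xi> i \<omega> * indicator {p i<..p (Suc i)} u)"

definition simple_integral ::
    "(real \<Rightarrow> 'a \<Rightarrow> real) \<Rightarrow> nat \<Rightarrow> (nat \<Rightarrow> real) \<Rightarrow> (nat \<Rightarrow> 'a \<Rightarrow> real) \<Rightarrow> real \<Rightarrow> 'a \<Rightarrow> real" where
  "simple_integral W n p \<xi> t \<omega> =
     (\<Sum>i<n. \<xi> i \<omega> * (W (min t (p (Suc i))) \<omega> - W (min t (p i)) \<omega>))"

definition vanishes_in_probability :: "'a measure \<Rightarrow> (nat \<Rightarrow> 'a \<Rightarrow> ennreal) \<Rightarrow> bool" where
  "vanishes_in_probability M D \<longleftrightarrow>
     (\<forall>j. D j \<in> borel_measurable (completion M)) \<and>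
     (\<forall>\<epsilon>>0. (\<lambda>j. emeasure (completion M) {\<omega> \<in> space M. ennreal \<epsilon> < D j \<omega>}) \<longlonglongrightarrow> 0)"

text \<open>\<open>I = \<integral>\<^sub>0\<^sup>t H dW\<close> as the limit in probability of the integrals of simple integrands that
  approximate \<open>H\<close> in \<open>L\<^sup>2([0,t])\<close> in probability. \<open>W\<close> is meant to be a Brownian motion with
  respect to the filtration.\<close>

definition has_ito_integral ::
    "'a measure \<Rightarrow> (ennreal \<Rightarrow> 'a measure) \<Rightarrow> (real \<Rightarrow> 'a \<Rightarrow> real) \<Rightarrow>
     (real \<Rightarrow> 'a \<Rightarrow> real) \<Rightarrow> real \<Rightarrow> ('a \<Rightarrow> real) \<Rightarrow> bool" where
  "has_ito_integral M \<FF> W H t I \<longleftrightarrow>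
     (\<exists>n p \<xi>. (\<forall>j. simple_integrand \<FF> (n j) (p j) (\<xi> j)) \<and>
       vanishes_in_probability M
         (\<lambda>j \<omega>. \<integral>\<^sup>+u\<in>{0..t}. ennreal ((simple_process (n j) (p j) (\<xi> j) u \<omega> - H u \<omega>)\<^sup>2) \<partial>lborel) \<and>
       vanishes_in_probability M
         (\<lambda>j \<omega>. ennreal \<bar>simple_integral W (n j) (p j) (\<xi> j) t \<omega> - I \<omega>\<bar>))"

text \<open>\<open>X\<close> is a strong solution of \<open>dX\<^sub>t = a(X\<^sub>t) dt + b(X\<^sub>t) dW\<^sub>t\<close>, \<open>X\<^sub>0 = x\<close>.\<close>

definition solves_SDE ::
    "'a measure \<Rightarrow> (ennreal \<Rightarrow> 'a measure) \<Rightarrow> (real \<Rightarrow> 'a \<Rightarrow> real) \<Rightarrow>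
     (real \<Rightarrow> real) \<Rightarrow> (real \<Rightarrow> real) \<Rightarrow> real \<Rightarrow> (real \<Rightarrow> 'a \<Rightarrow> real) \<Rightarrow> bool" where
  "solves_SDE M \<FF> W a b x X \<longleftrightarrow>
     (\<forall>t\<ge>0. X t \<in> borel_measurable (\<FF> (ennreal t))) \<and>
     (AE \<omega> in M. continuous_on {0..} (\<lambda>t. X t \<omega>)) \<and>
     (AE \<omega> in M. X 0 \<omega> = x) \<and>
     (\<forall>t\<ge>0. \<exists>I. has_ito_integral M \<FF> W (\<lambda>u \<omega>. b (X u \<omega>)) t I \<and>
        (AE \<omega> in M. set_integrable lborel {0..t} (\<lambda>u. a (X u \<omega>)) \<and>
           X t \<omega> = x + (LBINT u:{0..t}. a (X u \<omega>)) + I \<omega>))"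

section \<open>The optimal stopping problems\<close>

definition positive_orthant :: "'v::euclidean_space set" where
  "positive_orthant = {x. \<forall>b\<in>Basis. 0 < x \<bullet> b}"

text \<open>The class \<open>\<A>\<^sub>m\<^sup>+\<close>, at type \<^typ>\<open>real\<close> for \<open>m = 1\<close> and \<^typ>\<open>real \<times> real\<close> for \<open>m = 2\<close>. Functions are
  total, but only their values on the positive orthant matter.\<close>

definition A_plus :: "('v::euclidean_space \<Rightarrow> real) set" where
  "A_plus = {f. continuous_on positive_orthant f \<and> (\<forall>x\<in>positive_orthant. 0 \<le> f x) \<and>
                bdd_above ((\<lambda>x. \<bar>f x\<bar>\<^sup>2 / (1 + (norm x)\<^sup>2)) ` positive_orthant)}"

text \<open>All payoffs are nonnegative, so expectations, integrals and suprema are taken in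
  \<^typ>\<open>ennreal\<close>. Processes carry their starting point as first argument: an expectation
  \<open>E\<^sub>s\<^sub>,\<^sub>k\<close> of a functional of the processes is the expectation of that functional of the
  solutions \<open>S s\<close> and \<open>K k\<close> started at \<open>s\<close> and \<open>k\<close>.\<close>

definition Lambda_op ::
    "'a measure \<Rightarrow> (real \<Rightarrow> real) \<Rightarrow> real \<Rightarrow> real \<Rightarrow> (real \<Rightarrow> real \<Rightarrow> 'a \<Rightarrow> real) \<Rightarrow>
     (real \<Rightarrow> real \<Rightarrow> 'a \<Rightarrow> real) \<Rightarrow> (real \<times> real \<Rightarrow> real) \<Rightarrow> real \<times> real \<Rightarrow> ennreal" where
  "Lambda_op M F p r S K f = (\<lambda>(s, k).
     \<integral>\<^sup>+t\<in>{0..}. ennreal (exp (- r * t)) *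
       (\<integral>\<^sup>+\<omega>. ennreal (p * (S s t \<omega> + K k t \<omega>) + (1 - p) * f (S s t \<omega>, K k t \<omega>)) \<partial>completion M)
       \<partial>interval_measure F)"

definition Gamma_op ::
    "'a measure \<Rightarrow> (ennreal \<Rightarrow> 'a measure) \<Rightarrow> (real \<Rightarrow> real) \<Rightarrow> real \<Rightarrow> real \<Rightarrow>
     (real \<Rightarrow> real \<Rightarrow> 'a \<Rightarrow> real) \<Rightarrow> (real \<Rightarrow> real \<Rightarrow> 'a \<Rightarrow> real) \<Rightarrow>
     (real \<times> real \<Rightarrow> real) \<Rightarrow> real \<times> real \<Rightarrow> ennreal" where
  "Gamma_op M \<FF> F p r S K f = (\<lambda>(s, k).
     SUP \<tau>\<in>{\<tau>. stopping_time \<FF> \<tau>}.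
       \<integral>\<^sup>+\<omega>. (if \<tau> \<omega> = \<infinity> then 0 else
          let t = enn2real (\<tau> \<omega>) in
          ennreal (exp (- r * t)) *
            max (ennreal (S s t \<omega>)) (Lambda_op M F p r S K f (S s t \<omega>, K k t \<omega>)))
          \<partial>completion M)"

definition Pi_op ::
    "'a measure \<Rightarrow> (real \<Rightarrow> real) \<Rightarrow> real \<Rightarrow> real \<Rightarrow> real \<Rightarrow> (real \<Rightarrow> real \<Rightarrow> 'a \<Rightarrow> real) \<Rightarrow>
     (real \<Rightarrow> real) \<Rightarrow> real \<Rightarrow> ennreal" where
  "Pi_op M F p r \<mu>\<^sub>1 Z g z =
     (\<integral>\<^sup>+t\<in>{0..}. ennreal (exp (- (r - \<mu>\<^sub>1) * t)) *
       (\<integral>\<^sup>+\<omega>. ennreal (p * (1 + Z z t \<omega>) + (1 - p) * g (Z z t \<omega>)) \<partial>completion M)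
       \<partial>interval_measure F)"

definition Gamma_tilde_op ::
    "'a measure \<Rightarrow> (ennreal \<Rightarrow> 'a measure) \<Rightarrow> (real \<Rightarrow> real) \<Rightarrow> real \<Rightarrow> real \<Rightarrow> real \<Rightarrow>
     (real \<Rightarrow> real \<Rightarrow> 'a \<Rightarrow> real) \<Rightarrow> (real \<Rightarrow> real) \<Rightarrow> real \<Rightarrow> ennreal" where
  "Gamma_tilde_op M \<FF> F p r \<mu>\<^sub>1 Z g z =
     (SUP \<tau>\<in>{\<tau>. stopping_time \<FF> \<tau>}.
       \<integral>\<^sup>+\<omega>. (if \<tau> \<omega> = \<infinity> then 0 else
          let t = enn2real (\<tau> \<omega>) in
          ennreal (exp (- (r - \<mu>\<^sub>1) * t)) * max 1 (Pi_op M F p r \<mu>\<^sub>1 Z g (Z z t \<omega>)))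
          \<partial>completion M)"

end

theory Submission
  imports Defs
begin

text \<open>Everything reduces to the scaling relation
  \<open>\<Gamma> w (s, k) = s \<Gamma>\<^sup>~ g (k / s)\<close> for \<open>w (s, k) = s g (k / s)\<close>, where \<open>\<Gamma>\<close> and \<open>\<Gamma>\<^sup>~\<close> are the
  operators of the two stopping problems. Given this relation, \<open>u\<close> and any other fixed point of
  \<open>\<Gamma>\<^sup>~\<close> lift to fixed points of \<open>\<Gamma>\<close>, so they agree by uniqueness of \<open>v\<close>; and \<open>v\<close> is homogeneous of
  degree one, again by uniqueness, because \<open>\<Gamma>\<close> commutes with scaling.

  The paper's change of measure is avoided, since on the infinite horizon it would need a new measure
  on path space. Instead both problems are seen to be governed by the same one-dimensional transition
  kernel: under the weight \<open>exp (- r t) S\<^sub>t\<close> the ratio \<open>K / S\<close> moves by the law that \<open>Z\<close> has under the weight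
  \<open>exp (- (r - \<mu>\<^sub>1) t)\<close>, by a shift of a Gaussian density over each time step. The value of a weighted
  Markovian stopping problem with lower semicontinuous reward is the limit of Bellman recursions on
  dyadic grids (Fatou's lemma for stopping times rounded up to the grid), hence depends on the kernel
  only.

  Explicit formulas for \<open>S\<close>, \<open>K\<close>, \<open>Z\<close> come from uniqueness for linear equations: for a solution \<open>X\<close>
  and \<open>E\<^sub>t = exp (- b W\<^sub>t - (a - b\<^sup>2 / 2) t)\<close>, the increments of \<open>X E\<close> along a fine partition sum up to
  a quantity that vanishes in probability.\<close>

section \<open>A gauge for convergence in probability\<close>

text \<open>Three obstacles shape the proof. First, the Ito integral is given separately for each
  time, with its own approximating simple integrands, and no moments of the solutions are known. So
  every estimate is made in probability, after \<open>X\<close> and \<open>E\<close> have been cut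
  at a level \<open>C\<close>, and four limits follow each other: approximating integrands, mesh, a
  Young parameter \<open>\<kappa>\<close>, and \<open>C\<close>. Second, \<open>K / S\<close> and
  \<open>Z\<close> do not have the same law under the given measure, so payoffs cannot be matched
  stopping time by stopping time; only the values can be compared. The reward contains the integral
  operator applied to a function that is merely continuous with linear growth. Fatou's lemma makes
  it lower semicontinuous without any domination, and rounding up needs no more than that. Third,
  the relation between the two operators is available only for homogeneous \<open>w\<close>.
  Homogeneity of \<open>v\<close> must therefore come first, from a scaling law of the
  two-dimensional operator that is proved on paths for arbitrary functions.\<close>

text \<open>An outer expectation, so that no measurability of \<open>f\<close> has to be known; it is capped at \<open>1\<close>.\<close>

definition outer_mean :: "'a measure \<Rightarrow> ('a \<Rightarrow> ennreal) \<Rightarrow> real" where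
  "outer_mean N f = enn2real (INF g\<in>{g \<in> borel_measurable N. AE \<omega> in N. f \<omega> \<le> g \<omega>}. \<integral>\<^sup>+\<omega>. min 1 (g \<omega>) \<partial>N)"

lemma min_one_add_le: "min 1 (x + y) \<le> min 1 x + min 1 (y::ennreal)"
  by (cases "x \<le> 1"; cases "y \<le> 1") (auto simp: min_def add_increasing add_increasing2)

lemma min_one_cmult_le:
  assumes "1 \<le> C" shows "min 1 (ennreal C * y) \<le> ennreal C * min 1 y"
proof (cases "y \<le> 1")
  case False
  have "1 \<le> ennreal C" using assms by (simp add: ennreal_ge_1)
  moreover have "min 1 y = 1" using False by (auto simp: min_def)
  ultimately show ?thesis by (auto intro: order_trans[OF min.cobounded1])
qed (auto simp: min_def)

context prob_space
begin

lemma ennreal_outer_mean: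
  "ennreal (outer_mean M f) = (INF g\<in>{g \<in> borel_measurable M. AE \<omega> in M. f \<omega> \<le> g \<omega>}. \<integral>\<^sup>+\<omega>. min 1 (g \<omega>) \<partial>M)"
proof -
  have "(INF g\<in>{g \<in> borel_measurable M. AE \<omega> in M. f \<omega> \<le> g \<omega>}. \<integral>\<^sup>+\<omega>. min 1 (g \<omega>) \<partial>M) \<le> 1"
    by (rule INF_lower2[of "\<lambda>_. \<top>"]) (auto simp: emeasure_space_1)
  then show ?thesis unfolding outer_mean_def by (intro ennreal_enn2real) (auto simp: le_less_trans)
qed

lemma outer_mean_nonneg [simp]: "0 \<le> outer_mean M f"
  by (simp add: outer_mean_def)

lemma outer_mean_le1: "outer_mean M f \<le> 1"
proof -
  have "ennreal (outer_mean M f) \<le> 1"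
    unfolding ennreal_outer_mean by (rule INF_lower2[of "\<lambda>_. \<top>"]) (auto simp: emeasure_space_1)
  then show ?thesis by simp
qed

lemma outer_mean_upper:
  assumes "g \<in> borel_measurable M" "AE \<omega> in M. f \<omega> \<le> g \<omega>"
  shows "ennreal (outer_mean M f) \<le> (\<integral>\<^sup>+\<omega>. min 1 (g \<omega>) \<partial>M)"
  unfolding ennreal_outer_mean using assms by (auto intro: INF_lower)

lemma outer_mean_approx:
  assumes "0 < e"
  obtains g where "g \<in> borel_measurable M" "AE \<omega> in M. f \<omega> \<le> g \<omega>"
    "(\<integral>\<^sup>+\<omega>. min 1 (g \<omega>) \<partial>M) < ennreal (outer_mean M f + e)"
proof -
  have "ennreal (outer_mean M f) < ennreal (outer_mean M f + e)"
    using assms by (simp add: ennreal_lessI add_nonneg_pos)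
  then show ?thesis unfolding ennreal_outer_mean INF_less_iff using that by auto
qed

lemma outer_mean_mono:
  assumes "AE \<omega> in M. f \<omega> \<le> f' \<omega>" shows "outer_mean M f \<le> outer_mean M f'"
proof (rule field_le_epsilon)
  fix e :: real assume "0 < e"
  from outer_mean_approx[OF this, of f'] obtain g where g: "g \<in> borel_measurable M" "AE \<omega> in M. f' \<omega> \<le> g \<omega>"
    "(\<integral>\<^sup>+\<omega>. min 1 (g \<omega>) \<partial>M) < ennreal (outer_mean M f' + e)" .
  have "AE \<omega> in M. f \<omega> \<le> g \<omega>" using assms g(2) by eventually_elim (rule order_trans)
  from outer_mean_upper[OF g(1) this] g(3) have "ennreal (outer_mean M f) \<le> ennreal (outer_mean M f' + e)" by order
  then show "outer_mean M f \<le> outer_mean M f' + e" using \<open>0 < e\<close> by (simp add: ennreal_le_iff del: ennreal_plus)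
qed

lemma outer_mean_add: "outer_mean M (\<lambda>\<omega>. f \<omega> + f' \<omega>) \<le> outer_mean M f + outer_mean M f'"
proof (rule field_le_epsilon)
  fix e :: real assume "0 < e"
  then have e: "0 < e/2" by simp
  from outer_mean_approx[OF e, of f] obtain g where g: "g \<in> borel_measurable M" "AE \<omega> in M. f \<omega> \<le> g \<omega>"
    "(\<integral>\<^sup>+\<omega>. min 1 (g \<omega>) \<partial>M) < ennreal (outer_mean M f + e/2)" .
  from outer_mean_approx[OF e, of f'] obtain g' where g': "g' \<in> borel_measurable M" "AE \<omega> in M. f' \<omega> \<le> g' \<omega>"
    "(\<integral>\<^sup>+\<omega>. min 1 (g' \<omega>) \<partial>M) < ennreal (outer_mean M f' + e/2)" .
  have "AE \<omega> in M. f \<omega> + f' \<omega> \<le> g \<omega> + g' \<omega>" using g'(2) g(2) by eventually_elim (rule add_mono)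
  then have "ennreal (outer_mean M (\<lambda>\<omega>. f \<omega> + f' \<omega>)) \<le> (\<integral>\<^sup>+\<omega>. min 1 (g \<omega> + g' \<omega>) \<partial>M)"
    using g g' by (intro outer_mean_upper) auto
  also have "\<dots> \<le> (\<integral>\<^sup>+\<omega>. min 1 (g \<omega>) + min 1 (g' \<omega>) \<partial>M)"
    by (intro nn_integral_mono min_one_add_le)
  also have "\<dots> = (\<integral>\<^sup>+\<omega>. min 1 (g \<omega>) \<partial>M) + (\<integral>\<^sup>+\<omega>. min 1 (g' \<omega>) \<partial>M)"
    using g g' by (intro nn_integral_add) auto
  also have "\<dots> \<le> ennreal (outer_mean M f + e/2) + ennreal (outer_mean M f' + e/2)"
    using g(3) g'(3) by (intro add_mono) auto
  also have "\<dots> = ennreal (outer_mean M f + outer_mean M f' + e)"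
    using e by (subst ennreal_plus[symmetric]) (auto simp: add_nonneg_nonneg)
  finally show "outer_mean M (\<lambda>\<omega>. f \<omega> + f' \<omega>) \<le> outer_mean M f + outer_mean M f' + e"
    using \<open>0 < e\<close> by (simp add: ennreal_le_iff add_nonneg_nonneg del: ennreal_plus)
qed

text \<open>The cap forces \<open>1 <= C\<close>: for a positive \<open>C < 1\<close> and very large
  \<open>f\<close> the left side is still 1. This is why constants appear below in the form
  \<open>max 1 ...\<close>.\<close>

lemma outer_mean_cmult:
  assumes "1 \<le> C" shows "outer_mean M (\<lambda>\<omega>. ennreal C * f \<omega>) \<le> C * outer_mean M f"
proof (rule field_le_epsilon)
  fix e :: real assume "0 < e"
  then have e: "0 < e/C" using assms by simp
  from outer_mean_approx[OF e, of f] obtain g where g: "g \<in> borel_measurable M" "AE \<omega> in M. f \<omega> \<le> g \<omega>"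
    "(\<integral>\<^sup>+\<omega>. min 1 (g \<omega>) \<partial>M) < ennreal (outer_mean M f + e/C)" .
  have "AE \<omega> in M. ennreal C * f \<omega> \<le> ennreal C * g \<omega>" using g(2) by eventually_elim (rule mult_left_mono, auto)
  then have "ennreal (outer_mean M (\<lambda>\<omega>. ennreal C * f \<omega>)) \<le> (\<integral>\<^sup>+\<omega>. min 1 (ennreal C * g \<omega>) \<partial>M)"
    using g by (intro outer_mean_upper) auto
  also have "\<dots> \<le> (\<integral>\<^sup>+\<omega>. ennreal C * min 1 (g \<omega>) \<partial>M)"
    by (intro nn_integral_mono min_one_cmult_le assms)
  also have "\<dots> = ennreal C * (\<integral>\<^sup>+\<omega>. min 1 (g \<omega>) \<partial>M)"
    using g by (intro nn_integral_cmult) auto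
  also have "\<dots> \<le> ennreal C * ennreal (outer_mean M f + e/C)"
    using g(3) by (intro mult_left_mono) auto
  also have "\<dots> = ennreal (C * outer_mean M f + e)"
    using assms by (subst ennreal_mult'[symmetric]) (auto simp: distrib_left)
  finally show "outer_mean M (\<lambda>\<omega>. ennreal C * f \<omega>) \<le> C * outer_mean M f + e"
    using \<open>0 < e\<close> assms by (simp add: ennreal_le_iff del: ennreal_plus)
qed

lemma outer_mean_zero: "outer_mean M (\<lambda>_. 0) = 0"
  using outer_mean_upper[of "\<lambda>_. 0" "\<lambda>_. 0"] by (simp add: antisym ennreal_eq_0_iff)

lemma outer_mean_sum:
  assumes "finite I" shows "outer_mean M (\<lambda>\<omega>. \<Sum>i\<in>I. f i \<omega>) \<le> (\<Sum>i\<in>I. outer_mean M (f i))"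
  using assms
proof (induction I)
  case (insert x I)
  then show ?case using outer_mean_add[of "f x" "\<lambda>\<omega>. \<Sum>i\<in>I. f i \<omega>"] by simp
qed (simp add: outer_mean_zero)

lemma outer_mean_measurable:
  assumes "f \<in> borel_measurable M"
  shows "ennreal (outer_mean M f) = (\<integral>\<^sup>+\<omega>. min 1 (f \<omega>) \<partial>M)"
proof (rule antisym)
  show "ennreal (outer_mean M f) \<le> (\<integral>\<^sup>+\<omega>. min 1 (f \<omega>) \<partial>M)" by (intro outer_mean_upper assms) auto
  show "(\<integral>\<^sup>+\<omega>. min 1 (f \<omega>) \<partial>M) \<le> ennreal (outer_mean M f)"
    unfolding ennreal_outer_mean
  proof (safe intro!: INF_greatest)
    fix g assume "AE \<omega> in M. f \<omega> \<le> g \<omega>"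
    then have "AE \<omega> in M. min 1 (f \<omega>) \<le> min 1 (g \<omega>)" by eventually_elim (simp add: min.coboundedI2)
    then show "(\<integral>\<^sup>+\<omega>. min 1 (f \<omega>) \<partial>M) \<le> (\<integral>\<^sup>+\<omega>. min 1 (g \<omega>) \<partial>M)" by (rule nn_integral_mono_AE)
  qed
qed

lemma outer_mean_le_nn_integral:
  assumes "f \<in> borel_measurable M" "(\<integral>\<^sup>+\<omega>. f \<omega> \<partial>M) \<le> ennreal c" "0 \<le> c"
  shows "outer_mean M f \<le> c"
proof -
  have "ennreal (outer_mean M f) \<le> (\<integral>\<^sup>+\<omega>. f \<omega> \<partial>M)"
    unfolding outer_mean_measurable[OF assms(1)] by (intro nn_integral_mono) auto
  also note assms(2)
  finally show ?thesis using assms(3) by (simp add: ennreal_le_iff)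
qed

text \<open>Where a majorant \<open>g\<close> of the modulus is at most 1, squaring only decreases.
  Where \<open>g\<close> exceeds 1, it can be raised to infinity at no cost, because the capped
  integral does not see the difference.\<close>

lemma outer_mean_square_le: "outer_mean M (\<lambda>\<omega>. ennreal ((y \<omega>)\<^sup>2)) \<le> outer_mean M (\<lambda>\<omega>. ennreal \<bar>y \<omega> :: real\<bar>)"
proof (rule field_le_epsilon)
  fix e :: real assume "0 < e"
  from outer_mean_approx[OF this, of "\<lambda>\<omega>. ennreal \<bar>y \<omega> :: real\<bar>"] obtain g where
    g: "g \<in> borel_measurable M" "AE \<omega> in M. ennreal \<bar>y \<omega>\<bar> \<le> g \<omega>"
    "(\<integral>\<^sup>+\<omega>. min 1 (g \<omega>) \<partial>M) < ennreal (outer_mean M (\<lambda>\<omega>. ennreal \<bar>y \<omega> :: real\<bar>) + e)" .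
  define h where "h \<omega> = (if g \<omega> \<le> 1 then g \<omega> else \<top>)" for \<omega>
  have [measurable]: "h \<in> borel_measurable M" using g(1) unfolding h_def by measurable
  have "AE \<omega> in M. ennreal ((y \<omega>)\<^sup>2) \<le> h \<omega>"
    using g(2)
  proof eventually_elim
    fix \<omega> assume *: "ennreal \<bar>y \<omega>\<bar> \<le> g \<omega>"
    show "ennreal ((y \<omega>)\<^sup>2) \<le> h \<omega>"
    proof (cases "g \<omega> \<le> 1")
      case True
      with * have "ennreal \<bar>y \<omega>\<bar> \<le> 1" by order
      then have "\<bar>y \<omega>\<bar> \<le> 1" by simp
      then have "(y \<omega>)\<^sup>2 \<le> \<bar>y \<omega>\<bar>" using mult_left_le[of "\<bar>y \<omega>\<bar>" "\<bar>y \<omega>\<bar>"] by (simp add: power2_eq_square)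
      then have "ennreal ((y \<omega>)\<^sup>2) \<le> ennreal \<bar>y \<omega>\<bar>" by (rule ennreal_leI)
      from order_trans[OF this *] True show ?thesis unfolding h_def by simp
    qed (simp add: h_def)
  qed
  then have "ennreal (outer_mean M (\<lambda>\<omega>. ennreal ((y \<omega>)\<^sup>2))) \<le> (\<integral>\<^sup>+\<omega>. min 1 (h \<omega>) \<partial>M)"
    by (intro outer_mean_upper) auto
  also have "\<dots> = (\<integral>\<^sup>+\<omega>. min 1 (g \<omega>) \<partial>M)"
    by (intro nn_integral_cong) (auto simp: h_def min_def)
  also note g(3)
  finally show "outer_mean M (\<lambda>\<omega>. ennreal ((y \<omega>)\<^sup>2)) \<le> outer_mean M (\<lambda>\<omega>. ennreal \<bar>y \<omega> :: real\<bar>) + e"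
    using \<open>0 < e\<close> by (simp add: ennreal_less_iff del: ennreal_plus)
qed

lemma outer_mean_tendsto_AE:
  assumes [measurable]: "\<And>n. f n \<in> borel_measurable M"
    and "AE \<omega> in M. (\<lambda>n. f n \<omega>) \<longlonglongrightarrow> 0"
  shows "(\<lambda>n. outer_mean M (f n)) \<longlonglongrightarrow> 0"
proof -
  have "(\<lambda>n. \<integral>\<^sup>+\<omega>. min 1 (f n \<omega>) \<partial>M) \<longlonglongrightarrow> (\<integral>\<^sup>+\<omega>. 0 \<partial>M)"
  proof (rule nn_integral_dominated_convergence[where w="\<lambda>_. 1"])
    show "AE x in M. (\<lambda>i. min 1 (f i x)) \<longlonglongrightarrow> 0"
      using assms(2)
    proof eventually_elim
      fix x assume "(\<lambda>n. f n x) \<longlonglongrightarrow> 0"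
      from tendsto_min[OF tendsto_const this, of 1] show "(\<lambda>i. min 1 (f i x)) \<longlonglongrightarrow> 0" by simp
    qed
  qed (auto simp: emeasure_space_1)
  then have "(\<lambda>n. ennreal (outer_mean M (f n))) \<longlonglongrightarrow> ennreal 0"
    by (simp add: outer_mean_measurable)
  then show ?thesis by (subst (asm) tendsto_ennreal_iff) auto
qed

lemma outer_mean_eq_0_AE:
  assumes "f \<in> borel_measurable M" "outer_mean M f = 0"
  shows "AE \<omega> in M. f \<omega> = 0"
proof -
  have "(\<integral>\<^sup>+\<omega>. min 1 (f \<omega>) \<partial>M) = 0" using outer_mean_measurable[OF assms(1)] assms(2) by simp
  then have "AE \<omega> in M. min 1 (f \<omega>) = 0" using assms(1) by (subst (asm) nn_integral_0_iff_AE) auto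
  then show ?thesis by eventually_elim (auto simp: min_def split: if_splits)
qed

text \<open>The factor \<open>\<top>\<close> lets the left side dominate any function on the bad
  event, while the cap reduces its cost to the probability of that event.\<close>

lemma outer_mean_markov:
  assumes [measurable]: "A \<in> borel_measurable M" and "0 < c"
  shows "outer_mean M (\<lambda>\<omega>. \<top> * indicator {\<omega>\<in>space M. c < A \<omega>} \<omega>) \<le> outer_mean M (\<lambda>\<omega>. ennreal (1/c) * ennreal (A \<omega>))"
proof -
  have "ennreal (outer_mean M (\<lambda>\<omega>. \<top> * indicator {\<omega>\<in>space M. c < A \<omega>} \<omega>))
      = (\<integral>\<^sup>+\<omega>. min 1 (\<top> * indicator {\<omega>\<in>space M. c < A \<omega>} \<omega>) \<partial>M)"
    by (intro outer_mean_measurable) measurable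
  also have "\<dots> \<le> (\<integral>\<^sup>+\<omega>. min 1 (ennreal (1/c) * ennreal (A \<omega>)) \<partial>M)"
  proof (intro nn_integral_mono)
    fix \<omega> assume \<omega>: "\<omega> \<in> space M"
    show "min 1 (\<top> * indicator {\<omega>\<in>space M. c < A \<omega>} \<omega>) \<le> min 1 (ennreal (1/c) * ennreal (A \<omega>))"
    proof (cases "c < A \<omega>")
      case True
      then have "1 \<le> 1 / c * A \<omega>" using \<open>0 < c\<close> by (simp add: field_simps)
      then have "ennreal 1 \<le> ennreal (1 / c * A \<omega>)" by (rule ennreal_leI)
      also have "\<dots> = ennreal (1/c) * ennreal (A \<omega>)" using \<open>0 < c\<close> by (intro ennreal_mult') simp
      finally have "min 1 (ennreal (1/c) * ennreal (A \<omega>)) = 1" by (intro min_absorb1) simp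
      then show ?thesis by (simp only: min.cobounded1)
    qed simp
  qed
  also have "\<dots> = ennreal (outer_mean M (\<lambda>\<omega>. ennreal (1/c) * ennreal (A \<omega>)))"
    by (intro outer_mean_measurable[symmetric]) measurable
  finally show ?thesis by simp
qed

text \<open>The passage from \<open>vanishes_in_probability\<close> to the gauge: the capped
  integral is at most \<open>e\<close> plus the probability of exceeding \<open>e\<close>.\<close>

lemma outer_mean_vanish:
  assumes [measurable]: "\<And>j::nat. D j \<in> borel_measurable M"
    and lim: "\<And>e. 0 < e \<Longrightarrow> (\<lambda>j. emeasure M {\<omega> \<in> space M. ennreal e < D j \<omega>}) \<longlonglongrightarrow> 0"
  shows "(\<lambda>j. outer_mean M (D j)) \<longlonglongrightarrow> 0"
proof (rule LIMSEQ_I)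
  fix r :: real assume "0 < r"
  define e where "e = r/2"
  have e: "0 < e" using \<open>0 < r\<close> by (simp add: e_def)
  have "eventually (\<lambda>j. emeasure M {\<omega> \<in> space M. ennreal e < D j \<omega>} < ennreal e) sequentially"
    using lim[OF e] e by (intro order_tendstoD) auto
  then obtain n0 where n0: "\<And>j. n0 \<le> j \<Longrightarrow> emeasure M {\<omega> \<in> space M. ennreal e < D j \<omega>} < ennreal e"
    by (auto simp: eventually_sequentially)
  have "norm (outer_mean M (D j) - 0) < r" if "n0 \<le> j" for j
  proof -
    have "ennreal (outer_mean M (D j)) = (\<integral>\<^sup>+\<omega>. min 1 (D j \<omega>) \<partial>M)" by (intro outer_mean_measurable) auto
    also have "\<dots> \<le> (\<integral>\<^sup>+\<omega>. ennreal e + indicator {\<omega> \<in> space M. ennreal e < D j \<omega>} \<omega> \<partial>M)"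
    proof (intro nn_integral_mono)
      fix \<omega> assume "\<omega> \<in> space M"
      then show "min 1 (D j \<omega>) \<le> ennreal e + indicator {\<omega> \<in> space M. ennreal e < D j \<omega>} \<omega>"
        by (cases "ennreal e < D j \<omega>") (simp_all add: not_less min.coboundedI2 min.coboundedI1 add_increasing)
    qed
    also have "\<dots> = ennreal e + emeasure M {\<omega> \<in> space M. ennreal e < D j \<omega>}"
      by (subst nn_integral_add) (auto simp: emeasure_space_1)
    also have "\<dots> < ennreal e + ennreal e"
      using n0[OF that] by (simp add: ennreal_add_left_cancel_less)
    also have "\<dots> = ennreal r" using e by (subst ennreal_plus[symmetric]) (auto simp: e_def)
    finally show ?thesis by (simp add: ennreal_less_iff)
  qed
  then show "\<exists>no. \<forall>n\<ge>no. norm (outer_mean M (D n) - 0) < r" by auto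
qed

end

section \<open>Simple integrals against a Brownian motion\<close>

text \<open>To be instantiated with the completed measure, the filtration of the pair, and each of
  the three driving motions in turn. Hence increments of \<open>W\<close> must be independent of the
  whole past \<open>FF s\<close>, not only of the past of \<open>W\<close>.\<close>

locale filtered_bm = prob_space M for M :: "'a measure" +
  fixes FF :: "ennreal \<Rightarrow> 'a measure" and W :: "real \<Rightarrow> 'a \<Rightarrow> real"
  assumes space_FF [simp]: "space (FF t) = space M"
    and sets_FF: "sets (FF t) \<subseteq> sets M"
    and FF_mono: "i \<le> j \<Longrightarrow> sets (FF i) \<subseteq> sets (FF j)"
    and W_adapted: "0 \<le> s \<Longrightarrow> W s \<in> borel_measurable (FF (ennreal s))"
    and W_indep: "0 \<le> s \<Longrightarrow> s < s' \<Longrightarrow> Y \<in> borel_measurable (FF (ennreal s)) \<Longrightarrow>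
          indep_var borel (Y :: 'a \<Rightarrow> real) borel (\<lambda>\<omega>. W s' \<omega> - W s \<omega>)"
    and W_normal: "0 \<le> s \<Longrightarrow> s < s' \<Longrightarrow>
          distributed M lborel (\<lambda>\<omega>. W s' \<omega> - W s \<omega>) (normal_density 0 (sqrt (s' - s)))"
    and W_cont: "AE \<omega> in M. continuous_on {0..} (\<lambda>t. W t \<omega>)"
    and W_zero: "AE \<omega> in M. W 0 \<omega> = 0"
begin

lemma measurable_FF_mono:
  assumes "f \<in> measurable (FF s) B" "s \<le> t" shows "f \<in> measurable (FF t) B"
  by (rule measurable_mono[THEN subsetD, OF order.refl refl FF_mono _ assms(1)]) (simp_all add: assms(2))

lemma measurable_FF:
  assumes "f \<in> measurable (FF s) B" shows "f \<in> measurable M B"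
  by (rule measurable_mono[THEN subsetD, OF order.refl refl sets_FF _ assms]) simp

lemma W_measurable: "0 \<le> s \<Longrightarrow> W s \<in> borel_measurable M"
  by (rule measurable_FF[OF W_adapted])

lemma W_adapted_mono: "0 \<le> s \<Longrightarrow> s \<le> t \<Longrightarrow> W s \<in> borel_measurable (FF (ennreal t))"
  by (rule measurable_FF_mono[OF W_adapted ennreal_leI])

lemma increment_indep:
  assumes "0 \<le> s" "s < s'" "Y \<in> borel_measurable (FF (ennreal s))" "f \<in> borel_measurable borel"
  shows "indep_var borel (Y :: 'a \<Rightarrow> real) borel (\<lambda>\<omega>. f (W s' \<omega> - W s \<omega>) :: real)"
  using indep_var_compose[OF W_indep[OF assms(1-3)] measurable_ident assms(4)] by (simp only: comp_def id_def)

text \<open>The last summand has a factor \<open>\<zeta> b\<close> that is centred and independent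
  of what is known at time \<open>q b\<close>, so its product with the earlier sum has expectation
  0. The index set may have gaps, as blocks of indices do, and \<open>f\<close> covers plain
  increments as well as nonlinear functions of them.\<close>

lemma orthogonal_increments:
  fixes q :: "nat \<Rightarrow> real" and \<xi> :: "nat \<Rightarrow> 'a \<Rightarrow> real" and f :: "nat \<Rightarrow> real \<Rightarrow> real"
  defines "\<zeta> \<equiv> \<lambda>l \<omega>. f l (W (q (Suc l)) \<omega> - W (q l) \<omega>)"
  assumes "finite J"
    and "\<And>l. l \<in> J \<Longrightarrow> 0 \<le> q l" "\<And>l. l \<in> J \<Longrightarrow> q l < q (Suc l)"
    and "\<And>l l'. l \<in> J \<Longrightarrow> l' \<in> J \<Longrightarrow> l < l' \<Longrightarrow> q (Suc l) \<le> q l'"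
    and "\<And>l. l \<in> J \<Longrightarrow> \<xi> l \<in> borel_measurable (FF (ennreal (q l)))"
    and "\<And>l. l \<in> J \<Longrightarrow> \<exists>C. \<forall>\<omega>\<in>space M. \<bar>\<xi> l \<omega>\<bar> \<le> C"
    and "\<And>l. l \<in> J \<Longrightarrow> f l \<in> borel_measurable borel"
    and "\<And>l. l \<in> J \<Longrightarrow> integrable M (\<lambda>\<omega>. (\<zeta> l \<omega>)\<^sup>2)"
    and "\<And>l. l \<in> J \<Longrightarrow> expectation (\<zeta> l) = 0"
  shows "integrable M (\<lambda>\<omega>. (\<Sum>l\<in>J. \<xi> l \<omega> * \<zeta> l \<omega>)\<^sup>2) \<and>
    expectation (\<lambda>\<omega>. (\<Sum>l\<in>J. \<xi> l \<omega> * \<zeta> l \<omega>)\<^sup>2) = (\<Sum>l\<in>J. expectation (\<lambda>\<omega>. (\<xi> l \<omega>)\<^sup>2) * expectation (\<lambda>\<omega>. (\<zeta> l \<omega>)\<^sup>2))"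
  using assms(2-)
proof (induction J rule: finite_linorder_max_induct)
  case empty
  then show ?case by simp
next
  case (insert b A)
  define S where "S \<omega> = (\<Sum>l\<in>A. \<xi> l \<omega> * \<zeta> l \<omega>)" for \<omega>
  have IH: "integrable M (\<lambda>\<omega>. (S \<omega>)\<^sup>2)"
    "expectation (\<lambda>\<omega>. (S \<omega>)\<^sup>2) = (\<Sum>l\<in>A. expectation (\<lambda>\<omega>. (\<xi> l \<omega>)\<^sup>2) * expectation (\<lambda>\<omega>. (\<zeta> l \<omega>)\<^sup>2))"
    unfolding S_def using insert.IH insert.prems by simp_all
  have q: "0 \<le> q b" "q b < q (Suc b)" using insert.prems by auto
  have f [measurable]: "f b \<in> borel_measurable borel" using insert.prems by auto
  have \<xi>: "\<xi> b \<in> borel_measurable (FF (ennreal (q b)))" using insert.prems by auto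
  have \<xi>M [measurable]: "\<xi> b \<in> borel_measurable M" using \<xi> measurable_FF by blast
  have S: "S \<in> borel_measurable (FF (ennreal (q b)))"
    unfolding S_def
  proof (intro borel_measurable_sum borel_measurable_times)
    fix l assume l: "l \<in> A"
    then have l': "0 \<le> q l" "q l < q (Suc l)" "q (Suc l) \<le> q b"
      using insert.prems(3)[of l b] insert.prems(1,2) insert.hyps by auto
    show "\<xi> l \<in> borel_measurable (FF (ennreal (q b)))"
      using insert.prems(4)[of l] l l' by (auto intro: measurable_FF_mono ennreal_leI)
    have [measurable]: "f l \<in> borel_measurable borel" using insert.prems l by auto
    have [measurable]: "W (q l) \<in> borel_measurable (FF (ennreal (q b)))"
      "W (q (Suc l)) \<in> borel_measurable (FF (ennreal (q b)))"
      using l' by (auto intro!: W_adapted_mono)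
    show "\<zeta> l \<in> borel_measurable (FF (ennreal (q b)))"
      unfolding \<zeta>_def by measurable
  qed
  have SM [measurable]: "S \<in> borel_measurable M" using S measurable_FF by blast
  have [measurable]: "W (q b) \<in> borel_measurable M" "W (q (Suc b)) \<in> borel_measurable M"
    using q by (auto intro: W_measurable)
  have \<zeta>M [measurable]: "\<zeta> b \<in> borel_measurable M"
    unfolding \<zeta>_def by measurable
  obtain C where C: "\<And>\<omega>. \<omega> \<in> space M \<Longrightarrow> \<bar>\<xi> b \<omega>\<bar> \<le> C" using insert.prems(5)[of b] by auto
  obtain \<omega>0 where "\<omega>0 \<in> space M" using not_empty by auto
  from C[OF this] have C0: "0 \<le> C" by simp
  have int_\<zeta>2: "integrable M (\<lambda>\<omega>. (\<zeta> b \<omega>)\<^sup>2)" using insert.prems(7) by auto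
  have int_\<zeta>: "integrable M (\<zeta> b)"
    by (rule square_integrable_imp_integrable[OF \<zeta>M int_\<zeta>2])
  have int_S: "integrable M S"
    by (rule square_integrable_imp_integrable[OF SM IH(1)])
  have int_S\<xi>: "integrable M (\<lambda>\<omega>. S \<omega> * \<xi> b \<omega>)"
  proof (rule Bochner_Integration.integrable_bound[of _ "\<lambda>\<omega>. C * S \<omega>"])
    show "AE \<omega> in M. norm (S \<omega> * \<xi> b \<omega>) \<le> norm (C * S \<omega>)"
      using C C0 by (intro AE_I2) (auto simp: abs_mult mult.commute[of C] intro!: mult_left_mono)
  qed (use int_S in auto)
  have int_\<xi>2: "integrable M (\<lambda>\<omega>. (\<xi> b \<omega>)\<^sup>2)"
  proof (rule integrable_const_bound[of _ "C\<^sup>2"])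
    show "AE \<omega> in M. norm ((\<xi> b \<omega>)\<^sup>2) \<le> C\<^sup>2"
      proof (intro AE_I2)
      fix \<omega> assume "\<omega> \<in> space M"
      from power_mono[OF C[OF this], of 2] show "norm ((\<xi> b \<omega>)\<^sup>2) \<le> C\<^sup>2" by simp
    qed
  qed simp
  have i1: "indep_var borel (\<lambda>\<omega>. S \<omega> * \<xi> b \<omega>) borel (\<zeta> b)"
    unfolding \<zeta>_def using q S \<xi> f by (intro increment_indep) auto
  have i2: "indep_var borel (\<lambda>\<omega>. (\<xi> b \<omega>)\<^sup>2) borel (\<lambda>\<omega>. (\<zeta> b \<omega>)\<^sup>2)"
    unfolding \<zeta>_def using q \<xi> f
    by (intro increment_indep[where f="\<lambda>x. (f b x)\<^sup>2"]) auto
  have int_cross: "integrable M (\<lambda>\<omega>. S \<omega> * \<xi> b \<omega> * \<zeta> b \<omega>)"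
    by (rule indep_var_integrable[OF i1 int_S\<xi> int_\<zeta>])
  have cross: "expectation (\<lambda>\<omega>. S \<omega> * \<xi> b \<omega> * \<zeta> b \<omega>) = 0"
    using indep_var_lebesgue_integral[OF i1 int_S\<xi> int_\<zeta>] insert.prems(8)[of b] by simp
  have int_sq: "integrable M (\<lambda>\<omega>. (\<xi> b \<omega>)\<^sup>2 * (\<zeta> b \<omega>)\<^sup>2)"
    by (rule indep_var_integrable[OF i2 int_\<xi>2 int_\<zeta>2])
  have sq: "expectation (\<lambda>\<omega>. (\<xi> b \<omega>)\<^sup>2 * (\<zeta> b \<omega>)\<^sup>2) = expectation (\<lambda>\<omega>. (\<xi> b \<omega>)\<^sup>2) * expectation (\<lambda>\<omega>. (\<zeta> b \<omega>)\<^sup>2)"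
    by (rule indep_var_lebesgue_integral[OF i2 int_\<xi>2 int_\<zeta>2])
  have b: "b \<notin> A" using insert.hyps by auto
  have "(\<Sum>l\<in>insert b A. \<xi> l \<omega> * \<zeta> l \<omega>) = S \<omega> + \<xi> b \<omega> * \<zeta> b \<omega>" for \<omega>
    unfolding S_def using b insert.hyps(1) by simp
  then have eq: "(\<Sum>l\<in>insert b A. \<xi> l \<omega> * \<zeta> l \<omega>)\<^sup>2 =
      (S \<omega>)\<^sup>2 + (\<xi> b \<omega>)\<^sup>2 * (\<zeta> b \<omega>)\<^sup>2 + 2 * (S \<omega> * \<xi> b \<omega> * \<zeta> b \<omega>)" for \<omega>
    by (simp only: power2_sum power_mult_distrib mult.assoc)
  have "integrable M (\<lambda>\<omega>. (S \<omega>)\<^sup>2 + (\<xi> b \<omega>)\<^sup>2 * (\<zeta> b \<omega>)\<^sup>2 + 2 * (S \<omega> * \<xi> b \<omega> * \<zeta> b \<omega>))"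
    by (intro Bochner_Integration.integrable_add integrable_mult_right IH(1) int_sq int_cross)
  moreover have "expectation (\<lambda>\<omega>. (S \<omega>)\<^sup>2 + (\<xi> b \<omega>)\<^sup>2 * (\<zeta> b \<omega>)\<^sup>2 + 2 * (S \<omega> * \<xi> b \<omega> * \<zeta> b \<omega>))
      = expectation (\<lambda>\<omega>. (S \<omega>)\<^sup>2) + expectation (\<lambda>\<omega>. (\<xi> b \<omega>)\<^sup>2 * (\<zeta> b \<omega>)\<^sup>2)
        + 2 * expectation (\<lambda>\<omega>. S \<omega> * \<xi> b \<omega> * \<zeta> b \<omega>)"
    by (subst Bochner_Integration.integral_add
        | intro Bochner_Integration.integrable_add integrable_mult_right IH(1) int_sq int_cross refl
        | subst integral_mult_right_zero)+
  ultimately show ?case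
    unfolding eq cross sq IH(2) using b insert.hyps(1) by (simp add: add.commute)
qed

lemma W_increment_moments:
  assumes "0 \<le> s" "s < s'"
  shows "integrable M (\<lambda>\<omega>. (W s' \<omega> - W s \<omega>)\<^sup>2)" "expectation (\<lambda>\<omega>. W s' \<omega> - W s \<omega>) = 0"
    "expectation (\<lambda>\<omega>. (W s' \<omega> - W s \<omega>)\<^sup>2) = s' - s"
proof -
  have s: "0 < sqrt (s' - s)" using assms by simp
  note D = W_normal[OF assms]
  have "integrable lborel (\<lambda>x. normal_density 0 (sqrt (s' - s)) x * (x - 0)\<^sup>2)"
    by (rule integrable_normal_moment[OF s])
  then show "integrable M (\<lambda>\<omega>. (W s' \<omega> - W s \<omega>)\<^sup>2)"
    by (subst distributed_integrable[OF D, symmetric]) auto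
  show 0: "expectation (\<lambda>\<omega>. W s' \<omega> - W s \<omega>) = 0"
    using normal_distributed_expectation[OF s D] .
  show "expectation (\<lambda>\<omega>. (W s' \<omega> - W s \<omega>)\<^sup>2) = s' - s"
    using normal_distributed_variance[OF s D] 0 assms by simp
qed

text \<open>The quadratic sum \<open>P\<close> is adapted, so the integrand can be cut off once \<open>P\<close> exceeds \<open>c\<close>
  without spoiling the orthogonality of the increments; Markov's inequality pays for the cut.
  Grouping by \<open>\<gamma>\<close> covers both the square of a whole sum and the sum of the squares of its blocks.\<close>

lemma elementary_integral_bound:
  fixes q :: "nat \<Rightarrow> real" and \<phi> :: "nat \<Rightarrow> 'a \<Rightarrow> real" and \<gamma> :: "nat \<Rightarrow> nat"
  assumes q: "0 \<le> q 0" "\<And>l. l < m \<Longrightarrow> q l < q (Suc l)"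
    and \<phi>: "\<And>l. l < m \<Longrightarrow> \<phi> l \<in> borel_measurable (FF (ennreal (q l)))"
    and bd: "\<And>l. l < m \<Longrightarrow> \<exists>C. \<forall>\<omega>\<in>space M. \<bar>\<phi> l \<omega>\<bar> \<le> C"
  shows "outer_mean M (\<lambda>\<omega>. ennreal (\<Sum>i<n. (\<Sum>l | l < m \<and> \<gamma> l = i. \<phi> l \<omega> * (W (q (Suc l)) \<omega> - W (q l) \<omega>))\<^sup>2))
    \<le> 2 * sqrt (outer_mean M (\<lambda>\<omega>. ennreal (\<Sum>l<m. (\<phi> l \<omega>)\<^sup>2 * (q (Suc l) - q l))))"
    (is "outer_mean M ?S \<le> 2 * sqrt (outer_mean M (\<lambda>\<omega>. ennreal (?A \<omega>)))")
proof -
  have q_mono: "q l \<le> q l'" if "l \<le> l'" "l' \<le> m" for l l'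
    using that
  proof (induction l' rule: dec_induct)
    case (step k)
    then show ?case using q(2)[of k] by simp
  qed simp
  have q_nonneg: "0 \<le> q l" if "l \<le> m" for l using q_mono[of 0 l] q(1) that by simp
  have \<phi>M: "\<phi> l \<in> borel_measurable M" if "l < m" for l
    using \<phi>[OF that] measurable_FF by blast
  have AM: "?A \<in> borel_measurable M"
    by (intro borel_measurable_sum borel_measurable_times borel_measurable_power) (auto intro: \<phi>M)
  define P where "P l \<omega> = (\<Sum>j\<le>l. (\<phi> j \<omega>)\<^sup>2 * (q (Suc j) - q j))" for l \<omega>
  have step: "outer_mean M ?S \<le> c + outer_mean M (\<lambda>\<omega>. ennreal (?A \<omega>)) / c" if "0 < c" for c
  proof (cases "1 \<le> c")
    \<comment> \<open>For \<open>c >= 1\<close> the cap makes the bound trivial. Otherwise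
      \<open>1 / c >= 1\<close>, as \<open>outer_mean_cmult\<close> requires at the end of the other
      case.\<close>
    case True
    have "outer_mean M ?S \<le> 1" by (rule outer_mean_le1)
    also have "1 \<le> c + outer_mean M (\<lambda>\<omega>. ennreal (?A \<omega>)) / c"
      using True by (simp add: add_increasing2)
    finally show ?thesis .
  next
    case False
    \<comment> \<open>\<open>P l\<close> already contains the term with index \<open>l\<close>. So
      \<open>\<phi> l\<close> is dropped as soon as its own contribution would lift the quadratic
      sum above \<open>c\<close>, and \<open>\<psi> l\<close> is still known at time
      \<open>q l\<close>.\<close>
    define \<psi> where "\<psi> l \<omega> = \<phi> l \<omega> * indicator {\<omega>\<in>space M. P l \<omega> \<le> c} \<omega>" for l \<omega>
    have PF: "P l \<in> borel_measurable (FF (ennreal (q l)))" if "l < m" for l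
      unfolding P_def
    proof (intro borel_measurable_sum borel_measurable_times borel_measurable_power borel_measurable_const)
      fix j assume "j \<in> {..l}"
      then show "\<phi> j \<in> borel_measurable (FF (ennreal (q l)))"
        using \<phi>[of j] q_mono[of j l] that by (auto intro: measurable_FF_mono ennreal_leI)
    qed
    have \<psi>F: "\<psi> l \<in> borel_measurable (FF (ennreal (q l)))" if "l < m" for l
    proof -
      note PF[OF that, measurable] \<phi>[OF that, measurable]
      have "{\<omega>\<in>space (FF (ennreal (q l))). P l \<omega> \<le> c} \<in> sets (FF (ennreal (q l)))"
        by measurable
      then show ?thesis unfolding \<psi>_def by (intro borel_measurable_times) auto
    qed
    have \<psi>M: "\<psi> l \<in> borel_measurable M" if "l < m" for l
      using \<psi>F[OF that] measurable_FF by blast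
    have \<psi>_bd: "\<exists>C. \<forall>\<omega>\<in>space M. \<bar>\<psi> l \<omega>\<bar> \<le> C" if l: "l < m" for l
    proof -
      obtain C where "\<And>\<omega>. \<omega>\<in>space M \<Longrightarrow> \<bar>\<phi> l \<omega>\<bar> \<le> C" using bd[OF l] by blast
      then show ?thesis by (intro exI[of _ "max C 0"]) (auto simp: \<psi>_def indicator_def le_max_iff_disj)
    qed
    have \<psi>_int: "integrable M (\<lambda>\<omega>. (\<psi> l \<omega>)\<^sup>2)" if l: "l < m" for l
    proof -
      obtain C where C: "\<And>\<omega>. \<omega>\<in>space M \<Longrightarrow> \<bar>\<psi> l \<omega>\<bar> \<le> C" using \<psi>_bd[OF l] by blast
      show ?thesis
      proof (rule integrable_const_bound[of _ "C\<^sup>2"])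
        show "AE \<omega> in M. norm ((\<psi> l \<omega>)\<^sup>2) \<le> C\<^sup>2"
        proof (intro AE_I2)
          fix \<omega> assume "\<omega> \<in> space M"
          from power_mono[OF C[OF this], of 2] show "norm ((\<psi> l \<omega>)\<^sup>2) \<le> C\<^sup>2" by simp
        qed
      qed (intro borel_measurable_power \<psi>M[OF l])
    qed
    define T where "T i \<omega> = (\<Sum>l | l < m \<and> \<gamma> l = i. \<psi> l \<omega> * (W (q (Suc l)) \<omega> - W (q l) \<omega>))" for i \<omega>
    have T: "integrable M (\<lambda>\<omega>. (T i \<omega>)\<^sup>2) \<and> expectation (\<lambda>\<omega>. (T i \<omega>)\<^sup>2) =
       (\<Sum>l | l < m \<and> \<gamma> l = i. expectation (\<lambda>\<omega>. (\<psi> l \<omega>)\<^sup>2) * expectation (\<lambda>\<omega>. (W (q (Suc l)) \<omega> - W (q l) \<omega>)\<^sup>2))" for i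
      unfolding T_def
    proof (rule orthogonal_increments[where f="\<lambda>_ x. x"])
      show "\<exists>C. \<forall>\<omega>\<in>space M. \<bar>\<psi> l \<omega>\<bar> \<le> C" if "l \<in> {l. l < m \<and> \<gamma> l = i}" for l
        by (rule \<psi>_bd) (use that in simp)
      show "\<psi> l \<in> borel_measurable (FF (ennreal (q l)))" if "l \<in> {l. l < m \<and> \<gamma> l = i}" for l
        by (rule \<psi>F) (use that in simp)
      show "0 \<le> q l" "q l < q (Suc l)" if "l \<in> {l. l < m \<and> \<gamma> l = i}" for l
        using that q_nonneg[of l] q(2)[of l] by auto
      show "q (Suc l) \<le> q l'" if "l \<in> {l. l < m \<and> \<gamma> l = i}" "l' \<in> {l. l < m \<and> \<gamma> l = i}" "l < l'" for l l'
        by (rule q_mono) (use that in auto)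
      show "integrable M (\<lambda>\<omega>. (W (q (Suc l)) \<omega> - W (q l) \<omega>)\<^sup>2)"
        "expectation (\<lambda>\<omega>. W (q (Suc l)) \<omega> - W (q l) \<omega>) = 0" if "l \<in> {l. l < m \<and> \<gamma> l = i}" for l
        using that W_increment_moments[of "q l" "q (Suc l)"] q_nonneg[of l] q(2)[of l] by auto
    qed auto
    have [measurable]: "T i \<in> borel_measurable M" for i
      unfolding T_def
      by (intro borel_measurable_sum borel_measurable_times borel_measurable_diff W_measurable)
         (use q_nonneg \<psi>M in auto)
    have "expectation (\<lambda>\<omega>. \<Sum>i<n. (T i \<omega>)\<^sup>2) = (\<Sum>i<n. expectation (\<lambda>\<omega>. (T i \<omega>)\<^sup>2))"
      using T by simp
    also have "\<dots> = (\<Sum>i<n. \<Sum>l | l < m \<and> \<gamma> l = i. expectation (\<lambda>\<omega>. (\<psi> l \<omega>)\<^sup>2) * (q (Suc l) - q l))"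
      using T W_increment_moments(3) q(2) q_nonneg by (intro sum.cong) auto
    also have "\<dots> = (\<Sum>l | l < m \<and> \<gamma> l < n. expectation (\<lambda>\<omega>. (\<psi> l \<omega>)\<^sup>2) * (q (Suc l) - q l))"
    proof -
      have *: "{x \<in> {l. l < m \<and> \<gamma> l < n}. \<gamma> x = i} = {l. l < m \<and> \<gamma> l = i}" if "i < n" for i
        using that by auto
      show ?thesis
      proof (subst sum.group[of "{l. l < m \<and> \<gamma> l < n}" "{..<n}" \<gamma>, symmetric])
        show "\<gamma> ` {l. l < m \<and> \<gamma> l < n} \<subseteq> {..<n}" by auto
      qed (use * in \<open>auto intro!: sum.cong\<close>)
    qed
    also have "\<dots> \<le> (\<Sum>l<m. expectation (\<lambda>\<omega>. (\<psi> l \<omega>)\<^sup>2) * (q (Suc l) - q l))"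
      using q(2) by (intro sum_mono2) (auto intro!: mult_nonneg_nonneg simp: less_imp_le)
    also have "\<dots> = expectation (\<lambda>\<omega>. \<Sum>l<m. (\<psi> l \<omega>)\<^sup>2 * (q (Suc l) - q l))"
      using \<psi>_int by simp
    also have "\<dots> \<le> expectation (\<lambda>\<omega>. c)"
    proof (intro integral_mono)
      fix \<omega> assume \<omega>: "\<omega> \<in> space M"
      \<comment> \<open>\<open>P\<close> increases with its index, so the kept terms form an initial
        segment; the minimum with \<open>P (k-1)\<close> is the strengthening that carries the
        induction. The case \<open>k = 0\<close> is separate because \<open>P (0-1)\<close> is
        \<open>P 0\<close>, not an empty sum.\<close>
      have "(\<Sum>l<k. (\<psi> l \<omega>)\<^sup>2 * (q (Suc l) - q l)) \<le> (if k = 0 then 0 else min c (P (k-1) \<omega>))" if "k \<le> m" for k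
        using that
      proof (induction k)
        case (Suc k)
        have Pm: "0 < k \<Longrightarrow> P (k-1) \<omega> \<le> P k \<omega>" "0 \<le> P 0 \<omega>"
          unfolding P_def using q(2) Suc.prems q(2)[of 0]
          by (auto intro!: sum_mono2 mult_nonneg_nonneg simp: less_imp_le)
        have Pk: "0 < k \<Longrightarrow> P k \<omega> = P (k-1) \<omega> + (\<phi> k \<omega>)\<^sup>2 * (q (Suc k) - q k)"
          unfolding P_def by (cases k) auto
        show ?case
        proof (cases "P k \<omega> \<le> c")
          case True
          then have "\<psi> k \<omega> = \<phi> k \<omega>" using \<omega> by (simp add: \<psi>_def)
          with Suc True Pm Pk show ?thesis by (cases "k = 0") (auto simp: P_def)
        next
          case False
          then have "\<psi> k \<omega> = 0" by (simp add: \<psi>_def)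
          with Suc False Pm \<open>0 < c\<close> show ?thesis by (cases "k = 0") auto
        qed
      qed simp
      from this[of m] show "(\<Sum>l<m. (\<psi> l \<omega>)\<^sup>2 * (q (Suc l) - q l)) \<le> c"
        using \<open>0 < c\<close> by (auto split: if_splits)
    qed (use \<psi>_int in auto)
    finally have E: "expectation (\<lambda>\<omega>. \<Sum>i<n. (T i \<omega>)\<^sup>2) \<le> c" by (simp add: prob_space)
    have "(\<integral>\<^sup>+\<omega>. ennreal (\<Sum>i<n. (T i \<omega>)\<^sup>2) \<partial>M) = ennreal (expectation (\<lambda>\<omega>. \<Sum>i<n. (T i \<omega>)\<^sup>2))"
      using T by (intro nn_integral_eq_integral) (auto intro!: AE_I2 sum_nonneg)
    also have "\<dots> \<le> ennreal c" using E by (rule ennreal_leI)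
    finally have 1: "outer_mean M (\<lambda>\<omega>. ennreal (\<Sum>i<n. (T i \<omega>)\<^sup>2)) \<le> c"
      using \<open>0 < c\<close> by (intro outer_mean_le_nn_integral) auto
    let ?G = "\<lambda>\<omega>. indicator {\<omega>\<in>space M. c < ?A \<omega>} \<omega> :: ennreal"
    let ?H = "\<lambda>\<omega>. ennreal (1/c) * ennreal (?A \<omega>)"
    \<comment> \<open>Unless the full quadratic sum exceeds \<open>c\<close>, nothing has been cut;
      if it does, the infinite term absorbs the error.\<close>
    have "AE \<omega> in M. ?S \<omega> \<le> ennreal (\<Sum>i<n. (T i \<omega>)\<^sup>2) + \<top> * ?G \<omega>"
    proof (intro AE_I2)
      fix \<omega> assume \<omega>: "\<omega> \<in> space M"
      show "?S \<omega> \<le> ennreal (\<Sum>i<n. (T i \<omega>)\<^sup>2) + \<top> * ?G \<omega>"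
      proof (cases "c < ?A \<omega>")
        case False
        have "\<psi> l \<omega> = \<phi> l \<omega>" if "l < m" for l
        proof -
          have "P l \<omega> \<le> ?A \<omega>"
            unfolding P_def using q(2) that
            by (intro sum_mono2) (auto intro!: mult_nonneg_nonneg simp: less_imp_le)
          then show ?thesis using False \<omega> by (simp add: \<psi>_def)
        qed
        then have "?S \<omega> = ennreal (\<Sum>i<n. (T i \<omega>)\<^sup>2)"
          unfolding T_def by (intro arg_cong[where f=ennreal] sum.cong refl arg_cong[where f="\<lambda>x. x\<^sup>2"]) auto
        then show ?thesis by simp
      qed (use \<omega> in simp)
    qed
    then have "outer_mean M ?S \<le> outer_mean M (\<lambda>\<omega>. ennreal (\<Sum>i<n. (T i \<omega>)\<^sup>2) + \<top> * ?G \<omega>)" by (rule outer_mean_mono)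
    also have "\<dots> \<le> outer_mean M (\<lambda>\<omega>. ennreal (\<Sum>i<n. (T i \<omega>)\<^sup>2)) + outer_mean M (\<lambda>\<omega>. \<top> * ?G \<omega>)"
      by (rule outer_mean_add)
    also have "outer_mean M (\<lambda>\<omega>. \<top> * ?G \<omega>) \<le> outer_mean M ?H"
      using AM \<open>0 < c\<close> by (rule outer_mean_markov)
    also have "outer_mean M ?H \<le> (1/c) * outer_mean M (\<lambda>\<omega>. ennreal (?A \<omega>))"
      using False \<open>0 < c\<close> by (intro outer_mean_cmult) (simp add: field_simps)
    finally show ?thesis using 1 by (simp add: algebra_simps)
  qed
  show ?thesis
  proof (cases "outer_mean M (\<lambda>\<omega>. ennreal (?A \<omega>)) = 0")
    case True
    then have "outer_mean M ?S \<le> 0 + c" if "0 < c" for c using step[OF that] by simp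
    then have "outer_mean M ?S \<le> 0" by (rule field_le_epsilon)
    then show ?thesis using True by simp
  next
    case False
    then have p: "0 < outer_mean M (\<lambda>\<omega>. ennreal (?A \<omega>))" using outer_mean_nonneg[of "\<lambda>\<omega>. ennreal (?A \<omega>)"] by linarith
    \<comment> \<open>Taking for \<open>c\<close> the square root of the gauge of the quadratic sum
      makes the two terms of \<open>step\<close> equal.\<close>
    then have "outer_mean M ?S \<le> sqrt (outer_mean M (\<lambda>\<omega>. ennreal (?A \<omega>))) + outer_mean M (\<lambda>\<omega>. ennreal (?A \<omega>)) / sqrt
      (outer_mean M (\<lambda>\<omega>. ennreal (?A \<omega>)))"
      by (intro step) simp
    also have "\<dots> = 2 * sqrt (outer_mean M (\<lambda>\<omega>. ennreal (?A \<omega>)))"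
      using p by (simp add: real_div_sqrt)
    finally show ?thesis .
  qed
qed

end

section \<open>Common refinements of time grids\<close>

lemma finite_grid_enumeration:
  fixes Q :: "real set"
  assumes "finite Q" "0 \<in> Q" "\<And>x. x \<in> Q \<Longrightarrow> 0 \<le> x"
  obtains q :: "nat \<Rightarrow> real" and m where "strict_mono_on {..m} q" "q ` {..m} = Q" "q 0 = 0"
proof -
  define xs where "xs = sorted_list_of_set Q"
  have xs: "sorted_wrt (<) xs" "set xs = Q" using assms(1) by (auto simp: xs_def)
  have ne: "xs \<noteq> []" using assms xs by auto
  define m where "m = length xs - 1"
  have m: "i \<le> m \<longleftrightarrow> i < length xs" for i using ne unfolding m_def by (cases xs) auto
  have sm: "strict_mono_on {..m} (\<lambda>i. xs ! i)"
    using xs(1) by (intro strict_mono_onI) (auto simp: m sorted_wrt_iff_nth_less)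
  have im: "(\<lambda>i. xs ! i) ` {..m} = Q"
    using xs(2) by (auto simp: set_conv_nth m image_iff)
  obtain a where a: "a \<le> m" "xs ! a = 0" using im assms(2) by auto
  have "xs ! 0 \<le> 0"
  proof (cases "a = 0")
    case False
    then show ?thesis using strict_mono_onD[OF sm, of 0 a] a by auto
  qed (use a in simp)
  moreover have "xs ! 0 \<in> Q" using im by auto
  ultimately have "xs ! 0 = 0" using assms(3) by fastforce
  with sm im that show ?thesis by blast
qed

lemma grid_less_iff:
  fixes q :: "nat \<Rightarrow> real"
  assumes "strict_mono_on {..m} q" "i \<le> m" "j \<le> m"
  shows "q i < q j \<longleftrightarrow> i < j" "q i \<le> q j \<longleftrightarrow> i \<le> j"
proof -
  have *: "q i < q j" if "i < j" "i \<le> m" "j \<le> m" for i j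
    using strict_mono_onD[OF assms(1)] that by auto
  show "q i < q j \<longleftrightarrow> i < j" "q i \<le> q j \<longleftrightarrow> i \<le> j"
    using *[of i j] *[of j i] assms(2,3) by (cases i j rule: linorder_cases; auto)+
qed

text \<open>Simple processes are left-continuous and jump only at grid points, so a cell is
  represented by the value at its right end.\<close>

lemma simple_process_grid:
  assumes q: "strict_mono_on {..m} q" and p: "p ` {..n} \<subseteq> q ` {..m}"
    and l: "l < m" "q l < u" "u \<le> q (Suc l)"
  shows "simple_process n p \<xi> u \<omega> = simple_process n p \<xi> (q (Suc l)) \<omega>"
  unfolding simple_process_def
proof (intro sum.cong refl)
  fix i assume i: "i \<in> {..<n}"
  have *: "(x < u \<longleftrightarrow> x < q (Suc l))" if x: "x \<in> q ` {..m}" for x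
  proof -
    obtain a where a: "a \<le> m" "x = q a" using x by auto
    show ?thesis
    proof (cases "a \<le> l")
      case True
      then have "q a \<le> q l" "q l < q (Suc l)" using grid_less_iff[OF q, of a l] grid_less_iff[OF q, of l "Suc l"] a l
        by auto
      then show ?thesis using l a by auto
    next
      case False
      then have "q (Suc l) \<le> q a" using grid_less_iff[OF q, of "Suc l" a] a l by auto
      then show ?thesis using l a by auto
    qed
  qed
  have **: "p i \<in> q ` {..m}" "p (Suc i) \<in> q ` {..m}" using p i by auto
  from *[OF **(1)] *[OF **(2)]
  show "\<xi> i \<omega> * indicator {p i<..p (Suc i)} u = \<xi> i \<omega> * indicator {p i<..p (Suc i)} (q (Suc l))"
    by (auto simp: indicator_def not_less[symmetric])
qed

text \<open>On a grid containing all the \<open>p i\<close>, each difference of \<open>W\<close> in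
  the definition telescopes over the cells between \<open>p i\<close> and \<open>p (Suc i)\<close>
  that lie before \<open>q j\<close>.\<close>

lemma simple_integral_grid:
  assumes q: "strict_mono_on {..m} q" and p: "p ` {..n} \<subseteq> q ` {..m}"
    and pm: "\<And>i. i < n \<Longrightarrow> p i \<le> p (Suc i)" and j: "j \<le> m"
  shows "simple_integral W n p \<xi> (q j) \<omega> =
    (\<Sum>l<j. simple_process n p \<xi> (q (Suc l)) \<omega> * (W (q (Suc l)) \<omega> - W (q l) \<omega>))"
proof -
  have *: "W (min (q j) (p (Suc i))) \<omega> - W (min (q j) (p i)) \<omega> =
     (\<Sum>l<j. indicator {p i<..p (Suc i)} (q (Suc l)) * (W (q (Suc l)) \<omega> - W (q l) \<omega>))" if i: "i < n" for i
  proof -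
    have "p i \<in> q ` {..m}" "p (Suc i) \<in> q ` {..m}" using p i by auto
    then obtain a b where ab: "a \<le> m" "p i = q a" "b \<le> m" "p (Suc i) = q b" by auto
    have "a \<le> b" using pm[OF i] ab grid_less_iff[OF q] by auto
    have mn: "min (q j) (q c) = q (min j c)" if "c \<le> m" for c
      using grid_less_iff[OF q, of j c] j that by (auto simp: min_def)
    have "(\<Sum>l<j. indicator {p i<..p (Suc i)} (q (Suc l)) * (W (q (Suc l)) \<omega> - W (q l) \<omega>))
      = (\<Sum>l\<in>{min j a..<min j b}. W (q (Suc l)) \<omega> - W (q l) \<omega>)"
    proof (intro sum.mono_neutral_cong_right ballI)
      fix l assume "l \<in> {..<j} - {min j a..<min j b}"
      then have l: "l < j" "\<not> (a \<le> l \<and> l < b)" by auto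
      then have "\<not> (q a < q (Suc l) \<and> q (Suc l) \<le> q b)"
        using grid_less_iff[OF q, of a "Suc l"] grid_less_iff[OF q, of "Suc l" b] ab j by auto
      then show "indicator {p i<..p (Suc i)} (q (Suc l)) * (W (q (Suc l)) \<omega> - W (q l) \<omega>) = 0"
        by (auto simp: indicator_def ab)
    next
      fix l assume "l \<in> {min j a..<min j b}"
      then have l: "l < j" "a \<le> l" "l < b" by auto
      then have "q a < q (Suc l) \<and> q (Suc l) \<le> q b"
        using grid_less_iff[OF q, of a "Suc l"] grid_less_iff[OF q, of "Suc l" b] ab j by auto
      then show "indicator {p i<..p (Suc i)} (q (Suc l)) * (W (q (Suc l)) \<omega> - W (q l) \<omega>) =
        W (q (Suc l)) \<omega> - W (q l) \<omega>"
        by (auto simp: indicator_def ab)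
    qed auto
    also have "\<dots> = W (q (min j b)) \<omega> - W (q (min j a)) \<omega>"
      using \<open>a \<le> b\<close> by (intro sum_Suc_diff'[of _ _ "\<lambda>l. W (q l) \<omega>"]) auto
    finally show ?thesis using ab mn by simp
  qed
  have "simple_integral W n p \<xi> (q j) \<omega> =
    (\<Sum>i<n. \<Sum>l<j. \<xi> i \<omega> * indicator {p i<..p (Suc i)} (q (Suc l)) * (W (q (Suc l)) \<omega> - W (q l) \<omega>))"
    unfolding simple_integral_def
    by (intro sum.cong refl) (simp only: * lessThan_iff sum_distrib_left mult.assoc)
  also have "\<dots> = (\<Sum>l<j. \<Sum>i<n. \<xi> i \<omega> * indicator {p i<..p (Suc i)} (q (Suc l)) * (W (q (Suc l)) \<omega> - W (q l) \<omega>))"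
    by (rule sum.swap)
  finally show ?thesis
    by (simp only: simple_process_def sum_distrib_right)
qed

text \<open>Leads from the sums in \<open>elementary_integral_bound\<close> back to the time
  integrals in which approximation of the integrand is measured.\<close>

lemma grid_integral_le:
  fixes q :: "nat \<Rightarrow> real" and f :: "real \<Rightarrow> ennreal"
  assumes q: "strict_mono_on {..m} q" "q 0 = 0" and j: "j \<le> m"
    and c: "\<And>l. l < j \<Longrightarrow> 0 \<le> c l"
    and f: "\<And>l u. l < j \<Longrightarrow> q l < u \<Longrightarrow> u \<le> q (Suc l) \<Longrightarrow> ennreal (c l) \<le> f u"
  shows "ennreal (\<Sum>l<j. c l * (q (Suc l) - q l)) \<le> (\<integral>\<^sup>+u\<in>{0..q j}. f u \<partial>lborel)"
proof -
  have ql: "q l \<le> q (Suc l)" if "l < j" for l using grid_less_iff[OF q(1), of l "Suc l"] that j by auto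
  have "ennreal (\<Sum>l<j. c l * (q (Suc l) - q l)) = (\<Sum>l<j. ennreal (c l) * ennreal (q (Suc l) - q l))"
    using c ql by (subst sum_ennreal[symmetric]) (auto simp: ennreal_mult)
  also have "\<dots> = (\<Sum>l<j. \<integral>\<^sup>+u. ennreal (c l) * indicator {q l<..q (Suc l)} u \<partial>lborel)"
    using ql by (intro sum.cong refl) (subst nn_integral_cmult_indicator, auto)
  also have "\<dots> = (\<integral>\<^sup>+u. (\<Sum>l<j. ennreal (c l) * indicator {q l<..q (Suc l)} u) \<partial>lborel)"
    by (subst nn_integral_sum) auto
  also have "\<dots> \<le> (\<integral>\<^sup>+u\<in>{0..q j}. f u \<partial>lborel)"
  proof (intro nn_integral_mono)
    fix u :: real
    show "(\<Sum>l<j. ennreal (c l) * indicator {q l<..q (Suc l)} u) \<le> f u * indicator {0..q j} u"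
    proof (cases "\<exists>l<j. u \<in> {q l<..q (Suc l)}")
      case True
      then obtain l where l: "l < j" "q l < u" "u \<le> q (Suc l)" by auto
      have "indicator {q k<..q (Suc k)} u = (0::ennreal)" if "k < j" "k \<noteq> l" for k
      proof (cases "k < l")
        case True
        then have "q (Suc k) \<le> q l" using grid_less_iff[OF q(1), of "Suc k" l] that l j by auto
        then show ?thesis using l by (auto simp: indicator_def)
      next
        case False
        then have "q (Suc l) \<le> q k" using grid_less_iff[OF q(1), of "Suc l" k] that l j by auto
        then show ?thesis using l by (auto simp: indicator_def)
      qed
      then have "(\<Sum>l<j. ennreal (c l) * indicator {q l<..q (Suc l)} u) = (\<Sum>k\<in>{l}. ennreal (c k) * indicator {q k<..q
        (Suc k)} u)"
        using l by (intro sum.mono_neutral_right) auto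
      also have "\<dots> = ennreal (c l)" using l by simp
      also have "\<dots> \<le> f u" using f l by auto
      finally have *: "(\<Sum>l<j. ennreal (c l) * indicator {q l<..q (Suc l)} u) \<le> f u" .
      have "q 0 \<le> q l" "q (Suc l) \<le> q j"
        using grid_less_iff[OF q(1), of 0 l] grid_less_iff[OF q(1), of "Suc l" j] l j by auto
      then have "u \<in> {0..q j}" using l q(2) by auto
      with * show ?thesis by simp
    next
      case False
      then have "(\<Sum>l<j. ennreal (c l) * indicator {q l<..q (Suc l)} u) = 0" by (intro sum.neutral) auto
      then show ?thesis by simp
    qed
  qed
  finally show ?thesis .
qed

lemma ennreal_square_add_le: "ennreal ((x + y)\<^sup>2) \<le> ennreal 2 * ennreal (x\<^sup>2) + ennreal 2 * ennreal (y\<^sup>2)"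
proof -
  have "(x + y)\<^sup>2 \<le> 2 * x\<^sup>2 + 2 * y\<^sup>2" using sum_squares_bound[of x y] by (simp add: power2_sum)
  then have "ennreal ((x + y)\<^sup>2) \<le> ennreal (2 * x\<^sup>2 + 2 * y\<^sup>2)" by (rule ennreal_leI)
  then show ?thesis by (simp add: ennreal_plus ennreal_mult del: ennreal_numeral)
qed

lemma simple_process_measurable [measurable]:
  "(\<lambda>u. simple_process n p \<xi> u \<omega>) \<in> borel_measurable borel"
  unfolding simple_process_def by measurable

lemma simple_integrand_nonneg:
  assumes "simple_integrand \<FF> n p \<xi>" "i \<le> n"
  shows "0 \<le> p i"
  using assms(2)
proof (induction i)
  case (Suc i)
  then have "0 \<le> p i" "p i \<le> p (Suc i)" using assms(1) by (auto simp: simple_integrand_def)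
  then show ?case by simp
qed (use assms(1) in \<open>auto simp: simple_integrand_def\<close>)

context filtered_bm
begin

text \<open>Predictability: the summand with index \<open>i\<close> contributes at
  \<open>q (Suc l)\<close> only if \<open>p i < q (Suc l)\<close>. As \<open>p i\<close> is a grid
  point, this means \<open>p i <= q l\<close>, so \<open>\<xi> i\<close> is known at time
  \<open>q l\<close>.\<close>

lemma simple_process_adapted:
  assumes q: "strict_mono_on {..m} q" and p: "p ` {..n} \<subseteq> q ` {..m}"
    and s: "simple_integrand FF n p \<xi>" and l: "l < m"
  shows "simple_process n p \<xi> (q (Suc l)) \<in> borel_measurable (FF (ennreal (q l)))"
    "\<exists>C. \<forall>\<omega>\<in>space M. \<bar>simple_process n p \<xi> (q (Suc l)) \<omega>\<bar> \<le> C"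
proof -
  have eq: "simple_process n p \<xi> (q (Suc l)) = (\<lambda>\<omega>. \<Sum>i<n. \<xi> i \<omega> * indicator {p i<..p (Suc i)} (q (Suc l)))"
    by (auto simp: simple_process_def)
  show "simple_process n p \<xi> (q (Suc l)) \<in> borel_measurable (FF (ennreal (q l)))"
    unfolding eq
  proof (intro borel_measurable_sum)
    fix i assume i: "i \<in> {..<n}"
    show "(\<lambda>\<omega>. \<xi> i \<omega> * indicator {p i<..p (Suc i)} (q (Suc l))) \<in> borel_measurable (FF (ennreal (q l)))"
    proof (cases "p i < q (Suc l)")
      case True
      have "p i \<in> q ` {..m}" using p i by auto
      then obtain a where a: "a \<le> m" "p i = q a" by auto
      then have "p i \<le> q l" using True grid_less_iff[OF q, of a "Suc l"] grid_less_iff[OF q, of a l] l by auto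
      have "\<xi> i \<in> borel_measurable (FF (ennreal (p i)))" using s i by (auto simp: simple_integrand_def)
      from measurable_FF_mono[OF this ennreal_leI[OF \<open>p i \<le> q l\<close>]] show ?thesis
        by (intro borel_measurable_times borel_measurable_const)
    qed simp
  qed
  have "\<forall>i\<in>{..<n}. \<exists>C. \<forall>\<omega>\<in>space M. \<bar>\<xi> i \<omega>\<bar> \<le> C" using s by (auto simp: simple_integrand_def)
  from bchoice[OF this] obtain C where C: "\<And>i \<omega>. i < n \<Longrightarrow> \<omega> \<in> space M \<Longrightarrow> \<bar>\<xi> i \<omega>\<bar> \<le> C i" by auto
  have "\<bar>simple_process n p \<xi> (q (Suc l)) \<omega>\<bar> \<le> (\<Sum>i<n. C i)" if "\<omega> \<in> space M" for \<omega>
    unfolding simple_process_def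
  proof (intro order_trans[OF sum_abs] sum_mono)
    fix i assume "i \<in> {..<n}"
    then have "\<bar>\<xi> i \<omega>\<bar> \<le> C i" using C that by auto
    then show "\<bar>\<xi> i \<omega> * indicator {p i<..p (Suc i)} (q (Suc l))\<bar> \<le> C i"
      by (auto simp: indicator_def)
  qed
  then show "\<exists>C. \<forall>\<omega>\<in>space M. \<bar>simple_process n p \<xi> (q (Suc l)) \<omega>\<bar> \<le> C" by blast
qed

text \<open>The substitute for the Ito isometry. It holds in probability instead of in mean square,
  and the square root is the price of the cut at level \<open>c\<close> in
  \<open>elementary_integral_bound\<close>.\<close>

lemma simple_integral_diff_bound:
  assumes s: "simple_integrand FF n p \<xi>" and s': "simple_integrand FF n' p' \<xi>'" and t: "0 \<le> t"
  shows "outer_mean M (\<lambda>\<omega>. ennreal ((simple_integral W n p \<xi> t \<omega> - simple_integral W n' p' \<xi>' t \<omega>)\<^sup>2)) \<le>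
    2 * sqrt (outer_mean M (\<lambda>\<omega>. \<integral>\<^sup>+u\<in>{0..t}. ennreal ((simple_process n p \<xi> u \<omega> - simple_process n' p' \<xi>' u \<omega>)\<^sup>2)
      \<partial>lborel))"
proof -
  define Q where "Q = {0, t} \<union> p ` {..n} \<union> p' ` {..n'}"
  have pm: "p i \<le> p (Suc i)" if "simple_integrand FF n p \<xi>" "i < n" for n p \<xi> i
    using that by (auto simp: simple_integrand_def)
  have "finite Q" "0 \<in> Q" "\<And>x. x \<in> Q \<Longrightarrow> 0 \<le> x"
    using simple_integrand_nonneg[OF s] simple_integrand_nonneg[OF s'] t unfolding Q_def by auto
  from finite_grid_enumeration[OF this]
  obtain q :: "nat \<Rightarrow> real" and m where q: "strict_mono_on {..m} q" "q ` {..m} = Q" "q 0 = 0" .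
  have "t \<in> q ` {..m}" unfolding q(2) by (simp add: Q_def)
  then obtain j where j: "j \<le> m" "q j = t" by auto
  have sub: "p ` {..n} \<subseteq> q ` {..m}" "p' ` {..n'} \<subseteq> q ` {..m}" using q(2) by (auto simp: Q_def)
  define \<phi> where "\<phi> l \<omega> = simple_process n p \<xi> (q (Suc l)) \<omega> - simple_process n' p' \<xi>' (q (Suc l)) \<omega>" for l \<omega>
  \<comment> \<open>A single block with index 0, so that the sum of squares is the square of the
    whole integral.\<close>
  have "outer_mean M (\<lambda>\<omega>. ennreal (\<Sum>i<(1::nat). (\<Sum>l | l < j \<and> 0 = i. \<phi> l \<omega> * (W (q (Suc l)) \<omega> - W (q l) \<omega>))\<^sup>2))
    \<le> 2 * sqrt (outer_mean M (\<lambda>\<omega>. ennreal (\<Sum>l<j. (\<phi> l \<omega>)\<^sup>2 * (q (Suc l) - q l))))"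
  proof (rule elementary_integral_bound)
    show "q l < q (Suc l)" if "l < j" for l using grid_less_iff[OF q(1), of l "Suc l"] that j by auto
    show "\<phi> l \<in> borel_measurable (FF (ennreal (q l)))" if "l < j" for l
      unfolding \<phi>_def using that j
      by (intro borel_measurable_diff simple_process_adapted[OF q(1) sub(1) s] simple_process_adapted[OF q(1) sub(2)
        s']) auto
    fix l assume "l < j"
    then have "l < m" using j by auto
    from simple_process_adapted(2)[OF q(1) sub(1) s this] simple_process_adapted(2)[OF q(1) sub(2) s' this]
    obtain C C' where "\<forall>\<omega>\<in>space M. \<bar>simple_process n p \<xi> (q (Suc l)) \<omega>\<bar> \<le> C"
       "\<forall>\<omega>\<in>space M. \<bar>simple_process n' p' \<xi>' (q (Suc l)) \<omega>\<bar> \<le> C'" by auto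
    then show "\<exists>C. \<forall>\<omega>\<in>space M. \<bar>\<phi> l \<omega>\<bar> \<le> C"
      unfolding \<phi>_def by (intro exI[of _ "C + C'"]) (auto intro: order_trans[OF abs_triangle_ineq4] add_mono)
  qed (simp add: q)
  also have "(\<lambda>\<omega>. ennreal (\<Sum>i<(1::nat). (\<Sum>l | l < j \<and> 0 = i. \<phi> l \<omega> * (W (q (Suc l)) \<omega> - W (q l) \<omega>))\<^sup>2)) =
     (\<lambda>\<omega>. ennreal ((simple_integral W n p \<xi> t \<omega> - simple_integral W n' p' \<xi>' t \<omega>)\<^sup>2))"
  proof (rule ext)
    fix \<omega>
    have "{l. l < j \<and> 0 = (0::nat)} = {..<j}" by auto
    then show "ennreal (\<Sum>i<(1::nat). (\<Sum>l | l < j \<and> 0 = i. \<phi> l \<omega> * (W (q (Suc l)) \<omega> - W (q l) \<omega>))\<^sup>2) =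
      ennreal ((simple_integral W n p \<xi> t \<omega> - simple_integral W n' p' \<xi>' t \<omega>)\<^sup>2)"
      unfolding j(2)[symmetric] using simple_integral_grid[OF q(1) sub(1) pm[OF s] j(1), of W \<xi> \<omega>]
        simple_integral_grid[OF q(1) sub(2) pm[OF s'] j(1), of W \<xi>' \<omega>]
      by (simp add: \<phi>_def left_diff_distrib sum_subtractf)
  qed
  also have "outer_mean M (\<lambda>\<omega>. ennreal (\<Sum>l<j. (\<phi> l \<omega>)\<^sup>2 * (q (Suc l) - q l))) \<le>
    outer_mean M (\<lambda>\<omega>. \<integral>\<^sup>+u\<in>{0..t}. ennreal ((simple_process n p \<xi> u \<omega> - simple_process n' p' \<xi>' u \<omega>)\<^sup>2) \<partial>lborel)"
  proof (intro outer_mean_mono AE_I2)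
    fix \<omega>
    show "ennreal (\<Sum>l<j. (\<phi> l \<omega>)\<^sup>2 * (q (Suc l) - q l)) \<le>
      (\<integral>\<^sup>+u\<in>{0..t}. ennreal ((simple_process n p \<xi> u \<omega> - simple_process n' p' \<xi>' u \<omega>)\<^sup>2) \<partial>lborel)"
      unfolding j(2)[symmetric]
    proof (rule grid_integral_le[OF q(1,3) j(1)])
      fix l u assume "l < j" "q l < u" "u \<le> q (Suc l)"
      then show "ennreal ((\<phi> l \<omega>)\<^sup>2) \<le> ennreal ((simple_process n p \<xi> u \<omega> - simple_process n' p' \<xi>' u \<omega>)\<^sup>2)"
        using simple_process_grid[OF q(1) sub(1), of l u \<xi> \<omega>] simple_process_grid[OF q(1) sub(2), of l u \<xi>' \<omega>] j
        by (simp add: \<phi>_def)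
    qed simp
  qed
  finally show ?thesis by simp
qed

end

lemma nn_integral_lincomb:
  assumes [measurable]: "f \<in> borel_measurable M" "g \<in> borel_measurable M"
  shows "(\<integral>\<^sup>+x. c * f x + d * g x \<partial>M) = c * (\<integral>\<^sup>+x. f x \<partial>M) + d * (\<integral>\<^sup>+x. g x \<partial>M)"
  by (simp add: nn_integral_add nn_integral_cmult)

lemma ennreal_lincomb:
  assumes "0 \<le> a" "0 \<le> x" "0 \<le> b" "0 \<le> y"
  shows "ennreal (a * x + b * y) = ennreal a * ennreal x + ennreal b * ennreal y"
  using assms by (simp add: ennreal_plus ennreal_mult)

section \<open>Limits of simple integrals\<close>

context filtered_bm
begin

definition approximates ::
  "(real \<Rightarrow> 'a \<Rightarrow> real) \<Rightarrow> real \<Rightarrow> (nat \<Rightarrow> nat) \<Rightarrow> (nat \<Rightarrow> nat \<Rightarrow> real) \<Rightarrow> (nat \<Rightarrow> nat \<Rightarrow> 'a \<Rightarrow> real) \<Rightarrow> bool" where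
  "approximates H t n p \<xi> \<longleftrightarrow> (\<forall>j. simple_integrand FF (n j) (p j) (\<xi> j)) \<and>
     (\<lambda>j. outer_mean M (\<lambda>\<omega>. \<integral>\<^sup>+u\<in>{0..t}. ennreal ((simple_process (n j) (p j) (\<xi> j) u \<omega> - H u \<omega>)\<^sup>2) \<partial>lborel)) \<longlonglongrightarrow> 0"

lemma outer_mean_square_add:
  "outer_mean M (\<lambda>\<omega>. ennreal ((f \<omega> + g \<omega>)\<^sup>2)) \<le> 2 * outer_mean M (\<lambda>\<omega>. ennreal ((f \<omega>)\<^sup>2)) + 2 * outer_mean M (\<lambda>\<omega>.
    ennreal ((g \<omega>)\<^sup>2))"
proof -
  have "outer_mean M (\<lambda>\<omega>. ennreal ((f \<omega> + g \<omega>)\<^sup>2)) \<le> outer_mean M (\<lambda>\<omega>. ennreal 2 * ennreal ((f \<omega>)\<^sup>2) + ennreal 2 *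
    ennreal ((g \<omega>)\<^sup>2))"
    by (intro outer_mean_mono AE_I2 ennreal_square_add_le)
  also have "\<dots> \<le> outer_mean M (\<lambda>\<omega>. ennreal 2 * ennreal ((f \<omega>)\<^sup>2)) + outer_mean M (\<lambda>\<omega>. ennreal 2 * ennreal ((g \<omega>)\<^sup>2))"
    by (rule outer_mean_add)
  also have "\<dots> \<le> 2 * outer_mean M (\<lambda>\<omega>. ennreal ((f \<omega>)\<^sup>2)) + 2 * outer_mean M (\<lambda>\<omega>. ennreal ((g \<omega>)\<^sup>2))"
    by (intro add_mono outer_mean_cmult) auto
  finally show ?thesis .
qed

text \<open>The integrals at different times come with unrelated approximating sequences. Both
  sequences are close to \<open>H\<close> on \<open>[0,t]\<close>, hence to each other, so
  \<open>simple_integral_diff_bound\<close> makes their integrals close as well; thus the sequence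
  for the final time \<open>T\<close> serves all earlier times.\<close>

lemma simple_integral_tendsto:
  assumes H: "AE \<omega> in M. continuous_on {0..} (\<lambda>u. H u \<omega>)"
    and A: "approximates H T n p \<xi>" and A': "approximates H t n' p' \<xi>'"
    and t: "0 \<le> t" "t \<le> T"
    and I: "(\<lambda>j. outer_mean M (\<lambda>\<omega>. ennreal \<bar>simple_integral W (n' j) (p' j) (\<xi>' j) t \<omega> - I \<omega>\<bar>)) \<longlonglongrightarrow> 0"
  shows "(\<lambda>j. outer_mean M (\<lambda>\<omega>. ennreal ((simple_integral W (n j) (p j) (\<xi> j) t \<omega> - I \<omega>)\<^sup>2))) \<longlonglongrightarrow> 0"
proof -
  define D where "D j \<omega> = (\<integral>\<^sup>+u\<in>{0..T}. ennreal ((simple_process (n j) (p j) (\<xi> j) u \<omega> - H u \<omega>)\<^sup>2) \<partial>lborel)" for j \<omega>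
  define D' where "D' j \<omega> = (\<integral>\<^sup>+u\<in>{0..t}. ennreal ((simple_process (n' j) (p' j) (\<xi>' j) u \<omega> - H u \<omega>)\<^sup>2) \<partial>lborel)" for
    j \<omega>
  have lim: "(\<lambda>j. outer_mean M (D j)) \<longlonglongrightarrow> 0" "(\<lambda>j. outer_mean M (D' j)) \<longlonglongrightarrow> 0"
    using A A' by (auto simp: approximates_def D_def[abs_def] D'_def[abs_def])
  have s: "simple_integrand FF (n j) (p j) (\<xi> j)" "simple_integrand FF (n' j) (p' j) (\<xi>' j)" for j
    using A A' by (auto simp: approximates_def)
  let ?S = "\<lambda>j. simple_integral W (n j) (p j) (\<xi> j) t" and ?S' = "\<lambda>j. simple_integral W (n' j) (p' j) (\<xi>' j) t"
  have norm: "outer_mean M (\<lambda>\<omega>. \<integral>\<^sup>+u\<in>{0..t}. ennreal ((simple_process (n j) (p j) (\<xi> j) u \<omega> - simple_process (n' j)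
    (p' j) (\<xi>' j) u \<omega>)\<^sup>2) \<partial>lborel)
     \<le> 2 * outer_mean M (D j) + 2 * outer_mean M (D' j)" (is "outer_mean M ?N \<le> _") for j
  proof -
    have "AE \<omega> in M. ?N \<omega> \<le> ennreal 2 * D j \<omega> + ennreal 2 * D' j \<omega>"
      using H
    proof eventually_elim
      fix \<omega> assume "continuous_on {0..} (\<lambda>u. H u \<omega>)"
      then have "continuous_on {0..t} (\<lambda>u. H u \<omega>)" by (rule continuous_on_subset) auto
      \<comment> \<open>Measurability of \<open>H\<close> in time comes from the continuity of the
        path, cut to \<open>[0,t]\<close>; it is needed to split the integral of the sum.\<close>
      then have [measurable]: "(\<lambda>u. indicator {0..t} u * H u \<omega>) \<in> borel_measurable borel"
        using borel_measurable_continuous_on_indicator[of "{0..t}" "\<lambda>u. H u \<omega>"] by simp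
      let ?\<Phi> = "\<lambda>u. simple_process (n j) (p j) (\<xi> j) u \<omega>" and ?\<Psi> = "\<lambda>u. simple_process (n' j) (p' j) (\<xi>' j) u \<omega>"
      let ?H = "\<lambda>u. indicator {0..t} u * H u \<omega>"
      have "?N \<omega> \<le> (\<integral>\<^sup>+u\<in>{0..t}. (ennreal 2 * ennreal ((?\<Phi> u - ?H u)\<^sup>2) + ennreal 2 * ennreal ((?\<Psi> u - ?H u)\<^sup>2))
        \<partial>lborel)"
      proof (intro nn_integral_mono mult_right_mono)
        fix u
        show "ennreal ((?\<Phi> u - ?\<Psi> u)\<^sup>2) \<le> ennreal 2 * ennreal ((?\<Phi> u - ?H u)\<^sup>2) + ennreal 2 * ennreal ((?\<Psi> u -
          ?H u)\<^sup>2)"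
          using ennreal_square_add_le[of "?\<Phi> u - ?H u" "?H u - ?\<Psi> u"] by (simp add: power2_commute[of "?H u"])
      qed simp
      also have "\<dots> = (\<integral>\<^sup>+u. ennreal 2 * (ennreal ((?\<Phi> u - ?H u)\<^sup>2) * indicator {0..t} u) + ennreal 2 *
        (ennreal ((?\<Psi> u - ?H u)\<^sup>2) * indicator {0..t} u) \<partial>lborel)"
        by (simp only: distrib_right mult.assoc)
      also have "\<dots> = ennreal 2 * (\<integral>\<^sup>+u\<in>{0..t}. ennreal ((?\<Phi> u - ?H u)\<^sup>2) \<partial>lborel) + ennreal 2 * (\<integral>\<^sup>+u\<in>{0..t}. ennreal
        ((?\<Psi> u - ?H u)\<^sup>2) \<partial>lborel)"
        by (rule nn_integral_lincomb) measurable
      also have "(\<integral>\<^sup>+u\<in>{0..t}. ennreal ((?\<Phi> u - ?H u)\<^sup>2) \<partial>lborel) \<le> D j \<omega>"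
        unfolding D_def using t by (intro nn_integral_mono) (auto simp: indicator_def)
      also have "(\<integral>\<^sup>+u\<in>{0..t}. ennreal ((?\<Psi> u - ?H u)\<^sup>2) \<partial>lborel) = D' j \<omega>"
        unfolding D'_def using t by (intro nn_integral_cong) (auto simp: indicator_def)
      finally show "?N \<omega> \<le> ennreal 2 * D j \<omega> + ennreal 2 * D' j \<omega>"
        by (simp add: add_mono mult_left_mono)
    qed
    then have "outer_mean M ?N \<le> outer_mean M (\<lambda>\<omega>. ennreal 2 * D j \<omega> + ennreal 2 * D' j \<omega>)" by (rule outer_mean_mono)
    also have "\<dots> \<le> outer_mean M (\<lambda>\<omega>. ennreal 2 * D j \<omega>) + outer_mean M (\<lambda>\<omega>. ennreal 2 * D' j \<omega>)"
      by (rule outer_mean_add)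
    also have "\<dots> \<le> 2 * outer_mean M (D j) + 2 * outer_mean M (D' j)" by (intro add_mono outer_mean_cmult) auto
    finally show ?thesis .
  qed
  define U where "U j = 2 * (2 * sqrt (2 * outer_mean M (D j) + 2 * outer_mean M (D' j))) + 2 * outer_mean M (\<lambda>\<omega>.
    ennreal \<bar>?S' j \<omega> - I \<omega>\<bar>)" for j
  have bound: "outer_mean M (\<lambda>\<omega>. ennreal ((?S j \<omega> - I \<omega>)\<^sup>2)) \<le> U j" for j
  proof -
    have "outer_mean M (\<lambda>\<omega>. ennreal ((?S j \<omega> - I \<omega>)\<^sup>2)) \<le> 2 * outer_mean M (\<lambda>\<omega>. ennreal ((?S j \<omega> - ?S' j \<omega>)\<^sup>2)) + 2 *
      outer_mean M (\<lambda>\<omega>. ennreal ((?S' j \<omega> - I \<omega>)\<^sup>2))"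
      using outer_mean_square_add[of "\<lambda>\<omega>. ?S j \<omega> - ?S' j \<omega>" "\<lambda>\<omega>. ?S' j \<omega> - I \<omega>"] by simp
    moreover have "outer_mean M (\<lambda>\<omega>. ennreal ((?S j \<omega> - ?S' j \<omega>)\<^sup>2)) \<le> 2 * sqrt (2 * outer_mean M (D j) + 2 *
      outer_mean M (D' j))"
      by (rule order_trans[OF simple_integral_diff_bound[OF s t(1)]]) (use norm in simp)
    moreover have "outer_mean M (\<lambda>\<omega>. ennreal ((?S' j \<omega> - I \<omega>)\<^sup>2)) \<le> outer_mean M (\<lambda>\<omega>. ennreal \<bar>?S' j \<omega> - I \<omega>\<bar>)"
      by (rule outer_mean_square_le)
    ultimately show ?thesis unfolding U_def by linarith
  qed
  have "U \<longlonglongrightarrow> 2 * (2 * sqrt (2 * 0 + 2 * 0)) + 2 * 0"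
    unfolding U_def by (intro tendsto_intros lim I)
  then have U: "U \<longlonglongrightarrow> 0" by simp
  show ?thesis
    by (rule tendsto_sandwich[OF _ _ tendsto_const U]) (intro always_eventually allI outer_mean_nonneg bound)+
qed

text \<open>The weights \<open>e i\<close> are known at time \<open>t i\<close> and may be taken inside the simple integrals, so
  that only the distance of the integrand to its values at the left grid points matters.\<close>

lemma weighted_remainder_bound:
  fixes X :: "real \<Rightarrow> 'a \<Rightarrow> real" and t :: "nat \<Rightarrow> real" and e I :: "nat \<Rightarrow> 'a \<Rightarrow> real" and g :: "nat \<Rightarrow> nat"
  assumes X_cont: "AE \<omega> in M. continuous_on {0..} (\<lambda>u. X u \<omega>)"
    and A: "approximates (\<lambda>u \<omega>. b * X u \<omega>) T n p \<xi>"
    and t: "strict_mono_on {..k} t" "t 0 = 0" "t k = T"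
    and eX: "\<And>i. i < k \<Longrightarrow> X (t i) \<in> borel_measurable (FF (ennreal (t i)))"
            "\<And>i. i < k \<Longrightarrow> e i \<in> borel_measurable (FF (ennreal (t i)))"
    and C: "\<And>i \<omega>. i < k \<Longrightarrow> \<omega> \<in> space M \<Longrightarrow> \<bar>e i \<omega>\<bar> \<le> C"
            "\<And>i \<omega>. i < k \<Longrightarrow> \<omega> \<in> space M \<Longrightarrow> \<bar>e i \<omega> * X (t i) \<omega>\<bar> \<le> C'"
    and w: "AE \<omega> in M. \<forall>i<k. \<forall>u\<in>{t i..t (Suc i)}. ennreal ((X u \<omega> - X (t i) \<omega>)\<^sup>2) \<le> w \<omega>"
    and I: "\<And>i. i \<le> k \<Longrightarrow> (\<lambda>j. outer_mean M (\<lambda>\<omega>. ennreal ((simple_integral W (n j) (p j) (\<xi> j) (t i) \<omega> - I i \<omega>)\<^sup>2))) \<longlonglongrightarrow>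
      0"
  defines "\<eta> \<equiv> \<lambda>i \<omega>. I (Suc i) \<omega> - I i \<omega> - b * X (t i) \<omega> * (W (t (Suc i)) \<omega> - W (t i) \<omega>)"
  shows "outer_mean M (\<lambda>\<omega>. ennreal (\<Sum>r<k. (\<Sum>i | i < k \<and> g i = r. e i \<omega> * \<eta> i \<omega>)\<^sup>2)) \<le>
    4 * sqrt (max 1 (2 * C\<^sup>2 * b\<^sup>2 * T) * outer_mean M w)"
proof (cases "k = 0")
  case True
  then show ?thesis by (simp add: outer_mean_zero)
next
  case False
  have t_mono: "t i \<le> t i'" if "i \<le> i'" "i' \<le> k" for i i' using grid_less_iff[OF t(1), of i i'] that by auto
  have t_nonneg: "0 \<le> t i" if "i \<le> k" for i using t_mono[of 0 i] t that by simp
  have T: "0 \<le> T" using t_nonneg[of k] t by simp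
  have s: "simple_integrand FF (n j) (p j) (\<xi> j)" for j using A by (auto simp: approximates_def)
  define D where "D j \<omega> = (\<integral>\<^sup>+u\<in>{0..T}. ennreal ((simple_process (n j) (p j) (\<xi> j) u \<omega> - b * X u \<omega>)\<^sup>2) \<partial>lborel)" for j
    \<omega>
  have D: "(\<lambda>j. outer_mean M (D j)) \<longlonglongrightarrow> 0" using A by (auto simp: approximates_def D_def[abs_def])
  \<comment> \<open>The factor 2 stems from (x + y)^2 <= 2 x^2 + 2 y^2, \<open>C\<close> bounds the
    weights, and \<open>T\<close> is the length of the time interval; \<open>max 1\<close> makes
    \<open>outer_mean_cmult\<close> applicable.\<close>
  define K where "K = max 1 (2 * C\<^sup>2 * b\<^sup>2 * T)"
  define K' where "K' = max 1 (2 * C\<^sup>2)"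
  let ?SI = "\<lambda>j. simple_integral W (n j) (p j) (\<xi> j)"
  define \<eta>' where "\<eta>' j i \<omega> = ?SI j (t (Suc i)) \<omega> - ?SI j (t i) \<omega> - b * X (t i) \<omega> * (W (t (Suc i)) \<omega> - W (t i) \<omega>)" for
    j i \<omega>
  have main: "outer_mean M (\<lambda>\<omega>. ennreal (\<Sum>r<k. (\<Sum>i | i < k \<and> g i = r. e i \<omega> * \<eta>' j i \<omega>)\<^sup>2)) \<le>
    2 * sqrt (K' * outer_mean M (D j) + K * outer_mean M w)" for j
  proof -
    define \<Phi> where "\<Phi> = simple_process (n j) (p j) (\<xi> j)"
    define Q where "Q = t ` {..k} \<union> p j ` {..n j}"
    have "finite Q" "0 \<in> Q" "\<And>x. x \<in> Q \<Longrightarrow> 0 \<le> x"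
      using simple_integrand_nonneg[OF s[of j]] t_nonneg t(2) unfolding Q_def by (auto intro!: image_eqI[of 0 t 0])
    from finite_grid_enumeration[OF this]
    obtain q :: "nat \<Rightarrow> real" and m where q: "strict_mono_on {..m} q" "q ` {..m} = Q" "q 0 = 0" .
    have sub: "p j ` {..n j} \<subseteq> q ` {..m}" unfolding q(2) by (simp add: Q_def)
    have pm: "p j i \<le> p j (Suc i)" if "i < n j" for i
      using s[of j] that by (auto simp: simple_integrand_def)
    have "\<forall>i\<in>{..k}. \<exists>a. a \<le> m \<and> q a = t i"
    proof
      fix i assume "i \<in> {..k}"
      then have "t i \<in> q ` {..m}" unfolding q(2) by (simp add: Q_def)
      then show "\<exists>a. a \<le> m \<and> q a = t i" by auto
    qed
    from bchoice[OF this] obtain \<kappa> where \<kappa>: "\<And>i. i \<le> k \<Longrightarrow> \<kappa> i \<le> m" "\<And>i. i \<le> k \<Longrightarrow> q (\<kappa> i) = t i" by auto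
    have \<kappa>_mono: "\<kappa> i \<le> \<kappa> i' \<longleftrightarrow> i \<le> i'" if "i \<le> k" "i' \<le> k" for i i'
      using grid_less_iff(2)[OF q(1), of "\<kappa> i" "\<kappa> i'"] grid_less_iff(2)[OF t(1), of i i'] \<kappa> that by simp
    have \<kappa>0: "\<kappa> 0 = 0"
      using grid_less_iff(2)[OF q(1), of "\<kappa> 0" 0] \<kappa>(1,2)[of 0] t q by simp
    \<comment> \<open>The fine cell \<open>l\<close> lies in the coarse cell that starts at the last
      coarse point not after \<open>l\<close>; this cell will be \<open>idx l\<close>.\<close>
    have "\<exists>i<k. \<kappa> i \<le> l \<and> l < \<kappa> (Suc i)" if "l < \<kappa> k" for l
    proof -
      define i where "i = Max {i. i \<le> k \<and> \<kappa> i \<le> l}"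
      have fin: "finite {i. i \<le> k \<and> \<kappa> i \<le> l}" by (rule finite_subset[of _ "{..k}"]) auto
      have ne: "{i. i \<le> k \<and> \<kappa> i \<le> l} \<noteq> {}" using \<kappa>0 by (auto intro!: exI[of _ 0])
      have i: "i \<le> k" "\<kappa> i \<le> l" using Max_in[OF fin ne] unfolding i_def by auto
      have "i \<noteq> k" using i that by auto
      with i have "i < k" by simp
      moreover have "\<not> \<kappa> (Suc i) \<le> l"
        using Max_ge[OF fin, of "Suc i"] \<open>i < k\<close> unfolding i_def[symmetric] by auto
      ultimately show ?thesis using i by auto
    qed
    then have "\<forall>l\<in>{..<\<kappa> k}. \<exists>i. i < k \<and> \<kappa> i \<le> l \<and> l < \<kappa> (Suc i)" by blast
    from bchoice[OF this] obtain idx where "\<forall>l\<in>{..<\<kappa> k}. idx l < k \<and> \<kappa> (idx l) \<le> l \<and> l < \<kappa> (Suc (idx l))" ..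
    then have idx: "\<And>l. l < \<kappa> k \<Longrightarrow> idx l < k \<and> \<kappa> (idx l) \<le> l \<and> l < \<kappa> (Suc (idx l))" by simp
    have idx_eq: "{l. l < \<kappa> k \<and> idx l = i} = {\<kappa> i..<\<kappa> (Suc i)}" if "i < k" for i
    proof (intro set_eqI iffI)
      fix l assume "l \<in> {\<kappa> i..<\<kappa> (Suc i)}"
      then have l: "\<kappa> i \<le> l" "l < \<kappa> (Suc i)" by auto
      moreover have "\<kappa> (Suc i) \<le> \<kappa> k" using \<kappa>_mono[of "Suc i" k] that by simp
      ultimately have lk: "l < \<kappa> k" by simp
      note id = idx[OF lk]
      have "\<kappa> i < \<kappa> (Suc (idx l))" "\<kappa> (idx l) < \<kappa> (Suc i)" using id l by linarith+
      then have "i < Suc (idx l)" "idx l < Suc i"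
        using \<kappa>_mono[of "Suc (idx l)" i] \<kappa>_mono[of "Suc i" "idx l"] id that by (auto simp: not_le[symmetric])
      then show "l \<in> {l. l < \<kappa> k \<and> idx l = i}" using lk by auto
    qed (use idx in auto)
    \<comment> \<open>The simple integrand minus the integrand frozen at the left coarse point,
      times the weight, which is known there. Summed against the increments of \<open>W\<close> over
      one coarse cell, this gives \<open>e i * \<eta>' j i\<close>.\<close>
    define \<phi> where "\<phi> l \<omega> = e (idx l) \<omega> * (\<Phi> (q (Suc l)) \<omega> - b * X (t (idx l)) \<omega>)" for l \<omega>
    have lm: "l < m" if "l < \<kappa> k" for l using that \<kappa>(1)[of k] by simp
    have inner: "(\<Sum>l | l < \<kappa> k \<and> g (idx l) = r. \<phi> l \<omega> * (W (q (Suc l)) \<omega> - W (q l) \<omega>)) =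
        (\<Sum>i | i < k \<and> g i = r. e i \<omega> * \<eta>' j i \<omega>)" for \<omega> r
    proof -
      have "(\<Sum>l | l < \<kappa> k \<and> g (idx l) = r. \<phi> l \<omega> * (W (q (Suc l)) \<omega> - W (q l) \<omega>)) =
        (\<Sum>i | i < k \<and> g i = r. \<Sum>l | l \<in> {l. l < \<kappa> k \<and> g (idx l) = r} \<and> idx l = i. \<phi> l \<omega> * (W (q (Suc l)) \<omega> - W
          (q l) \<omega>))"
        using idx by (intro sum.group[symmetric]) auto
      also have "\<dots> = (\<Sum>i | i < k \<and> g i = r. e i \<omega> * \<eta>' j i \<omega>)"
      proof (intro sum.cong refl)
        fix i assume "i \<in> {i. i < k \<and> g i = r}"
        then have i: "i < k" "g i = r" by auto
        let ?d = "\<lambda>l. W (q (Suc l)) \<omega> - W (q l) \<omega>"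
        have set_eq: "{l \<in> {l. l < \<kappa> k \<and> g (idx l) = r}. idx l = i} = {\<kappa> i..<\<kappa> (Suc i)}"
          unfolding idx_eq[OF i(1), symmetric] using i by auto
        have le: "\<kappa> i \<le> \<kappa> (Suc i)" using \<kappa>_mono[of i "Suc i"] i by auto
        have SI: "?SI j (t i') \<omega> = (\<Sum>l<\<kappa> i'. \<Phi> (q (Suc l)) \<omega> * ?d l)" if "i' \<le> k" for i'
          using simple_integral_grid[OF q(1) sub pm \<kappa>(1)[OF that], of W "\<xi> j" \<omega>] \<kappa>(2)[OF that] by (simp add: \<Phi>_def)
        have "(\<Sum>l\<in>{\<kappa> i..<\<kappa> (Suc i)}. \<Phi> (q (Suc l)) \<omega> * ?d l) = ?SI j (t (Suc i)) \<omega> - ?SI j (t i) \<omega>"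
          using sum.atLeastLessThan_concat[of 0 "\<kappa> i" "\<kappa> (Suc i)" "\<lambda>l. \<Phi> (q (Suc l)) \<omega> * ?d l"] le i
          by (simp add: SI lessThan_atLeast0)
        moreover have "(\<Sum>l\<in>{\<kappa> i..<\<kappa> (Suc i)}. ?d l) = W (t (Suc i)) \<omega> - W (t i) \<omega>"
          using sum_Suc_diff'[OF le, of "\<lambda>l. W (q l) \<omega>"] \<kappa>(2)[of i] \<kappa>(2)[of "Suc i"] i by simp
        moreover have "(\<Sum>l\<in>{\<kappa> i..<\<kappa> (Suc i)}. \<phi> l \<omega> * ?d l) =
          (\<Sum>l\<in>{\<kappa> i..<\<kappa> (Suc i)}. e i \<omega> * (\<Phi> (q (Suc l)) \<omega> * ?d l) - e i \<omega> * (b * X (t i) \<omega>) * ?d l)"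
        proof (intro sum.cong refl)
          fix l assume "l \<in> {\<kappa> i..<\<kappa> (Suc i)}"
          then have "idx l = i" unfolding idx_eq[OF i(1), symmetric] by simp
          then show "\<phi> l \<omega> * ?d l = e i \<omega> * (\<Phi> (q (Suc l)) \<omega> * ?d l) - e i \<omega> * (b * X (t i) \<omega>) * ?d l"
            unfolding \<phi>_def by (simp only:) (simp add: algebra_simps)
        qed
        ultimately show "(\<Sum>l | l \<in> {l. l < \<kappa> k \<and> g (idx l) = r} \<and> idx l = i. \<phi> l \<omega> * ?d l) = e i \<omega> * \<eta>' j i \<omega>"
          unfolding set_eq \<eta>'_def by (simp only: sum_subtractf sum_distrib_left[symmetric]) (simp add: algebra_simps)
      qed
      finally show ?thesis .
    qed
    have "outer_mean M (\<lambda>\<omega>. ennreal (\<Sum>r<k. (\<Sum>l | l < \<kappa> k \<and> g (idx l) = r. \<phi> l \<omega> * (W (q (Suc l)) \<omega> - W (q l) \<omega>))\<^sup>2))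
      \<le> 2 * sqrt (outer_mean M (\<lambda>\<omega>. ennreal (\<Sum>l<\<kappa> k. (\<phi> l \<omega>)\<^sup>2 * (q (Suc l) - q l))))"
    proof (rule elementary_integral_bound)
      show "q l < q (Suc l)" if "l < \<kappa> k" for l
        using grid_less_iff[OF q(1), of l "Suc l"] lm[OF that] by auto
      fix l assume l: "l < \<kappa> k"
      have i: "idx l < k" "t (idx l) \<le> q l"
        using idx[OF l] \<kappa>(2)[of "idx l"] \<kappa>(1)[of "idx l"] grid_less_iff(2)[OF q(1), of "\<kappa> (idx l)" l] lm[OF l] by auto
      note mono = measurable_FF_mono[OF _ ennreal_leI[OF i(2)]]
      note SP = simple_process_adapted[OF q(1) sub s lm[OF l]]
      show "\<phi> l \<in> borel_measurable (FF (ennreal (q l)))"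
        unfolding \<phi>_def \<Phi>_def
        by (intro borel_measurable_times borel_measurable_diff borel_measurable_const mono eX SP i)
      obtain c where c: "\<And>\<omega>. \<omega> \<in> space M \<Longrightarrow> \<bar>\<Phi> (q (Suc l)) \<omega>\<bar> \<le> c" using SP(2) unfolding \<Phi>_def by auto
      show "\<exists>C. \<forall>\<omega>\<in>space M. \<bar>\<phi> l \<omega>\<bar> \<le> C"
      proof (intro exI ballI)
        fix \<omega> assume \<omega>: "\<omega> \<in> space M"
        have "\<bar>\<phi> l \<omega>\<bar> = \<bar>e (idx l) \<omega> * \<Phi> (q (Suc l)) \<omega> - b * (e (idx l) \<omega> * X (t (idx l)) \<omega>)\<bar>"
          unfolding \<phi>_def by (simp add: algebra_simps)
        also have "\<dots> \<le> \<bar>e (idx l) \<omega>\<bar> * \<bar>\<Phi> (q (Suc l)) \<omega>\<bar> + \<bar>b\<bar> * \<bar>e (idx l) \<omega> * X (t (idx l)) \<omega>\<bar>"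
          unfolding abs_mult[symmetric] by (rule abs_triangle_ineq4)
        also have "\<dots> \<le> C * c + \<bar>b\<bar> * C'"
          using C[OF i(1) \<omega>] c[OF \<omega>] order_trans[OF abs_ge_zero C(1)[OF i(1) \<omega>]] by (intro add_mono mult_mono) auto
        finally show "\<bar>\<phi> l \<omega>\<bar> \<le> C * c + \<bar>b\<bar> * C'" .
      qed
    qed (simp add: q)
    also have "(\<lambda>\<omega>. ennreal (\<Sum>r<k. (\<Sum>l | l < \<kappa> k \<and> g (idx l) = r. \<phi> l \<omega> * (W (q (Suc l)) \<omega> - W (q l) \<omega>))\<^sup>2)) =
      (\<lambda>\<omega>. ennreal (\<Sum>r<k. (\<Sum>i | i < k \<and> g i = r. e i \<omega> * \<eta>' j i \<omega>)\<^sup>2))"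
      by (simp only: inner)
    also have "outer_mean M (\<lambda>\<omega>. ennreal (\<Sum>l<\<kappa> k. (\<phi> l \<omega>)\<^sup>2 * (q (Suc l) - q l))) \<le> K' * outer_mean M (D j) + K *
      outer_mean M w"
    proof -
      have "AE \<omega> in M. ennreal (\<Sum>l<\<kappa> k. (\<phi> l \<omega>)\<^sup>2 * (q (Suc l) - q l)) \<le> ennreal K' * D j \<omega> + ennreal K * w \<omega>"
        using X_cont w AE_space
      proof eventually_elim
        fix \<omega> assume c: "continuous_on {0..} (\<lambda>u. X u \<omega>)" and \<omega>: "\<omega> \<in> space M"
          and w: "\<forall>i<k. \<forall>u\<in>{t i..t (Suc i)}. ennreal ((X u \<omega> - X (t i) \<omega>)\<^sup>2) \<le> w \<omega>"
        from c have "continuous_on {0..T} (\<lambda>u. X u \<omega>)" by (rule continuous_on_subset) auto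
        then have [measurable]: "(\<lambda>u. indicator {0..T} u * X u \<omega>) \<in> borel_measurable borel"
          using borel_measurable_continuous_on_indicator[of "{0..T}" "\<lambda>u. X u \<omega>"] by simp
        have [measurable]: "(\<lambda>u. \<Phi> u \<omega>) \<in> borel_measurable borel" unfolding \<Phi>_def by measurable
        have C0: "0 \<le> C" using C(1)[OF _ \<omega>, of 0] False by (intro order_trans[OF abs_ge_zero[of "e 0 \<omega>"]]) simp
        let ?f = "\<lambda>u. ennreal (2 * C\<^sup>2) * ennreal ((\<Phi> u \<omega> - b * X u \<omega>)\<^sup>2) + ennreal (2 * C\<^sup>2 * b\<^sup>2) * w \<omega>"
        have "ennreal (\<Sum>l<\<kappa> k. (\<phi> l \<omega>)\<^sup>2 * (q (Suc l) - q l)) \<le> (\<integral>\<^sup>+u\<in>{0..q (\<kappa> k)}. ?f u \<partial>lborel)"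
        proof (rule grid_integral_le[OF q(1,3)])
          fix l u assume l: "l < \<kappa> k" and u: "q l < u" "u \<le> q (Suc l)"
          define i where "i = idx l"
          have i: "i < k" "\<kappa> i \<le> l" "Suc l \<le> \<kappa> (Suc i)" using idx[OF l] by (auto simp: i_def)
          have "t i \<le> q l" "q (Suc l) \<le> t (Suc i)"
            using i \<kappa>(1)[of i] \<kappa>(2)[of i] \<kappa>(1)[of "Suc i"] \<kappa>(2)[of "Suc i"] lm[OF l]
              grid_less_iff(2)[OF q(1), of "\<kappa> i" l] grid_less_iff(2)[OF q(1), of "Suc l" "\<kappa> (Suc i)"] by auto
          then have "u \<in> {t i..t (Suc i)}" using u by auto
          with w i have wu: "ennreal ((X u \<omega> - X (t i) \<omega>)\<^sup>2) \<le> w \<omega>" by auto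
          \<comment> \<open>The simple integrand is constant on the fine cell and may be evaluated
            at any \<open>u\<close> in it. This splits \<open>\<phi> l\<close> into the
            approximation error at \<open>u\<close> and the oscillation of \<open>X\<close> on the
            coarse cell.\<close>
          have "\<Phi> u \<omega> = \<Phi> (q (Suc l)) \<omega>" unfolding \<Phi>_def by (rule simple_process_grid[OF q(1) sub lm[OF l] u])
          then have "(\<phi> l \<omega>)\<^sup>2 = (e i \<omega>)\<^sup>2 * ((\<Phi> u \<omega> - b * X u \<omega>) + b * (X u \<omega> - X (t i) \<omega>))\<^sup>2"
            unfolding \<phi>_def i_def by (simp add: power_mult_distrib right_diff_distrib[of b])
          also have "\<dots> \<le> C\<^sup>2 * ((\<Phi> u \<omega> - b * X u \<omega>) + b * (X u \<omega> - X (t i) \<omega>))\<^sup>2"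
            using C(1)[OF i(1) \<omega>] C0 by (intro mult_right_mono) (auto simp: abs_le_square_iff[symmetric])
          also have "\<dots> \<le> C\<^sup>2 * (2 * (\<Phi> u \<omega> - b * X u \<omega>)\<^sup>2 + 2 * (b * (X u \<omega> - X (t i) \<omega>))\<^sup>2)"
            using sum_squares_bound[of "\<Phi> u \<omega> - b * X u \<omega>" "b * (X u \<omega> - X (t i) \<omega>)"]
            by (intro mult_left_mono) (simp_all add: power2_sum)
          also have "\<dots> = 2 * C\<^sup>2 * (\<Phi> u \<omega> - b * X u \<omega>)\<^sup>2 + 2 * C\<^sup>2 * b\<^sup>2 * (X u \<omega> - X (t i) \<omega>)\<^sup>2"
            by (simp only: power_mult_distrib distrib_left mult_ac)
          finally have "ennreal ((\<phi> l \<omega>)\<^sup>2) \<le> ennreal (2 * C\<^sup>2 * (\<Phi> u \<omega> - b * X u \<omega>)\<^sup>2 + 2 * C\<^sup>2 * b\<^sup>2 * (X u \<omega> -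
            X (t i) \<omega>)\<^sup>2)"
            by (rule ennreal_leI)
          also have "\<dots> = ennreal (2 * C\<^sup>2) * ennreal ((\<Phi> u \<omega> - b * X u \<omega>)\<^sup>2) + ennreal (2 * C\<^sup>2 * b\<^sup>2) *
            ennreal ((X u \<omega> - X (t i) \<omega>)\<^sup>2)"
            by (rule ennreal_lincomb) auto
          also have "\<dots> \<le> ?f u" using wu by (intro add_left_mono mult_left_mono) auto
          finally show "ennreal ((\<phi> l \<omega>)\<^sup>2) \<le> ?f u" .
        qed (use \<kappa> in auto)
        also have "\<dots> = (\<integral>\<^sup>+u. ennreal (2 * C\<^sup>2) * (ennreal ((\<Phi> u \<omega> - b * (indicator {0..T} u * X u \<omega>))\<^sup>2) * indicator
          {0..T} u) + ennreal (2 * C\<^sup>2 * b\<^sup>2) * w \<omega> * indicator {0..T} u \<partial>lborel)"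
          using \<kappa>(2)[of k] t by (intro nn_integral_cong) (auto simp: indicator_def)
        also have "\<dots> = ennreal (2 * C\<^sup>2) * (\<integral>\<^sup>+u. (ennreal ((\<Phi> u \<omega> - b * (indicator {0..T} u * X u \<omega>))\<^sup>2) * indicator
          {0..T} u) \<partial>lborel) + ennreal (2 * C\<^sup>2 * b\<^sup>2) * w \<omega> * (\<integral>\<^sup>+u. indicator {0..T} u \<partial>lborel)"
          by (rule nn_integral_lincomb) measurable
        also have "(\<integral>\<^sup>+u. indicator {0..T} u \<partial>lborel) = ennreal T" using T by simp
        also have "(\<integral>\<^sup>+u. (ennreal ((\<Phi> u \<omega> - b * (indicator {0..T} u * X u \<omega>))\<^sup>2) * indicator {0..T} u) \<partial>lborel) =
          D j \<omega>"
          unfolding D_def \<Phi>_def by (intro nn_integral_cong) (auto simp: indicator_def)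
        also have "ennreal (2 * C\<^sup>2) * D j \<omega> + ennreal (2 * C\<^sup>2 * b\<^sup>2) * w \<omega> * ennreal T = ennreal (2 * C\<^sup>2) * D j \<omega> +
          ennreal (2 * C\<^sup>2 * b\<^sup>2 * T) * w \<omega>"
          using T by (simp only: ennreal_mult[of "2 * C\<^sup>2 * b\<^sup>2" T] mult_nonneg_nonneg zero_le_numeral zero_le_power2)
            (simp only: mult_ac)
        also have "\<dots> \<le> ennreal K' * D j \<omega> + ennreal K * w \<omega>"
          unfolding K_def K'_def by (intro add_mono mult_right_mono ennreal_leI) auto
        finally show "ennreal (\<Sum>l<\<kappa> k. (\<phi> l \<omega>)\<^sup>2 * (q (Suc l) - q l)) \<le> ennreal K' * D j \<omega> + ennreal K * w \<omega>" .
      qed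
      then have "outer_mean M (\<lambda>\<omega>. ennreal (\<Sum>l<\<kappa> k. (\<phi> l \<omega>)\<^sup>2 * (q (Suc l) - q l))) \<le> outer_mean M (\<lambda>\<omega>. ennreal K' *
        D j \<omega> + ennreal K * w \<omega>)"
        by (rule outer_mean_mono)
      also have "\<dots> \<le> outer_mean M (\<lambda>\<omega>. ennreal K' * D j \<omega>) + outer_mean M (\<lambda>\<omega>. ennreal K * w \<omega>)"
        by (rule outer_mean_add)
      also have "\<dots> \<le> K' * outer_mean M (D j) + K * outer_mean M w"
        by (intro add_mono outer_mean_cmult) (auto simp: K_def K'_def)
      finally show ?thesis .
    qed
    finally show ?thesis by simp
  qed
  \<comment> \<open>The error of the simple integrals at the coarse points. It is estimated by
    Cauchy-Schwarz with a constant \<open>c\<close> that grows with \<open>k\<close>, which is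
    harmless since \<open>j\<close> tends to infinity while \<open>k\<close> stays fixed.\<close>
  define \<delta> where "\<delta> j i \<omega> = ?SI j (t i) \<omega> - I i \<omega>" for j i \<omega>
  define c where "c = max 1 (real k * C\<^sup>2 * real k * 2)"
  have "0 \<le> c" by (simp add: c_def)
  have err: "outer_mean M (\<lambda>\<omega>. ennreal (\<Sum>r<k. (\<Sum>i | i < k \<and> g i = r. e i \<omega> * \<eta> i \<omega>)\<^sup>2)) \<le>
     2 * (2 * sqrt (K' * outer_mean M (D j) + K * outer_mean M w)) + 2 * (c * (\<Sum>i<k. outer_mean M (\<lambda>\<omega>. ennreal ((\<delta> j
       (Suc i) \<omega>)\<^sup>2)) + outer_mean M (\<lambda>\<omega>. ennreal ((\<delta> j i \<omega>)\<^sup>2))))" for j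
  proof -
    let ?E = "\<lambda>\<omega>. \<Sum>i<k. (\<delta> j (Suc i) \<omega>)\<^sup>2 + (\<delta> j i \<omega>)\<^sup>2"
    let ?V = "\<lambda>\<omega>. \<Sum>r<k. (\<Sum>i | i < k \<and> g i = r. e i \<omega> * \<eta>' j i \<omega>)\<^sup>2"
    have "AE \<omega> in M. ennreal (\<Sum>r<k. (\<Sum>i | i < k \<and> g i = r. e i \<omega> * \<eta> i \<omega>)\<^sup>2) \<le> ennreal 2 * ennreal (?V \<omega>) + ennreal 2
      * (ennreal c * ennreal (?E \<omega>))"
    proof (intro AE_I2)
      fix \<omega> assume \<omega>: "\<omega> \<in> space M"
      have C0: "0 \<le> C" using C(1)[OF _ \<omega>, of 0] False by (intro order_trans[OF abs_ge_zero[of "e 0 \<omega>"]]) simp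
      have 1: "(\<Sum>i | i < k \<and> g i = r. e i \<omega> * \<eta> i \<omega>)\<^sup>2 \<le> 2 * (\<Sum>i | i < k \<and> g i = r. e i \<omega> * \<eta>' j i \<omega>)\<^sup>2 + 2 *
        (real k * C\<^sup>2 * 2 * ?E \<omega>)" for r
      proof -
        let ?J = "{i. i < k \<and> g i = r}"
        have fin: "finite ?J" by simp
        have eq: "\<eta> i \<omega> = \<eta>' j i \<omega> + (\<delta> j i \<omega> - \<delta> j (Suc i) \<omega>)" for i
          unfolding \<eta>_def \<eta>'_def \<delta>_def by simp
        have "(\<Sum>i\<in>?J. e i \<omega> * (\<delta> j i \<omega> - \<delta> j (Suc i) \<omega>))\<^sup>2 \<le> (\<Sum>i\<in>?J. (e i \<omega> * (\<delta> j i \<omega> - \<delta> j (Suc i) \<omega>))\<^sup>2) *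
          real (card ?J)"
          by (rule sum_squared_le_sum_of_squares)
        also have "\<dots> \<le> (\<Sum>i\<in>?J. C\<^sup>2 * (2 * ((\<delta> j (Suc i) \<omega>)\<^sup>2 + (\<delta> j i \<omega>)\<^sup>2))) * real k"
        proof (intro mult_mono sum_mono)
          fix i assume "i \<in> ?J"
          then have "(e i \<omega>)\<^sup>2 \<le> C\<^sup>2" using C(1)[OF _ \<omega>, of i] C0 by (simp add: abs_le_square_iff[symmetric])
          moreover have "(\<delta> j i \<omega> - \<delta> j (Suc i) \<omega>)\<^sup>2 \<le> 2 * ((\<delta> j (Suc i) \<omega>)\<^sup>2 + (\<delta> j i \<omega>)\<^sup>2)"
            using sum_squares_bound[of "\<delta> j i \<omega>" "- \<delta> j (Suc i) \<omega>"] by (simp add: power2_diff)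
          ultimately show "(e i \<omega> * (\<delta> j i \<omega> - \<delta> j (Suc i) \<omega>))\<^sup>2 \<le> C\<^sup>2 * (2 * ((\<delta> j (Suc i) \<omega>)\<^sup>2 + (\<delta> j i \<omega>)\<^sup>2))"
            unfolding power_mult_distrib by (intro mult_mono) auto
        next
          have "card ?J \<le> card {..<k}" by (intro card_mono) auto
          then show "real (card ?J) \<le> real k" by simp
        qed (auto intro!: sum_nonneg)
        also have "\<dots> \<le> (\<Sum>i<k. C\<^sup>2 * (2 * ((\<delta> j (Suc i) \<omega>)\<^sup>2 + (\<delta> j i \<omega>)\<^sup>2))) * real k"
          by (intro mult_right_mono sum_mono2) auto
        also have "\<dots> = real k * C\<^sup>2 * 2 * ?E \<omega>"
          by (simp only: sum_distrib_left[symmetric] mult_ac)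
        finally have a: "(\<Sum>i\<in>?J. e i \<omega> * (\<delta> j i \<omega> - \<delta> j (Suc i) \<omega>))\<^sup>2 \<le> real k * C\<^sup>2 * 2 * ?E \<omega>" .
        have "(\<Sum>i\<in>?J. e i \<omega> * \<eta> i \<omega>) = (\<Sum>i\<in>?J. e i \<omega> * \<eta>' j i \<omega>) + (\<Sum>i\<in>?J. e i \<omega> * (\<delta> j i \<omega> - \<delta> j (Suc i) \<omega>))"
          unfolding eq by (simp only: distrib_left sum.distrib)
        moreover have "(x + y)\<^sup>2 \<le> 2 * x\<^sup>2 + 2 * y\<^sup>2" for x y :: real
          using sum_squares_bound[of x y] by (simp add: power2_sum)
        ultimately have "(\<Sum>i\<in>?J. e i \<omega> * \<eta> i \<omega>)\<^sup>2 \<le> 2 * (\<Sum>i\<in>?J. e i \<omega> * \<eta>' j i \<omega>)\<^sup>2 + 2 * (\<Sum>i\<in>?J. e i \<omega> * (\<delta> j i \<omega> -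
          \<delta> j (Suc i) \<omega>))\<^sup>2"
          by simp
        with a show ?thesis by linarith
      qed
      have E0: "0 \<le> ?E \<omega>" by (intro sum_nonneg) auto
      have "(\<Sum>r<k. (\<Sum>i | i < k \<and> g i = r. e i \<omega> * \<eta> i \<omega>)\<^sup>2) \<le> (\<Sum>r<k. 2 * (\<Sum>i | i < k \<and> g i = r. e i \<omega> * \<eta>' j i \<omega>)\<^sup>2 +
        2 * (real k * C\<^sup>2 * 2 * ?E \<omega>))"
        by (intro sum_mono 1)
      also have "\<dots> = 2 * ?V \<omega> + 2 * ((real k * C\<^sup>2 * real k * 2) * ?E \<omega>)"
        by (simp add: sum.distrib sum_distrib_left[symmetric] distrib_left)
      also have "\<dots> \<le> 2 * ?V \<omega> + 2 * (c * ?E \<omega>)"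
        unfolding c_def by (intro add_left_mono mult_left_mono mult_right_mono E0) auto
      finally have "ennreal (\<Sum>r<k. (\<Sum>i | i < k \<and> g i = r. e i \<omega> * \<eta> i \<omega>)\<^sup>2) \<le> ennreal (2 * ?V \<omega> + 2 * (c * ?E \<omega>))"
        by (rule ennreal_leI)
      also have "\<dots> = ennreal 2 * ennreal (?V \<omega>) + ennreal 2 * (ennreal c * ennreal (?E \<omega>))"
      proof -
        have "0 \<le> ?V \<omega>" by (intro sum_nonneg) auto
        moreover have "0 \<le> c" by (simp add: c_def)
        ultimately show ?thesis using E0 by (subst ennreal_lincomb) (simp_all add: ennreal_mult)
      qed
      finally show "ennreal (\<Sum>r<k. (\<Sum>i | i < k \<and> g i = r. e i \<omega> * \<eta> i \<omega>)\<^sup>2) \<le> ennreal 2 * ennreal (?V \<omega>) + ennreal 2 *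
        (ennreal c * ennreal (?E \<omega>))" .
    qed
    then have "outer_mean M (\<lambda>\<omega>. ennreal (\<Sum>r<k. (\<Sum>i | i < k \<and> g i = r. e i \<omega> * \<eta> i \<omega>)\<^sup>2)) \<le>
       outer_mean M (\<lambda>\<omega>. ennreal 2 * ennreal (?V \<omega>) + ennreal 2 * (ennreal c * ennreal (?E \<omega>)))" by (rule
         outer_mean_mono)
    also have "\<dots> \<le> outer_mean M (\<lambda>\<omega>. ennreal 2 * ennreal (?V \<omega>)) + outer_mean M (\<lambda>\<omega>. ennreal 2 * (ennreal c *
      ennreal (?E \<omega>)))" by (rule outer_mean_add)
    also have "\<dots> \<le> 2 * outer_mean M (\<lambda>\<omega>. ennreal (?V \<omega>)) + 2 * outer_mean M (\<lambda>\<omega>. ennreal c * ennreal (?E \<omega>))"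
      by (intro add_mono outer_mean_cmult) auto
    also have "outer_mean M (\<lambda>\<omega>. ennreal c * ennreal (?E \<omega>)) \<le> c * outer_mean M (\<lambda>\<omega>. ennreal (?E \<omega>))"
      by (intro outer_mean_cmult) (simp add: c_def)
    also have "outer_mean M (\<lambda>\<omega>. ennreal (?E \<omega>)) = outer_mean M (\<lambda>\<omega>. \<Sum>i<k. ennreal ((\<delta> j (Suc i) \<omega>)\<^sup>2) +
      ennreal ((\<delta> j i \<omega>)\<^sup>2))"
      by (subst sum_ennreal[symmetric]) (auto simp: ennreal_plus)
    also have "\<dots> \<le> (\<Sum>i<k. outer_mean M (\<lambda>\<omega>. ennreal ((\<delta> j (Suc i) \<omega>)\<^sup>2) + ennreal ((\<delta> j i \<omega>)\<^sup>2)))"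
      by (rule outer_mean_sum) simp
    also have "\<dots> \<le> (\<Sum>i<k. outer_mean M (\<lambda>\<omega>. ennreal ((\<delta> j (Suc i) \<omega>)\<^sup>2)) + outer_mean M (\<lambda>\<omega>. ennreal ((\<delta> j i \<omega>)\<^sup>2)))"
      by (intro sum_mono outer_mean_add)
    also note main[of j]
    finally show ?thesis using \<open>0 \<le> c\<close> by (simp add: mult_left_mono)
  qed
  \<comment> \<open>As \<open>j\<close> tends to infinity only the oscillation term survives, and
    the two factors 2 in front of its root give the 4 of the claim.\<close>
  have "(\<lambda>j. 2 * (2 * sqrt (K' * outer_mean M (D j) + K * outer_mean M w)) + 2 * (c * (\<Sum>i<k. outer_mean M (\<lambda>\<omega>. ennreal
    ((\<delta> j (Suc i) \<omega>)\<^sup>2)) + outer_mean M (\<lambda>\<omega>. ennreal ((\<delta> j i \<omega>)\<^sup>2)))))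
     \<longlonglongrightarrow> 2 * (2 * sqrt (K' * 0 + K * outer_mean M w)) + 2 * (c * (\<Sum>i<k. 0 + 0))"
    unfolding \<delta>_def by (intro tendsto_intros D I) auto
  from LIMSEQ_le_const[OF this, of "outer_mean M (\<lambda>\<omega>. ennreal (\<Sum>r<k. (\<Sum>i | i < k \<and> g i = r. e i \<omega> * \<eta> i \<omega>)\<^sup>2))"] err
  show ?thesis by (simp add: K_def)
qed

end

section \<open>Linear stochastic differential equations\<close>

lemma real_bound_from_Rats:
  fixes f :: "real \<Rightarrow> real"
  assumes ab: "a < b" and f: "continuous_on {a..b} f"
    and le: "\<And>u. u \<in> \<rat> \<Longrightarrow> u \<in> {a..b} \<Longrightarrow> f u \<le> c" and u: "u \<in> {a..b}"
  shows "f u \<le> c"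
proof (rule ccontr)
  assume "\<not> f u \<le> c"
  then have pos: "0 < f u - c" by simp
  from f u pos obtain d where d: "0 < d" "\<And>v. v \<in> {a..b} \<Longrightarrow> dist v u < d \<Longrightarrow> dist (f v) (f u) < f u - c"
    unfolding continuous_on_iff by metis
  have "max a (u - d) < min b (u + d)" using ab u d(1) by auto
  from Rats_dense_in_real[OF this] obtain v where v: "v \<in> \<rat>" "max a (u - d) < v" "v < min b (u + d)" by auto
  then have "v \<in> {a..b}" "dist v u < d" by (auto simp: dist_real_def)
  with d(2)[of v] le[of v] v(1) show False by (auto simp: dist_real_def)
qed

text \<open>For sums of \<open>N\<close> one-step errors, each of size \<open>h (T / N)\<close>:
  they disappear in the limit exactly when the derivative of \<open>h\<close> at 0 does.\<close>

lemma scaled_derivative_limit: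
  fixes h :: "real \<Rightarrow> real"
  assumes "(h has_real_derivative D) (at 0)" "h 0 = 0" "0 < T"
  shows "(\<lambda>N. real N * h (T / real N)) \<longlonglongrightarrow> T * D"
proof -
  have "(\<lambda>x. h x / x) \<midarrow>0\<rightarrow> D"
    using assms(1,2) by (simp add: has_field_derivative_iff)
  moreover have "filterlim (\<lambda>N. T / real N) (at 0) sequentially"
    unfolding filterlim_at
  proof
    show "\<forall>\<^sub>F N in sequentially. T / real N \<in> UNIV \<and> T / real N \<noteq> 0"
      using eventually_gt_at_top[of 0] by eventually_elim (use assms(3) in auto)
    show "(\<lambda>N. T / real N) \<longlonglongrightarrow> 0" by (rule lim_const_over_n)
  qed
  ultimately have "(\<lambda>N. h (T / real N) / (T / real N)) \<longlonglongrightarrow> D"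
    by (rule filterlim_compose)
  then have "(\<lambda>N. T * (h (T / real N) / (T / real N))) \<longlonglongrightarrow> T * D" by (rule tendsto_mult_left)
  moreover have "\<forall>\<^sub>F N in sequentially. T * (h (T / real N) / (T / real N)) = real N * h (T / real N)"
    using eventually_gt_at_top[of 0] by eventually_elim (use assms(3) in \<open>simp add: field_simps\<close>)
  ultimately show ?thesis by (rule Lim_transform_eventually)
qed

lemma set_integral_increment_bound:
  fixes f :: "real \<Rightarrow> real"
  assumes int: "set_integrable lborel {0..t} (\<lambda>u. a * f u)" and st: "0 \<le> s" "s \<le> t"
    and bd: "\<And>u. u \<in> {s..t} \<Longrightarrow> \<bar>f u - f s\<bar> \<le> e"
  shows "\<bar>(LBINT u:{0..t}. a * f u) - (LBINT u:{0..s}. a * f u) - a * (t - s) * f s\<bar> \<le> \<bar>a\<bar> * e * (t - s)"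
proof -
  have eq: "{0..t} = {0..s} \<union> {s<..t}" using st by auto
  have i1: "set_integrable lborel {0..s} (\<lambda>u. a * f u)" "set_integrable lborel {s<..t} (\<lambda>u. a * f u)"
    using int st by (auto intro: set_integrable_subset)
  have ic: "set_integrable lborel {s<..t} (\<lambda>u. c)" for c :: real
    by (rule set_integrable_subset[of _ "{s..t}"]) (auto simp: continuous_on_const intro!:
      borel_integrable_atLeastAtMost')
  have const: "(LBINT u:{s<..t}. c) = c * (t - s)" for c :: real
    unfolding set_lebesgue_integral_def using st by simp
  have "(LBINT u:{0..t}. a * f u) = (LBINT u:{0..s}. a * f u) + (LBINT u:{s<..t}. a * f u)"
    unfolding eq using i1 by (intro set_integral_Un) auto
  then have "(LBINT u:{0..t}. a * f u) - (LBINT u:{0..s}. a * f u) - a * (t - s) * f s = (LBINT u:{s<..t}. a * f u) -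
    (LBINT u:{s<..t}. a * f s)"
    by (simp add: const)
  also have "\<dots> = (LBINT u:{s<..t}. a * f u - a * f s)"
    using i1 ic by (intro set_integral_diff(2)[symmetric]) auto
  also have "\<bar>\<dots>\<bar> \<le> (LBINT u:{s<..t}. \<bar>a\<bar> * e)"
  proof -
    have i2: "set_integrable lborel {s<..t} (\<lambda>u. a * f u - a * f s)"
      using i1 ic by (intro set_integral_diff(1)) auto
    have "\<bar>LBINT u:{s<..t}. a * f u - a * f s\<bar> \<le> (LBINT u:{s<..t}. \<bar>a * f u - a * f s\<bar>)"
      using i2 set_integral_norm_bound[OF i2] by simp
    also have "\<dots> \<le> (LBINT u:{s<..t}. \<bar>a\<bar> * e)"
    proof (rule set_integral_mono)
      show "set_integrable lborel {s<..t} (\<lambda>u. \<bar>a * f u - a * f s\<bar>)" using i2 by (rule set_integrable_abs)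
      fix u assume "u \<in> {s<..t}"
      then show "\<bar>a * f u - a * f s\<bar> \<le> \<bar>a\<bar> * e"
        using bd[of u] by (simp add: right_diff_distrib[symmetric] abs_mult mult_left_mono)
    qed (rule ic)
    finally show ?thesis .
  qed
  finally show ?thesis by (simp add: const mult_ac)
qed

lemma normal_density_exp_tilt:
  assumes "0 < \<sigma>"
  shows "normal_density 0 \<sigma> x * exp (l * x) = exp (l\<^sup>2 * \<sigma>\<^sup>2 / 2) * normal_density (l * \<sigma>\<^sup>2) \<sigma> x"
proof -
  have "- (x - 0)\<^sup>2 / (2 * \<sigma>\<^sup>2) + l * x = l\<^sup>2 * \<sigma>\<^sup>2 / 2 + - (x - l * \<sigma>\<^sup>2)\<^sup>2 / (2 * \<sigma>\<^sup>2)"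
    using assms by (simp add: field_simps power2_eq_square)
  then have "exp (- (x - 0)\<^sup>2 / (2 * \<sigma>\<^sup>2)) * exp (l * x) = exp (l\<^sup>2 * \<sigma>\<^sup>2 / 2) * exp (- (x - l * \<sigma>\<^sup>2)\<^sup>2 / (2 * \<sigma>\<^sup>2))"
    unfolding exp_add[symmetric] by (rule arg_cong)
  then show ?thesis unfolding normal_density_def by simp
qed

context filtered_bm
begin

text \<open>By \<open>normal_density_exp_tilt\<close> the exponential weight merely moves the mean
  of the Gaussian from 0 to \<open>l * d\<close>. The weighted moments are thus those of a normal
  law with mean \<open>l * d\<close> and variance \<open>d\<close>, times the total mass of the
  weight.\<close>

lemma increment_exp_moments:
  fixes l :: real
  assumes "0 \<le> s" "s < s'"
  defines "d \<equiv> s' - s" and "G \<equiv> \<lambda>\<omega>. W s' \<omega> - W s \<omega>"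
  shows "integrable M (\<lambda>\<omega>. exp (l * G \<omega>))" "expectation (\<lambda>\<omega>. exp (l * G \<omega>)) = exp (l\<^sup>2 * d / 2)"
    "integrable M (\<lambda>\<omega>. G \<omega> * exp (l * G \<omega>))" "expectation (\<lambda>\<omega>. G \<omega> * exp (l * G \<omega>)) = exp (l\<^sup>2 * d / 2) * (l * d)"
    "integrable M (\<lambda>\<omega>. (G \<omega>)\<^sup>2 * exp (l * G \<omega>))" "expectation (\<lambda>\<omega>. (G \<omega>)\<^sup>2 * exp (l * G \<omega>)) = exp (l\<^sup>2 * d / 2) * (d +
      (l * d)\<^sup>2)"
proof -
  define \<sigma> where "\<sigma> = sqrt d"
  have \<sigma>: "0 < \<sigma>" "\<sigma>\<^sup>2 = d" using assms by (auto simp: \<sigma>_def d_def)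
  have D: "distributed M lborel G (\<lambda>x. ennreal (normal_density 0 \<sigma> x))"
    unfolding G_def \<sigma>_def d_def by (rule W_normal[OF assms(1,2)])
  let ?n = "normal_density (l * d) \<sigma>" and ?c = "exp (l\<^sup>2 * d / 2)"
  have tilt: "normal_density 0 \<sigma> x * (k x * exp (l * x)) = ?c * (?n x * k x)" for k :: "real \<Rightarrow> real" and x
    using normal_density_exp_tilt[OF \<sigma>(1), of x l] \<sigma>(2) by (simp add: mult_ac)
  have transfer: "integrable M (\<lambda>\<omega>. k (G \<omega>) * exp (l * G \<omega>)) \<and> expectation (\<lambda>\<omega>. k (G \<omega>) * exp (l * G \<omega>)) = ?c * c"
    if k: "has_bochner_integral lborel (\<lambda>x. ?n x * k x) c" "k \<in> borel_measurable borel" for k :: "real \<Rightarrow> real" and c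
  proof -
    have hb: "has_bochner_integral lborel (\<lambda>x. normal_density 0 \<sigma> x * (k x * exp (l * x))) (?c * c)"
      unfolding tilt by (intro has_bochner_integral_mult_right k)
    have [measurable]: "k \<in> borel_measurable borel" by fact
    have "integrable M (\<lambda>\<omega>. k (G \<omega>) * exp (l * G \<omega>)) \<longleftrightarrow> integrable lborel (\<lambda>x. normal_density 0 \<sigma> x * (k x * exp (l *
      x)))"
      by (rule distributed_integrable[OF D, symmetric]) auto
    moreover have "expectation (\<lambda>\<omega>. k (G \<omega>) * exp (l * G \<omega>)) = (\<integral>x. normal_density 0 \<sigma> x * (k x * exp (l * x))
      \<partial>lborel)"
      by (rule distributed_integral[OF D, symmetric]) auto
    ultimately show ?thesis using hb by (auto simp: has_bochner_integral_iff)
  qed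
  have b0: "has_bochner_integral lborel (\<lambda>x. ?n x * 1) 1"
    using \<sigma> by (simp add: has_bochner_integral_iff)
  have b1: "has_bochner_integral lborel (\<lambda>x. ?n x * x) (l * d)"
    using \<sigma>(1) by (rule normal_moment_nz_1)
  have "has_bochner_integral lborel (\<lambda>x. ?n x * (x - l * d)\<^sup>2) d"
    using normal_moment_even[OF \<sigma>(1), of "l * d" 1] \<sigma>(2) by (simp add: fact_2)
  \<comment> \<open>Here x^2 = (x - m)^2 + 2 m x - m^2 with m = l d.\<close>
  from has_bochner_integral_add[OF has_bochner_integral_add[OF this has_bochner_integral_mult_right[OF b1, of
    "2 * (l * d)"]] has_bochner_integral_mult_right[OF b0, of "- (l * d)\<^sup>2"]]
  have b2: "has_bochner_integral lborel (\<lambda>x. ?n x * x\<^sup>2) (d + (l * d)\<^sup>2)"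
    by (simp add: power2_eq_square algebra_simps)
  show "integrable M (\<lambda>\<omega>. exp (l * G \<omega>))" "expectation (\<lambda>\<omega>. exp (l * G \<omega>)) = exp (l\<^sup>2 * d / 2)"
    using transfer[OF b0] by simp_all
  show "integrable M (\<lambda>\<omega>. G \<omega> * exp (l * G \<omega>))" "expectation (\<lambda>\<omega>. G \<omega> * exp (l * G \<omega>)) = exp (l\<^sup>2 * d / 2) * (l * d)"
    using transfer[OF b1] by simp_all
  show "integrable M (\<lambda>\<omega>. (G \<omega>)\<^sup>2 * exp (l * G \<omega>))" "expectation (\<lambda>\<omega>. (G \<omega>)\<^sup>2 * exp (l * G \<omega>)) = exp (l\<^sup>2 * d / 2) *
    (d + (l * d)\<^sup>2)"
    using transfer[OF b2] by simp_all
qed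

text \<open>With \<open>E t = exp (- b * W t - c * t)\<close>, \<open>\<rho>\<close> is the relative increment of \<open>X E\<close> over a step on
  which \<open>X\<close> follows the Euler scheme, and \<open>R\<close> is that of \<open>E\<close>. The choice of \<open>c\<close> makes \<open>m\<close> and \<open>v\<close>
  of order \<open>o(d)\<close>.\<close>

lemma increment_rho_moments:
  fixes a b :: real
  assumes s: "0 \<le> s" "s < s'"
  defines "d \<equiv> s' - s" and "c \<equiv> a - b\<^sup>2 / 2" and "G \<equiv> \<lambda>\<omega>. W s' \<omega> - W s \<omega>"
  defines "\<rho> \<equiv> \<lambda>\<omega>. exp (- b * G \<omega> - c * d) * (1 + a * d + b * G \<omega>) - 1"
  defines "R \<equiv> \<lambda>\<omega>. exp (- b * G \<omega> - c * d) - 1"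
  defines "m \<equiv> exp ((b\<^sup>2 / 2 - c) * d) * (1 + a * d - b\<^sup>2 * d) - 1"
  defines "v \<equiv> exp ((2 * b\<^sup>2 - 2 * c) * d) * ((1 + a * d)\<^sup>2 - 4 * (1 + a * d) * b\<^sup>2 * d + b\<^sup>2 * (d + 4 * b\<^sup>2 * d\<^sup>2)) -
    2 * (m + 1) + 1"
  shows "integrable M \<rho>" "expectation \<rho> = m" "integrable M (\<lambda>\<omega>. (\<rho> \<omega>)\<^sup>2)" "expectation (\<lambda>\<omega>. (\<rho> \<omega>)\<^sup>2) = v"
    "integrable M (\<lambda>\<omega>. (R \<omega>)\<^sup>2)"
    "expectation (\<lambda>\<omega>. (R \<omega>)\<^sup>2) = exp ((2 * b\<^sup>2 - 2 * c) * d) - 2 * exp ((b\<^sup>2 / 2 - c) * d) + 1"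
proof -
  let ?e1 = "\<lambda>\<omega>. exp (- b * G \<omega>)" and ?e2 = "\<lambda>\<omega>. exp (- 2 * b * G \<omega>)"
  have G: "W s' \<omega> - W s \<omega> = G \<omega>" for \<omega> by (simp add: G_def)
  note I1 = increment_exp_moments[OF s, where l = "- b", unfolded G, folded d_def]
  note I2 = increment_exp_moments[OF s, where l = "- 2 * b", unfolded G, folded d_def]
  have e2: "?e2 \<omega> = (?e1 \<omega>)\<^sup>2" for \<omega> by (simp add: exp_double[symmetric] mult.assoc)
  define A where "A = exp (- c * d)"
  have eA: "exp (- b * G \<omega> - c * d) = A * ?e1 \<omega>" for \<omega>
    unfolding A_def exp_add[symmetric] by (simp add: algebra_simps)
  have \<rho>: "\<rho> \<omega> = A * (1 + a * d) * ?e1 \<omega> + A * b * (G \<omega> * ?e1 \<omega>) - 1" for \<omega>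
    unfolding \<rho>_def eA by (simp add: algebra_simps)
  have em: "A * exp (b\<^sup>2 * d / 2) = exp ((b\<^sup>2 / 2 - c) * d)"
    unfolding A_def exp_add[symmetric] by (simp add: algebra_simps)
  have ev: "A\<^sup>2 * exp ((2 * b)\<^sup>2 * d / 2) = exp ((2 * b\<^sup>2 - 2 * c) * d)"
    unfolding A_def exp_double[symmetric] exp_add[symmetric] by (simp add: algebra_simps power2_eq_square)
  show i1: "integrable M \<rho>" unfolding \<rho>[abs_def] using I1 by simp
  show E1: "expectation \<rho> = m"
  proof -
    have "expectation \<rho> = A * (1 + a * d) * exp (b\<^sup>2 * d / 2) + A * b * (exp (b\<^sup>2 * d / 2) * (- b * d)) - 1"
      unfolding \<rho>[abs_def] using I1 by (simp add: prob_space)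
    also have "\<dots> = (A * exp (b\<^sup>2 * d / 2)) * (1 + a * d - b\<^sup>2 * d) - 1"
      by (simp add: algebra_simps power2_eq_square)
    finally show ?thesis unfolding em m_def .
  qed
  have \<rho>2: "(\<rho> \<omega>)\<^sup>2 = A\<^sup>2 * (1 + a * d)\<^sup>2 * ?e2 \<omega> + 2 * A\<^sup>2 * (1 + a * d) * b * (G \<omega> * ?e2 \<omega>)
     + A\<^sup>2 * b\<^sup>2 * ((G \<omega>)\<^sup>2 * ?e2 \<omega>) - 2 * (\<rho> \<omega> + 1) + 1" for \<omega>
    unfolding \<rho> e2 by (simp add: power2_eq_square algebra_simps)
  show "integrable M (\<lambda>\<omega>. (\<rho> \<omega>)\<^sup>2)" unfolding \<rho>2 using I2 i1 by simp
  show "expectation (\<lambda>\<omega>. (\<rho> \<omega>)\<^sup>2) = v"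
  proof -
    have "expectation (\<lambda>\<omega>. (\<rho> \<omega>)\<^sup>2) = A\<^sup>2 * (1 + a * d)\<^sup>2 * exp ((2 * b)\<^sup>2 * d / 2) + 2 * A\<^sup>2 * (1 + a * d) * b *
      (exp ((2 * b)\<^sup>2 * d / 2) * (- 2 * b * d))
       + A\<^sup>2 * b\<^sup>2 * (exp ((2 * b)\<^sup>2 * d / 2) * (d + (2 * b * d)\<^sup>2)) - 2 * (m + 1) + 1"
      unfolding \<rho>2 using I2 i1 E1 by (simp add: prob_space)
    also have "\<dots> = (A\<^sup>2 * exp ((2 * b)\<^sup>2 * d / 2)) * ((1 + a * d)\<^sup>2 - 4 * (1 + a * d) * b\<^sup>2 * d + b\<^sup>2 * (d + 4 * b\<^sup>2 *
      d\<^sup>2)) - 2 * (m + 1) + 1"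
      by (simp add: algebra_simps power2_eq_square)
    finally show ?thesis unfolding ev v_def .
  qed
  have R2: "(R \<omega>)\<^sup>2 = A\<^sup>2 * ?e2 \<omega> - 2 * A * ?e1 \<omega> + 1" for \<omega>
    unfolding R_def eA e2 by (simp add: power2_eq_square algebra_simps)
  show "integrable M (\<lambda>\<omega>. (R \<omega>)\<^sup>2)" unfolding R2 using I1 I2 by simp
  show "expectation (\<lambda>\<omega>. (R \<omega>)\<^sup>2) = exp ((2 * b\<^sup>2 - 2 * c) * d) - 2 * exp ((b\<^sup>2 / 2 - c) * d) + 1"
  proof -
    have "expectation (\<lambda>\<omega>. (R \<omega>)\<^sup>2) = A\<^sup>2 * exp ((2 * b)\<^sup>2 * d / 2) - 2 * (A * exp (b\<^sup>2 * d / 2)) + 1"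
      unfolding R2 using I1 I2 by (simp add: prob_space)
    then show ?thesis unfolding em ev .
  qed
qed

end

section \<open>Explicit solution of the linear equation\<close>

context filtered_bm
begin

text \<open>The supremum runs over rational times, which keeps \<open>w N\<close> measurable.
  Continuity of the path extends the bound to all times of a cell, and uniform continuity on
  \<open>[0,T]\<close> gives the limit.\<close>

lemma path_modulus:
  fixes X :: "real \<Rightarrow> 'a \<Rightarrow> real"
  assumes T: "0 < T" and XM: "\<And>t. 0 \<le> t \<Longrightarrow> X t \<in> borel_measurable M"
    and X_cont: "AE \<omega> in M. continuous_on {0..} (\<lambda>t. X t \<omega>)"
  obtains w :: "nat \<Rightarrow> 'a \<Rightarrow> ennreal" where "\<And>N. w N \<in> borel_measurable M"
    "AE \<omega> in M. \<forall>N>0. \<forall>i<N. \<forall>u\<in>{T * real i / real N..T * real (Suc i) / real N}. ennreal ((X u \<omega> - X (T *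
      real i / real N) \<omega>)\<^sup>2) \<le> w N \<omega>"
    "AE \<omega> in M. \<forall>N. w N \<omega> < \<top>" "AE \<omega> in M. (\<lambda>N. w N \<omega>) \<longlonglongrightarrow> 0"
proof -
  define t where "t N i = T * real i / real N" for N i
  have t0: "0 \<le> t N i" for N i using T by (simp add: t_def)
  have tT: "t N (Suc i) \<le> T" if "i < N" for N i
  proof -
    have "T * real (Suc i) \<le> T * real N" using that T by (intro mult_left_mono) auto
    then show ?thesis using that by (simp add: t_def divide_le_eq)
  qed
  have tl: "t N i < t N (Suc i)" "t N (Suc i) - t N i = T / real N" if "i < N" for N i
    using that T by (auto simp: t_def field_simps)
  define w where "w N \<omega> = (SUP i\<in>{..<N}. SUP u\<in>\<rat> \<inter> {t N i..t N (Suc i)}. ennreal ((X u \<omega> - X (t N i) \<omega>)\<^sup>2))" for N \<omega>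
  have wM: "w N \<in> borel_measurable M" for N
    unfolding w_def
  proof (intro borel_measurable_SUP)
    fix i u assume "i \<in> {..<N}" "u \<in> \<rat> \<inter> {t N i..t N (Suc i)}"
    then have "0 \<le> u" using t0[of N i] by auto
    then have [measurable]: "X u \<in> borel_measurable M" "X (t N i) \<in> borel_measurable M" using XM t0 by auto
    show "(\<lambda>\<omega>. ennreal ((X u \<omega> - X (t N i) \<omega>)\<^sup>2)) \<in> borel_measurable M" by measurable
  next
    show "countable (\<rat> \<inter> {t N i..t N (Suc i)})" for i by (intro countable_Int1 countable_rat)
  qed auto
  have w_le: "w N \<omega> \<le> ennreal (e\<^sup>2)"
    if "0 \<le> e" "\<And>i u. i < N \<Longrightarrow> u \<in> {t N i..t N (Suc i)} \<Longrightarrow> \<bar>X u \<omega> - X (t N i) \<omega>\<bar> \<le> e" for N \<omega> e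
    unfolding w_def
  proof (intro SUP_least ennreal_leI)
    fix i u assume "i \<in> {..<N}" "u \<in> \<rat> \<inter> {t N i..t N (Suc i)}"
    then have "\<bar>X u \<omega> - X (t N i) \<omega>\<bar> \<le> e" using that(2) by auto
    from power_mono[OF this, of 2] show "(X u \<omega> - X (t N i) \<omega>)\<^sup>2 \<le> e\<^sup>2" by simp
  qed
  have sub: "{t N i..t N (Suc i)} \<subseteq> {0..T}" if "i < N" for N i using t0[of N i] tT[OF that] by auto
  have 1: "AE \<omega> in M. \<forall>N>0. \<forall>i<N. \<forall>u\<in>{t N i..t N (Suc i)}. ennreal ((X u \<omega> - X (t N i) \<omega>)\<^sup>2) \<le> w N \<omega>"
    using X_cont
  proof eventually_elim
    fix \<omega> assume c: "continuous_on {0..} (\<lambda>t. X t \<omega>)"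
    show "\<forall>N>0. \<forall>i<N. \<forall>u\<in>{t N i..t N (Suc i)}. ennreal ((X u \<omega> - X (t N i) \<omega>)\<^sup>2) \<le> w N \<omega>"
    proof (intro allI impI ballI)
      fix N i u assume i: "i < N" and u: "u \<in> {t N i..t N (Suc i)}"
      show "ennreal ((X u \<omega> - X (t N i) \<omega>)\<^sup>2) \<le> w N \<omega>"
      proof (cases "w N \<omega> = \<top>")
        case False
        have "(X u \<omega> - X (t N i) \<omega>)\<^sup>2 \<le> enn2real (w N \<omega>)"
        proof (rule real_bound_from_Rats[OF tl(1)[OF i] _ _ u])
          show "continuous_on {t N i..t N (Suc i)} (\<lambda>u. (X u \<omega> - X (t N i) \<omega>)\<^sup>2)"
            using t0[of N i] by (intro continuous_intros continuous_on_subset[OF c]) auto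
          fix u assume u: "u \<in> \<rat>" "u \<in> {t N i..t N (Suc i)}"
          have "ennreal ((X u \<omega> - X (t N i) \<omega>)\<^sup>2) \<le> (SUP u\<in>\<rat> \<inter> {t N i..t N (Suc i)}. ennreal ((X u \<omega> - X (t N i)
            \<omega>)\<^sup>2))"
            using u by (intro SUP_upper) auto
          also have "\<dots> \<le> w N \<omega>" unfolding w_def using i
            by (intro SUP_upper[of i "{..<N}" "\<lambda>i. SUP u\<in>\<rat> \<inter> {t N i..t N (Suc i)}. ennreal ((X u \<omega> - X (t N i)
              \<omega>)\<^sup>2)"]) auto
          finally show "(X u \<omega> - X (t N i) \<omega>)\<^sup>2 \<le> enn2real (w N \<omega>)"
            using False by (cases "w N \<omega>") auto
        qed
        then have "ennreal ((X u \<omega> - X (t N i) \<omega>)\<^sup>2) \<le> ennreal (enn2real (w N \<omega>))" by (rule ennreal_leI)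
        also have "\<dots> = w N \<omega>" using False by (simp add: less_top)
        finally show ?thesis .
      qed simp
    qed
  qed
  have uc: "\<exists>d>0. \<forall>u\<in>{0..T}. \<forall>v\<in>{0..T}. \<bar>u - v\<bar> < d \<longrightarrow> \<bar>X u \<omega> - X v \<omega>\<bar> < e"
    if "continuous_on {0..} (\<lambda>t. X t \<omega>)" "0 < e" for \<omega> e
  proof -
    have "continuous_on {0..T} (\<lambda>t. X t \<omega>)" using that(1) by (rule continuous_on_subset) auto
    then have "uniformly_continuous_on {0..T} (\<lambda>t. X t \<omega>)"
      by (rule compact_uniformly_continuous) auto
    with that(2) show ?thesis unfolding uniformly_continuous_on_def dist_real_def by metis
  qed
  have 2: "AE \<omega> in M. \<forall>N. w N \<omega> < \<top>"
    using X_cont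
  proof eventually_elim
    fix \<omega> assume c: "continuous_on {0..} (\<lambda>t. X t \<omega>)"
    have "continuous_on {0..T} (\<lambda>t. X t \<omega>)" using c by (rule continuous_on_subset) auto
    then have "bounded ((\<lambda>t. X t \<omega>) ` {0..T})" by (intro compact_imp_bounded compact_continuous_image) auto
    then obtain B where "\<forall>u\<in>{0..T}. \<bar>X u \<omega>\<bar> \<le> B" unfolding bounded_iff by auto
    then have B: "\<And>u. u \<in> {0..T} \<Longrightarrow> \<bar>X u \<omega>\<bar> \<le> B" by blast
    have "0 \<le> B" using B[of 0] T by auto
    show "\<forall>N. w N \<omega> < \<top>"
    proof
      fix N
      have "w N \<omega> \<le> ennreal ((2 * B)\<^sup>2)"
      proof (rule w_le)
        fix i u assume i: "i < N" and u: "u \<in> {t N i..t N (Suc i)}"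
        have "u \<in> {0..T}" "t N i \<in> {0..T}" using sub[OF i] u tl(1)[OF i] by auto
        then have "\<bar>X u \<omega>\<bar> \<le> B" "\<bar>X (t N i) \<omega>\<bar> \<le> B" using B by auto
        then show "\<bar>X u \<omega> - X (t N i) \<omega>\<bar> \<le> 2 * B" by linarith
      qed (use \<open>0 \<le> B\<close> in simp)
      then show "w N \<omega> < \<top>" by (rule le_less_trans) simp
    qed
  qed
  have 3: "AE \<omega> in M. (\<lambda>N. w N \<omega>) \<longlonglongrightarrow> 0"
    using X_cont
  proof eventually_elim
    fix \<omega> assume c: "continuous_on {0..} (\<lambda>t. X t \<omega>)"
    show "(\<lambda>N. w N \<omega>) \<longlonglongrightarrow> 0"
    proof (rule order_tendstoI)
      fix y :: ennreal assume "0 < y"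
      then obtain r where r: "0 < r" "ennreal r < y"
      proof (cases y)
        case (real y')
        with \<open>0 < y\<close> have "0 < y'" by simp
        then show ?thesis using real by (intro that[of "y'/2"]) (auto simp: ennreal_less_iff)
      next
        case top then show ?thesis by (intro that[of 1]) auto
      qed
      obtain d where d: "0 < d" "\<And>u v. u \<in> {0..T} \<Longrightarrow> v \<in> {0..T} \<Longrightarrow> \<bar>u - v\<bar> < d \<Longrightarrow> \<bar>X u \<omega> - X v \<omega>\<bar> < sqrt r"
        using uc[OF c, of "sqrt r"] r(1) by auto
      have "(\<lambda>N. T / real N) \<longlonglongrightarrow> 0" by (rule lim_const_over_n)
      then have "eventually (\<lambda>N. T / real N < d) sequentially" using d(1) by (rule order_tendstoD)
      then show "eventually (\<lambda>N. w N \<omega> < y) sequentially"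
      proof eventually_elim
        fix N assume N: "T / real N < d"
        have "w N \<omega> \<le> ennreal ((sqrt r)\<^sup>2)"
        proof (rule w_le)
          fix i u assume i: "i < N" and u: "u \<in> {t N i..t N (Suc i)}"
          have "u \<in> {0..T}" "t N i \<in> {0..T}" using sub[OF i] u tl(1)[OF i] by auto
          moreover have "\<bar>u - t N i\<bar> < d" using u tl(2)[OF i] N by auto
          ultimately show "\<bar>X u \<omega> - X (t N i) \<omega>\<bar> \<le> sqrt r" using d(2) by (simp add: less_imp_le)
        qed (use r in simp)
        also have "\<dots> < y" using r by simp
        finally show "w N \<omega> < y" .
      qed
    qed simp
  qed
  show thesis by (rule that[OF wM 1[unfolded t_def] 2 3])
qed

text \<open>A discrete Ito formula for the product \<open>X E\<close>, which telescopes over a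
  partition into \<open>N\<close> steps. In each step \<open>X\<close> is compared with its Euler
  scheme, for which the relative increment of the product has negligible mean and variance; the
  remainders are controlled by the oscillation of \<open>X\<close>. In place of moments of
  \<open>X\<close> there is the event \<open>\<Omega> C\<close>, on which \<open>X\<close> and
  \<open>E\<close> stay below \<open>C\<close> at all grid points.\<close>

lemma linear_SDE_fixed_time:
  fixes X :: "real \<Rightarrow> 'a \<Rightarrow> real"
  assumes T: "0 < T" and XF: "\<And>t. 0 \<le> t \<Longrightarrow> X t \<in> borel_measurable (FF (ennreal t))"
    and X_cont: "AE \<omega> in M. continuous_on {0..} (\<lambda>t. X t \<omega>)" and X_zero: "AE \<omega> in M. X 0 \<omega> = x"
    and ito: "\<And>t. 0 \<le> t \<Longrightarrow> \<exists>I. (\<exists>n p \<xi>. approximates (\<lambda>u \<omega>. b * X u \<omega>) t n p \<xi> \<and>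
        (\<lambda>j. outer_mean M (\<lambda>\<omega>. ennreal \<bar>simple_integral W (n j) (p j) (\<xi> j) t \<omega> - I \<omega>\<bar>)) \<longlonglongrightarrow> 0) \<and>
        (AE \<omega> in M. set_integrable lborel {0..t} (\<lambda>u. a * X u \<omega>) \<and> X t \<omega> = x + (LBINT u:{0..t}. a * X u \<omega>) + I \<omega>)"
  shows "AE \<omega> in M. X T \<omega> * exp (- b * W T \<omega> - (a - b\<^sup>2 / 2) * T) = x"
proof -
  define c where "c = a - b\<^sup>2 / 2"
  define E where "E t \<omega> = exp (- b * W t \<omega> - c * t)" for t \<omega>
  have XM: "X t \<in> borel_measurable M" if "0 \<le> t" for t using measurable_FF[OF XF[OF that]] .
  obtain w where w: "\<And>N. w N \<in> borel_measurable M"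
    "AE \<omega> in M. \<forall>N>0. \<forall>i<N. \<forall>u\<in>{T * real i / real N..T * real (Suc i) / real N}. ennreal ((X u \<omega> - X (T *
      real i / real N) \<omega>)\<^sup>2) \<le> w N \<omega>"
    "AE \<omega> in M. \<forall>N. w N \<omega> < \<top>" "AE \<omega> in M. (\<lambda>N. w N \<omega>) \<longlonglongrightarrow> 0"
    using path_modulus[OF T XM X_cont] by blast
  have w_lim: "(\<lambda>N. outer_mean M (w N)) \<longlonglongrightarrow> 0" by (rule outer_mean_tendsto_AE[OF w(1,4)])
  have "\<forall>t\<in>{0..}. \<exists>I. (\<exists>n p \<xi>. approximates (\<lambda>u \<omega>. b * X u \<omega>) t n p \<xi> \<and>
        (\<lambda>j. outer_mean M (\<lambda>\<omega>. ennreal \<bar>simple_integral W (n j) (p j) (\<xi> j) t \<omega> - I \<omega>\<bar>)) \<longlonglongrightarrow> 0) \<and>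
        (AE \<omega> in M. set_integrable lborel {0..t} (\<lambda>u. a * X u \<omega>) \<and> X t \<omega> = x + (LBINT u:{0..t}. a * X u \<omega>) + I \<omega>)"
    using ito by simp
  from bchoice[OF this] obtain I where I0: "\<forall>t\<in>{0..}. (\<exists>n p \<xi>. approximates (\<lambda>u \<omega>. b * X u \<omega>) t n p \<xi> \<and>
        (\<lambda>j. outer_mean M (\<lambda>\<omega>. ennreal \<bar>simple_integral W (n j) (p j) (\<xi> j) t \<omega> - I t \<omega>\<bar>)) \<longlonglongrightarrow> 0) \<and>
        (AE \<omega> in M. set_integrable lborel {0..t} (\<lambda>u. a * X u \<omega>) \<and> X t \<omega> = x + (LBINT u:{0..t}. a * X u \<omega>) +
          I t \<omega>)" ..
  have I_ae: "AE \<omega> in M. set_integrable lborel {0..t} (\<lambda>u. a * X u \<omega>) \<and> X t \<omega> = x + (LBINT u:{0..t}. a * X u \<omega>) +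
    I t \<omega>" if "0 \<le> t" for t
    using bspec[OF I0, of t] that by blast
  have I_ap: "\<exists>n p \<xi>. approximates (\<lambda>u \<omega>. b * X u \<omega>) t n p \<xi> \<and>
        (\<lambda>j. outer_mean M (\<lambda>\<omega>. ennreal \<bar>simple_integral W (n j) (p j) (\<xi> j) t \<omega> - I t \<omega>\<bar>)) \<longlonglongrightarrow> 0" if "0 \<le> t" for t
    using bspec[OF I0, of t] that by blast
  have bX_cont: "AE \<omega> in M. continuous_on {0..} (\<lambda>t. b * X t \<omega>)"
    using X_cont by eventually_elim (intro continuous_intros)
  \<comment> \<open>The sequence belonging to the final time; \<open>SI\<close> reconciles it with
    the integrals \<open>I t\<close> at all earlier times.\<close>
  obtain n p \<xi> where A: "approximates (\<lambda>u \<omega>. b * X u \<omega>) T n p \<xi>" using I_ap[OF less_imp_le[OF T]] by blast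
  have SI: "(\<lambda>j. outer_mean M (\<lambda>\<omega>. ennreal ((simple_integral W (n j) (p j) (\<xi> j) t \<omega> - I t \<omega>)\<^sup>2))) \<longlonglongrightarrow> 0"
    if t: "0 \<le> t" "t \<le> T" for t
  proof -
    obtain n' p' \<xi>' where A': "approximates (\<lambda>u \<omega>. b * X u \<omega>) t n' p' \<xi>'"
        "(\<lambda>j. outer_mean M (\<lambda>\<omega>. ennreal \<bar>simple_integral W (n' j) (p' j) (\<xi>' j) t \<omega> - I t \<omega>\<bar>)) \<longlonglongrightarrow> 0"
      using I_ap[OF t(1)] by blast
    show ?thesis by (rule simple_integral_tendsto[OF bX_cont A A'(1) t A'(2)])
  qed
  have EF: "E t \<in> borel_measurable (FF (ennreal t))" if "0 \<le> t" for t
  proof -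
    note W_adapted[OF that, measurable]
    show ?thesis unfolding E_def by measurable
  qed
  have EM: "E t \<in> borel_measurable M" if "0 \<le> t" for t using measurable_FF[OF EF[OF that]] .
  define mf where "mf d = exp ((b\<^sup>2 / 2 - c) * d) * (1 + a * d - b\<^sup>2 * d) - 1" for d
  define vf where "vf d = exp ((2 * b\<^sup>2 - 2 * c) * d) * ((1 + a * d)\<^sup>2 - 4 * (1 + a * d) * b\<^sup>2 * d + b\<^sup>2 * (d + 4 *
    b\<^sup>2 * d\<^sup>2)) - 2 * (mf d + 1) + 1" for d
  define rf where "rf d = exp ((2 * b\<^sup>2 - 2 * c) * d) - 2 * exp ((b\<^sup>2 / 2 - c) * d) + 1" for d
  \<comment> \<open>The value of \<open>c\<close> is what cancels the linear terms of
    \<open>mf\<close> and \<open>vf\<close>. That of \<open>rf\<close> is \<open>b\<^sup>2\<close>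
    and remains; it is dealt with by the parameter \<open>\<kappa>\<close>.\<close>
  have mf: "(mf has_real_derivative 0) (at 0)" "mf 0 = 0"
    unfolding mf_def c_def by (auto intro!: derivative_eq_intros)
  have vf: "(vf has_real_derivative 0) (at 0)" "vf 0 = 0"
    unfolding vf_def c_def using mf(2) by (auto intro!: derivative_eq_intros mf(1) simp: algebra_simps)
  have rf: "(rf has_real_derivative b\<^sup>2) (at 0)" "rf 0 = 0"
    unfolding rf_def c_def by (auto intro!: derivative_eq_intros simp: algebra_simps)
  note lims = scaled_derivative_limit[OF mf T] scaled_derivative_limit[OF vf T] scaled_derivative_limit[OF rf T]
  define S where "S N i = T * real i / real N" for N i
  have S0: "0 \<le> S N i" for N i using T by (simp add: S_def)
  have ST: "S N i \<le> T" if "i \<le> N" for N i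
  proof (cases "N = 0")
    case False
    have "T * real i \<le> T * real N" using that T by (intro mult_left_mono) auto
    then show ?thesis using False by (simp add: S_def divide_le_eq)
  qed (use T in \<open>simp add: S_def\<close>)
  define good where "good C t \<omega> \<longleftrightarrow> \<bar>X t \<omega>\<bar> \<le> C \<and> E t \<omega> \<le> C" for C t \<omega>
  \<comment> \<open>All grids are included at once, so \<open>\<Omega> C\<close> does not depend on
    \<open>N\<close>; still there are only countably many conditions, so it is an event.\<close>
  define \<Omega> where "\<Omega> C = {\<omega>\<in>space M. \<forall>N. \<forall>i\<le>N. good C (S N i) \<omega>}" for C
  have \<Omega>: "\<Omega> C \<in> sets M" for C
  proof -
    have [measurable]: "X (S N i) \<in> borel_measurable M" "E (S N i) \<in> borel_measurable M" for N i
      using XM EM S0 by auto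
    show ?thesis unfolding \<Omega>_def good_def by measurable
  qed
  have key: "AE \<omega> in M. \<omega> \<in> \<Omega> C \<longrightarrow> X T \<omega> * E T \<omega> = x" if C1: "1 \<le> C" for C :: real
  proof -
    define ind where "ind \<omega> = (indicator (\<Omega> C) \<omega> :: real)" for \<omega>
    have ind: "ind \<omega> = 0 \<or> ind \<omega> = 1" for \<omega> by (auto simp: ind_def indicator_def)
    have C0: "0 \<le> C" "C \<le> C\<^sup>2" using C1 by (auto simp: power2_eq_square)
    define Z where "Z \<omega> = X T \<omega> * E T \<omega> - x" for \<omega>
    define K where "K = max 1 (2 * C\<^sup>2 * b\<^sup>2 * T)"
    define K3 where "K3 = max 1 (C\<^sup>2 * a\<^sup>2 * T\<^sup>2)"
    define Q where "Q N = 4 * sqrt (K * outer_mean M (w N))" for N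
    \<comment> \<open>Bounds for the five error terms \<open>z1\<close> to \<open>z5\<close> below,
      nested to the right; every level of the nesting costs a factor 2 by
      \<open>outer_mean_square_add\<close>.\<close>
    define B where "B \<kappa> N = 2 * (C^4 * (real N * vf (T / real N))) + 2 * (2 * ((real N * mf (T / real N)) * C\<^sup>2)\<^sup>2 +
       2 * (2 * (K3 * outer_mean M (w N)) + 2 * (2 * Q N + 2 * (C * \<kappa> * (real N * rf (T / real N)) + max 1 (C / \<kappa>) *
         Q N))))" for \<kappa> N
    have bound: "outer_mean M (\<lambda>\<omega>. ennreal ((ind \<omega> * Z \<omega>)\<^sup>2)) \<le> B \<kappa> N" if N: "0 < N" and \<kappa>: "0 < \<kappa>" for N \<kappa>
    proof -
      define d where "d = T / real N"
      have d: "0 < d" "real N * d = T" using N T by (auto simp: d_def)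
      define t where "t i = S N i" for i
      have t0: "0 \<le> t i" for i unfolding t_def by (rule S0)
      have tl: "t i < t (Suc i)" "t (Suc i) - t i = d" for i
        using N T by (auto simp: t_def S_def d_def field_simps)
      have t_end: "t 0 = 0" "t N = T" using N by (auto simp: t_def S_def)
      have t_mono: "strict_mono t" using tl(1) by (rule strict_mono_Suc_iff[THEN iffD2, OF allI])
      then have t_mono': "strict_mono_on {..N} t" by (auto simp: strict_mono_on_def strict_mono_def)
      have t_le: "t i \<le> t j \<longleftrightarrow> i \<le> j" for i j using strict_mono_less_eq[OF t_mono] .
      define G where "G i \<omega> = W (t (Suc i)) \<omega> - W (t i) \<omega>" for i \<omega>
      have G: "W (t (Suc i)) \<omega> - W (t i) \<omega> = G i \<omega>" for i \<omega> by (simp add: G_def)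
      define rho where "rho y = exp (- b * y - c * d) * (1 + a * d + b * y) - 1" for y
      define Rf where "Rf y = exp (- b * y - c * d) - 1" for y
      have [measurable]: "rho \<in> borel_measurable borel" "Rf \<in> borel_measurable borel"
        unfolding rho_def[abs_def] Rf_def[abs_def] by measurable
      note m = increment_rho_moments[OF t0 tl(1), where a=a and b=b, unfolded tl(2) G c_def[symmetric]]
      have mom: "integrable M (\<lambda>\<omega>. rho (G i \<omega>))" "expectation (\<lambda>\<omega>. rho (G i \<omega>)) = mf d"
         "integrable M (\<lambda>\<omega>. (rho (G i \<omega>))\<^sup>2)" "expectation (\<lambda>\<omega>. (rho (G i \<omega>))\<^sup>2) = vf d"
         "integrable M (\<lambda>\<omega>. (Rf (G i \<omega>))\<^sup>2)" "expectation (\<lambda>\<omega>. (Rf (G i \<omega>))\<^sup>2) = rf d" for i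
        unfolding rho_def Rf_def mf_def vf_def rf_def by (rule m)+
      \<comment> \<open>The indicator of \<open>\<Omega> C\<close> depends on the whole path and
        cannot serve as a weight inside a stochastic sum. \<open>e1\<close> and \<open>e2\<close>
        are cut off by the state at \<open>t i\<close> alone, hence adapted and bounded, and on
        \<open>\<Omega> C\<close> they equal \<open>E (t i)\<close> and 1.\<close>
      define e1 where "e1 i \<omega> = (if good C (t i) \<omega> then E (t i) \<omega> else 0)" for i \<omega>
      define e2 where "e2 i \<omega> = (if good C (t i) \<omega> then 1 else 0 :: real)" for i \<omega>
      have eF: "e1 i \<in> borel_measurable (FF (ennreal (t i)))" "e2 i \<in> borel_measurable (FF (ennreal (t i)))" for i
      proof -
        note XF[OF t0[of i], measurable] EF[OF t0[of i], measurable]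
        show "e1 i \<in> borel_measurable (FF (ennreal (t i)))" "e2 i \<in> borel_measurable (FF (ennreal (t i)))"
          unfolding e1_def[abs_def] e2_def[abs_def] good_def by measurable
      qed
      have Epos: "0 \<le> E s \<omega>" for s \<omega> by (simp add: E_def)
      have e1b: "\<bar>e1 i \<omega>\<bar> \<le> C" "\<bar>e1 i \<omega> * X (t i) \<omega>\<bar> \<le> C\<^sup>2" for i \<omega>
        using Epos[of "t i" \<omega>] C0 unfolding e1_def good_def
        by (auto simp: abs_mult power2_eq_square intro!: mult_mono)
      have e2b: "\<bar>e2 i \<omega>\<bar> \<le> C" "\<bar>e2 i \<omega> * X (t i) \<omega>\<bar> \<le> C\<^sup>2" for i \<omega>
        using C0 C1 unfolding e2_def good_def by auto
      have e12: "\<bar>e1 i \<omega>\<bar> \<le> C * e2 i \<omega>" for i \<omega>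
        using Epos[of "t i" \<omega>] unfolding e1_def e2_def good_def by auto
      define \<eta> where "\<eta> i \<omega> = I (t (Suc i)) \<omega> - I (t i) \<omega> - b * X (t i) \<omega> * (W (t (Suc i)) \<omega> - W (t i) \<omega>)" for i \<omega>
      define \<alpha> where "\<alpha> i \<omega> = X (t (Suc i)) \<omega> - X (t i) \<omega> - (I (t (Suc i)) \<omega> - I (t i) \<omega>) - a * d * X (t i) \<omega>" for i \<omega>
      \<comment> \<open>On \<open>\<Omega> C\<close>, \<open>Z\<close> is the sum of \<open>z1\<close> (centred Euler increments), \<open>z2\<close> (their means),
        \<open>z3\<close> (error of the drift) and \<open>z4 + z5\<close> (error of the stochastic integral).\<close>
      define z1 where "z1 \<omega> = (\<Sum>i<N. (e1 i \<omega> * X (t i) \<omega>) * (rho (W (t (Suc i)) \<omega> - W (t i) \<omega>) - mf d))" for \<omega>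
      define z2 where "z2 \<omega> = mf d * (\<Sum>i<N. e1 i \<omega> * X (t i) \<omega>)" for \<omega>
      define z3 where "z3 \<omega> = (\<Sum>i<N. E (t (Suc i)) \<omega> * \<alpha> i \<omega>)" for \<omega>
      define z4 where "z4 \<omega> = (\<Sum>i<N. e1 i \<omega> * \<eta> i \<omega>)" for \<omega>
      define z5 where "z5 \<omega> = (\<Sum>i<N. e1 i \<omega> * Rf (G i \<omega>) * \<eta> i \<omega>)" for \<omega>
      have decomp: "AE \<omega> in M. ind \<omega> * Z \<omega> = ind \<omega> * z1 \<omega> + (ind \<omega> * z2 \<omega> + (ind \<omega> * z3 \<omega> + (ind \<omega> * z4 \<omega> + ind \<omega> *
        z5 \<omega>)))"
        using X_zero W_zero
      proof eventually_elim
        fix \<omega> assume 0: "X 0 \<omega> = x" "W 0 \<omega> = 0"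
        show "ind \<omega> * Z \<omega> = ind \<omega> * z1 \<omega> + (ind \<omega> * z2 \<omega> + (ind \<omega> * z3 \<omega> + (ind \<omega> * z4 \<omega> + ind \<omega> * z5 \<omega>)))"
        proof (cases "\<omega> \<in> \<Omega> C")
          case True
          have e1: "e1 i \<omega> = E (t i) \<omega>" if "i < N" for i
            using True that unfolding \<Omega>_def e1_def t_def by auto
          have step: "X (t (Suc i)) \<omega> * E (t (Suc i)) \<omega> - X (t i) \<omega> * E (t i) \<omega> =
             (e1 i \<omega> * X (t i) \<omega>) * (rho (W (t (Suc i)) \<omega> - W (t i) \<omega>) - mf d) + mf d * (e1 i \<omega> * X (t i) \<omega>)
             + E (t (Suc i)) \<omega> * \<alpha> i \<omega> + e1 i \<omega> * \<eta> i \<omega> + e1 i \<omega> * Rf (G i \<omega>) * \<eta> i \<omega>" if "i < N" for i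
          proof -
            have "- b * W (t (Suc i)) \<omega> - c * t (Suc i) = (- b * W (t i) \<omega> - c * t i) + (- b * G i \<omega> - c * d)"
              unfolding G_def tl(2)[of i, symmetric] by (simp add: algebra_simps)
            then have Es: "E (t (Suc i)) \<omega> = E (t i) \<omega> * (1 + Rf (G i \<omega>))"
              unfolding E_def Rf_def by (simp add: exp_add[symmetric])
            have rR: "rho (G i \<omega>) = (1 + Rf (G i \<omega>)) * (1 + a * d + b * G i \<omega>) - 1"
              unfolding rho_def Rf_def by simp
            show ?thesis
              unfolding e1[OF that] \<eta>_def \<alpha>_def G Es rR by (simp add: algebra_simps)
          qed
          have "Z \<omega> = X (t N) \<omega> * E (t N) \<omega> - X (t 0) \<omega> * E (t 0) \<omega>"
            unfolding Z_def t_end using 0 by (simp add: E_def)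
          also have "\<dots> = (\<Sum>i<N. X (t (Suc i)) \<omega> * E (t (Suc i)) \<omega> - X (t i) \<omega> * E (t i) \<omega>)"
            by (rule sum_lessThan_telescope[of "\<lambda>i. X (t i) \<omega> * E (t i) \<omega>", symmetric])
          also have "\<dots> = (\<Sum>i<N. (e1 i \<omega> * X (t i) \<omega>) * (rho (W (t (Suc i)) \<omega> - W (t i) \<omega>) - mf d) + mf d * (e1 i \<omega> *
            X (t i) \<omega>)
             + E (t (Suc i)) \<omega> * \<alpha> i \<omega> + e1 i \<omega> * \<eta> i \<omega> + e1 i \<omega> * Rf (G i \<omega>) * \<eta> i \<omega>)"
            using step by (intro sum.cong) auto
          also have "\<dots> = z1 \<omega> + z2 \<omega> + z3 \<omega> + z4 \<omega> + z5 \<omega>"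
            unfolding z1_def z2_def z3_def z4_def z5_def by (simp only: sum.distrib sum_distrib_left)
          finally show ?thesis by (simp only: distrib_left add.assoc)
        qed (simp add: ind_def)
      qed
      have ind_le: "outer_mean M (\<lambda>\<omega>. ennreal ((ind \<omega> * z \<omega>)\<^sup>2)) \<le> outer_mean M (\<lambda>\<omega>. ennreal ((z \<omega>)\<^sup>2))" for z
      proof (intro outer_mean_mono AE_I2 ennreal_leI)
        fix \<omega> show "(ind \<omega> * z \<omega>)\<^sup>2 \<le> (z \<omega>)\<^sup>2" using ind[of \<omega>] by auto
      qed
      have N1: "outer_mean M (\<lambda>\<omega>. ennreal ((z1 \<omega>)\<^sup>2)) \<le> C^4 * (real N * vf d)"
      proof -
        have sq_int: "integrable M (\<lambda>\<omega>. (rho (W (t (Suc l)) \<omega> - W (t l) \<omega>) - mf d)\<^sup>2)"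
          and sq_exp: "expectation (\<lambda>\<omega>. (rho (W (t (Suc l)) \<omega> - W (t l) \<omega>) - mf d)\<^sup>2) \<le> vf d"
          and cent: "expectation (\<lambda>\<omega>. rho (W (t (Suc l)) \<omega> - W (t l) \<omega>) - mf d) = 0" for l
        proof -
          have eq: "(rho y - mf d)\<^sup>2 = (rho y)\<^sup>2 - 2 * mf d * rho y + (mf d)\<^sup>2" for y
            by (simp add: power2_diff)
          show "integrable M (\<lambda>\<omega>. (rho (W (t (Suc l)) \<omega> - W (t l) \<omega>) - mf d)\<^sup>2)"
            unfolding G eq using mom by simp
          have "expectation (\<lambda>\<omega>. (rho (G l \<omega>) - mf d)\<^sup>2) = vf d - 2 * mf d * mf d + (mf d)\<^sup>2"
            unfolding eq using mom by (simp add: prob_space)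
          also have "\<dots> \<le> vf d" by (simp add: power2_eq_square)
          finally show "expectation (\<lambda>\<omega>. (rho (W (t (Suc l)) \<omega> - W (t l) \<omega>) - mf d)\<^sup>2) \<le> vf d" unfolding G .
          show "expectation (\<lambda>\<omega>. rho (W (t (Suc l)) \<omega> - W (t l) \<omega>) - mf d) = 0"
            unfolding G using mom by (simp add: prob_space)
        qed
        have o: "integrable M (\<lambda>\<omega>. (z1 \<omega>)\<^sup>2) \<and> expectation (\<lambda>\<omega>. (z1 \<omega>)\<^sup>2) =
          (\<Sum>l<N. expectation (\<lambda>\<omega>. (e1 l \<omega> * X (t l) \<omega>)\<^sup>2) * expectation (\<lambda>\<omega>. (rho (W (t (Suc l)) \<omega> - W (t l) \<omega>) -
            mf d)\<^sup>2))"
          unfolding z1_def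
        proof (rule orthogonal_increments[where f="\<lambda>_ y. rho y - mf d"])
          show "(\<lambda>\<omega>. e1 l \<omega> * X (t l) \<omega>) \<in> borel_measurable (FF (ennreal (t l)))" for l
            by (intro borel_measurable_times eF XF t0)
          show "\<exists>C. \<forall>\<omega>\<in>space M. \<bar>e1 l \<omega> * X (t l) \<omega>\<bar> \<le> C" for l using e1b(2) by blast
        qed (use t0 tl(1) t_le sq_int cent in \<open>auto simp: Suc_le_eq\<close>)
        have "expectation (\<lambda>\<omega>. (z1 \<omega>)\<^sup>2) \<le> (\<Sum>l<N. C^4 * vf d)"
        proof -
          have "expectation (\<lambda>\<omega>. (e1 l \<omega> * X (t l) \<omega>)\<^sup>2) * expectation (\<lambda>\<omega>. (rho (W (t (Suc l)) \<omega> - W (t l) \<omega>) -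
            mf d)\<^sup>2) \<le> C^4 * vf d" for l
          proof (intro mult_mono sq_exp)
            have le: "(e1 l \<omega> * X (t l) \<omega>)\<^sup>2 \<le> C^4" for \<omega>
              using power_mono[OF e1b(2), of l \<omega> 2] by (simp add: power_mult[symmetric])
            have "expectation (\<lambda>\<omega>. (e1 l \<omega> * X (t l) \<omega>)\<^sup>2) \<le> expectation (\<lambda>\<omega>. C^4)"
            proof (intro integral_mono le)
              have [measurable]: "e1 l \<in> borel_measurable M" "X (t l) \<in> borel_measurable M"
                using measurable_FF[OF eF(1)] XM t0 by auto
              show "integrable M (\<lambda>\<omega>. (e1 l \<omega> * X (t l) \<omega>)\<^sup>2)"
                by (rule integrable_const_bound[of _ "C^4"]) (use le in auto)
            qed simp
            then show "expectation (\<lambda>\<omega>. (e1 l \<omega> * X (t l) \<omega>)\<^sup>2) \<le> C^4" by (simp add: prob_space)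
          qed auto
          then show ?thesis unfolding conjunct2[OF o] by (intro sum_mono)
        qed
        then have le: "expectation (\<lambda>\<omega>. (z1 \<omega>)\<^sup>2) \<le> C^4 * (real N * vf d)" by (simp add: mult_ac)
        have "(\<integral>\<^sup>+\<omega>. ennreal ((z1 \<omega>)\<^sup>2) \<partial>M) = ennreal (expectation (\<lambda>\<omega>. (z1 \<omega>)\<^sup>2))"
          using o by (intro nn_integral_eq_integral) auto
        also have "\<dots> \<le> ennreal (C^4 * (real N * vf d))" using le by (rule ennreal_leI)
        finally show ?thesis
        proof (rule outer_mean_le_nn_integral[rotated])
          have "0 \<le> expectation (\<lambda>\<omega>. (z1 \<omega>)\<^sup>2)" by (intro integral_nonneg_AE) auto
          with le show "0 \<le> C^4 * (real N * vf d)" by linarith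
          show "(\<lambda>\<omega>. ennreal ((z1 \<omega>)\<^sup>2)) \<in> borel_measurable M"
            using borel_measurable_integrable[OF conjunct1[OF o]]
              by (intro measurable_compose[OF _ measurable_ennreal])
        qed
      qed
      have N2: "outer_mean M (\<lambda>\<omega>. ennreal ((z2 \<omega>)\<^sup>2)) \<le> ((real N * mf d) * C\<^sup>2)\<^sup>2"
      proof -
        have "ennreal ((z2 \<omega>)\<^sup>2) \<le> ennreal (((real N * mf d) * C\<^sup>2)\<^sup>2)" for \<omega>
        proof (rule ennreal_leI)
          have "\<bar>\<Sum>i<N. e1 i \<omega> * X (t i) \<omega>\<bar> \<le> (\<Sum>i<N. C\<^sup>2)"
            by (intro order_trans[OF sum_abs] sum_mono e1b)
          then have "\<bar>z2 \<omega>\<bar> \<le> \<bar>mf d\<bar> * (real N * C\<^sup>2)"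
            unfolding z2_def abs_mult by (intro mult_left_mono) auto
          from power_mono[OF this, of 2] show "(z2 \<omega>)\<^sup>2 \<le> ((real N * mf d) * C\<^sup>2)\<^sup>2"
            by (simp add: power_mult_distrib mult_ac)
        qed
        then have "outer_mean M (\<lambda>\<omega>. ennreal ((z2 \<omega>)\<^sup>2)) \<le> outer_mean M (\<lambda>_. ennreal (((real N * mf d) * C\<^sup>2)\<^sup>2))"
          by (intro outer_mean_mono AE_I2)
        also have "\<dots> \<le> ((real N * mf d) * C\<^sup>2)\<^sup>2"
          by (intro outer_mean_le_nn_integral) (auto simp: emeasure_space_1)
        finally show ?thesis .
      qed
      have w2: "AE \<omega> in M. \<forall>i<N. \<forall>u\<in>{t i..t (Suc i)}. ennreal ((X u \<omega> - X (t i) \<omega>)\<^sup>2) \<le> w N \<omega>"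
        using w(2) by eventually_elim (use N in \<open>auto simp: t_def S_def\<close>)
      have N3: "outer_mean M (\<lambda>\<omega>. ennreal ((ind \<omega> * z3 \<omega>)\<^sup>2)) \<le> K3 * outer_mean M (w N)"
      proof -
        have "AE \<omega> in M. \<forall>i. set_integrable lborel {0..t i} (\<lambda>u. a * X u \<omega>) \<and> X (t i) \<omega> = x + (LBINT u:{0..t i}. a *
          X u \<omega>) + I (t i) \<omega>"
          unfolding AE_all_countable using I_ae t0 by blast
        then have "AE \<omega> in M. ennreal ((ind \<omega> * z3 \<omega>)\<^sup>2) \<le> ennreal K3 * w N \<omega>"
          using w2 w(3)
        proof eventually_elim
          fix \<omega> assume Ii: "\<forall>i. set_integrable lborel {0..t i} (\<lambda>u. a * X u \<omega>) \<and> X (t i) \<omega> =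
            x + (LBINT u:{0..t i}. a * X u \<omega>) + I (t i) \<omega>"
            and w2: "\<forall>i<N. \<forall>u\<in>{t i..t (Suc i)}. ennreal ((X u \<omega> - X (t i) \<omega>)\<^sup>2) \<le> w N \<omega>" and w3: "\<forall>N. w N \<omega> < \<top>"
          define r where "r = enn2real (w N \<omega>)"
          have r: "w N \<omega> = ennreal r" "0 \<le> r" using w3 unfolding r_def by (auto simp: less_top)
          show "ennreal ((ind \<omega> * z3 \<omega>)\<^sup>2) \<le> ennreal K3 * w N \<omega>"
          proof (cases "\<omega> \<in> \<Omega> C")
            case True
            have \<alpha>b: "\<bar>\<alpha> i \<omega>\<bar> \<le> \<bar>a\<bar> * sqrt r * d" if i: "i < N" for i
            proof -
              have "\<alpha> i \<omega> = (LBINT u:{0..t (Suc i)}. a * X u \<omega>) - (LBINT u:{0..t i}. a * X u \<omega>) - a * (t (Suc i) -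
                t i) * X (t i) \<omega>"
                using Ii[rule_format, of i] Ii[rule_format, of "Suc i"] unfolding \<alpha>_def tl(2) by linarith
              also have "\<bar>\<dots>\<bar> \<le> \<bar>a\<bar> * sqrt r * (t (Suc i) - t i)"
              proof (rule set_integral_increment_bound)
                fix u assume "u \<in> {t i..t (Suc i)}"
                with w2 i have "ennreal ((X u \<omega> - X (t i) \<omega>)\<^sup>2) \<le> ennreal r" unfolding r(1)[symmetric] by auto
                then have "(X u \<omega> - X (t i) \<omega>)\<^sup>2 \<le> r" using r(2) by (simp add: ennreal_le_iff)
                then show "\<bar>X u \<omega> - X (t i) \<omega>\<bar> \<le> sqrt r" by (simp add: real_le_rsqrt)
              qed (use Ii t0 tl(1)[of i] in auto)
              finally show ?thesis unfolding tl(2) .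
            qed
            have "\<bar>z3 \<omega>\<bar> \<le> (\<Sum>i<N. C * (\<bar>a\<bar> * sqrt r * d))"
              unfolding z3_def
            proof (intro order_trans[OF sum_abs] sum_mono)
              fix i assume i: "i \<in> {..<N}"
              have "\<bar>E (t (Suc i)) \<omega>\<bar> \<le> C" using True i Epos[of "t (Suc i)" \<omega>] unfolding \<Omega>_def good_def t_def by auto
              with \<alpha>b[of i] i C0 show "\<bar>E (t (Suc i)) \<omega> * \<alpha> i \<omega>\<bar> \<le> C * (\<bar>a\<bar> * sqrt r * d)"
                unfolding abs_mult by (intro mult_mono) auto
            qed
            also have "\<dots> = C * \<bar>a\<bar> * sqrt r * T" unfolding d(2)[symmetric] by (simp add: mult_ac)
            finally have "\<bar>z3 \<omega>\<bar>\<^sup>2 \<le> (C * \<bar>a\<bar> * sqrt r * T)\<^sup>2" by (intro power_mono) auto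
            also have "\<dots> = C\<^sup>2 * a\<^sup>2 * T\<^sup>2 * r" using r(2) by (simp add: power_mult_distrib mult_ac)
            also have "\<dots> \<le> K3 * r" unfolding K3_def using r(2) by (intro mult_right_mono) auto
            finally have "ennreal ((z3 \<omega>)\<^sup>2) \<le> ennreal (K3 * r)" by (intro ennreal_leI) simp
            also have "\<dots> = ennreal K3 * w N \<omega>" unfolding r(1) using r(2) by (simp add: ennreal_mult K3_def)
            finally show ?thesis using True by (simp add: ind_def)
          qed (simp add: ind_def)
        qed
        then have "outer_mean M (\<lambda>\<omega>. ennreal ((ind \<omega> * z3 \<omega>)\<^sup>2)) \<le> outer_mean M (\<lambda>\<omega>. ennreal K3 * w N \<omega>)"
          by (rule outer_mean_mono)
        also have "\<dots> \<le> K3 * outer_mean M (w N)" by (rule outer_mean_cmult) (simp add: K3_def)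
        finally show ?thesis .
      qed
      have Q1: "outer_mean M (\<lambda>\<omega>. ennreal (\<Sum>r<N. (\<Sum>i | i < N \<and> g i = r. e i \<omega> * \<eta> i \<omega>)\<^sup>2)) \<le> Q N"
        if "\<And>i. e i \<in> borel_measurable (FF (ennreal (t i)))" "\<And>i \<omega>. \<bar>e i \<omega>\<bar> \<le> C" "\<And>i \<omega>. \<bar>e i \<omega> * X (t i) \<omega>\<bar> \<le> C\<^sup>2"
        for e and g :: "nat \<Rightarrow> nat"
        unfolding Q_def K_def \<eta>_def
        by (rule weighted_remainder_bound[OF X_cont A t_mono' t_end XF[OF t0] that w2, where I="\<lambda>i. I (t i)"])
           (use SI t0 ST in \<open>auto simp: t_def\<close>)
      have N4: "outer_mean M (\<lambda>\<omega>. ennreal ((z4 \<omega>)\<^sup>2)) \<le> Q N"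
      proof -
        have "outer_mean M (\<lambda>\<omega>. ennreal ((z4 \<omega>)\<^sup>2)) \<le> outer_mean M (\<lambda>\<omega>. ennreal (\<Sum>r<N. (\<Sum>i | i < N \<and> 0 =
          r. e1 i \<omega> * \<eta> i \<omega>)\<^sup>2))"
        proof (intro outer_mean_mono AE_I2 ennreal_leI)
          fix \<omega>
          have "{i. i < N \<and> 0 = (0::nat)} = {..<N}" by auto
          then have "(z4 \<omega>)\<^sup>2 = (\<Sum>r\<in>{0::nat}. (\<Sum>i | i < N \<and> 0 = r. e1 i \<omega> * \<eta> i \<omega>)\<^sup>2)" by (simp add: z4_def)
          also have "\<dots> \<le> (\<Sum>r<N. (\<Sum>i | i < N \<and> 0 = r. e1 i \<omega> * \<eta> i \<omega>)\<^sup>2)"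
            using N by (intro sum_mono2) auto
          finally show "(z4 \<omega>)\<^sup>2 \<le> (\<Sum>r<N. (\<Sum>i | i < N \<and> 0 = r. e1 i \<omega> * \<eta> i \<omega>)\<^sup>2)" .
        qed
        also have "\<dots> \<le> Q N" by (rule Q1[OF eF(1) e1b])
        finally show ?thesis .
      qed
      have N5: "outer_mean M (\<lambda>\<omega>. ennreal ((z5 \<omega>)\<^sup>2)) \<le> C * \<kappa> * (real N * rf d) + max 1 (C / \<kappa>) * Q N"
      proof -
        \<comment> \<open>The sum of the squares of \<open>Rf\<close> has expectation
          \<open>N * rf d\<close>, which tends to \<open>T * b\<^sup>2\<close> and does not vanish.
          Young's inequality puts the small weight \<open>\<kappa>\<close> on it and the weight
          \<open>1 / \<kappa>\<close> on the squared remainders, whose sum does vanish as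
          \<open>N\<close> grows.\<close>
        let ?R = "\<lambda>\<omega>. C * \<kappa> * (\<Sum>i<N. (Rf (G i \<omega>))\<^sup>2)" and ?V = "\<lambda>\<omega>. \<Sum>i<N. (e2 i \<omega> * \<eta> i \<omega>)\<^sup>2"
        have "ennreal \<bar>z5 \<omega>\<bar> \<le> ennreal (?R \<omega>) + ennreal (max 1 (C / \<kappa>)) * ennreal (?V \<omega>)" for \<omega>
        proof -
          have "\<bar>z5 \<omega>\<bar> \<le> (\<Sum>i<N. C * \<kappa> * (Rf (G i \<omega>))\<^sup>2 + max 1 (C / \<kappa>) * (e2 i \<omega> * \<eta> i \<omega>)\<^sup>2)"
            unfolding z5_def
          proof (intro order_trans[OF sum_abs] sum_mono)
            fix i
            let ?x = "\<bar>Rf (G i \<omega>)\<bar>" and ?y = "\<bar>e2 i \<omega> * \<eta> i \<omega>\<bar>"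
            have e2n: "0 \<le> e2 i \<omega>" by (simp add: e2_def)
            have "\<bar>e1 i \<omega> * Rf (G i \<omega>) * \<eta> i \<omega>\<bar> = \<bar>e1 i \<omega>\<bar> * (?x * \<bar>\<eta> i \<omega>\<bar>)" by (simp add: abs_mult)
            also have "\<dots> \<le> (C * e2 i \<omega>) * (?x * \<bar>\<eta> i \<omega>\<bar>)" by (intro mult_right_mono e12) auto
            also have "\<dots> = C * (?x * ?y)" using e2n by (simp add: abs_mult)
            also have "\<dots> \<le> C * (\<kappa> * ?x\<^sup>2 + (1/\<kappa>) * ?y\<^sup>2)"
            proof (intro mult_left_mono C0)
              have "0 \<le> (\<kappa> * ?x - ?y)\<^sup>2 / \<kappa> + ?x * ?y" using \<kappa> by (intro add_nonneg_nonneg) auto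
              also have "\<dots> = \<kappa> * ?x\<^sup>2 + (1/\<kappa>) * ?y\<^sup>2 - ?x * ?y" using \<kappa>
                by (simp add: power2_diff field_simps power2_eq_square)
              finally show "?x * ?y \<le> \<kappa> * ?x\<^sup>2 + (1/\<kappa>) * ?y\<^sup>2" by simp
            qed
            also have "\<dots> = C * \<kappa> * (Rf (G i \<omega>))\<^sup>2 + (C / \<kappa>) * (e2 i \<omega> * \<eta> i \<omega>)\<^sup>2" by (simp add: algebra_simps)
            also have "\<dots> \<le> C * \<kappa> * (Rf (G i \<omega>))\<^sup>2 + max 1 (C / \<kappa>) * (e2 i \<omega> * \<eta> i \<omega>)\<^sup>2"
              by (intro add_left_mono mult_right_mono) auto
            finally show "\<bar>e1 i \<omega> * Rf (G i \<omega>) * \<eta> i \<omega>\<bar> \<le> C * \<kappa> * (Rf (G i \<omega>))\<^sup>2 + max 1 (C / \<kappa>) * (e2 i \<omega> * \<eta> i \<omega>)\<^sup>2"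
              .
          qed
          also have "\<dots> = 1 * ?R \<omega> + max 1 (C / \<kappa>) * ?V \<omega>"
            by (simp only: sum.distrib sum_distrib_left mult_1)
          finally have "ennreal \<bar>z5 \<omega>\<bar> \<le> ennreal (1 * ?R \<omega> + max 1 (C / \<kappa>) * ?V \<omega>)" by (rule ennreal_leI)
          also have "\<dots> = ennreal 1 * ennreal (?R \<omega>) + ennreal (max 1 (C / \<kappa>)) * ennreal (?V \<omega>)"
            using C0 \<kappa> by (intro ennreal_lincomb mult_nonneg_nonneg sum_nonneg) auto
          finally show ?thesis by simp
        qed
        then have "outer_mean M (\<lambda>\<omega>. ennreal \<bar>z5 \<omega>\<bar>) \<le> outer_mean M (\<lambda>\<omega>. ennreal (?R \<omega>) + ennreal (max 1 (C / \<kappa>)) *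
          ennreal (?V \<omega>))"
          by (intro outer_mean_mono AE_I2)
        also have "\<dots> \<le> outer_mean M (\<lambda>\<omega>. ennreal (?R \<omega>)) + outer_mean M (\<lambda>\<omega>. ennreal (max 1 (C / \<kappa>)) *
          ennreal (?V \<omega>))"
          by (rule outer_mean_add)
        also have "outer_mean M (\<lambda>\<omega>. ennreal (?R \<omega>)) \<le> C * \<kappa> * (real N * rf d)"
        proof -
          have Ri: "integrable M ?R" using mom(5) by simp
          have Re: "expectation ?R = C * \<kappa> * (real N * rf d)" using mom(5,6) by simp
          have R0: "0 \<le> ?R \<omega>" for \<omega> using C0 \<kappa> by (intro mult_nonneg_nonneg sum_nonneg) auto
          have "(\<integral>\<^sup>+\<omega>. ennreal (?R \<omega>) \<partial>M) = ennreal (expectation ?R)"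
            using Ri R0 by (intro nn_integral_eq_integral) auto
          moreover have "0 \<le> expectation ?R" using R0 by (intro integral_nonneg_AE) auto
          ultimately show ?thesis unfolding Re[symmetric] using Ri by (intro outer_mean_le_nn_integral) auto
        qed
        also have "outer_mean M (\<lambda>\<omega>. ennreal (max 1 (C / \<kappa>)) * ennreal (?V \<omega>)) \<le> max 1 (C / \<kappa>) * outer_mean M (\<lambda>\<omega>.
          ennreal (?V \<omega>))"
          by (rule outer_mean_cmult) simp
        also have "outer_mean M (\<lambda>\<omega>. ennreal (?V \<omega>)) = outer_mean M (\<lambda>\<omega>. ennreal (\<Sum>r<N. (\<Sum>i | i < N \<and> id i =
          r. e2 i \<omega> * \<eta> i \<omega>)\<^sup>2))"
        proof (intro arg_cong[where f="outer_mean M"] ext arg_cong[where f=ennreal])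
          fix \<omega>
          have "{i. i < N \<and> id i = r} = {r}" if "r < N" for r using that by auto
          then show "?V \<omega> = (\<Sum>r<N. (\<Sum>i | i < N \<and> id i = r. e2 i \<omega> * \<eta> i \<omega>)\<^sup>2)" by simp
        qed
        also have "\<dots> \<le> Q N" by (rule Q1[OF eF(2) e2b])
        finally show ?thesis using outer_mean_square_le[of z5] by (simp add: mult_left_mono)
      qed
      have comb: "a \<le> 2 * q + 2 * A" if "a \<le> 2 * p + 2 * a'" "p \<le> q" "a' \<le> A" for a p a' q A :: real
        using that by linarith
      have "outer_mean M (\<lambda>\<omega>. ennreal ((ind \<omega> * Z \<omega>)\<^sup>2)) \<le>
         outer_mean M (\<lambda>\<omega>. ennreal ((ind \<omega> * z1 \<omega> + (ind \<omega> * z2 \<omega> + (ind \<omega> * z3 \<omega> + (ind \<omega> * z4 \<omega> + ind \<omega> *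
           z5 \<omega>))))\<^sup>2))"
        by (rule outer_mean_mono[OF eventually_mono[OF decomp]]) (simp only: order.refl)
      also have "\<dots> \<le> B \<kappa> N"
        unfolding B_def d_def[symmetric]
        by (intro comb[OF outer_mean_square_add] order_trans[OF ind_le N1] order_trans[OF ind_le N2] N3
            order_trans[OF ind_le N4] order_trans[OF ind_le N5])
      finally show ?thesis .
    qed
    have lim: "B \<kappa> \<longlonglongrightarrow> 16 * (C * \<kappa> * (T * b\<^sup>2))" for \<kappa>
    proof -
      have Q: "Q \<longlonglongrightarrow> 4 * sqrt (K * 0)" unfolding Q_def by (intro tendsto_intros w_lim)
      have "B \<kappa> \<longlonglongrightarrow> 2 * (C^4 * (T * 0)) + 2 * (2 * ((T * 0) * C\<^sup>2)\<^sup>2 +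
       2 * (2 * (K3 * 0) + 2 * (2 * (4 * sqrt (K * 0)) + 2 * (C * \<kappa> * (T * b\<^sup>2) + max 1 (C / \<kappa>) * (4 * sqrt (K *
         0))))))"
        unfolding B_def by (intro tendsto_intros w_lim Q lims)
      then show ?thesis by simp
    qed
    have le: "outer_mean M (\<lambda>\<omega>. ennreal ((ind \<omega> * Z \<omega>)\<^sup>2)) \<le> 16 * (C * \<kappa> * (T * b\<^sup>2))" if "0 < \<kappa>" for \<kappa>
      by (rule LIMSEQ_le_const[OF lim]) (use bound that in \<open>auto intro!: exI[of _ 1]\<close>)
    \<comment> \<open>The left side of \<open>le\<close> does not involve \<open>\<kappa>\<close>,
      so \<open>\<kappa>\<close> may tend to 0 once \<open>N\<close> has gone to infinity.\<close>
    have "((\<lambda>\<kappa>. 16 * (C * \<kappa> * (T * b\<^sup>2))) \<longlongrightarrow> 16 * (C * 0 * (T * b\<^sup>2))) (at_right 0)"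
      by (intro tendsto_intros)
    then have "outer_mean M (\<lambda>\<omega>. ennreal ((ind \<omega> * Z \<omega>)\<^sup>2)) \<le> 16 * (C * 0 * (T * b\<^sup>2))"
      by (rule tendsto_lowerbound) (auto intro!: le eventually_mono[OF eventually_at_right_less])
    then have "outer_mean M (\<lambda>\<omega>. ennreal ((ind \<omega> * Z \<omega>)\<^sup>2)) = 0"
      by (intro antisym) auto
    moreover have "(\<lambda>\<omega>. ennreal ((ind \<omega> * Z \<omega>)\<^sup>2)) \<in> borel_measurable M"
    proof -
      have [measurable]: "X T \<in> borel_measurable M" "E T \<in> borel_measurable M" "\<Omega> C \<in> sets M" using XM EM T \<Omega> by auto
      show ?thesis unfolding ind_def Z_def by measurable
    qed
    ultimately have "AE \<omega> in M. ennreal ((ind \<omega> * Z \<omega>)\<^sup>2) = 0" by (intro outer_mean_eq_0_AE)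
    then show ?thesis
    proof eventually_elim
      fix \<omega> assume "ennreal ((ind \<omega> * Z \<omega>)\<^sup>2) = 0"
      then have "ind \<omega> * Z \<omega> = 0" by (simp add: ennreal_eq_0_iff)
      then show "\<omega> \<in> \<Omega> C \<longrightarrow> X T \<omega> * E T \<omega> = x" by (auto simp: ind_def Z_def)
    qed
  qed
  \<comment> \<open>Integer levels suffice: continuous paths are bounded on \<open>[0,T]\<close>, so
    almost every path lies in some \<open>\<Omega> C\<close>.\<close>
  have "AE \<omega> in M. \<forall>k::nat. \<omega> \<in> \<Omega> (real (Suc k)) \<longrightarrow> X T \<omega> * E T \<omega> = x"
    unfolding AE_all_countable by (intro allI key) simp
  then have "AE \<omega> in M. X T \<omega> * E T \<omega> = x"
    using X_cont W_cont AE_space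
  proof eventually_elim
    fix \<omega> assume k: "\<forall>k::nat. \<omega> \<in> \<Omega> (real (Suc k)) \<longrightarrow> X T \<omega> * E T \<omega> = x"
      and c: "continuous_on {0..} (\<lambda>t. X t \<omega>)" "continuous_on {0..} (\<lambda>t. W t \<omega>)" and \<omega>: "\<omega> \<in> space M"
    have "bounded ((\<lambda>t. X t \<omega>) ` {0..T})" "bounded ((\<lambda>t. E t \<omega>) ` {0..T})"
      unfolding E_def
      by (intro compact_imp_bounded compact_continuous_image continuous_intros continuous_on_subset[OF c(1)]
        continuous_on_subset[OF c(2)]; auto)+
    then obtain B1 B2 where "\<forall>u\<in>{0..T}. \<bar>X u \<omega>\<bar> \<le> B1" "\<forall>u\<in>{0..T}. \<bar>E u \<omega>\<bar> \<le> B2"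
      unfolding bounded_iff by auto
    then have B: "\<And>u. u \<in> {0..T} \<Longrightarrow> \<bar>X u \<omega>\<bar> \<le> B1" "\<And>u. u \<in> {0..T} \<Longrightarrow> \<bar>E u \<omega>\<bar> \<le> B2" by blast+
    obtain k :: nat where kk: "max B1 B2 < real k" using reals_Archimedean2 by blast
    have "\<omega> \<in> \<Omega> (real (Suc k))"
      unfolding \<Omega>_def good_def
    proof (intro CollectI conjI \<omega> allI impI)
      fix N i :: nat assume "i \<le> N"
      then have "S N i \<in> {0..T}" using S0 ST by auto
      from B[OF this] kk show "\<bar>X (S N i) \<omega>\<bar> \<le> real (Suc k)" "E (S N i) \<omega> \<le> real (Suc k)" by auto
    qed
    with k show "X T \<omega> * E T \<omega> = x" by blast
  qed
  then show ?thesis unfolding E_def c_def .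
qed

end

text \<open>The formula must hold for all times off a single null set, because it is later evaluated
  at stopping times. Rational times and the continuity of both sides give this.\<close>

theorem linear_SDE_explicit:
  assumes fbm: "filtered_bm (completion M) FF W"
    and sde: "solves_SDE M FF W (\<lambda>x. a * x) (\<lambda>x. b * x) x X"
  shows "AE \<omega> in completion M. \<forall>t\<ge>0. X t \<omega> = x * exp ((a - b\<^sup>2 / 2) * t + b * W t \<omega>)"
proof -
  interpret filtered_bm "completion M" FF W by fact
  have XF: "X t \<in> borel_measurable (FF (ennreal t))" if "0 \<le> t" for t
    using sde that by (auto simp: solves_SDE_def)
  have X_cont: "AE \<omega> in completion M. continuous_on {0..} (\<lambda>t. X t \<omega>)"
    and X_zero: "AE \<omega> in completion M. X 0 \<omega> = x"
    using sde by (auto simp: solves_SDE_def intro: AE_completion)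
  have vanish: "(\<lambda>j. outer_mean (completion M) (D j)) \<longlonglongrightarrow> 0" if "vanishes_in_probability M D" for D
    using that unfolding vanishes_in_probability_def by (intro outer_mean_vanish) (auto simp: space_completion)
  have ito: "\<exists>I. (\<exists>n p \<xi>. approximates (\<lambda>u \<omega>. b * X u \<omega>) t n p \<xi> \<and>
        (\<lambda>j. outer_mean (completion M) (\<lambda>\<omega>. ennreal \<bar>simple_integral W (n j) (p j) (\<xi> j) t \<omega> - I \<omega>\<bar>)) \<longlonglongrightarrow> 0) \<and>
        (AE \<omega> in completion M. set_integrable lborel {0..t} (\<lambda>u. a * X u \<omega>) \<and> X t \<omega> = x + (LBINT u:{0..t}. a *
          X u \<omega>) + I \<omega>)"
    if t: "0 \<le> t" for t
  proof -
    obtain I where I: "has_ito_integral M FF W (\<lambda>u \<omega>. b * X u \<omega>) t I"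
      "AE \<omega> in M. set_integrable lborel {0..t} (\<lambda>u. a * X u \<omega>) \<and> X t \<omega> = x + (LBINT u:{0..t}. a * X u \<omega>) + I \<omega>"
      using sde t unfolding solves_SDE_def by blast
    from I(1) obtain n p \<xi> where A: "\<forall>j. simple_integrand FF (n j) (p j) (\<xi> j)"
       "vanishes_in_probability M
         (\<lambda>j \<omega>. \<integral>\<^sup>+u\<in>{0..t}. ennreal ((simple_process (n j) (p j) (\<xi> j) u \<omega> - b * X u \<omega>)\<^sup>2) \<partial>lborel)"
       "vanishes_in_probability M (\<lambda>j \<omega>. ennreal \<bar>simple_integral W (n j) (p j) (\<xi> j) t \<omega> - I \<omega>\<bar>)"
      unfolding has_ito_integral_def by blast
    show ?thesis
    proof (intro exI conjI)
      show "approximates (\<lambda>u \<omega>. b * X u \<omega>) t n p \<xi>"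
        unfolding approximates_def using A(1) vanish[OF A(2)] by (intro conjI)
      show "(\<lambda>j. outer_mean (completion M) (\<lambda>\<omega>. ennreal \<bar>simple_integral W (n j) (p j) (\<xi> j) t \<omega> - I \<omega>\<bar>)) \<longlonglongrightarrow> 0"
        by (rule vanish[OF A(3)])
      show "AE \<omega> in completion M. set_integrable lborel {0..t} (\<lambda>u. a * X u \<omega>) \<and> X t \<omega> = x + (LBINT u:{0..t}. a *
        X u \<omega>) + I \<omega>"
        by (rule AE_completion[OF I(2)])
    qed
  qed
  have fixed: "AE \<omega> in completion M. X t \<omega> = x * exp ((a - b\<^sup>2 / 2) * t + b * W t \<omega>)" if t: "0 \<le> t" for t
  proof (cases "t = 0")
    case True
    show ?thesis using X_zero W_zero by eventually_elim (simp add: True)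
  next
    case False
    with t have "0 < t" by simp
    have "AE \<omega> in completion M. X t \<omega> * exp (- b * W t \<omega> - (a - b\<^sup>2 / 2) * t) = x"
      using XF ito by (rule linear_SDE_fixed_time[OF \<open>0 < t\<close> _ X_cont X_zero])
    then show ?thesis
    proof eventually_elim
      fix \<omega> assume *: "X t \<omega> * exp (- b * W t \<omega> - (a - b\<^sup>2 / 2) * t) = x"
      have "X t \<omega> = (X t \<omega> * exp (- b * W t \<omega> - (a - b\<^sup>2 / 2) * t)) * exp ((a - b\<^sup>2 / 2) * t + b * W t \<omega>)"
        unfolding mult.assoc exp_add[symmetric] by simp
      then show "X t \<omega> = x * exp ((a - b\<^sup>2 / 2) * t + b * W t \<omega>)" unfolding * .
    qed
  qed
  have "AE \<omega> in completion M. \<forall>q\<in>\<rat>. 0 \<le> q \<longrightarrow> X q \<omega> = x * exp ((a - b\<^sup>2 / 2) * q + b * W q \<omega>)"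
  proof (subst AE_ball_countable[OF countable_rat], intro ballI)
    fix q :: real
    show "AE \<omega> in completion M. 0 \<le> q \<longrightarrow> X q \<omega> = x * exp ((a - b\<^sup>2 / 2) * q + b * W q \<omega>)"
      using fixed[of q] by (cases "0 \<le> q") auto
  qed
  then show ?thesis
    using X_cont W_cont
  proof eventually_elim
    fix \<omega> assume q: "\<forall>q\<in>\<rat>. 0 \<le> q \<longrightarrow> X q \<omega> = x * exp ((a - b\<^sup>2 / 2) * q + b * W q \<omega>)"
      and c: "continuous_on {0..} (\<lambda>t. X t \<omega>)" "continuous_on {0..} (\<lambda>t. W t \<omega>)"
    show "\<forall>t\<ge>0. X t \<omega> = x * exp ((a - b\<^sup>2 / 2) * t + b * W t \<omega>)"
    proof (intro allI impI)
      fix t :: real assume t: "0 \<le> t"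
      have "\<bar>X t \<omega> - x * exp ((a - b\<^sup>2 / 2) * t + b * W t \<omega>)\<bar> \<le> 0"
      proof (rule real_bound_from_Rats[where f="\<lambda>t. \<bar>X t \<omega> - x * exp ((a - b\<^sup>2 / 2) * t + b * W t \<omega>)\<bar>" and a=0
        and b="t + 1"])
        show "continuous_on {0..t + 1} (\<lambda>t. \<bar>X t \<omega> - x * exp ((a - b\<^sup>2 / 2) * t + b * W t \<omega>)\<bar>)"
          by (intro continuous_intros continuous_on_subset[OF c(1)] continuous_on_subset[OF c(2)]) auto
      qed (use q t in auto)
      then show "X t \<omega> = x * exp ((a - b\<^sup>2 / 2) * t + b * W t \<omega>)" by simp
    qed
  qed
qed

section \<open>Independent increments of the pair of Brownian motions\<close>

locale bm_pair = prob_space M for M :: "'a measure" +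
  fixes B1 B2 :: "real \<Rightarrow> 'a \<Rightarrow> real"
  assumes bm1: "brownian_motion M B1" and bm2: "brownian_motion M B2"
    and indep_B: "independent_processes M B1 B2"
begin

abbreviation "FF \<equiv> completed_filtration M B1 B2"

lemma bm_measurable: "0 \<le> t \<Longrightarrow> B1 t \<in> borel_measurable M" "0 \<le> t \<Longrightarrow> B2 t \<in> borel_measurable M"
  using bm1 bm2 by (auto simp: brownian_motion_def)

text \<open>The values at the times of \<open>U\<close> are partial sums of increments over a grid
  that ends in \<open>s\<close>, and \<open>B t - B s\<close> is the next increment of that
  grid.\<close>

lemma bm_past_indep:
  assumes bm: "brownian_motion M B" and st: "0 \<le> s" "s < t"
    and U: "finite U" "U \<subseteq> {0..s}" "\<forall>u\<in>U. A u \<in> sets borel" and C: "C \<in> sets borel"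
  shows "prob {\<omega>\<in>space M. (\<forall>u\<in>U. B u \<omega> \<in> A u) \<and> B t \<omega> - B s \<omega> \<in> C} =
    prob {\<omega>\<in>space M. \<forall>u\<in>U. B u \<omega> \<in> A u} * prob {\<omega>\<in>space M. B t \<omega> - B s \<omega> \<in> C}"
proof -
  have BM: "B u \<in> borel_measurable M" if "0 \<le> u" for u using bm that by (auto simp: brownian_motion_def)
  define Q where "Q = {0, s} \<union> U"
  have "finite Q" "0 \<in> Q" "\<And>x. x \<in> Q \<Longrightarrow> 0 \<le> x" using U st by (auto simp: Q_def)
  from finite_grid_enumeration[OF this]
  obtain q :: "nat \<Rightarrow> real" and m where q: "strict_mono_on {..m} q" "q ` {..m} = Q" "q 0 = 0" .
  have qs: "q i \<le> s" if "i \<le> m" for i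
  proof -
    have "q i \<in> Q" using q(2) that by auto
    then show ?thesis using U st by (auto simp: Q_def)
  qed
  have "s \<in> q ` {..m}" unfolding q(2) by (simp add: Q_def)
  then obtain j where j: "j \<le> m" "q j = s" by auto
  have qm: "q m = s" using qs[of m] grid_less_iff(2)[OF q(1), of j m] j by auto
  \<comment> \<open>\<open>brownian_motion\<close> speaks about monotone sequences indexed by all
    naturals, so the grid is continued by the constant \<open>t\<close>. The increment with index
    \<open>m\<close> is the one from \<open>s\<close> to \<open>t\<close>.\<close>
  define p where "p i = (if i \<le> m then q i else t)" for i
  have p_mono: "mono p"
  proof (rule monoI)
    fix i k :: nat assume "i \<le> k"
    then show "p i \<le> p k"
      using qs[of i] st grid_less_iff(2)[OF q(1), of i k] by (auto simp: p_def)
  qed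
  have p0: "0 \<le> p 0" by (simp add: p_def q)
  define Y where "Y i \<omega> = B (p (Suc i)) \<omega> - B (p i) \<omega>" for i \<omega>
  have ind: "indep_vars (\<lambda>_. borel) Y {..<Suc m}"
    using bm p_mono p0 unfolding brownian_motion_def Y_def by blast
  have iv: "indep_var (PiM {..<m} (\<lambda>_. borel)) (\<lambda>\<omega>. restrict (\<lambda>i. Y i \<omega>) {..<m}) (PiM {m} (\<lambda>_. borel)) (\<lambda>\<omega>. restrict
    (\<lambda>i. Y i \<omega>) {m})"
    by (rule indep_var_restrict[OF ind]) auto
  have "\<forall>u\<in>U. \<exists>a\<le>m. q a = u"
  proof
    fix u assume "u \<in> U"
    then have "u \<in> q ` {..m}" unfolding q(2) by (simp add: Q_def)
    then show "\<exists>a\<le>m. q a = u" by auto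
  qed
  from bchoice[OF this] obtain \<kappa> where \<kappa>: "\<And>u. u \<in> U \<Longrightarrow> \<kappa> u \<le> m" "\<And>u. u \<in> U \<Longrightarrow> q (\<kappa> u) = u" by auto
  define E1 where "E1 = {x\<in>space (PiM {..<m} (\<lambda>_. borel :: real measure)). \<forall>u\<in>U. (\<Sum>i<\<kappa> u. x i) \<in> A u}"
  define E2 where "E2 = {x\<in>space (PiM {m} (\<lambda>_. borel :: real measure)). x m \<in> C}"
  have E1: "E1 \<in> sets (PiM {..<m} (\<lambda>_. borel))"
    unfolding E1_def
  proof (intro sets.sets_Collect_finite_All U(1))
    fix u assume u: "u \<in> U"
    note [measurable] = U(3)[rule_format, OF u]
    have [measurable]: "(\<lambda>x. \<Sum>i<\<kappa> u. x i) \<in> borel_measurable (PiM {..<m} (\<lambda>_. borel :: real measure))"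
      using \<kappa>(1)[OF u] by (intro borel_measurable_sum measurable_component_singleton) auto
    show "{x\<in>space (PiM {..<m} (\<lambda>_. borel :: real measure)). (\<Sum>i<\<kappa> u. x i) \<in> A u} \<in> sets (PiM {..<m} (\<lambda>_. borel))"
      by measurable
  qed
  have E2: "E2 \<in> sets (PiM {m} (\<lambda>_. borel))"
  proof -
    note [measurable] = C
    have [measurable]: "(\<lambda>x. x m) \<in> borel_measurable (PiM {m} (\<lambda>_. borel :: real measure))"
      by (rule measurable_component_singleton) simp
    show ?thesis unfolding E2_def by measurable
  qed
  have YM: "Y i \<in> borel_measurable M" for i
    unfolding Y_def using p_mono p0 by (intro borel_measurable_diff BM) (auto intro: order_trans[OF p0 monoD[OF
      p_mono]])
  have v1: "(\<lambda>\<omega>. restrict (\<lambda>i. Y i \<omega>) {..<m}) -` E1 \<inter> space M = {\<omega>\<in>space M. \<forall>u\<in>U. (\<Sum>i<\<kappa> u. Y i \<omega>) \<in> A u}"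
  proof -
    have "(\<Sum>i<\<kappa> u. restrict (\<lambda>i. Y i \<omega>) {..<m} i) = (\<Sum>i<\<kappa> u. Y i \<omega>)" if "u \<in> U" for u \<omega>
      using \<kappa>(1)[OF that] by (intro sum.cong) auto
    then show ?thesis unfolding E1_def by (auto simp: space_PiM)
  qed
  have v2: "(\<lambda>\<omega>. restrict (\<lambda>i. Y i \<omega>) {m}) -` E2 \<inter> space M = {\<omega>\<in>space M. B t \<omega> - B s \<omega> \<in> C}"
    unfolding E2_def by (auto simp: space_PiM Y_def p_def qm)
  have eq: "prob {\<omega>\<in>space M. (\<forall>u\<in>U. (\<Sum>i<\<kappa> u. Y i \<omega>) \<in> A u) \<and> B t \<omega> - B s \<omega> \<in> C} =
     prob {\<omega>\<in>space M. \<forall>u\<in>U. (\<Sum>i<\<kappa> u. Y i \<omega>) \<in> A u} * prob {\<omega>\<in>space M. B t \<omega> - B s \<omega> \<in> C}"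
  proof -
    have "(\<lambda>\<omega>. (restrict (\<lambda>i. Y i \<omega>) {..<m}, restrict (\<lambda>i. Y i \<omega>) {m})) -` (E1 \<times> E2) \<inter> space M =
      ((\<lambda>\<omega>. restrict (\<lambda>i. Y i \<omega>) {..<m}) -` E1 \<inter> space M) \<inter> ((\<lambda>\<omega>. restrict (\<lambda>i. Y i \<omega>) {m}) -` E2 \<inter> space M)"
      by auto
    also have "\<dots> = {\<omega>\<in>space M. (\<forall>u\<in>U. (\<Sum>i<\<kappa> u. Y i \<omega>) \<in> A u) \<and> B t \<omega> - B s \<omega> \<in> C}"
      unfolding v1 v2 by blast
    finally show ?thesis using indep_varD[OF iv E1 E2] unfolding v1 v2 by simp
  qed
  have [measurable]: "(\<lambda>\<omega>. \<Sum>i<k. Y i \<omega>) \<in> borel_measurable M" for k by (intro borel_measurable_sum YM)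
  have m1: "{\<omega>\<in>space M. \<forall>u\<in>U. (\<Sum>i<\<kappa> u. Y i \<omega>) \<in> A u} \<in> sets M"
    by (intro sets.sets_Collect_finite_All U(1)) (use U(3) in measurable)
  have m2: "{\<omega>\<in>space M. \<forall>u\<in>U. B u \<omega> \<in> A u} \<in> sets M"
  proof (intro sets.sets_Collect_finite_All U(1))
    fix u assume u: "u \<in> U"
    then have "0 \<le> u" using U(2) by auto
    note [measurable] = U(3)[rule_format, OF u] BM[OF this]
    show "{\<omega>\<in>space M. B u \<omega> \<in> A u} \<in> sets M" by measurable
  qed
  have m3: "{\<omega>\<in>space M. B t \<omega> - B s \<omega> \<in> C} \<in> sets M"
  proof -
    note [measurable] = C
    have [measurable]: "B t \<in> borel_measurable M" "B s \<in> borel_measurable M" using BM st by auto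
    show ?thesis by measurable
  qed
  \<comment> \<open>The path starts in 0 only almost surely, so partial sums and values agree up to
    a null event.\<close>
  have "AE \<omega> in M. B 0 \<omega> = 0" using bm by (auto simp: brownian_motion_def)
  then have ae: "AE \<omega> in M. \<forall>u\<in>U. (\<Sum>i<\<kappa> u. Y i \<omega>) = B u \<omega>"
  proof eventually_elim
    fix \<omega> assume 0: "B 0 \<omega> = 0"
    show "\<forall>u\<in>U. (\<Sum>i<\<kappa> u. Y i \<omega>) = B u \<omega>"
    proof
      fix u assume u: "u \<in> U"
      have "(\<Sum>i<\<kappa> u. Y i \<omega>) = B (p (\<kappa> u)) \<omega> - B (p 0) \<omega>"
        unfolding Y_def by (rule sum_lessThan_telescope)
      then show "(\<Sum>i<\<kappa> u. Y i \<omega>) = B u \<omega>" using \<kappa>[OF u] 0 q(3) by (simp add: p_def)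
    qed
  qed
  have s1: "prob {\<omega>\<in>space M. \<forall>u\<in>U. (\<Sum>i<\<kappa> u. Y i \<omega>) \<in> A u} = prob {\<omega>\<in>space M. \<forall>u\<in>U. B u \<omega> \<in> A u}"
    by (intro measure_eq_AE m1 m2 eventually_mono[OF ae]) auto
  have split: "{\<omega>\<in>space M. P \<omega> \<and> R \<omega>} = {\<omega>\<in>space M. P \<omega>} \<inter> {\<omega>\<in>space M. R \<omega>}" for P R by auto
  have s2: "prob {\<omega>\<in>space M. (\<forall>u\<in>U. (\<Sum>i<\<kappa> u. Y i \<omega>) \<in> A u) \<and> B t \<omega> - B s \<omega> \<in> C} =
      prob {\<omega>\<in>space M. (\<forall>u\<in>U. B u \<omega> \<in> A u) \<and> B t \<omega> - B s \<omega> \<in> C}"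
    unfolding split by (intro measure_eq_AE sets.Int m1 m2 m3 eventually_mono[OF ae]) auto
  show ?thesis using eq unfolding s1 s2 .
qed

lemma processes_indep:
  assumes "E \<in> sets (PiM {0..} (\<lambda>_. borel))" "E' \<in> sets (PiM {0..} (\<lambda>_. borel))"
  shows "prob ({\<omega>\<in>space M. (\<lambda>t\<in>{0..}. B1 t \<omega>) \<in> E} \<inter> {\<omega>\<in>space M. (\<lambda>t\<in>{0..}. B2 t \<omega>) \<in> E'}) =
    prob {\<omega>\<in>space M. (\<lambda>t\<in>{0..}. B1 t \<omega>) \<in> E} * prob {\<omega>\<in>space M. (\<lambda>t\<in>{0..}. B2 t \<omega>) \<in> E'}"
proof -
  have v: "(\<lambda>\<omega>. f \<omega>) -` E \<inter> space M = {\<omega>\<in>space M. f \<omega> \<in> E}" for f and E :: "(real \<Rightarrow> real) set" by auto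
  have p: "(\<lambda>\<omega>. (f \<omega>, g \<omega>)) -` (E \<times> E') \<inter> space M = {\<omega>\<in>space M. f \<omega> \<in> E} \<inter> {\<omega>\<in>space M. g \<omega> \<in> E'}" for f g by auto
  show ?thesis
    using indep_varD[OF indep_B[unfolded independent_processes_def] assms] unfolding v p .
qed

text \<open>Conditions on finitely many past values and one increment, rewritten as membership of
  the whole path in a product-measurable set, the form in which independence of the two processes is
  given.\<close>

lemma path_event:
  fixes B :: "real \<Rightarrow> 'a \<Rightarrow> real" and U :: "real set"
  assumes "finite U" "U \<subseteq> {0..s}" "\<forall>u\<in>U. A u \<in> sets borel" "0 \<le> s" "s < t" "C \<in> sets (borel :: real measure)"
  shows "{x\<in>space (PiM {0..} (\<lambda>_. borel :: real measure)). (\<forall>u\<in>U. x u \<in> A u) \<and> x t - x s \<in> C} \<in> sets (PiM {0..} (\<lambda>_.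
    borel))" (is ?A)
    and "{\<omega>\<in>space M. (\<lambda>t\<in>{0..}. B t \<omega>) \<in> {x\<in>space (PiM {0..} (\<lambda>_. borel :: real measure)). (\<forall>u\<in>U. x u \<in> A u) \<and>
      x t - x s \<in> C}}
      = {\<omega>\<in>space M. (\<forall>u\<in>U. B u \<omega> \<in> A u) \<and> B t \<omega> - B s \<omega> \<in> C}" (is ?B)
proof -
  have c: "(\<lambda>x. x u) \<in> borel_measurable (PiM {0..} (\<lambda>_. borel :: real measure))" if "0 \<le> u" for u :: real
    by (rule measurable_component_singleton) (use that in simp)
  have split: "{x\<in>space (PiM {0..} (\<lambda>_. borel :: real measure)). (\<forall>u\<in>U. x u \<in> A u) \<and> x t - x s \<in> C} =
    {x\<in>space (PiM {0..} (\<lambda>_. borel)). \<forall>u\<in>U. x u \<in> A u} \<inter> {x\<in>space (PiM {0..} (\<lambda>_. borel)). x t - x s \<in> C}"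
    by blast
  show ?A
    unfolding split
  proof (intro sets.Int sets.sets_Collect_finite_All assms(1))
    fix u assume u: "u \<in> U"
    then have "0 \<le> u" using assms(2) by auto
    note [measurable] = c[OF this] assms(3)[rule_format, OF u]
    show "{x\<in>space (PiM {0..} (\<lambda>_. borel :: real measure)). x u \<in> A u} \<in> sets (PiM {0..} (\<lambda>_. borel))" by measurable
  next
    have t: "0 \<le> t" using assms by simp
    note [measurable] = c[OF t] c[OF \<open>0 \<le> s\<close>] assms(6)
    show "{x\<in>space (PiM {0..} (\<lambda>_. borel :: real measure)). x t - x s \<in> C} \<in> sets (PiM {0..} (\<lambda>_. borel))"
      by measurable
  qed
  have "(\<lambda>t\<in>{0..}. B t \<omega>) u = B u \<omega>" if "u \<in> U" for u \<omega> using that assms(2) by auto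
  then show ?B using assms(4,5) by (auto simp: space_PiM)
qed

definition past_cylinders :: "real \<Rightarrow> 'a set set" where
  "past_cylinders s = {{\<omega>\<in>space M. (\<forall>u\<in>U. B1 u \<omega> \<in> A u) \<and> (\<forall>u\<in>U'. B2 u \<omega> \<in> A' u)} | U A U' A'.
     finite U \<and> U \<subseteq> {0..s} \<and> (\<forall>u\<in>U. A u \<in> sets borel) \<and> finite U' \<and> U' \<subseteq> {0..s} \<and> (\<forall>u\<in>U'. A' u \<in> sets borel)}"

definition increment_rectangles :: "real \<Rightarrow> real \<Rightarrow> 'a set set" where
  "increment_rectangles s t = {{\<omega>\<in>space M. B1 t \<omega> - B1 s \<omega> \<in> C \<and> B2 t \<omega> - B2 s \<omega> \<in> C'} | C C'.
     C \<in> sets borel \<and> C' \<in> sets borel}"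

text \<open>On generators, independence of the processes separates the two coordinates, and
  \<open>bm_past_indep\<close> separates past from increment within each. The marginals come from
  the same product formula, with \<open>UNIV\<close> or an empty set of times. Both families of
  generators are stable under intersection.\<close>

lemma cylinders_indep:
  assumes st: "0 \<le> s" "s < t"
  shows "indep_set (sigma_sets (space M) (past_cylinders s)) (sigma_sets (space M) (increment_rectangles s t))"
proof (rule indep_set_sigma_sets)
  note [measurable] = bm_measurable
  have Bm: "{\<omega>\<in>space M. \<forall>u\<in>U. B u \<omega> \<in> A u} \<in> sets M"
    if "finite U" "U \<subseteq> {0..s}" "\<And>u. u \<in> U \<Longrightarrow> A u \<in> sets borel" "\<And>u. 0 \<le> u \<Longrightarrow> B u \<in> borel_measurable M"
    for U A and B :: "real \<Rightarrow> 'a \<Rightarrow> real"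
  proof (intro sets.sets_Collect_finite_All that(1))
    fix u assume u: "u \<in> U"
    then have "0 \<le> u" using that(2) by auto
    note [measurable] = that(4)[OF this] that(3)[OF u]
    show "{\<omega>\<in>space M. B u \<omega> \<in> A u} \<in> sets M" by measurable
  qed
  have Im: "{\<omega>\<in>space M. B t \<omega> - B s \<omega> \<in> C} \<in> sets M"
    if "C \<in> sets borel" "\<And>u. 0 \<le> u \<Longrightarrow> B u \<in> borel_measurable M" for C and B :: "real \<Rightarrow> 'a \<Rightarrow> real"
  proof -
    have t: "0 \<le> t" using st by simp
    note [measurable] = that(2)[OF t] that(2)[OF st(1)] that(1)
    show ?thesis by measurable
  qed
  have split: "{\<omega>\<in>space M. P \<omega> \<and> R \<omega>} = {\<omega>\<in>space M. P \<omega>} \<inter> {\<omega>\<in>space M. R \<omega>}" for P R by auto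
  show "indep_set (past_cylinders s) (increment_rectangles s t)"
  proof (rule indep_setI)
    show "past_cylinders s \<subseteq> events"
      unfolding past_cylinders_def split by (auto intro!: sets.Int Bm bm_measurable)
    show "increment_rectangles s t \<subseteq> events"
      unfolding increment_rectangles_def split by (auto intro!: sets.Int Im bm_measurable)
    fix a b assume "a \<in> past_cylinders s" "b \<in> increment_rectangles s t"
    then obtain U A U' A' C C' where
      a: "a = {\<omega>\<in>space M. (\<forall>u\<in>U. B1 u \<omega> \<in> A u) \<and> (\<forall>u\<in>U'. B2 u \<omega> \<in> A' u)}" and
      U: "finite U" "U \<subseteq> {0..s}" "\<forall>u\<in>U. A u \<in> sets borel" and
      U': "finite U'" "U' \<subseteq> {0..s}" "\<forall>u\<in>U'. A' u \<in> sets borel" and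
      b: "b = {\<omega>\<in>space M. B1 t \<omega> - B1 s \<omega> \<in> C \<and> B2 t \<omega> - B2 s \<omega> \<in> C'}" and
      C: "C \<in> sets borel" "C' \<in> sets borel"
      unfolding past_cylinders_def increment_rectangles_def by blast
    define p1 where "p1 = (\<lambda>U A C. prob {\<omega>\<in>space M. (\<forall>u\<in>U. B1 u \<omega> \<in> A u) \<and> B1 t \<omega> - B1 s \<omega> \<in> C})"
    define p2 where "p2 = (\<lambda>U A C. prob {\<omega>\<in>space M. (\<forall>u\<in>U. B2 u \<omega> \<in> A u) \<and> B2 t \<omega> - B2 s \<omega> \<in> C})"
    have joint: "prob ({\<omega>\<in>space M. (\<forall>u\<in>U. B1 u \<omega> \<in> A u) \<and> B1 t \<omega> - B1 s \<omega> \<in> C} \<inter> {\<omega>\<in>space M. (\<forall>u\<in>U'. B2 u \<omega> \<in> A' u) \<and>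
      B2 t \<omega> - B2 s \<omega> \<in> C'})
       = p1 U A C * p2 U' A' C'"
      if "finite U" "U \<subseteq> {0..s}" "\<forall>u\<in>U. A u \<in> sets borel" "finite U'" "U' \<subseteq> {0..s}" "\<forall>u\<in>U'. A' u \<in> sets borel"
        "C \<in> sets borel" "C' \<in> sets borel"
      for U A U' A' C C'
      using processes_indep[OF path_event(1)[OF that(1-3) st that(7)] path_event(1)[OF that(4-6) st that(8)]]
      unfolding p1_def p2_def path_event(2)[OF that(1-3) st that(7)] path_event(2)[OF that(4-6) st that(8)] .
    have e: "{} \<subseteq> {0..s}" "\<forall>u\<in>{}. A u \<in> sets borel" for A :: "real \<Rightarrow> real set" by auto
    have f1: "p1 U A C = p1 U A UNIV * p1 {} A C" if "finite U" "U \<subseteq> {0..s}" "\<forall>u\<in>U. A u \<in> sets borel"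
      "C \<in> sets borel" for U A C
      using bm_past_indep[OF bm1 st that] unfolding p1_def by simp
    have f2: "p2 U A C = p2 U A UNIV * p2 {} A C" if "finite U" "U \<subseteq> {0..s}" "\<forall>u\<in>U. A u \<in> sets borel"
      "C \<in> sets borel" for U A C
      using bm_past_indep[OF bm2 st that] unfolding p2_def by simp
    have "a \<inter> b = {\<omega>\<in>space M. (\<forall>u\<in>U. B1 u \<omega> \<in> A u) \<and> B1 t \<omega> - B1 s \<omega> \<in> C} \<inter> {\<omega>\<in>space M. (\<forall>u\<in>U'. B2 u \<omega> \<in> A' u) \<and>
      B2 t \<omega> - B2 s \<omega> \<in> C'}"
      unfolding a b by blast
    then have 1: "prob (a \<inter> b) = p1 U A UNIV * p1 {} A C * (p2 U' A' UNIV * p2 {} A' C')"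
      using joint[OF U U' C] f1[OF U C(1)] f2[OF U' C(2)] by simp
    have "a = {\<omega>\<in>space M. (\<forall>u\<in>U. B1 u \<omega> \<in> A u) \<and> B1 t \<omega> - B1 s \<omega> \<in> UNIV} \<inter> {\<omega>\<in>space M. (\<forall>u\<in>U'. B2 u \<omega> \<in> A' u) \<and>
      B2 t \<omega> - B2 s \<omega> \<in> UNIV}"
      unfolding a by blast
    then have 2: "prob a = p1 U A UNIV * p2 U' A' UNIV"
      using joint[OF U U', of UNIV UNIV] by simp
    have "b = {\<omega>\<in>space M. (\<forall>u\<in>{}. B1 u \<omega> \<in> A u) \<and> B1 t \<omega> - B1 s \<omega> \<in> C} \<inter> {\<omega>\<in>space M. (\<forall>u\<in>{}. B2 u \<omega> \<in> A' u) \<and>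
      B2 t \<omega> - B2 s \<omega> \<in> C'}"
      unfolding b by blast
    then have 3: "prob b = p1 {} A C * p2 {} A' C'"
      using joint[of "{}" A "{}" A', OF _ e _ e C] by simp
    show "prob (a \<inter> b) = prob a * prob b" unfolding 1 2 3 by simp
  qed
  show "Int_stable (past_cylinders s)"
  proof (rule Int_stableI)
    fix a b assume "a \<in> past_cylinders s" "b \<in> past_cylinders s"
    then obtain U A U' A' V D V' D' where
      a: "a = {\<omega>\<in>space M. (\<forall>u\<in>U. B1 u \<omega> \<in> A u) \<and> (\<forall>u\<in>U'. B2 u \<omega> \<in> A' u)}" and
      U: "finite U" "U \<subseteq> {0..s}" "\<forall>u\<in>U. A u \<in> sets borel" and
      U': "finite U'" "U' \<subseteq> {0..s}" "\<forall>u\<in>U'. A' u \<in> sets borel" and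
      b: "b = {\<omega>\<in>space M. (\<forall>u\<in>V. B1 u \<omega> \<in> D u) \<and> (\<forall>u\<in>V'. B2 u \<omega> \<in> D' u)}" and
      V: "finite V" "V \<subseteq> {0..s}" "\<forall>u\<in>V. D u \<in> sets borel" and
      V': "finite V'" "V' \<subseteq> {0..s}" "\<forall>u\<in>V'. D' u \<in> sets borel"
      unfolding past_cylinders_def by blast
    define J where "J = (\<lambda>U A V D (u::real). (if u \<in> U then A u else UNIV) \<inter> (if u \<in> V then D u else (UNIV :: real
      set)))"
    have "a \<inter> b = {\<omega>\<in>space M. (\<forall>u\<in>U\<union>V. B1 u \<omega> \<in> J U A V D u) \<and> (\<forall>u\<in>U'\<union>V'. B2 u \<omega> \<in> J U' A' V' D' u)}"
      unfolding a b J_def by (auto split: if_splits)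
    moreover have "finite (U \<union> V)" "U \<union> V \<subseteq> {0..s}" "\<forall>u\<in>U\<union>V. J U A V D u \<in> sets borel"
      "finite (U' \<union> V')" "U' \<union> V' \<subseteq> {0..s}" "\<forall>u\<in>U'\<union>V'. J U' A' V' D' u \<in> sets borel"
      using U V U' V' by (auto simp: J_def)
    ultimately show "a \<inter> b \<in> past_cylinders s" unfolding past_cylinders_def by blast
  qed
  show "Int_stable (increment_rectangles s t)"
  proof (rule Int_stableI)
    fix a b assume "a \<in> increment_rectangles s t" "b \<in> increment_rectangles s t"
    then obtain C C' D D' where
      a: "a = {\<omega>\<in>space M. B1 t \<omega> - B1 s \<omega> \<in> C \<and> B2 t \<omega> - B2 s \<omega> \<in> C'}" and
      b: "b = {\<omega>\<in>space M. B1 t \<omega> - B1 s \<omega> \<in> D \<and> B2 t \<omega> - B2 s \<omega> \<in> D'}" and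
      C: "C \<in> sets borel" "C' \<in> sets borel" "D \<in> sets borel" "D' \<in> sets borel"
      unfolding increment_rectangles_def by blast
    have "a \<inter> b = {\<omega>\<in>space M. B1 t \<omega> - B1 s \<omega> \<in> C \<inter> D \<and> B2 t \<omega> - B2 s \<omega> \<in> C' \<inter> D'}"
      unfolding a b by blast
    moreover have "C \<inter> D \<in> sets borel" "C' \<inter> D' \<in> sets borel" using C by auto
    ultimately show "a \<inter> b \<in> increment_rectangles s t" unfolding increment_rectangles_def by blast
  qed
qed

end

section \<open>Increments independent of the completed past\<close>

definition gauss2 :: "(real \<times> real) measure" where
  "gauss2 = density lborel std_normal_density \<Otimes>\<^sub>M density lborel std_normal_density"

context bm_pair
begin

abbreviation "N \<equiv> completion M"

lemma prob_space_N: "prob_space N"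
  by (rule prob_spaceI) (simp add: emeasure_space_1)

definition FF_gen :: "ennreal \<Rightarrow> 'a set set" where
  "FF_gen t = {B1 u -` A \<inter> space M | u A. 0 \<le> u \<and> ennreal u \<le> t \<and> A \<in> sets borel} \<union>
      {B2 u -` A \<inter> space M | u A. 0 \<le> u \<and> ennreal u \<le> t \<and> A \<in> sets borel} \<union>
      null_sets (completion M)"

lemma FF_gen_sets: "FF_gen t \<subseteq> sets N"
  unfolding FF_gen_def using bm_measurable by (auto intro: measurable_sets)

lemma FF_gen_Pow: "FF_gen t \<subseteq> Pow (space M)"
  using FF_gen_sets[of t] sets.space_closed[of N] by auto

lemma FF_eq: "FF t = sigma (space M) (FF_gen t)"
  by (simp add: completed_filtration_def FF_gen_def)

lemma space_FF: "space (FF t) = space M"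
  unfolding FF_eq by (rule space_measure_of[OF FF_gen_Pow])

lemma space_in_FF: "space M \<in> sets (FF t)"
  using sets.top[of "FF t"] by (simp add: space_FF)

lemma sets_FF_eq: "sets (FF t) = sigma_sets (space M) (FF_gen t)"
  unfolding FF_eq by (rule sets_measure_of[OF FF_gen_Pow])

lemma sets_FF: "sets (FF t) \<subseteq> sets N"
  unfolding sets_FF_eq using sets.sigma_sets_subset[OF FF_gen_sets] by simp

lemma FF_mono: "i \<le> j \<Longrightarrow> sets (FF i) \<subseteq> sets (FF j)"
  unfolding sets_FF_eq
proof (rule sigma_sets_mono')
  show "FF_gen i \<subseteq> FF_gen j" if "i \<le> j"
    unfolding FF_gen_def by (intro Un_mono order.refl) (use that in \<open>blast intro: order_trans\<close>)+
qed

lemma B_adapted: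
  assumes "0 \<le> u" "ennreal u \<le> t"
  shows "B1 u \<in> borel_measurable (FF t)" "B2 u \<in> borel_measurable (FF t)"
proof -
  have "B u \<in> borel_measurable (FF t)" if "B = B1 \<or> B = B2" for B
  proof (rule measurableI)
    fix A :: "real set" assume "A \<in> sets borel"
    then show "B u -` A \<inter> space (FF t) \<in> sets (FF t)"
      unfolding space_FF sets_FF_eq using that assms
      by (intro sigma_sets.Basic) (auto simp: FF_gen_def)
  qed simp
  then show "B1 u \<in> borel_measurable (FF t)" "B2 u \<in> borel_measurable (FF t)" by auto
qed

text \<open>Null sets of the completion need not be events of \<open>M\<close>, so independence is
  proved for cylinders only and transferred through almost sure equality. The sets equal almost
  surely to a cylinder event form a sigma-algebra containing all generators.\<close>

lemma FF_approx:
  assumes "A \<in> sets (FF (ennreal s))" and s: "0 \<le> s"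
  shows "\<exists>A'\<in>sigma_sets (space M) (past_cylinders s). AE \<omega> in N. \<omega> \<in> A \<longleftrightarrow> \<omega> \<in> A'"
  using assms(1) unfolding sets_FF_eq
proof (induction rule: sigma_sets.induct)
  case (Basic a)
  then consider (1) u A where "a = B1 u -` A \<inter> space M" "0 \<le> u" "ennreal u \<le> ennreal s" "A \<in> sets borel"
    | (2) u A where "a = B2 u -` A \<inter> space M" "0 \<le> u" "ennreal u \<le> ennreal s" "A \<in> sets borel"
    | (3) "a \<in> null_sets N" unfolding FF_gen_def by blast
  then show ?case
  proof cases
    case 1
    have us: "u \<le> s" using 1 s by (simp add: ennreal_le_iff)
    have "a = {\<omega>\<in>space M. (\<forall>u\<in>{u}. B1 u \<omega> \<in> (\<lambda>_. A) u) \<and> (\<forall>u\<in>{}. B2 u \<omega> \<in> (\<lambda>_. A) u)}" unfolding 1 by auto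
    then have "a \<in> past_cylinders s" unfolding past_cylinders_def using 1 us
      by (intro CollectI exI[of _ "{u}"] exI[of _ "\<lambda>_. A"] exI[of _ "{}"]) auto
    then show ?thesis by (intro bexI[of _ a] sigma_sets.Basic) auto
  next
    case 2
    have us: "u \<le> s" using 2 s by (simp add: ennreal_le_iff)
    have "a = {\<omega>\<in>space M. (\<forall>u\<in>{}. B1 u \<omega> \<in> (\<lambda>_. A) u) \<and> (\<forall>u\<in>{u}. B2 u \<omega> \<in> (\<lambda>_. A) u)}" unfolding 2 by auto
    then have "a \<in> past_cylinders s" unfolding past_cylinders_def using 2 us
      by (intro CollectI exI[of _ "{}"] exI[of _ "\<lambda>_. A"] exI[of _ "{u}"]) auto
    then show ?thesis by (intro bexI[of _ a] sigma_sets.Basic) auto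
  next
    case 3
    then have "AE \<omega> in N. \<omega> \<in> a \<longleftrightarrow> \<omega> \<in> {}" using AE_not_in[OF 3] by simp
    then show ?thesis by (intro bexI[of _ "{}"] sigma_sets.Empty)
  qed
next
  case Empty
  then show ?case by (intro bexI[of _ "{}"] sigma_sets.Empty) auto
next
  case (Compl a)
  then obtain A' where A': "A' \<in> sigma_sets (space M) (past_cylinders s)" "AE \<omega> in N. \<omega> \<in> a \<longleftrightarrow> \<omega> \<in> A'" by blast
  have "AE \<omega> in N. \<omega> \<in> space M - a \<longleftrightarrow> \<omega> \<in> space M - A'" using A'(2) by eventually_elim auto
  with A'(1) show ?case by (intro bexI[of _ "space M - A'"] sigma_sets.Compl)
next
  case (Union a)
  then have "\<forall>i. \<exists>A'. A' \<in> sigma_sets (space M) (past_cylinders s) \<and> (AE \<omega> in N. \<omega> \<in> a i \<longleftrightarrow> \<omega> \<in> A')" by blast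
  from choice[OF this] obtain A' where A': "\<And>i. A' i \<in> sigma_sets (space M) (past_cylinders s)"
    "\<And>i. AE \<omega> in N. \<omega> \<in> a i \<longleftrightarrow> \<omega> \<in> A' i" by blast
  have "AE \<omega> in N. \<forall>i. \<omega> \<in> a i \<longleftrightarrow> \<omega> \<in> A' i" unfolding AE_all_countable using A'(2) by blast
  then have "AE \<omega> in N. \<omega> \<in> (\<Union>i. a i) \<longleftrightarrow> \<omega> \<in> (\<Union>i. A' i)" by eventually_elim auto
  then show ?case by (intro bexI[of _ "\<Union>i. A' i"] sigma_sets.Union A'(1))
qed

text \<open>Normalised so that the law is \<open>gauss2\<close> for every pair \<open>s < t\<close>;
  the step length then enters only through explicit factors \<open>sqrt d\<close>.\<close>

definition std_increments :: "real \<Rightarrow> real \<Rightarrow> 'a \<Rightarrow> real \<times> real" where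
  "std_increments s t \<omega> = ((B1 t \<omega> - B1 s \<omega>) / sqrt (t - s), (B2 t \<omega> - B2 s \<omega>) / sqrt (t - s))"

lemma std_increments_measurable: "0 \<le> s \<Longrightarrow> s < t \<Longrightarrow> std_increments s t \<in> measurable M (borel \<Otimes>\<^sub>M borel)"
proof -
  assume st: "0 \<le> s" "s < t"
  then have "0 \<le> t" by simp
  note [measurable] = bm_measurable[OF st(1)] bm_measurable[OF this]
  show ?thesis unfolding std_increments_def[abs_def] by measurable
qed

abbreviation "IF s t \<equiv> sigma (space M) (increment_rectangles s t)"

lemma IF_Pow: "increment_rectangles s t \<subseteq> Pow (space M)"
  unfolding increment_rectangles_def by auto

lemmas sets_IF = sets_measure_of[OF IF_Pow]
lemmas space_IF = space_measure_of[OF IF_Pow]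

lemma increments_IF:
  "(\<lambda>\<omega>. B1 t \<omega> - B1 s \<omega>) \<in> borel_measurable (IF s t)" "(\<lambda>\<omega>. B2 t \<omega> - B2 s \<omega>) \<in> borel_measurable (IF s t)"
proof -
  show "(\<lambda>\<omega>. B1 t \<omega> - B1 s \<omega>) \<in> borel_measurable (IF s t)"
  proof (rule measurableI)
    fix C :: "real set" assume "C \<in> sets borel"
    then have "(\<lambda>\<omega>. B1 t \<omega> - B1 s \<omega>) -` C \<inter> space M \<in> increment_rectangles s t"
      unfolding increment_rectangles_def by (intro CollectI exI[of _ C] exI[of _ UNIV]) auto
    then show "(\<lambda>\<omega>. B1 t \<omega> - B1 s \<omega>) -` C \<inter> space (IF s t) \<in> sets (IF s t)"
      unfolding space_IF sets_IF by (rule sigma_sets.Basic)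
  qed simp
  show "(\<lambda>\<omega>. B2 t \<omega> - B2 s \<omega>) \<in> borel_measurable (IF s t)"
  proof (rule measurableI)
    fix C :: "real set" assume "C \<in> sets borel"
    then have "(\<lambda>\<omega>. B2 t \<omega> - B2 s \<omega>) -` C \<inter> space M \<in> increment_rectangles s t"
      unfolding increment_rectangles_def by (intro CollectI exI[of _ UNIV] exI[of _ C]) auto
    then show "(\<lambda>\<omega>. B2 t \<omega> - B2 s \<omega>) -` C \<inter> space (IF s t) \<in> sets (IF s t)"
      unfolding space_IF sets_IF by (rule sigma_sets.Basic)
  qed simp
qed

lemma FF_increment_indep:
  assumes st: "0 \<le> s" "s < t" and a: "a \<in> sets (FF (ennreal s))" and b: "b \<in> sets (IF s t)"
  shows "b \<in> events" "measure N (a \<inter> b) = measure N a * measure N b"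
proof -
  interpret N: prob_space N by (rule prob_space_N)
  have ev: "sigma_sets (space M) (past_cylinders s) \<subseteq> events" "sigma_sets (space M) (increment_rectangles s t) \<subseteq>
    events"
    using cylinders_indep[OF st] by (auto dest: indep_setD_ev1 indep_setD_ev2)
  from FF_approx[OF a st(1)] obtain A' where A': "A' \<in> sigma_sets (space M) (past_cylinders s)" "AE \<omega> in N. \<omega> \<in> a \<longleftrightarrow>
    \<omega> \<in> A'" by blast
  have aN: "a \<in> sets N" and AM: "A' \<in> events" and bM: "b \<in> events" using a sets_FF A' b ev by (auto simp: sets_IF)
  show "b \<in> events" by fact
  have 1: "measure N a = prob A'"
    using A'(2) aN AM by (subst measure_completion[OF AM, symmetric]) (rule measure_eq_AE, auto)
  have "AE \<omega> in N. \<omega> \<in> a \<inter> b \<longleftrightarrow> \<omega> \<in> A' \<inter> b" using A'(2) by eventually_elim auto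
  then have "measure N (a \<inter> b) = measure N (A' \<inter> b)"
    using aN AM bM by (intro measure_eq_AE) auto
  also have "\<dots> = prob (A' \<inter> b)" using AM bM by (intro measure_completion) auto
  also have "\<dots> = prob A' * prob b" using indep_setD[OF cylinders_indep[OF st] A'(1) b[unfolded sets_IF]] .
  finally show "measure N (a \<inter> b) = measure N a * measure N b" using 1 bM by simp
qed

lemma increment_indep_var:
  assumes st: "0 \<le> s" "s < t" and Y: "Y \<in> measurable (FF (ennreal s)) S" and V: "V \<in> measurable (IF s t) S'"
  shows "prob_space.indep_var N S Y S' V"
proof -
  interpret N: prob_space N by (rule prob_space_N)
  have IM: "sets (IF s t) \<subseteq> events" using FF_increment_indep(1)[OF st sets.empty_sets] by auto
  have "N.indep_set (sets (FF (ennreal s))) (sets (IF s t))"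
    using FF_increment_indep(2)[OF st] sets_FF IM by (intro N.indep_setI) auto
  have YN: "Y \<in> measurable N S"
    by (rule measurable_mono[THEN subsetD, OF order.refl refl sets_FF _ Y]) (simp add: space_FF)
  have VN: "V \<in> measurable N S'"
    by (rule measurable_mono[THEN subsetD, OF order.refl refl _ _ V]) (use IM in \<open>auto simp: space_IF\<close>)
  have "N.indep_set (sigma_sets (space N) {Y -` A \<inter> space N | A. A \<in> sets S}) (sigma_sets (space N) {V -` A \<inter> space N
    | A. A \<in> sets S'})"
  proof (rule N.indep_setI)
    have 1: "sigma_sets (space N) {Y -` A \<inter> space N | A. A \<in> sets S} \<subseteq> sets (FF (ennreal s))"
      using sets.sigma_sets_subset[of "{Y -` A \<inter> space N | A. A \<in> sets S}" "FF (ennreal s)"] measurable_sets[OF Y]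
      by (auto simp: space_FF)
    have 2: "sigma_sets (space N) {V -` A \<inter> space N | A. A \<in> sets S'} \<subseteq> sets (IF s t)"
      using sets.sigma_sets_subset[of "{V -` A \<inter> space N | A. A \<in> sets S'}" "IF s t"] measurable_sets[OF V]
      by (auto simp: space_IF)
    show "sigma_sets (space N) {Y -` A \<inter> space N | A. A \<in> sets S} \<subseteq> sets N" using 1 sets_FF by blast
    show "sigma_sets (space N) {V -` A \<inter> space N | A. A \<in> sets S'} \<subseteq> sets N" using 2 IM by auto
    show "measure N (a \<inter> b) = measure N a * measure N b"
      if "a \<in> sigma_sets (space N) {Y -` A \<inter> space N | A. A \<in> sets S}" "b \<in> sigma_sets (space N) {V -` A \<inter> space N |
        A. A \<in> sets S'}" for a b
      using that 1 2 by (intro FF_increment_indep[OF st]) auto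
  qed
  then show ?thesis using YN VN unfolding N.indep_var_eq by simp
qed

lemma increments_indep:
  assumes st: "0 \<le> s" "s < t"
  shows "indep_var borel (\<lambda>\<omega>. B1 t \<omega> - B1 s \<omega>) borel (\<lambda>\<omega>. B2 t \<omega> - B2 s \<omega>)"
proof -
  have f: "(\<lambda>x. x t - x s) \<in> borel_measurable (PiM {0..} (\<lambda>_. borel :: real measure))"
    using st by (intro borel_measurable_diff measurable_component_singleton) auto
  from indep_var_compose[OF indep_B[unfolded independent_processes_def] f f] show ?thesis
    using st by (simp add: comp_def)
qed

lemma increment_std:
  assumes st: "0 \<le> s" "s < t"
  shows "distributed M lborel (\<lambda>\<omega>. (B1 t \<omega> - B1 s \<omega>) / sqrt (t - s)) std_normal_density"
    "distributed M lborel (\<lambda>\<omega>. (B2 t \<omega> - B2 s \<omega>) / sqrt (t - s)) std_normal_density"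
proof -
  have s: "0 < sqrt (t - s)" using st by simp
  have "distributed M lborel (\<lambda>\<omega>. B1 t \<omega> - B1 s \<omega>) (normal_density 0 (sqrt (t - s)))"
    "distributed M lborel (\<lambda>\<omega>. B2 t \<omega> - B2 s \<omega>) (normal_density 0 (sqrt (t - s)))"
    using bm1 bm2 st by (auto simp: brownian_motion_def)
  then show "distributed M lborel (\<lambda>\<omega>. (B1 t \<omega> - B1 s \<omega>) / sqrt (t - s)) std_normal_density"
    "distributed M lborel (\<lambda>\<omega>. (B2 t \<omega> - B2 s \<omega>) / sqrt (t - s)) std_normal_density"
    using normal_standard_normal_convert[OF s, of _ 0] by auto
qed

lemma std_increments_law:
  assumes st: "0 \<le> s" "s < t"
  shows "distr N (borel \<Otimes>\<^sub>M borel) (std_increments s t) = gauss2"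
proof -
  let ?X = "\<lambda>\<omega>. (B1 t \<omega> - B1 s \<omega>) / sqrt (t - s)" and ?Y = "\<lambda>\<omega>. (B2 t \<omega> - B2 s \<omega>) / sqrt (t - s)"
  have d: "(\<lambda>x. x / sqrt (t - s)) \<in> borel_measurable borel" by measurable
  have i: "indep_var borel ?X borel ?Y"
    using indep_var_compose[OF increments_indep[OF st] d d] by (simp add: comp_def)
  have b: "distr M borel X = density lborel std_normal_density" if "distributed M lborel X std_normal_density" for X
    using distributed_distr_eq_density[OF that] by (subst distr_cong[of M M lborel borel X X, symmetric]) auto
  have "distr N (borel \<Otimes>\<^sub>M borel) (std_increments s t) = distr M (borel \<Otimes>\<^sub>M borel) (std_increments s t)"
    by (rule distr_completion[OF std_increments_measurable[OF st]])
  also have "\<dots> = distr M borel ?X \<Otimes>\<^sub>M distr M borel ?Y"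
    using i unfolding indep_var_distribution_eq std_increments_def[abs_def] by simp
  also have "\<dots> = gauss2"
    unfolding gauss2_def b[OF increment_std(1)[OF st]] b[OF increment_std(2)[OF st]] ..
  finally show ?thesis .
qed

text \<open>The freezing lemma, a substitute for conditional expectation: the increment after
  \<open>s\<close> is integrated out while the past is held fixed, because past and increment have a
  product law. The result is again known at time \<open>s\<close>, as the Markov property
  requires.\<close>

lemma nn_integral_increment:
  assumes st: "0 \<le> s" "s < t" and G: "G \<in> borel_measurable (FF (ennreal s) \<Otimes>\<^sub>M (borel \<Otimes>\<^sub>M borel))"
  shows "(\<integral>\<^sup>+\<omega>. G (\<omega>, std_increments s t \<omega>) \<partial>N) = (\<integral>\<^sup>+\<omega>. \<integral>\<^sup>+y. G (\<omega>, y) \<partial>gauss2 \<partial>N)"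
    "(\<lambda>\<omega>. \<integral>\<^sup>+y. G (\<omega>, y) \<partial>gauss2) \<in> borel_measurable (FF (ennreal s))"
proof -
  interpret N: prob_space N by (rule prob_space_N)
  let ?F = "FF (ennreal s)"
  \<comment> \<open>The identity, viewed as a random variable with values in the coarser space
    \<open>?F\<close>, stands for the entire past up to time \<open>s\<close>.\<close>
  have id: "(\<lambda>\<omega>. \<omega>) \<in> measurable N ?F"
  proof (rule measurableI)
    fix A assume A: "A \<in> sets ?F"
    then have "A \<subseteq> space M" using sets.sets_into_space[OF A] by (simp add: space_FF)
    then show "(\<lambda>\<omega>. \<omega>) -` A \<inter> space N \<in> sets N" using A sets_FF by (auto simp: Int_absorb2)
  qed (simp add: space_FF)
  have xI: "std_increments s t \<in> measurable (IF s t) (borel \<Otimes>\<^sub>M borel)"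
  proof -
    note [measurable] = increments_IF
    show ?thesis unfolding std_increments_def[abs_def] by measurable
  qed
  have x: "std_increments s t \<in> measurable N (borel \<Otimes>\<^sub>M borel)"
    by (rule measurable_completion[OF std_increments_measurable[OF st]])
  interpret g: prob_space gauss2
    unfolding std_increments_law[OF st, symmetric] by (rule N.prob_space_distr[OF x])
  have sg: "sets gauss2 = sets (borel \<Otimes>\<^sub>M borel)"
    unfolding gauss2_def by (intro sets_pair_measure_cong) auto
  have G': "G \<in> borel_measurable (?F \<Otimes>\<^sub>M gauss2)" and G'': "G \<in> borel_measurable (distr N ?F (\<lambda>\<omega>. \<omega>) \<Otimes>\<^sub>M gauss2)"
    using G by (auto simp: sg cong: measurable_cong_sets sets_pair_measure_cong)
  interpret d: prob_space "distr N ?F (\<lambda>\<omega>. \<omega>)" by (rule N.prob_space_distr[OF id])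
  have eq: "distr N ?F (\<lambda>\<omega>. \<omega>) \<Otimes>\<^sub>M gauss2 = distr N (?F \<Otimes>\<^sub>M (borel \<Otimes>\<^sub>M borel)) (\<lambda>\<omega>. (\<omega>, std_increments s t \<omega>))"
  proof (rule pair_measure_eqI)
    show "sigma_finite_measure (distr N ?F (\<lambda>\<omega>. \<omega>))" "sigma_finite_measure gauss2" by unfold_locales
    show "sets (distr N ?F (\<lambda>\<omega>. \<omega>) \<Otimes>\<^sub>M gauss2) = sets (distr N (?F \<Otimes>\<^sub>M (borel \<Otimes>\<^sub>M borel)) (\<lambda>\<omega>. (\<omega>, std_increments s t
      \<omega>)))"
      by (simp add: sg cong: sets_pair_measure_cong)
    fix A B assume "A \<in> sets (distr N ?F (\<lambda>\<omega>. \<omega>))" "B \<in> sets gauss2"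
    then have A: "A \<in> sets ?F" and B: "B \<in> sets (borel \<Otimes>\<^sub>M borel)" by (auto simp: sg)
    have AN: "A \<in> sets N" "A \<subseteq> space M" using A sets_FF sets.sets_into_space[OF A] by (auto simp: space_FF)
    have BI: "std_increments s t -` B \<inter> space M \<in> sets (IF s t)" using measurable_sets[OF xI B]
      by (simp add: space_IF)
    have "emeasure (distr N ?F (\<lambda>\<omega>. \<omega>)) A = emeasure N A"
      using emeasure_distr[OF id A] AN by (simp add: Int_absorb2)
    moreover have "emeasure gauss2 B = emeasure N (std_increments s t -` B \<inter> space M)"
      unfolding std_increments_law[OF st, symmetric] using emeasure_distr[OF x B] by simp
    moreover have "emeasure (distr N (?F \<Otimes>\<^sub>M (borel \<Otimes>\<^sub>M borel)) (\<lambda>\<omega>. (\<omega>, std_increments s t \<omega>))) (A \<times> B) =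
      emeasure N (A \<inter> (std_increments s t -` B \<inter> space M))"
    proof -
      have "(\<lambda>\<omega>. (\<omega>, std_increments s t \<omega>)) \<in> measurable N (?F \<Otimes>\<^sub>M (borel \<Otimes>\<^sub>M borel))" using id x by simp
      moreover have "A \<times> B \<in> sets (?F \<Otimes>\<^sub>M (borel \<Otimes>\<^sub>M borel))" using A B by simp
      moreover have "(\<lambda>\<omega>. (\<omega>, std_increments s t \<omega>)) -` (A \<times> B) \<inter> space N = A \<inter> (std_increments s t -` B \<inter> space M)"
        using AN by auto
      ultimately show ?thesis by (simp add: emeasure_distr del: emeasure_completion)
    qed
    moreover have "emeasure N (A \<inter> (std_increments s t -` B \<inter> space M)) = emeasure N A * emeasure N (std_increments s
      t -` B \<inter> space M)"
      unfolding N.emeasure_eq_measure FF_increment_indep(2)[OF st A BI] by (simp add: ennreal_mult')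
    ultimately show "emeasure (distr N ?F (\<lambda>\<omega>. \<omega>)) A * emeasure gauss2 B =
      emeasure (distr N (?F \<Otimes>\<^sub>M (borel \<Otimes>\<^sub>M borel)) (\<lambda>\<omega>. (\<omega>, std_increments s t \<omega>))) (A \<times> B)"
      by simp
  qed
  show m: "(\<lambda>\<omega>. \<integral>\<^sup>+y. G (\<omega>, y) \<partial>gauss2) \<in> borel_measurable ?F"
    using g.borel_measurable_nn_integral_fst[OF G'] .
  have "(\<integral>\<^sup>+\<omega>. G (\<omega>, std_increments s t \<omega>) \<partial>N) = integral\<^sup>N (distr N (?F \<Otimes>\<^sub>M (borel \<Otimes>\<^sub>M borel)) (\<lambda>\<omega>. (\<omega>,
    std_increments s t \<omega>))) G"
    using id x G by (subst nn_integral_distr) auto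
  also have "\<dots> = (\<integral>\<^sup>+\<omega>. \<integral>\<^sup>+y. G (\<omega>, y) \<partial>gauss2 \<partial>distr N ?F (\<lambda>\<omega>. \<omega>))"
    unfolding eq[symmetric] by (rule g.nn_integral_fst[OF G'', symmetric])
  also have "\<dots> = (\<integral>\<^sup>+\<omega>. \<integral>\<^sup>+y. G (\<omega>, y) \<partial>gauss2 \<partial>N)"
    using id m by (subst nn_integral_distr) auto
  finally show "(\<integral>\<^sup>+\<omega>. G (\<omega>, std_increments s t \<omega>) \<partial>N) = (\<integral>\<^sup>+\<omega>. \<integral>\<^sup>+y. G (\<omega>, y) \<partial>gauss2 \<partial>N)" .
qed

text \<open>One statement for the three driving motions: that of \<open>S\<close> has coefficients 1
  and 0, those of \<open>K\<close> and \<open>Z\<close> are other unit vectors.\<close>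

lemma filtered_bm_combination:
  assumes ab: "\<alpha>\<^sup>2 + \<beta>\<^sup>2 = 1"
  shows "filtered_bm N FF (\<lambda>t \<omega>. \<alpha> * B1 t \<omega> + \<beta> * B2 t \<omega>)"
proof -
  interpret N: prob_space N by (rule prob_space_N)
  let ?W = "\<lambda>t \<omega>. \<alpha> * B1 t \<omega> + \<beta> * B2 t \<omega>"
  show ?thesis
  proof
    show "space (FF t) = space N" for t by (simp add: space_FF)
    show "sets (FF t) \<subseteq> sets N" for t by (rule sets_FF)
    show "sets (FF i) \<subseteq> sets (FF j)" if "i \<le> j" for i j using that by (rule FF_mono)
    show "?W s \<in> borel_measurable (FF (ennreal s))" if "0 \<le> s" for s
    proof -
      note [measurable] = B_adapted[OF that order.refl]
      show ?thesis by measurable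
    qed
    show "N.indep_var borel Y borel (\<lambda>\<omega>. ?W t \<omega> - ?W s \<omega>)"
      if st: "0 \<le> s" "s < t" and Y: "Y \<in> borel_measurable (FF (ennreal s))" for s t and Y :: "'a \<Rightarrow> real"
    proof -
      have "(\<lambda>\<omega>. ?W t \<omega> - ?W s \<omega>) = (\<lambda>\<omega>. \<alpha> * (B1 t \<omega> - B1 s \<omega>) + \<beta> * (B2 t \<omega> - B2 s \<omega>))"
        by (auto simp: algebra_simps)
      moreover have "(\<lambda>\<omega>. \<alpha> * (B1 t \<omega> - B1 s \<omega>) + \<beta> * (B2 t \<omega> - B2 s \<omega>)) \<in> borel_measurable (IF s t)"
        by (intro borel_measurable_add borel_measurable_times borel_measurable_const increments_IF)
      ultimately show ?thesis using increment_indep_var[OF st Y] by simp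
    qed
    show "distributed N lborel (\<lambda>\<omega>. ?W t \<omega> - ?W s \<omega>) (normal_density 0 (sqrt (t - s)))" if st: "0 \<le> s" "s < t" for s t
    proof -
      define \<sigma> where "\<sigma> = sqrt (t - s)"
      have \<sigma>: "0 < \<sigma>" using st by (simp add: \<sigma>_def)
      let ?X = "\<lambda>\<omega>. B1 t \<omega> - B1 s \<omega>" and ?Y = "\<lambda>\<omega>. B2 t \<omega> - B2 s \<omega>"
      have n: "distributed M lborel ?X (normal_density 0 \<sigma>)" "distributed M lborel ?Y (normal_density 0 \<sigma>)"
        using bm1 bm2 st by (auto simp: brownian_motion_def \<sigma>_def)
      have eq: "(\<lambda>\<omega>. ?W t \<omega> - ?W s \<omega>) = (\<lambda>\<omega>. \<alpha> * ?X \<omega> + \<beta> * ?Y \<omega>)" by (auto simp: algebra_simps)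
      have "distributed M lborel (\<lambda>\<omega>. \<alpha> * ?X \<omega> + \<beta> * ?Y \<omega>) (normal_density 0 \<sigma>)"
      proof (cases "\<alpha> = 0 \<or> \<beta> = 0")
        \<comment> \<open>A multiple with coefficient 0 has no density, so this case stays outside
          the addition theorem for normal laws; the other coefficient then has modulus 1.\<close>
        case True
        then consider "\<alpha> = 0" "\<bar>\<beta>\<bar> = 1" | "\<beta> = 0" "\<bar>\<alpha>\<bar> = 1" using ab by (auto simp: abs_square_eq_1)
        then show ?thesis
        proof cases
          case 1
          then have "\<beta> \<noteq> 0" by auto
          from normal_density_affine[OF n(2) \<sigma> this, of 0] 1 show ?thesis by simp
        next
          case 2
          then have "\<alpha> \<noteq> 0" by auto
          from normal_density_affine[OF n(1) \<sigma> this, of 0] 2 show ?thesis by simp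
        qed
      next
        case False
        have m: "(\<lambda>x. \<alpha> * x) \<in> borel_measurable borel" "(\<lambda>x. \<beta> * x) \<in> borel_measurable borel" by measurable
        have i: "indep_var borel (\<lambda>\<omega>. \<alpha> * ?X \<omega>) borel (\<lambda>\<omega>. \<beta> * ?Y \<omega>)"
          using indep_var_compose[OF increments_indep[OF st] m] by (simp add: comp_def)
        have a: "distributed M lborel (\<lambda>\<omega>. \<alpha> * ?X \<omega>) (normal_density 0 (\<bar>\<alpha>\<bar> * \<sigma>))"
          "distributed M lborel (\<lambda>\<omega>. \<beta> * ?Y \<omega>) (normal_density 0 (\<bar>\<beta>\<bar> * \<sigma>))"
          using normal_density_affine[OF n(1) \<sigma>, of \<alpha> 0] normal_density_affine[OF n(2) \<sigma>, of \<beta> 0] False by auto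
        have "(\<bar>\<alpha>\<bar> * \<sigma>)\<^sup>2 + (\<bar>\<beta>\<bar> * \<sigma>)\<^sup>2 = (\<alpha>\<^sup>2 + \<beta>\<^sup>2) * \<sigma>\<^sup>2" by (simp add: power_mult_distrib algebra_simps)
        then have "sqrt ((\<bar>\<alpha>\<bar> * \<sigma>)\<^sup>2 + (\<bar>\<beta>\<bar> * \<sigma>)\<^sup>2) = \<sigma>" using ab \<sigma> by simp
        with add_indep_normal[OF i _ _ a] False \<sigma> show ?thesis by simp
      qed
      then show ?thesis
        unfolding eq \<sigma>_def[symmetric] distributed_def
        using distr_completion[of "\<lambda>\<omega>. \<alpha> * ?X \<omega> + \<beta> * ?Y \<omega>" M lborel] by (auto simp: measurable_completion)
    qed
    have "AE \<omega> in N. continuous_on {0..} (\<lambda>t. B1 t \<omega>)" "AE \<omega> in N. continuous_on {0..} (\<lambda>t. B2 t \<omega>)"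
      "AE \<omega> in N. B1 0 \<omega> = 0" "AE \<omega> in N. B2 0 \<omega> = 0"
      using bm1 bm2 by (auto simp: brownian_motion_def intro: AE_completion)
    then have "AE \<omega> in N. continuous_on {0..} (\<lambda>t. ?W t \<omega>) \<and> ?W 0 \<omega> = 0"
      by eventually_elim (auto intro!: continuous_intros)
    then show "AE \<omega> in N. continuous_on {0..} (\<lambda>t. ?W t \<omega>)" "AE \<omega> in N. ?W 0 \<omega> = 0" by auto
  qed
qed

end

section \<open>Gaussian shift\<close>

lemma sets_gauss2 [measurable_cong]: "sets gauss2 = sets (borel \<Otimes>\<^sub>M borel)"
  unfolding gauss2_def by (intro sets_pair_measure_cong) auto

lemma prob_space_gauss2: "prob_space gauss2"
proof -
  interpret n: prob_space "density lborel std_normal_density"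
    using prob_space_normal_density[of 1 0] by simp
  interpret pair_prob_space "density lborel std_normal_density" "density lborel std_normal_density" ..
  show ?thesis unfolding gauss2_def by unfold_locales
qed

lemma std_normal_shift:
  fixes f :: "real \<Rightarrow> ennreal"
  assumes [measurable]: "f \<in> borel_measurable borel"
  shows "(\<integral>\<^sup>+x. ennreal (exp (a * x - a\<^sup>2 / 2)) * f x \<partial>density lborel std_normal_density) =
    (\<integral>\<^sup>+x. f (x + a) \<partial>density lborel std_normal_density)"
proof -
  have eq: "std_normal_density x * exp (a * x - a\<^sup>2 / 2) = std_normal_density (x - a)" for x
  proof -
    have "- x\<^sup>2 / 2 + (a * x - a\<^sup>2 / 2) = - (x - a)\<^sup>2 / 2" by (simp add: power2_diff field_simps)
    then have "exp (- x\<^sup>2 / 2) * exp (a * x - a\<^sup>2 / 2) = exp (- (x - a)\<^sup>2 / 2)" unfolding exp_add[symmetric] by simp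
    then show ?thesis unfolding std_normal_density_def by simp
  qed
  have "(\<integral>\<^sup>+x. ennreal (exp (a * x - a\<^sup>2 / 2)) * f x \<partial>density lborel std_normal_density) =
     (\<integral>\<^sup>+x. ennreal (std_normal_density (x - a)) * f x \<partial>lborel)"
    unfolding eq[symmetric] by (subst nn_integral_density) (auto simp: ennreal_mult' mult.assoc)
  also have "\<dots> = (\<integral>\<^sup>+x. ennreal (std_normal_density x) * f (x + a) \<partial>lborel)"
    by (subst nn_integral_real_affine[where c=1 and t=a]) (auto simp: add.commute)
  also have "\<dots> = (\<integral>\<^sup>+x. f (x + a) \<partial>density lborel std_normal_density)"
    by (subst nn_integral_density) auto
  finally show ?thesis .
qed

text \<open>The change of measure confined to a single time step. Only the first coordinate is
  tilted, since \<open>S\<close> is driven by \<open>B1\<close> alone.\<close>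

lemma gauss2_shift:
  fixes f :: "real \<times> real \<Rightarrow> ennreal"
  assumes [measurable]: "f \<in> borel_measurable (borel \<Otimes>\<^sub>M borel)"
  shows "(\<integral>\<^sup>+y. ennreal (exp (a * fst y - a\<^sup>2 / 2)) * f y \<partial>gauss2) = (\<integral>\<^sup>+y. f (fst y + a, snd y) \<partial>gauss2)"
proof -
  let ?n = "density lborel std_normal_density"
  interpret n: prob_space ?n using prob_space_normal_density[of 1 0] by simp
  interpret pair_sigma_finite ?n ?n ..
  have "(\<integral>\<^sup>+y. ennreal (exp (a * fst y - a\<^sup>2 / 2)) * f y \<partial>gauss2) =
     (\<integral>\<^sup>+y2. \<integral>\<^sup>+y1. ennreal (exp (a * y1 - a\<^sup>2 / 2)) * f (y1, y2) \<partial>?n \<partial>?n)"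
    unfolding gauss2_def by (subst nn_integral_snd[symmetric]) (auto simp: split_beta')
  also have "\<dots> = (\<integral>\<^sup>+y2. \<integral>\<^sup>+y1. f (y1 + a, y2) \<partial>?n \<partial>?n)"
    by (intro nn_integral_cong std_normal_shift) measurable
  also have "\<dots> = (\<integral>\<^sup>+y. f (fst y + a, snd y) \<partial>gauss2)"
    unfolding gauss2_def by (subst nn_integral_snd[symmetric]) (auto simp: split_beta')
  finally show ?thesis .
qed

section \<open>Transition kernels\<close>

locale exchange_model = bm_pair M B1 B2 for M :: "'a measure" and B1 B2 +
  fixes \<mu>\<^sub>1 \<mu>\<^sub>2 \<sigma>\<^sub>1 \<sigma>\<^sub>2 \<nu> r :: real
  assumes nu: "\<nu>\<^sup>2 \<le> 1"
begin

text \<open>\<open>b1\<close> and \<open>b2\<close> are the coefficients of \<open>B1\<close> and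
  \<open>B2\<close> in log (K / S), and \<open>drift\<close> is the drift of log Z.\<close>

definition "b1 = \<sigma>\<^sub>2 * \<nu> - \<sigma>\<^sub>1"
definition "b2 = \<sigma>\<^sub>2 * sqrt (1 - \<nu>\<^sup>2)"
definition "drift = \<mu>\<^sub>2 - \<mu>\<^sub>1 - (b1\<^sup>2 + b2\<^sup>2) / 2"

definition Sx :: "real \<Rightarrow> real \<Rightarrow> 'a \<Rightarrow> real" where
  "Sx s t \<omega> = s * exp ((\<mu>\<^sub>1 - \<sigma>\<^sub>1\<^sup>2 / 2) * t + \<sigma>\<^sub>1 * B1 t \<omega>)"
definition Kx :: "real \<Rightarrow> real \<Rightarrow> 'a \<Rightarrow> real" where
  "Kx k t \<omega> = k * exp ((\<mu>\<^sub>2 - \<sigma>\<^sub>2\<^sup>2 / 2) * t + \<sigma>\<^sub>2 * (\<nu> * B1 t \<omega> + sqrt (1 - \<nu>\<^sup>2) * B2 t \<omega>))"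
definition Zx :: "real \<Rightarrow> real \<Rightarrow> 'a \<Rightarrow> real" where
  "Zx z t \<omega> = z * exp (drift * t + (b1 * B1 t \<omega> + b2 * B2 t \<omega>))"

definition kernel :: "real \<Rightarrow> (real \<Rightarrow> ennreal) \<Rightarrow> real \<Rightarrow> ennreal" where
  "kernel d f z = (\<integral>\<^sup>+y. f (z * exp (drift * d + sqrt d * (b1 * fst y + b2 * snd y))) \<partial>gauss2)"

lemma b_square_sum: "b1\<^sup>2 + b2\<^sup>2 = \<sigma>\<^sub>2\<^sup>2 - 2 * \<sigma>\<^sub>1 * \<sigma>\<^sub>2 * \<nu> + \<sigma>\<^sub>1\<^sup>2"
  using nu unfolding b1_def b2_def by (simp add: power_mult_distrib power2_diff algebra_simps)

lemma adapted:
  assumes "0 \<le> t"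
  shows "Sx s t \<in> borel_measurable (FF (ennreal t))" "Kx k t \<in> borel_measurable (FF (ennreal t))"
    "Zx z t \<in> borel_measurable (FF (ennreal t))"
proof -
  note [measurable] = B_adapted[OF assms order.refl]
  show "Sx s t \<in> borel_measurable (FF (ennreal t))" "Kx k t \<in> borel_measurable (FF (ennreal t))"
    "Zx z t \<in> borel_measurable (FF (ennreal t))"
    unfolding Sx_def[abs_def] Kx_def[abs_def] Zx_def[abs_def] by measurable
qed

lemma positive: "0 < s \<Longrightarrow> 0 < Sx s t \<omega>" "0 < k \<Longrightarrow> 0 < Kx k t \<omega>" "0 < z \<Longrightarrow> 0 < Zx z t \<omega>"
  by (auto simp: Sx_def Kx_def Zx_def)

lemma sqrt_std_increments:
  assumes "0 < d"
  shows "sqrt d * fst (std_increments t (t + d) \<omega>) = B1 (t + d) \<omega> - B1 t \<omega>" "sqrt d * snd (std_increments t (t + d) \<omega>)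
    = B2 (t + d) \<omega> - B2 t \<omega>"
  using assms by (auto simp: std_increments_def)

lemma Zx_step:
  assumes "0 < d"
  shows "Zx z (t + d) \<omega> = Zx z t \<omega> * exp (drift * d + sqrt d * (b1 * fst (std_increments t (t + d) \<omega>) + b2 *
    snd (std_increments t (t + d) \<omega>)))"
proof -
  have "sqrt d * (b1 * fst (std_increments t (t + d) \<omega>) + b2 * snd (std_increments t (t + d) \<omega>)) =
      b1 * (sqrt d * fst (std_increments t (t + d) \<omega>)) + b2 * (sqrt d * snd (std_increments t (t + d) \<omega>))"
    by (simp add: algebra_simps)
  also have "\<dots> = b1 * (B1 (t + d) \<omega> - B1 t \<omega>) + b2 * (B2 (t + d) \<omega> - B2 t \<omega>)"
    unfolding sqrt_std_increments[OF assms] ..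
  finally show ?thesis
    unfolding Zx_def mult.assoc exp_add[symmetric] by (simp add: algebra_simps)
qed

lemma Sx_step:
  assumes "0 < d"
  shows "Sx s (t + d) \<omega> = Sx s t \<omega> * exp ((\<mu>\<^sub>1 - \<sigma>\<^sub>1\<^sup>2 / 2) * d + \<sigma>\<^sub>1 * (sqrt d * fst (std_increments t (t + d) \<omega>)))"
  unfolding sqrt_std_increments[OF assms] Sx_def mult.assoc exp_add[symmetric] by (simp add: algebra_simps)

text \<open>\<open>K / S\<close> and \<open>Z\<close> are driven by the same noise. Their
  logarithmic drifts differ by \<open>\<sigma>\<^sub>1 * b1\<close>, the rate of covariation of log
  S and log (K / S); the weight \<open>S\<close> removes precisely this difference in
  \<open>markov_SK\<close>.\<close>

lemma ratio_eq:
  assumes "0 < s"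
  shows "Kx k t \<omega> / Sx s t \<omega> = (k / s) * exp ((drift - \<sigma>\<^sub>1 * b1) * t + (b1 * B1 t \<omega> + b2 * B2 t \<omega>))"
proof -
  have e: "drift - \<sigma>\<^sub>1 * b1 = (\<mu>\<^sub>2 - \<sigma>\<^sub>2\<^sup>2 / 2) - (\<mu>\<^sub>1 - \<sigma>\<^sub>1\<^sup>2 / 2)"
    unfolding drift_def b_square_sum by (simp add: b1_def field_simps power2_eq_square)
  have "(drift - \<sigma>\<^sub>1 * b1) * t + (b1 * B1 t \<omega> + b2 * B2 t \<omega>) =
    ((\<mu>\<^sub>2 - \<sigma>\<^sub>2\<^sup>2 / 2) * t + \<sigma>\<^sub>2 * (\<nu> * B1 t \<omega> + sqrt (1 - \<nu>\<^sup>2) * B2 t \<omega>)) - ((\<mu>\<^sub>1 - \<sigma>\<^sub>1\<^sup>2 / 2) * t + \<sigma>\<^sub>1 * B1 t \<omega>)"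
    unfolding e by (simp add: b1_def b2_def algebra_simps)
  then show ?thesis unfolding Kx_def Sx_def by (simp add: exp_diff)
qed

lemma ratio_step:
  assumes "0 < d" "0 < s"
  shows "Kx k (t + d) \<omega> / Sx s (t + d) \<omega> = Kx k t \<omega> / Sx s t \<omega> *
    exp ((drift - \<sigma>\<^sub>1 * b1) * d + sqrt d * (b1 * fst (std_increments t (t + d) \<omega>) + b2 * snd (std_increments t (t +
      d) \<omega>)))"
proof -
  have "sqrt d * (b1 * fst (std_increments t (t + d) \<omega>) + b2 * snd (std_increments t (t + d) \<omega>)) =
      b1 * (sqrt d * fst (std_increments t (t + d) \<omega>)) + b2 * (sqrt d * snd (std_increments t (t + d) \<omega>))"
    by (simp add: algebra_simps)
  also have "\<dots> = b1 * (B1 (t + d) \<omega> - B1 t \<omega>) + b2 * (B2 (t + d) \<omega> - B2 t \<omega>)"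
    unfolding sqrt_std_increments[OF assms(1)] ..
  finally show ?thesis
    unfolding ratio_eq[OF assms(2)] mult.assoc exp_add[symmetric] by (simp add: algebra_simps)
qed

lemma kernel_measurable:
  assumes [measurable]: "f \<in> borel_measurable borel"
  shows "kernel d f \<in> borel_measurable borel"
proof -
  interpret g: prob_space gauss2 by (rule prob_space_gauss2)
  show ?thesis unfolding kernel_def[abs_def] by measurable
qed

lemma kernel_zero: "kernel 0 f z = f z"
  using prob_space.emeasure_space_1[OF prob_space_gauss2] by (simp add: kernel_def)

lemma markov_Z:
  assumes t: "0 \<le> t" "0 < d" and A: "A \<in> sets (FF (ennreal t))" and f [measurable]: "f \<in> borel_measurable borel"
  shows "(\<integral>\<^sup>+\<omega>. indicator A \<omega> * f (Zx z (t + d) \<omega>) \<partial>N) = (\<integral>\<^sup>+\<omega>. indicator A \<omega> * kernel d f (Zx z t \<omega>) \<partial>N)"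
proof -
  interpret g: prob_space gauss2 by (rule prob_space_gauss2)
  note [measurable] = A adapted(3)[OF t(1)]
  let ?G = "\<lambda>(\<omega>, y). indicator A \<omega> * f (Zx z t \<omega> * exp (drift * d + sqrt d * (b1 * fst y + b2 * snd y)))"
  have G: "?G \<in> borel_measurable (FF (ennreal t) \<Otimes>\<^sub>M (borel \<Otimes>\<^sub>M borel))" by measurable
  have "(\<integral>\<^sup>+\<omega>. indicator A \<omega> * f (Zx z (t + d) \<omega>) \<partial>N) = (\<integral>\<^sup>+\<omega>. ?G (\<omega>, std_increments t (t + d) \<omega>) \<partial>N)"
    using t by (simp add: Zx_step)
  also have "\<dots> = (\<integral>\<^sup>+\<omega>. \<integral>\<^sup>+y. ?G (\<omega>, y) \<partial>gauss2 \<partial>N)"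
    using t by (intro nn_integral_increment(1) G) auto
  also have "\<dots> = (\<integral>\<^sup>+\<omega>. indicator A \<omega> * kernel d f (Zx z t \<omega>) \<partial>N)"
    unfolding kernel_def by (intro nn_integral_cong) (simp add: nn_integral_cmult)
  finally show ?thesis .
qed

text \<open>Over one step \<open>S\<close> is multiplied by \<open>exp (\<mu>\<^sub>1 * d)\<close>
  times an exponential of mean 1 in the first normal coordinate. \<open>gauss2_shift\<close> trades
  the latter for a shift of that coordinate by \<open>\<sigma>\<^sub>1 * sqrt d\<close>. The shift
  adds \<open>\<sigma>\<^sub>1 * b1 * d\<close> to the exponent of \<open>K / S\<close> and so turns
  its drift into that of \<open>Z\<close>.\<close>

lemma markov_SK:
  assumes t: "0 \<le> t" "0 < d" and s: "0 < s" and A: "A \<in> sets (FF (ennreal t))" and f [measurable]: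
    "f \<in> borel_measurable borel"
  shows "(\<integral>\<^sup>+\<omega>. indicator A \<omega> * (ennreal (Sx s (t + d) \<omega>) * f (Kx k (t + d) \<omega> / Sx s (t + d) \<omega>)) \<partial>N) =
     (\<integral>\<^sup>+\<omega>. indicator A \<omega> * (ennreal (Sx s t \<omega>) * (ennreal (exp (\<mu>\<^sub>1 * d)) * kernel d f (Kx k t \<omega> / Sx s t \<omega>))) \<partial>N)"
proof -
  interpret g: prob_space gauss2 by (rule prob_space_gauss2)
  note [measurable] = A adapted[OF t(1)]
  let ?a = "\<sigma>\<^sub>1 * sqrt d"
  let ?h = "\<lambda>x y. f (x * exp ((drift - \<sigma>\<^sub>1 * b1) * d + sqrt d * (b1 * fst y + b2 * snd y)))"
  let ?G = "\<lambda>(\<omega>, y). indicator A \<omega> * (ennreal (Sx s t \<omega> * exp ((\<mu>\<^sub>1 - \<sigma>\<^sub>1\<^sup>2 / 2) * d + \<sigma>\<^sub>1 * (sqrt d * fst y))) *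
    ?h (Kx k t \<omega> / Sx s t \<omega>) y)"
  have G: "?G \<in> borel_measurable (FF (ennreal t) \<Otimes>\<^sub>M (borel \<Otimes>\<^sub>M borel))" by measurable
  have "(\<integral>\<^sup>+\<omega>. indicator A \<omega> * (ennreal (Sx s (t + d) \<omega>) * f (Kx k (t + d) \<omega> / Sx s (t + d) \<omega>)) \<partial>N) =
    (\<integral>\<^sup>+\<omega>. ?G (\<omega>, std_increments t (t + d) \<omega>) \<partial>N)"
    by (simp only: ratio_step[OF t(2) s] prod.case) (simp only: Sx_step[OF t(2)])
  also have "\<dots> = (\<integral>\<^sup>+\<omega>. \<integral>\<^sup>+y. ?G (\<omega>, y) \<partial>gauss2 \<partial>N)"
    using t by (intro nn_integral_increment(1) G) auto
  also have "\<dots> = (\<integral>\<^sup>+\<omega>. indicator A \<omega> * (ennreal (Sx s t \<omega>) * (ennreal (exp (\<mu>\<^sub>1 * d)) * kernel d f (Kx k t \<omega> / Sx s t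
    \<omega>))) \<partial>N)"
  proof (intro nn_integral_cong)
    fix \<omega>
    let ?x = "Kx k t \<omega> / Sx s t \<omega>"
    have e: "ennreal (Sx s t \<omega> * exp ((\<mu>\<^sub>1 - \<sigma>\<^sub>1\<^sup>2 / 2) * d + \<sigma>\<^sub>1 * (sqrt d * fst y))) =
       ennreal (Sx s t \<omega>) * (ennreal (exp (\<mu>\<^sub>1 * d)) * ennreal (exp (?a * fst y - ?a\<^sup>2 / 2)))" for y :: "real \<times> real"
    proof -
      have "(\<mu>\<^sub>1 - \<sigma>\<^sub>1\<^sup>2 / 2) * d + \<sigma>\<^sub>1 * (sqrt d * fst y) = \<mu>\<^sub>1 * d + (?a * fst y - ?a\<^sup>2 / 2)"
        using t(2) by (simp add: power_mult_distrib algebra_simps)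
      then show ?thesis
        using positive(1)[OF s, of t \<omega>] by (simp only: exp_add) (simp add: ennreal_mult')
    qed
    have "(\<integral>\<^sup>+y. ?G (\<omega>, y) \<partial>gauss2) = (\<integral>\<^sup>+y. indicator A \<omega> * (ennreal (Sx s t \<omega>) * (ennreal (exp (\<mu>\<^sub>1 * d)) *
      (ennreal (exp (?a * fst y - ?a\<^sup>2 / 2)) * ?h ?x y))) \<partial>gauss2)"
      by (simp only: prod.case e mult.assoc)
    also have "\<dots> = indicator A \<omega> * (ennreal (Sx s t \<omega>) * (ennreal (exp (\<mu>\<^sub>1 * d)) * (\<integral>\<^sup>+y. ennreal (exp (?a * fst y -
      ?a\<^sup>2 / 2)) * ?h ?x y \<partial>gauss2)))"
      by (simp add: nn_integral_cmult)
    also have "(\<integral>\<^sup>+y. ennreal (exp (?a * fst y - ?a\<^sup>2 / 2)) * ?h ?x y \<partial>gauss2) = (\<integral>\<^sup>+y. ?h ?x (fst y + ?a, snd y)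
      \<partial>gauss2)"
      by (rule gauss2_shift) measurable
    also have "\<dots> = kernel d f ?x"
    proof -
      have "(drift - \<sigma>\<^sub>1 * b1) * d + sqrt d * (b1 * (y1 + ?a) + b2 * y2) = drift * d + sqrt d * (b1 * y1 + b2 *
        y2)" for y1 y2
      proof -
        have "sqrt d * (b1 * ?a) = \<sigma>\<^sub>1 * b1 * (sqrt d * sqrt d)" by (simp only: mult_ac)
        also have "\<dots> = \<sigma>\<^sub>1 * b1 * d" using t(2) by simp
        finally show ?thesis by (simp add: algebra_simps)
      qed
      then show ?thesis unfolding kernel_def by simp
    qed
    finally show "(\<integral>\<^sup>+y. ?G (\<omega>, y) \<partial>gauss2) = indicator A \<omega> * (ennreal (Sx s t \<omega>) * (ennreal (exp (\<mu>\<^sub>1 * d)) *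
      kernel d f ?x))" .
  qed
  finally show ?thesis .
qed

end

section \<open>Optimal stopping by backward recursion\<close>

primrec bellman :: "((real \<Rightarrow> ennreal) \<Rightarrow> real \<Rightarrow> ennreal) \<Rightarrow> (real \<Rightarrow> ennreal) \<Rightarrow> nat \<Rightarrow> real \<Rightarrow> ennreal" where
  "bellman q h 0 = h"
| "bellman q h (Suc n) = (\<lambda>z. max (h z) (q (bellman q h n) z))"

text \<open>A common frame for both problems, with weight \<open>L\<close>, state \<open>X\<close>
  and weighted one-step kernel \<open>Q\<close>. The Markov property is integrated over events of
  the past, which avoids conditional expectations. Lower semicontinuity is asked only along times
  \<open>u n >= t\<close>, since stopping times will be rounded up.\<close>

locale weighted_markov = bm_pair M B1 B2 for M :: "'a measure" and B1 B2 +
  fixes L X :: "real \<Rightarrow> 'a \<Rightarrow> real" and Q :: "real \<Rightarrow> (real \<Rightarrow> ennreal) \<Rightarrow> real \<Rightarrow> ennreal"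
    and H :: "real \<Rightarrow> ennreal" and l0 x0 :: real
  assumes L_adapted: "0 \<le> t \<Longrightarrow> L t \<in> borel_measurable (FF (ennreal t))"
    and X_adapted: "0 \<le> t \<Longrightarrow> X t \<in> borel_measurable (FF (ennreal t))"
    and Q_measurable: "f \<in> borel_measurable borel \<Longrightarrow> Q d f \<in> borel_measurable borel"
    and markov: "0 \<le> t \<Longrightarrow> 0 < d \<Longrightarrow> A \<in> sets (FF (ennreal t)) \<Longrightarrow> f \<in> borel_measurable borel \<Longrightarrow>
      (\<integral>\<^sup>+\<omega>. indicator A \<omega> * (ennreal (L (t + d) \<omega>) * f (X (t + d) \<omega>)) \<partial>N) =
      (\<integral>\<^sup>+\<omega>. indicator A \<omega> * (ennreal (L t \<omega>) * Q d f (X t \<omega>)) \<partial>N)"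
    and H_measurable: "H \<in> borel_measurable borel"
    and init: "AE \<omega> in N. L 0 \<omega> = l0 \<and> X 0 \<omega> = x0"
    and lsc: "AE \<omega> in N. \<forall>t u. 0 \<le> t \<longrightarrow> (\<forall>n. t \<le> u n) \<longrightarrow> u \<longlonglongrightarrow> t \<longrightarrow>
      ennreal (L t \<omega>) * H (X t \<omega>) \<le> liminf (\<lambda>n. ennreal (L (u n) \<omega>) * H (X (u n) \<omega>))"
begin

abbreviation "G t \<omega> \<equiv> ennreal (L t \<omega>) * H (X t \<omega>)"

lemma bellman_measurable: "bellman (Q d) H n \<in> borel_measurable borel"
proof (induction n)
  case (Suc n)
  note [measurable] = H_measurable Q_measurable[OF Suc]
  show ?case unfolding bellman.simps by measurable
qed (simp add: H_measurable)

lemma payoff_measurable: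
  assumes "0 \<le> t" and [measurable]: "f \<in> borel_measurable borel"
  shows "(\<lambda>\<omega>. ennreal (L t \<omega>) * f (X t \<omega>)) \<in> borel_measurable (FF (ennreal t))"
    "(\<lambda>\<omega>. ennreal (L t \<omega>) * f (X t \<omega>)) \<in> borel_measurable N"
proof -
  note [measurable] = L_adapted[OF assms(1)] X_adapted[OF assms(1)]
  show *: "(\<lambda>\<omega>. ennreal (L t \<omega>) * f (X t \<omega>)) \<in> borel_measurable (FF (ennreal t))" by measurable
  show "(\<lambda>\<omega>. ennreal (L t \<omega>) * f (X t \<omega>)) \<in> borel_measurable N"
    by (rule measurable_mono[THEN subsetD, OF order.refl refl sets_FF _ *]) (simp add: space_FF)
qed

lemma sets_FF_mono_real: "s \<le> t \<Longrightarrow> A \<in> sets (FF (ennreal s)) \<Longrightarrow> A \<in> sets (FF (ennreal t))"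
  using FF_mono[of "ennreal s" "ennreal t"] ennreal_leI[of s t] by auto

text \<open>A grid-valued stopping rule is encoded by disjoint events \<open>T i\<close> of stopping
  after \<open>i\<close> more steps; where none occurs the payoff is 0. Backward induction works on
  the event \<open>A\<close> of not having stopped before step \<open>k\<close>: what
  \<open>T 0\<close> leaves over is the corresponding event for step \<open>k + 1\<close>.\<close>

lemma grid_upper:
  assumes d: "0 < d" and A: "A \<in> sets (FF (ennreal (real k * d)))"
    and T: "\<And>i. i \<le> n \<Longrightarrow> T i \<in> sets (FF (ennreal (real (k + i) * d)))" "\<And>i. i \<le> n \<Longrightarrow> T i \<subseteq> A"
      "disjoint_family_on T {..n}"
  shows "(\<Sum>i\<le>n. \<integral>\<^sup>+\<omega>. indicator (T i) \<omega> * G (real (k + i) * d) \<omega> \<partial>N) \<le>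
    (\<integral>\<^sup>+\<omega>. indicator A \<omega> * (ennreal (L (real k * d) \<omega>) * bellman (Q d) H n (X (real k * d) \<omega>)) \<partial>N)"
  using A T
proof (induction n arbitrary: k A T)
  case 0
  have "T 0 \<subseteq> A" using 0(3)[of 0] by simp
  then have "(\<integral>\<^sup>+\<omega>. indicator (T 0) \<omega> * G (real k * d) \<omega> \<partial>N) \<le> (\<integral>\<^sup>+\<omega>. indicator A \<omega> * G (real k * d) \<omega> \<partial>N)"
    by (intro nn_integral_mono mult_right_mono) (auto simp: indicator_def)
  then show ?case by simp
next
  case (Suc n)
  define A' where "A' = A - T 0"
  have T0: "T 0 \<in> sets (FF (ennreal (real k * d)))" "T 0 \<subseteq> A" using Suc.prems(2)[of 0] Suc.prems(3)[of 0] by auto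
  have A'k: "A' \<in> sets (FF (ennreal (real k * d)))" unfolding A'_def using Suc.prems(1) T0 by auto
  have kd: "0 \<le> real k * d" using d by simp
  have Sk: "real (Suc k) * d = real k * d + d" by (simp add: algebra_simps)
  have A': "A' \<in> sets (FF (ennreal (real (Suc k) * d)))" by (rule sets_FF_mono_real[OF _ A'k]) (use d in \<open>simp add:
    Sk\<close>)
  have "(\<Sum>i\<le>n. \<integral>\<^sup>+\<omega>. indicator (T (Suc i)) \<omega> * G (real (Suc k + i) * d) \<omega> \<partial>N) \<le>
    (\<integral>\<^sup>+\<omega>. indicator A' \<omega> * (ennreal (L (real (Suc k) * d) \<omega>) * bellman (Q d) H n (X (real (Suc k) * d) \<omega>)) \<partial>N)"
  proof (rule Suc.IH[OF A'])
    show "T (Suc i) \<in> sets (FF (ennreal (real (Suc k + i) * d)))" if "i \<le> n" for i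
      using Suc.prems(2)[of "Suc i"] that by simp
    show "T (Suc i) \<subseteq> A'" if "i \<le> n" for i
    proof -
      have "T 0 \<inter> T (Suc i) = {}" using Suc.prems(4) that unfolding disjoint_family_on_def by auto
      then show ?thesis using Suc.prems(3)[of "Suc i"] that unfolding A'_def by auto
    qed
    show "disjoint_family_on (\<lambda>i. T (Suc i)) {..n}" using Suc.prems(4) unfolding disjoint_family_on_def by auto
  qed
  also have "\<dots> = (\<integral>\<^sup>+\<omega>. indicator A' \<omega> * (ennreal (L (real k * d) \<omega>) * Q d (bellman (Q d) H n) (X (real k * d) \<omega>))
    \<partial>N)"
    unfolding Sk by (rule markov[OF kd d A'k bellman_measurable])
  finally have IH: "(\<Sum>i\<le>n. \<integral>\<^sup>+\<omega>. indicator (T (Suc i)) \<omega> * G (real (k + Suc i) * d) \<omega> \<partial>N) \<le>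
     (\<integral>\<^sup>+\<omega>. indicator A' \<omega> * (ennreal (L (real k * d) \<omega>) * Q d (bellman (Q d) H n) (X (real k * d) \<omega>)) \<partial>N)" by simp
  have [measurable]: "T 0 \<in> sets N" "A' \<in> sets N" using T0(1) A'k sets_FF by auto
  note [measurable] = payoff_measurable(2)[OF kd H_measurable] payoff_measurable(2)[OF kd Q_measurable[OF
    bellman_measurable]]
  have "(\<Sum>i\<le>Suc n. \<integral>\<^sup>+\<omega>. indicator (T i) \<omega> * G (real (k + i) * d) \<omega> \<partial>N) =
    (\<integral>\<^sup>+\<omega>. indicator (T 0) \<omega> * G (real k * d) \<omega> \<partial>N) + (\<Sum>i\<le>n. \<integral>\<^sup>+\<omega>. indicator (T (Suc i)) \<omega> * G (real (k + Suc i) *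
      d) \<omega> \<partial>N)"
    by (subst sum.atMost_Suc_shift) simp
  also have "\<dots> \<le> (\<integral>\<^sup>+\<omega>. indicator (T 0) \<omega> * G (real k * d) \<omega> \<partial>N) +
     (\<integral>\<^sup>+\<omega>. indicator A' \<omega> * (ennreal (L (real k * d) \<omega>) * Q d (bellman (Q d) H n) (X (real k * d) \<omega>)) \<partial>N)"
    by (rule add_left_mono[OF IH])
  also have "\<dots> = (\<integral>\<^sup>+\<omega>. indicator (T 0) \<omega> * G (real k * d) \<omega> +
      indicator A' \<omega> * (ennreal (L (real k * d) \<omega>) * Q d (bellman (Q d) H n) (X (real k * d) \<omega>)) \<partial>N)"
    by (rule nn_integral_add[symmetric]) measurable
  also have "\<dots> \<le> (\<integral>\<^sup>+\<omega>. indicator A \<omega> * (ennreal (L (real k * d) \<omega>) * bellman (Q d) H (Suc n) (X (real k * d) \<omega>)) \<partial>N)"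
    using T0(2) by (intro nn_integral_mono) (auto simp: indicator_def A'_def intro!: mult_left_mono)
  finally show ?case .
qed

text \<open>The rule stops on \<open>D\<close>, where the immediate reward is at least the
  continuation value, and at the horizon in any case. With this choice every inequality of
  \<open>grid_upper\<close> becomes an equality.\<close>

lemma grid_attained:
  assumes d: "0 < d" and A: "A \<in> sets (FF (ennreal (real k * d)))"
  shows "\<exists>T. (\<forall>i\<le>n. T i \<in> sets (FF (ennreal (real (k + i) * d))) \<and> T i \<subseteq> A) \<and> disjoint_family_on T {..n} \<and>
    (\<Sum>i\<le>n. \<integral>\<^sup>+\<omega>. indicator (T i) \<omega> * G (real (k + i) * d) \<omega> \<partial>N) =
    (\<integral>\<^sup>+\<omega>. indicator A \<omega> * (ennreal (L (real k * d) \<omega>) * bellman (Q d) H n (X (real k * d) \<omega>)) \<partial>N)"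
  using A
proof (induction n arbitrary: k A)
  case 0
  then show ?case by (intro exI[of _ "\<lambda>_. A"]) (simp add: disjoint_family_on_def)
next
  case (Suc n)
  have kd: "0 \<le> real k * d" using d by simp
  have Sk: "real (Suc k) * d = real k * d + d" by (simp add: algebra_simps)
  define D where "D = {\<omega>\<in>space (FF (ennreal (real k * d))). Q d (bellman (Q d) H n) (X (real k * d) \<omega>) \<le>
    H (X (real k * d) \<omega>)}"
  have D: "D \<in> sets (FF (ennreal (real k * d)))"
  proof -
    note [measurable] = X_adapted[OF kd] H_measurable Q_measurable[OF bellman_measurable]
    show ?thesis unfolding D_def by measurable
  qed
  define T0 where "T0 = A \<inter> D"
  define A' where "A' = A - D"
  have T0: "T0 \<in> sets (FF (ennreal (real k * d)))" unfolding T0_def using D Suc.prems by auto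
  have A'k: "A' \<in> sets (FF (ennreal (real k * d)))" unfolding A'_def using D Suc.prems by auto
  have A': "A' \<in> sets (FF (ennreal (real (Suc k) * d)))" by (rule sets_FF_mono_real[OF _ A'k]) (use d in \<open>simp add:
    Sk\<close>)
  from Suc.IH[OF A'] obtain T where T: "\<And>i. i \<le> n \<Longrightarrow> T i \<in> sets (FF (ennreal (real (Suc k + i) * d)))" "\<And>i. i \<le> n \<Longrightarrow>
    T i \<subseteq> A'"
    "disjoint_family_on T {..n}" and eq: "(\<Sum>i\<le>n. \<integral>\<^sup>+\<omega>. indicator (T i) \<omega> * G (real (Suc k + i) * d) \<omega> \<partial>N) =
    (\<integral>\<^sup>+\<omega>. indicator A' \<omega> * (ennreal (L (real (Suc k) * d) \<omega>) * bellman (Q d) H n (X (real (Suc k) * d) \<omega>)) \<partial>N)" by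
      blast
  define T' where "T' i = (case i of 0 \<Rightarrow> T0 | Suc j \<Rightarrow> T j)" for i
  have T'_simps: "T' 0 = T0" "T' (Suc i) = T i" for i by (auto simp: T'_def)
  have eq2: "(\<Sum>i\<le>n. \<integral>\<^sup>+\<omega>. indicator (T i) \<omega> * G (real (Suc k + i) * d) \<omega> \<partial>N) =
     (\<integral>\<^sup>+\<omega>. indicator A' \<omega> * (ennreal (L (real k * d) \<omega>) * Q d (bellman (Q d) H n) (X (real k * d) \<omega>)) \<partial>N)"
    unfolding eq unfolding Sk by (rule markov[OF kd d A'k bellman_measurable])
  have [measurable]: "T0 \<in> sets N" "A' \<in> sets N" using T0 A'k sets_FF by auto
  note [measurable] = payoff_measurable(2)[OF kd H_measurable] payoff_measurable(2)[OF kd Q_measurable[OF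
    bellman_measurable]]
  show ?case
  proof (intro exI[of _ T'] conjI allI impI)
    fix i assume i: "i \<le> Suc n"
    show "T' i \<in> sets (FF (ennreal (real (k + i) * d)))"
      using T0 T(1)[of "i - 1"] i by (cases i) (auto simp: T'_simps)
    show "T' i \<subseteq> A"
      using T(2)[of "i - 1"] i by (cases i) (auto simp: T'_simps T0_def A'_def)
  next
    show "disjoint_family_on T' {..Suc n}"
      unfolding disjoint_family_on_def
    proof (intro ballI impI)
      fix i j assume ij: "i \<in> {..Suc n}" "j \<in> {..Suc n}" "i \<noteq> j"
      show "T' i \<inter> T' j = {}"
        using ij T(2) T(3) unfolding disjoint_family_on_def
        by (cases i; cases j) (fastforce simp: T'_simps T0_def A'_def)+
    qed
    have "(\<Sum>i\<le>Suc n. \<integral>\<^sup>+\<omega>. indicator (T' i) \<omega> * G (real (k + i) * d) \<omega> \<partial>N) =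
      (\<integral>\<^sup>+\<omega>. indicator T0 \<omega> * G (real k * d) \<omega> \<partial>N) + (\<Sum>i\<le>n. \<integral>\<^sup>+\<omega>. indicator (T i) \<omega> * G (real (Suc k + i) * d) \<omega> \<partial>N)"
      by (subst sum.atMost_Suc_shift) (simp add: T'_simps)
    also have "\<dots> = (\<integral>\<^sup>+\<omega>. indicator T0 \<omega> * G (real k * d) \<omega> +
      indicator A' \<omega> * (ennreal (L (real k * d) \<omega>) * Q d (bellman (Q d) H n) (X (real k * d) \<omega>)) \<partial>N)"
      unfolding eq2 by (rule nn_integral_add[symmetric]) measurable
    also have "\<dots> = (\<integral>\<^sup>+\<omega>. indicator A \<omega> * (ennreal (L (real k * d) \<omega>) * bellman (Q d) H (Suc n) (X (real k * d) \<omega>))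
      \<partial>N)"
      by (intro nn_integral_cong) (auto simp: indicator_def T0_def A'_def D_def space_FF max_def)
    finally show "(\<Sum>i\<le>Suc n. \<integral>\<^sup>+\<omega>. indicator (T' i) \<omega> * G (real (k + i) * d) \<omega> \<partial>N) =
      (\<integral>\<^sup>+\<omega>. indicator A \<omega> * (ennreal (L (real k * d) \<omega>) * bellman (Q d) H (Suc n) (X (real k * d) \<omega>)) \<partial>N)" .
  qed
qed

definition payoff :: "('a \<Rightarrow> ennreal) \<Rightarrow> 'a \<Rightarrow> ennreal" where
  "payoff \<tau> \<omega> = (if \<tau> \<omega> = \<infinity> then 0 else G (enn2real (\<tau> \<omega>)) \<omega>)"

text \<open>The indicator of the whole space and the time \<open>real 0 * d\<close> are the shape in
  which \<open>grid_upper\<close> and \<open>grid_attained\<close> end for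
  \<open>k = 0\<close>.\<close>

lemma initial_value:
  assumes [measurable]: "f \<in> borel_measurable borel"
  shows "(\<integral>\<^sup>+\<omega>. indicator (space M) \<omega> * (ennreal (L (real 0 * d) \<omega>) * f (X (real 0 * d) \<omega>)) \<partial>N) = ennreal l0 * f x0"
proof -
  interpret N: prob_space N by (rule prob_space_N)
  have "AE \<omega> in N. indicator (space M) \<omega> * (ennreal (L (real 0 * d) \<omega>) * f (X (real 0 * d) \<omega>)) = ennreal l0 * f x0"
    using init AE_space[of N] by eventually_elim simp
  then have "(\<integral>\<^sup>+\<omega>. indicator (space M) \<omega> * (ennreal (L (real 0 * d) \<omega>) * f (X (real 0 * d) \<omega>)) \<partial>N) =
    (\<integral>\<^sup>+\<omega>. ennreal l0 * f x0 \<partial>N)"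
    by (rule nn_integral_cong_AE)
  also have "\<dots> = ennreal l0 * f x0" using N.emeasure_space_1 by simp
  finally show ?thesis .
qed

text \<open>With mesh \<open>1 / 2 ^ m\<close> and \<open>m * 2 ^ m\<close> steps the horizon is
  \<open>m\<close>, so refinement and extension of the horizon share one index. Rounding up to the
  grid and Fatou's lemma bound every stopping time by the grid values; conversely the optimal grid
  rules are themselves stopping times.\<close>

theorem optimal_stopping_value:
  "(SUP \<tau>\<in>{\<tau>. stopping_time FF \<tau>}. \<integral>\<^sup>+\<omega>. payoff \<tau> \<omega> \<partial>N) =
   (SUP m. ennreal l0 * bellman (Q (1 / 2 ^ m)) H (m * 2 ^ m) x0)" (is "?J = (SUP m. ?V m)")
proof (rule antisym)
  show "?J \<le> (SUP m. ?V m)"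
  proof (rule SUP_least)
    fix \<tau> assume "\<tau> \<in> {\<tau>. stopping_time FF \<tau>}"
    then have \<tau>: "stopping_time FF \<tau>" by simp
    \<comment> \<open>The event that \<open>\<tau>\<close> has occurred by the \<open>j\<close>-th
      grid point. After disjointing, \<open>T m j\<close> says that this is the first grid point not
      before \<open>\<tau>\<close>, and it is known at that time.\<close>
    define c where "c m j = {\<omega>\<in>space M. \<tau> \<omega> \<le> ennreal (real j * (1 / 2 ^ m))}" for m j :: nat
    have c: "c m j \<in> sets (FF (ennreal (real j * (1 / 2 ^ m))))" for m j
      using stopping_timeD[OF \<tau>, of "ennreal (real j * (1 / 2 ^ m))"] by (simp add: pred_def space_FF c_def)
    define T where "T m = disjointed (c m)" for m
    have T: "T m j \<in> sets (FF (ennreal (real j * (1 / 2 ^ m))))" for m j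
      unfolding T_def disjointed_def using c[of m j]
      by (intro sets.Diff sets.finite_UN) (auto intro!: sets_FF_mono_real[OF _ c] divide_right_mono)
    have Tsp: "T m j \<subseteq> space M" for m j unfolding T_def disjointed_def c_def by auto
    define P where "P m \<omega> = (\<Sum>j\<le>m * 2 ^ m. indicator (T m j) \<omega> * G (real j * (1 / 2 ^ m)) \<omega>)" for m \<omega>
    have PG: "(\<lambda>\<omega>. indicator (T m j) \<omega> * G (real j * (1 / 2 ^ m)) \<omega>) \<in> borel_measurable N" for m j
    proof -
      have "T m j \<in> sets N" using T sets_FF by auto
      then show ?thesis by (intro borel_measurable_times_ennreal borel_measurable_indicator payoff_measurable(2)
        H_measurable) simp_all
    qed
    have PM: "P m \<in> borel_measurable N" for m
      unfolding P_def by (intro borel_measurable_sum PG)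
    have PV: "(\<integral>\<^sup>+\<omega>. P m \<omega> \<partial>N) \<le> ?V m" for m
    proof -
      have "(\<integral>\<^sup>+\<omega>. P m \<omega> \<partial>N) = (\<Sum>j\<le>m * 2 ^ m. \<integral>\<^sup>+\<omega>. indicator (T m j) \<omega> * G (real (0 + j) * (1 / 2 ^ m)) \<omega> \<partial>N)"
        unfolding P_def using PG by (subst nn_integral_sum) auto
      also have "\<dots> \<le> (\<integral>\<^sup>+\<omega>. indicator (space M) \<omega> * (ennreal (L (real 0 * (1 / 2 ^ m)) \<omega>) * bellman (Q (1 / 2 ^ m)) H
        (m * 2 ^ m) (X (real 0 * (1 / 2 ^ m)) \<omega>)) \<partial>N)"
      proof (rule grid_upper)
        show "disjoint_family_on (T m) {..m * 2 ^ m}"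
          using disjoint_family_disjointed[of "c m"] unfolding T_def disjoint_family_on_def by auto
      qed (use T Tsp in \<open>auto intro: space_in_FF\<close>)
      also have "\<dots> = ?V m" by (rule initial_value[OF bellman_measurable])
      finally show ?thesis .
    qed
    have "AE \<omega> in N. payoff \<tau> \<omega> \<le> liminf (\<lambda>m. P m \<omega>)"
      using lsc AE_space[of N]
    proof eventually_elim
      fix \<omega> assume l: "\<forall>t u. 0 \<le> t \<longrightarrow> (\<forall>n. t \<le> u n) \<longrightarrow> u \<longlonglongrightarrow> t \<longrightarrow> G t \<omega> \<le> liminf (\<lambda>n. G (u n) \<omega>)"
        and "\<omega> \<in> space N"
      then have \<omega>: "\<omega> \<in> space M" by simp
      show "payoff \<tau> \<omega> \<le> liminf (\<lambda>m. P m \<omega>)"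
      proof (cases "\<tau> \<omega>")
        case (real t)
        \<comment> \<open>The index of \<open>\<tau>\<close> rounded up, so that \<open>u m\<close>
          approaches \<open>t\<close> from above, as \<open>lsc\<close> demands.\<close>
        define j where "j m = nat \<lceil>t * 2 ^ m\<rceil>" for m :: nat
        define u where "u m = real (j m) * (1 / 2 ^ m)" for m
        have jr: "real (j m) = of_int \<lceil>t * 2 ^ m\<rceil>" for m using real by (simp add: j_def)
        have tu: "t \<le> u m" "u m \<le> t + 1 / 2 ^ m" for m
        proof -
          have "t * 2 ^ m \<le> real (j m)" unfolding jr by (rule le_of_int_ceiling)
          then show "t \<le> u m" by (simp add: u_def field_simps)
          have "real (j m) \<le> t * 2 ^ m + 1" unfolding jr by (rule of_int_ceiling_le_add_one)
          then show "u m \<le> t + 1 / 2 ^ m" by (simp add: u_def field_simps)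
        qed
        have "(\<lambda>m. t + (1 / 2) ^ m) \<longlonglongrightarrow> t + 0"
          by (intro tendsto_add tendsto_const LIMSEQ_realpow_zero) auto
        then have lim: "(\<lambda>m. t + 1 / 2 ^ m) \<longlonglongrightarrow> t" by (simp add: power_one_over)
        have ut: "u \<longlonglongrightarrow> t"
          by (rule tendsto_sandwich[OF _ _ tendsto_const lim]) (use tu in auto)
        have mem: "\<omega> \<in> T m (j m)" for m
        proof -
          have iff: "\<omega> \<in> c m i \<longleftrightarrow> j m \<le> i" for i
          proof -
            have "\<omega> \<in> c m i \<longleftrightarrow> t \<le> real i * (1 / 2 ^ m)"
              unfolding c_def using \<omega> real by (simp add: ennreal_le_iff)
            also have "\<dots> \<longleftrightarrow> t * 2 ^ m \<le> of_int (int i)" by (simp add: field_simps)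
            also have "\<dots> \<longleftrightarrow> \<lceil>t * 2 ^ m\<rceil> \<le> int i" by (rule ceiling_le_iff[symmetric])
            also have "\<dots> \<longleftrightarrow> j m \<le> i" unfolding j_def by (rule nat_le_iff[symmetric])
            finally show ?thesis .
          qed
          show ?thesis unfolding T_def disjointed_def using iff by auto
        qed
        \<comment> \<open>Once \<open>m\<close> exceeds \<open>t\<close>, the rounded time lies
          within the horizon and its summand is present in \<open>P m\<close>.\<close>
        have "eventually (\<lambda>m. G (u m) \<omega> \<le> P m \<omega>) sequentially"
          using eventually_ge_at_top[of "nat \<lceil>t\<rceil>"]
        proof eventually_elim
          fix m assume m: "nat \<lceil>t\<rceil> \<le> m"
          have "t \<le> real m" using m by linarith
          then have "t * 2 ^ m \<le> of_int (int (m * 2 ^ m))" by simp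
          then have "\<lceil>t * 2 ^ m\<rceil> \<le> int (m * 2 ^ m)" unfolding ceiling_le_iff .
          then have jm: "j m \<le> m * 2 ^ m" unfolding j_def nat_le_iff .
          have "G (u m) \<omega> = (\<Sum>i\<in>{j m}. indicator (T m i) \<omega> * G (real i * (1 / 2 ^ m)) \<omega>)"
            using mem by (simp add: u_def)
          also have "\<dots> \<le> P m \<omega>" unfolding P_def using jm by (intro sum_mono2) auto
          finally show "G (u m) \<omega> \<le> P m \<omega>" .
        qed
        then have "liminf (\<lambda>m. G (u m) \<omega>) \<le> liminf (\<lambda>m. P m \<omega>)" by (rule Liminf_mono)
        moreover have "G t \<omega> \<le> liminf (\<lambda>m. G (u m) \<omega>)" using l real ut tu by blast
        ultimately show ?thesis using real by (simp add: payoff_def)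
      qed (simp add: payoff_def)
    qed
    then have "(\<integral>\<^sup>+\<omega>. payoff \<tau> \<omega> \<partial>N) \<le> (\<integral>\<^sup>+\<omega>. liminf (\<lambda>m. P m \<omega>) \<partial>N)" by (rule nn_integral_mono_AE)
    also have "\<dots> \<le> liminf (\<lambda>m. \<integral>\<^sup>+\<omega>. P m \<omega> \<partial>N)" by (rule nn_integral_liminf[OF PM])
    also have "\<dots> \<le> liminf (\<lambda>m::nat. SUP m. ?V m)"
    proof (intro Liminf_mono always_eventually allI)
      fix m
      have "?V m \<le> (SUP m. ?V m)" by (rule SUP_upper) simp
      with PV[of m] show "(\<integral>\<^sup>+\<omega>. P m \<omega> \<partial>N) \<le> (SUP m. ?V m)" by (rule order_trans)
    qed
    also have "\<dots> = (SUP m. ?V m)" by (rule Liminf_const) simp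
    finally show "(\<integral>\<^sup>+\<omega>. payoff \<tau> \<omega> \<partial>N) \<le> (SUP m. ?V m)" .
  qed
  show "(SUP m. ?V m) \<le> ?J"
  proof (rule SUP_least)
    fix m :: nat
    define d where "d = (1 / 2 ^ m :: real)"
    define n where "n = m * 2 ^ m"
    have d: "0 < d" by (simp add: d_def)
    from grid_attained[OF d space_in_FF, where k = 0 and n = n, unfolded add_0] obtain T where
      T: "\<And>i. i \<le> n \<Longrightarrow> T i \<in> sets (FF (ennreal (real i * d)))" "\<And>i. i \<le> n \<Longrightarrow> T i \<subseteq> space M" "disjoint_family_on T {..n}"
        and
      eq: "(\<Sum>i\<le>n. \<integral>\<^sup>+\<omega>. indicator (T i) \<omega> * G (real i * d) \<omega> \<partial>N) =
        (\<integral>\<^sup>+\<omega>. indicator (space M) \<omega> * (ennreal (L (real 0 * d) \<omega>) * bellman (Q d) H n (X (real 0 * d) \<omega>)) \<partial>N)"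
      by blast
    \<comment> \<open>\<open>LEAST\<close> picks from a single candidate, as the \<open>T i\<close>
      are disjoint. The value infinity off their union gives payoff 0, in agreement with the sum in
      \<open>pay\<close>.\<close>
    define \<tau> where "\<tau> \<omega> = (if \<exists>i\<le>n. \<omega> \<in> T i then ennreal (real (LEAST i. i \<le> n \<and> \<omega> \<in> T i) * d) else \<infinity>)" for \<omega>
    have uniq: "i = j" if "\<omega> \<in> T i" "\<omega> \<in> T j" "i \<le> n" "j \<le> n" for \<omega> i j
      using T(3) that unfolding disjoint_family_on_def by blast
    have \<tau>_in: "\<tau> \<omega> = ennreal (real i * d)" if i: "i \<le> n" "\<omega> \<in> T i" for \<omega> i
    proof -
      have "(LEAST i. i \<le> n \<and> \<omega> \<in> T i) = i" using i uniq by (intro Least_equality) auto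
      then show ?thesis unfolding \<tau>_def using i by auto
    qed
    have \<tau>_out: "\<tau> \<omega> = \<infinity>" if "\<not> (\<exists>i\<le>n. \<omega> \<in> T i)" for \<omega> using that by (simp add: \<tau>_def)
    have st: "stopping_time FF \<tau>"
      unfolding stopping_time_def pred_def space_FF
    proof
      fix t :: ennreal
      show "{\<omega> \<in> space M. \<tau> \<omega> \<le> t} \<in> sets (FF t)"
      proof (cases "t = \<infinity>")
        case True
        then show ?thesis using space_in_FF by simp
      next
        case False
        have "{\<omega> \<in> space M. \<tau> \<omega> \<le> t} = (\<Union>i\<in>{i. i \<le> n \<and> ennreal (real i * d) \<le> t}. T i)"
        proof (intro set_eqI iffI)
          fix \<omega> assume \<omega>: "\<omega> \<in> {\<omega> \<in> space M. \<tau> \<omega> \<le> t}"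
          then have "\<tau> \<omega> \<noteq> \<infinity>" using False by (auto simp: top_unique)
          then obtain i where "i \<le> n" "\<omega> \<in> T i" using \<tau>_out by blast
          with \<omega> \<tau>_in show "\<omega> \<in> (\<Union>i\<in>{i. i \<le> n \<and> ennreal (real i * d) \<le> t}. T i)" by auto
        qed (use T(2) \<tau>_in in fastforce)
        moreover have "\<dots> \<in> sets (FF t)"
        proof (intro sets.finite_UN)
          fix i assume "i \<in> {i. i \<le> n \<and> ennreal (real i * d) \<le> t}"
          then show "T i \<in> sets (FF t)" using T(1)[of i] FF_mono[of "ennreal (real i * d)" t] by auto
        qed simp
        ultimately show ?thesis by simp
      qed
    qed
    have pay: "payoff \<tau> \<omega> = (\<Sum>i\<le>n. indicator (T i) \<omega> * G (real i * d) \<omega>)" for \<omega>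
    proof (cases "\<exists>i\<le>n. \<omega> \<in> T i")
      case True
      then obtain i where i: "i \<le> n" "\<omega> \<in> T i" by auto
      have "(\<Sum>i\<le>n. indicator (T i) \<omega> * G (real i * d) \<omega>) = (\<Sum>i\<in>{i}. indicator (T i) \<omega> * G (real i * d) \<omega>)"
        using i uniq by (intro sum.mono_neutral_right) (auto simp: indicator_def)
      then show ?thesis using i d \<tau>_in[OF i] by (simp add: payoff_def)
    next
      case False
      then have "(\<Sum>i\<le>n. indicator (T i) \<omega> * G (real i * d) \<omega>) = 0" by (intro sum.neutral) auto
      then show ?thesis using \<tau>_out[OF False] by (simp add: payoff_def)
    qed
    have "?V m = (\<Sum>i\<le>n. \<integral>\<^sup>+\<omega>. indicator (T i) \<omega> * G (real i * d) \<omega> \<partial>N)"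
      unfolding eq d_def[symmetric] n_def[symmetric] by (rule initial_value[OF bellman_measurable, symmetric])
    also have "\<dots> = (\<integral>\<^sup>+\<omega>. payoff \<tau> \<omega> \<partial>N)"
      unfolding pay
    proof (rule nn_integral_sum[symmetric])
      fix i assume "i \<in> {..n}"
      then have [measurable]: "T i \<in> sets N" using T(1) sets_FF by auto
      have "0 \<le> real i * d" using d by simp
      note [measurable] = payoff_measurable(2)[OF this H_measurable]
      show "(\<lambda>\<omega>. indicator (T i) \<omega> * G (real i * d) \<omega>) \<in> borel_measurable N" by measurable
    qed
    also have "\<dots> \<le> ?J" using st by (intro SUP_upper) simp
    finally show "?V m \<le> ?J" .
  qed
qed

end

section \<open>The two stopping problems\<close>

text \<open>Unlike \<open>nn_integral_cmult\<close>, this does not ask \<open>f\<close> to be measurable.\<close>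

lemma nn_integral_cmult_pos:
  fixes c :: real
  assumes c: "0 < c"
  shows "(\<integral>\<^sup>+x. ennreal c * f x \<partial>M) = ennreal c * (\<integral>\<^sup>+x. f x \<partial>M)"
proof -
  have le: "ennreal c * (\<integral>\<^sup>+x. f x \<partial>M) \<le> (\<integral>\<^sup>+x. ennreal c * f x \<partial>M)" for c :: real and f :: "'a \<Rightarrow> ennreal"
  proof -
    have "ennreal c * (\<integral>\<^sup>+x. f x \<partial>M) = (SUP g\<in>{g. simple_function M g \<and> g \<le> f}. ennreal c * integral\<^sup>S M g)"
      unfolding nn_integral_def by (rule SUP_mult_left_ennreal)
    also have "\<dots> \<le> (\<integral>\<^sup>+x. ennreal c * f x \<partial>M)"
    proof (rule SUP_least)
      fix g assume "g \<in> {g. simple_function M g \<and> g \<le> f}"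
      then have g: "simple_function M g" "g \<le> f" by auto
      have "ennreal c * integral\<^sup>S M g = (\<integral>\<^sup>+x. ennreal c * g x \<partial>M)"
        using g(1) by (simp add: nn_integral_cmult nn_integral_eq_simple_integral borel_measurable_simple_function)
      also have "\<dots> \<le> (\<integral>\<^sup>+x. ennreal c * f x \<partial>M)"
        using g(2) by (intro nn_integral_mono mult_left_mono) (auto simp: le_fun_def)
      finally show "ennreal c * integral\<^sup>S M g \<le> (\<integral>\<^sup>+x. ennreal c * f x \<partial>M)" .
    qed
    finally show ?thesis .
  qed
  have inv: "ennreal (1 / c) * (ennreal c * y) = y" "ennreal c * (ennreal (1 / c) * y) = y" for y
    using c by (simp_all add: mult.assoc[symmetric] ennreal_mult'[symmetric])
  have "(\<integral>\<^sup>+x. ennreal c * f x \<partial>M) = ennreal c * (ennreal (1 / c) * (\<integral>\<^sup>+x. ennreal c * f x \<partial>M))"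
    by (simp only: inv)
  also have "\<dots> \<le> ennreal c * (\<integral>\<^sup>+x. ennreal (1 / c) * (ennreal c * f x) \<partial>M)"
    by (intro mult_left_mono le) simp
  also have "\<dots> = ennreal c * (\<integral>\<^sup>+x. f x \<partial>M)" by (simp only: inv)
  finally show ?thesis using le by (intro antisym)
qed

lemma positive_orthant_real: "positive_orthant = ({0<..} :: real set)"
  by (auto simp: positive_orthant_def)

lemma positive_orthant_pair: "positive_orthant = {(s::real, k::real). 0 < s \<and> 0 < k}"
  by (auto simp: positive_orthant_def Basis_prod_def)

text \<open>The indicator extends the integrand by 0, which makes it Borel on the whole line
  although \<open>g\<close> is continuous on the positive half-line only.\<close>

definition gain :: "real \<Rightarrow> (real \<Rightarrow> real) \<Rightarrow> real \<Rightarrow> real" where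
  "gain p g z = indicator {0<..} z * (p * (1 + z) + (1 - p) * g z)"

lemma gain_pos: "0 < z \<Longrightarrow> gain p g z = p * (1 + z) + (1 - p) * g z"
  by (simp add: gain_def)

lemma gain_measurable:
  assumes "continuous_on {0<..} g"
  shows "gain p g \<in> borel_measurable borel"
proof -
  have "(\<lambda>z. indicator {0<..} z *\<^sub>R (p * (1 + z) + (1 - p) * g z)) \<in> borel_measurable borel"
    by (intro borel_measurable_continuous_on_indicator continuous_intros assms) auto
  then show ?thesis by (simp add: gain_def[abs_def])
qed

lemma gain_nonneg:
  assumes "0 \<le> p" "p \<le> 1" "\<And>z. 0 < z \<Longrightarrow> 0 \<le> g z"
  shows "0 \<le> gain p g z"
  using assms by (auto simp: gain_def indicator_def intro!: add_nonneg_nonneg mult_nonneg_nonneg)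

lemma gain_tendsto:
  assumes g: "continuous_on {0<..} g" and z: "(\<lambda>n. u n) \<longlonglongrightarrow> z" "0 < z" "\<And>n. 0 < u n"
  shows "(\<lambda>n. gain p g (u n)) \<longlonglongrightarrow> gain p g z"
proof -
  have "(\<lambda>n. g (u n)) \<longlonglongrightarrow> g z"
    using z by (intro continuous_on_tendsto_compose[OF g]) auto
  then have "(\<lambda>n. p * (1 + u n) + (1 - p) * g (u n)) \<longlonglongrightarrow> p * (1 + z) + (1 - p) * g z"
    by (intro tendsto_intros z)
  then show ?thesis using z by (simp add: gain_pos)
qed

locale exchange_reward = exchange_model M B1 B2 \<mu>\<^sub>1 \<mu>\<^sub>2 \<sigma>\<^sub>1 \<sigma>\<^sub>2 \<nu> r
  for M :: "'a measure" and B1 B2 and \<mu>\<^sub>1 \<mu>\<^sub>2 \<sigma>\<^sub>1 \<sigma>\<^sub>2 \<nu> r +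
  fixes p :: real and F :: "real \<Rightarrow> real"
  assumes p: "0 \<le> p" "p \<le> 1" and F_cdf: "\<exists>D. real_distribution D \<and> F = cdf D"
begin

lemma F_sigma_finite: "sigma_finite_measure (interval_measure F)"
proof -
  obtain D where D: "real_distribution D" "F = cdf D" using F_cdf by blast
  then interpret D: real_distribution D by simp
  show ?thesis unfolding D(2) by (intro sigma_finite_interval_measure D.cdf_nondecreasing D.cdf_is_right_cont)
qed

definition Pi_kernel :: "(real \<Rightarrow> real) \<Rightarrow> real \<Rightarrow> ennreal" where
  "Pi_kernel g z = (\<integral>\<^sup>+t\<in>{0..}. ennreal (exp (- (r - \<mu>\<^sub>1) * t)) * kernel t (\<lambda>z. ennreal (gain p g z)) z
    \<partial>interval_measure F)"

lemma Pi_kernel_measurable: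
  assumes "continuous_on {0<..} g"
  shows "Pi_kernel g \<in> borel_measurable borel"
proof -
  interpret g: prob_space gauss2 by (rule prob_space_gauss2)
  interpret f: sigma_finite_measure "interval_measure F" by (rule F_sigma_finite)
  note [measurable] = gain_measurable[OF assms, of p]
  show ?thesis unfolding Pi_kernel_def[abs_def] kernel_def by measurable
qed

text \<open>All factors are gathered inside one \<open>ennreal\<close> of a real number. Convergence
  of the integrand in \<open>l\<close> and \<open>z\<close> thereby becomes a limit of real
  functions, ready for Fatou's lemma.\<close>

lemma Pi_kernel_integral:
  assumes "continuous_on {0<..} g" "\<And>z. 0 < z \<Longrightarrow> 0 \<le> g z" "0 \<le> l"
  shows "ennreal l * Pi_kernel g z = (\<integral>\<^sup>+t. \<integral>\<^sup>+y. ennreal (l * (exp (- (r - \<mu>\<^sub>1) * t) * gain p g (z * exp (drift * t +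
    sqrt t * (b1 * fst y + b2 * snd y))) * indicator {0..} t)) \<partial>gauss2 \<partial>interval_measure F)"
proof -
  interpret g: prob_space gauss2 by (rule prob_space_gauss2)
  interpret f: sigma_finite_measure "interval_measure F" by (rule F_sigma_finite)
  note [measurable] = gain_measurable[OF assms(1), of p]
  have gn: "0 \<le> gain p g x" for x using assms(2) by (intro gain_nonneg p) auto
  let ?x = "\<lambda>t y. z * exp (drift * t + sqrt t * (b1 * fst y + b2 * snd y))"
  let ?c = "\<lambda>t. ennreal (exp (- (r - \<mu>\<^sub>1) * t)) * indicator {0..} t"
  have inner: "(\<integral>\<^sup>+y. ennreal (l * (exp (- (r - \<mu>\<^sub>1) * t) * gain p g (?x t y) * indicator {0..} t)) \<partial>gauss2)
     = ennreal l * (?c t * (\<integral>\<^sup>+y. ennreal (gain p g (?x t y)) \<partial>gauss2))" for t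
  proof -
    have "ennreal (l * (exp (- (r - \<mu>\<^sub>1) * t) * gain p g x * indicator {0..} t)) = (ennreal l * ?c t) * ennreal (gain
      p g x)" for x
      using assms(3) gn[of x] by (cases "0 \<le> t") (simp_all add: ennreal_mult mult.assoc)
    then have "(\<integral>\<^sup>+y. ennreal (l * (exp (- (r - \<mu>\<^sub>1) * t) * gain p g (?x t y) * indicator {0..} t)) \<partial>gauss2) =
      (\<integral>\<^sup>+y. (ennreal l * ?c t) * ennreal (gain p g (?x t y)) \<partial>gauss2)" by (simp only:)
    also have "\<dots> = (ennreal l * ?c t) * (\<integral>\<^sup>+y. ennreal (gain p g (?x t y)) \<partial>gauss2)"
      by (rule nn_integral_cmult) measurable
    finally show ?thesis by (simp only: mult.assoc)
  qed
  have "Pi_kernel g z = (\<integral>\<^sup>+t. ?c t * (\<integral>\<^sup>+y. ennreal (gain p g (?x t y)) \<partial>gauss2) \<partial>interval_measure F)"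
    unfolding Pi_kernel_def kernel_def by (simp only: mult_ac)
  then have "ennreal l * Pi_kernel g z = (\<integral>\<^sup>+t. ennreal l * (?c t * (\<integral>\<^sup>+y. ennreal (gain p g (?x t y)) \<partial>gauss2))
    \<partial>interval_measure F)"
    by (simp only:) (rule nn_integral_cmult[symmetric], measurable)
  then show ?thesis by (simp only: inner)
qed

text \<open>Fatou's lemma twice, over the Gaussian and over \<open>F\<close>. The weight
  \<open>l\<close> varies along with \<open>z\<close> because discount factor and \<open>S\<close>
  move together with the state.\<close>

lemma Pi_kernel_lsc:
  assumes g: "continuous_on {0<..} g" "\<And>z. 0 < z \<Longrightarrow> 0 \<le> g z"
    and l: "ls \<longlonglongrightarrow> l" "0 \<le> l" "\<And>n. 0 \<le> ls n" and z: "zs \<longlonglongrightarrow> z" "0 < z" "\<And>n. 0 < zs n"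
  shows "ennreal l * Pi_kernel g z \<le> liminf (\<lambda>n. ennreal (ls n) * Pi_kernel g (zs n))"
proof -
  interpret g: prob_space gauss2 by (rule prob_space_gauss2)
  interpret f: sigma_finite_measure "interval_measure F" by (rule F_sigma_finite)
  note [measurable] = gain_measurable[OF g(1), of p]
  define \<Phi> where "\<Phi> l z t y = ennreal (l * (exp (- (r - \<mu>\<^sub>1) * t) * gain p g (z * exp (drift * t + sqrt t * (b1 *
    fst y + b2 * snd y))) * indicator {0..} t))"
    for l z t :: real and y :: "real \<times> real"
  have \<Phi>M [measurable]: "(\<lambda>(t, y). \<Phi> l z t y) \<in> borel_measurable (interval_measure F \<Otimes>\<^sub>M gauss2)" for l z
    unfolding \<Phi>_def by measurable
  have lim: "(\<lambda>n. \<Phi> (ls n) (zs n) t y) \<longlonglongrightarrow> \<Phi> l z t y" for t y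
    unfolding \<Phi>_def
    by (intro tendsto_ennrealI tendsto_intros l gain_tendsto[OF g(1)] tendsto_mult_right z) (use z in auto)
  have PI: "ennreal c * Pi_kernel g x = (\<integral>\<^sup>+t. \<integral>\<^sup>+y. \<Phi> c x t y \<partial>gauss2 \<partial>interval_measure F)" if "0 \<le> c" for c x
    unfolding \<Phi>_def by (rule Pi_kernel_integral[OF g that])
  have "ennreal l * Pi_kernel g z = (\<integral>\<^sup>+t. \<integral>\<^sup>+y. \<Phi> l z t y \<partial>gauss2 \<partial>interval_measure F)"
    by (rule PI[OF l(2)])
  also have "\<dots> = (\<integral>\<^sup>+t. \<integral>\<^sup>+y. liminf (\<lambda>n. \<Phi> (ls n) (zs n) t y) \<partial>gauss2 \<partial>interval_measure F)"
    using lim_imp_Liminf[OF _ lim] by simp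
  also have "\<dots> \<le> (\<integral>\<^sup>+t. liminf (\<lambda>n. \<integral>\<^sup>+y. \<Phi> (ls n) (zs n) t y \<partial>gauss2) \<partial>interval_measure F)"
  proof (intro nn_integral_mono nn_integral_liminf)
    fix t n show "\<Phi> (ls n) (zs n) t \<in> borel_measurable gauss2" unfolding \<Phi>_def[abs_def] by measurable
  qed
  also have "\<dots> \<le> liminf (\<lambda>n. \<integral>\<^sup>+t. \<integral>\<^sup>+y. \<Phi> (ls n) (zs n) t y \<partial>gauss2 \<partial>interval_measure F)"
    by (intro nn_integral_liminf) measurable
  also have "\<dots> = liminf (\<lambda>n. ennreal (ls n) * Pi_kernel g (zs n))"
    by (simp only: PI[OF l(3)])
  finally show ?thesis .
qed

definition reward :: "(real \<Rightarrow> real) \<Rightarrow> real \<Rightarrow> ennreal" where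
  "reward g z = max 1 (Pi_kernel g z)"

lemma reward_lsc:
  assumes g: "continuous_on {0<..} g" "\<And>z. 0 < z \<Longrightarrow> 0 \<le> g z"
    and l: "ls \<longlonglongrightarrow> l" "0 \<le> l" "\<And>n. 0 \<le> ls n" and z: "zs \<longlonglongrightarrow> z" "0 < z" "\<And>n. 0 < zs n"
  shows "ennreal l * reward g z \<le> liminf (\<lambda>n. ennreal (ls n) * reward g (zs n))"
proof -
  have le: "ennreal c * Pi_kernel g z \<le> ennreal c * reward g z" "ennreal c \<le> ennreal c * reward g z" for c z
  proof -
    show "ennreal c * Pi_kernel g z \<le> ennreal c * reward g z" unfolding reward_def by (intro mult_left_mono) auto
    have "ennreal c * 1 \<le> ennreal c * reward g z" unfolding reward_def by (intro mult_left_mono) auto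
    then show "ennreal c \<le> ennreal c * reward g z" by simp
  qed
  have "ennreal l * Pi_kernel g z \<le> liminf (\<lambda>n. ennreal (ls n) * reward g (zs n))"
    by (rule order_trans[OF Pi_kernel_lsc[OF g l z] Liminf_mono]) (simp_all add: le always_eventually)
  moreover have "ennreal l \<le> liminf (\<lambda>n. ennreal (ls n) * reward g (zs n))"
  proof -
    have "ennreal l = liminf (\<lambda>n. ennreal (ls n))"
      by (rule lim_imp_Liminf[symmetric]) (auto intro!: tendsto_ennrealI l)
    also have "\<dots> \<le> liminf (\<lambda>n. ennreal (ls n) * reward g (zs n))"
      by (rule Liminf_mono) (simp add: le always_eventually)
    finally show ?thesis .
  qed
  ultimately show ?thesis unfolding reward_def by (cases "Pi_kernel g z \<le> 1") (auto simp: max_def)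
qed

text \<open>The one-step operator shared by both problems. For \<open>Z\<close> its factor is the
  discount itself; for \<open>S\<close> and \<open>K\<close> it is the product of the discount at
  rate \<open>r\<close> with the growth \<open>exp (\<mu>\<^sub>1 * d)\<close> of the
  weight.\<close>

definition discounted_kernel :: "real \<Rightarrow> (real \<Rightarrow> ennreal) \<Rightarrow> real \<Rightarrow> ennreal" where
  "discounted_kernel d f x = ennreal (exp (- (r - \<mu>\<^sub>1) * d)) * kernel d f x"

lemma discounted_kernel_measurable: "f \<in> borel_measurable borel \<Longrightarrow> discounted_kernel d f \<in> borel_measurable borel"
  unfolding discounted_kernel_def[abs_def] using kernel_measurable[of f d] by measurable

lemma kernel_cmult:
  assumes [measurable]: "f \<in> borel_measurable borel"
  shows "kernel d (\<lambda>x. c * f x) z = c * kernel d f z"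
  unfolding kernel_def by (rule nn_integral_cmult) measurable

lemma bm_paths: "AE \<omega> in N. continuous_on {0..} (\<lambda>t. B1 t \<omega>) \<and> continuous_on {0..} (\<lambda>t. B2 t \<omega>) \<and> B1 0 \<omega> = 0 \<and>
  B2 0 \<omega> = 0"
proof -
  have "AE \<omega> in N. continuous_on {0..} (\<lambda>t. B1 t \<omega>)" "AE \<omega> in N. continuous_on {0..} (\<lambda>t. B2 t \<omega>)"
      "AE \<omega> in N. B1 0 \<omega> = 0" "AE \<omega> in N. B2 0 \<omega> = 0"
    using bm1 bm2 by (auto simp: brownian_motion_def intro: AE_completion)
  then show ?thesis by eventually_elim auto
qed

lemma reward_measurable: "continuous_on {0<..} g \<Longrightarrow> reward g \<in> borel_measurable borel"
  unfolding reward_def[abs_def] using Pi_kernel_measurable[of g] by measurable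

lemma weighted_markov_Z:
  assumes g: "continuous_on {0<..} g" "\<And>z. 0 < z \<Longrightarrow> 0 \<le> g z" and z: "0 < z"
  shows "weighted_markov M B1 B2 (\<lambda>t _. exp (- (r - \<mu>\<^sub>1) * t)) (Zx z) discounted_kernel (reward g) 1 z"
proof
  show "Zx z t \<in> borel_measurable (FF (ennreal t))" if "0 \<le> t" for t using adapted(3)[OF that] .
  show "discounted_kernel d f \<in> borel_measurable borel" if "f \<in> borel_measurable borel" for d f
    using discounted_kernel_measurable[OF that] .
  show "reward g \<in> borel_measurable borel" by (rule reward_measurable[OF g(1)])
  show "(\<integral>\<^sup>+\<omega>. indicator A \<omega> * (ennreal (exp (- (r - \<mu>\<^sub>1) * (t + d))) * f (Zx z (t + d) \<omega>)) \<partial>N) =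
      (\<integral>\<^sup>+\<omega>. indicator A \<omega> * (ennreal (exp (- (r - \<mu>\<^sub>1) * t)) * discounted_kernel d f (Zx z t \<omega>)) \<partial>N)"
    if "0 \<le> t" "0 < d" "A \<in> sets (FF (ennreal t))" and [measurable]: "f \<in> borel_measurable borel" for t d A f
  proof -
    let ?c = "ennreal (exp (- (r - \<mu>\<^sub>1) * (t + d)))"
    have c: "?c = ennreal (exp (- (r - \<mu>\<^sub>1) * t)) * ennreal (exp (- (r - \<mu>\<^sub>1) * d))"
      by (simp add: ennreal_mult'[symmetric] exp_add[symmetric] algebra_simps)
    have "(\<integral>\<^sup>+\<omega>. indicator A \<omega> * (?c * f (Zx z (t + d) \<omega>)) \<partial>N) = (\<integral>\<^sup>+\<omega>. indicator A \<omega> * kernel d (\<lambda>x. ?c * f x) (Zx z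
      t \<omega>) \<partial>N)"
      by (rule markov_Z[OF that(1-3)]) measurable
    then show ?thesis unfolding kernel_cmult[OF that(4)] discounted_kernel_def unfolding c by (simp only: mult.assoc)
  qed
  show "AE \<omega> in N. exp (- (r - \<mu>\<^sub>1) * 0) = 1 \<and> Zx z 0 \<omega> = z"
    using bm_paths by eventually_elim (simp add: Zx_def)
  show "AE \<omega> in N. \<forall>t u. 0 \<le> t \<longrightarrow> (\<forall>n. t \<le> u n) \<longrightarrow> u \<longlonglongrightarrow> t \<longrightarrow>
      ennreal (exp (- (r - \<mu>\<^sub>1) * t)) * reward g (Zx z t \<omega>) \<le> liminf (\<lambda>n. ennreal (exp (- (r - \<mu>\<^sub>1) * u n)) * reward g
        (Zx z (u n) \<omega>))"
    using bm_paths
  proof eventually_elim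
    fix \<omega> assume "continuous_on {0..} (\<lambda>t. B1 t \<omega>) \<and> continuous_on {0..} (\<lambda>t. B2 t \<omega>) \<and> B1 0 \<omega> = 0 \<and> B2 0 \<omega> = 0"
    then have c: "continuous_on {0..} (\<lambda>t. Zx z t \<omega>)" unfolding Zx_def by (auto intro!: continuous_intros)
    have lim: "(\<lambda>n. Zx z (u n) \<omega>) \<longlonglongrightarrow> Zx z t \<omega>" if "0 \<le> t" "\<forall>n. t \<le> u n" "u \<longlonglongrightarrow> t" for t and u :: "nat \<Rightarrow> real"
      using that by (auto intro!: continuous_on_tendsto_compose[OF c] always_eventually intro: order_trans)
    show "\<forall>t u. 0 \<le> t \<longrightarrow> (\<forall>n. t \<le> u n) \<longrightarrow> u \<longlonglongrightarrow> t \<longrightarrow>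
      ennreal (exp (- (r - \<mu>\<^sub>1) * t)) * reward g (Zx z t \<omega>) \<le> liminf (\<lambda>n. ennreal (exp (- (r - \<mu>\<^sub>1) * u n)) * reward g
        (Zx z (u n) \<omega>))"
    proof (intro allI impI)
      fix t and u :: "nat \<Rightarrow> real" assume h: "0 \<le> t" "\<forall>n. t \<le> u n" "u \<longlonglongrightarrow> t"
      show "ennreal (exp (- (r - \<mu>\<^sub>1) * t)) * reward g (Zx z t \<omega>) \<le> liminf (\<lambda>n. ennreal (exp (- (r - \<mu>\<^sub>1) * u n)) *
        reward g (Zx z (u n) \<omega>))"
      proof (rule reward_lsc[OF g])
        show "(\<lambda>n. exp (- (r - \<mu>\<^sub>1) * u n)) \<longlonglongrightarrow> exp (- (r - \<mu>\<^sub>1) * t)" by (intro tendsto_intros h)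
        show "(\<lambda>n. Zx z (u n) \<omega>) \<longlonglongrightarrow> Zx z t \<omega>" by (rule lim[OF h])
      qed (use positive(3)[OF z] in auto)
    qed
  qed
qed auto

text \<open>Kernel and reward are the same as in \<open>weighted_markov_Z\<close>. Only the weight
  and its initial value differ, and the latter puts the factor \<open>s\<close> in front of the
  value.\<close>

lemma weighted_markov_SK:
  assumes g: "continuous_on {0<..} g" "\<And>z. 0 < z \<Longrightarrow> 0 \<le> g z" and sk: "0 < s" "0 < k"
  shows "weighted_markov M B1 B2 (\<lambda>t \<omega>. exp (- r * t) * Sx s t \<omega>) (\<lambda>t \<omega>. Kx k t \<omega> / Sx s t \<omega>) discounted_kernel
    (reward g) s (k / s)"
proof
  show "(\<lambda>\<omega>. exp (- r * t) * Sx s t \<omega>) \<in> borel_measurable (FF (ennreal t))"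
    "(\<lambda>\<omega>. Kx k t \<omega> / Sx s t \<omega>) \<in> borel_measurable (FF (ennreal t))" if "0 \<le> t" for t
    using adapted(1,2)[OF that] by measurable
  show "discounted_kernel d f \<in> borel_measurable borel" if "f \<in> borel_measurable borel" for d f
    using discounted_kernel_measurable[OF that] .
  show "reward g \<in> borel_measurable borel" by (rule reward_measurable[OF g(1)])
  show "(\<integral>\<^sup>+\<omega>. indicator A \<omega> * (ennreal (exp (- r * (t + d)) * Sx s (t + d) \<omega>) * f (Kx k (t + d) \<omega> / Sx s (t + d) \<omega>))
    \<partial>N) =
      (\<integral>\<^sup>+\<omega>. indicator A \<omega> * (ennreal (exp (- r * t) * Sx s t \<omega>) * discounted_kernel d f (Kx k t \<omega> / Sx s t \<omega>)) \<partial>N)"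
    if "0 \<le> t" "0 < d" "A \<in> sets (FF (ennreal t))" and [measurable]: "f \<in> borel_measurable borel" for t d A f
  proof -
    let ?c = "ennreal (exp (- r * (t + d)))"
    have c: "ennreal (exp (\<mu>\<^sub>1 * d)) * ?c = ennreal (exp (- r * t)) * ennreal (exp (- (r - \<mu>\<^sub>1) * d))"
      by (simp add: ennreal_mult'[symmetric] exp_add[symmetric] algebra_simps)
    have sp: "ennreal (exp x * Sx s t \<omega>) = ennreal (Sx s t \<omega>) * ennreal (exp x)" for x t \<omega>
      using positive(1)[OF sk(1), of t \<omega>] by (simp add: ennreal_mult mult.commute)
    have "(\<integral>\<^sup>+\<omega>. indicator A \<omega> * (ennreal (Sx s (t + d) \<omega>) * (?c * f (Kx k (t + d) \<omega> / Sx s (t + d) \<omega>))) \<partial>N) =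
       (\<integral>\<^sup>+\<omega>. indicator A \<omega> * (ennreal (Sx s t \<omega>) * (ennreal (exp (\<mu>\<^sub>1 * d)) * kernel d (\<lambda>x. ?c * f x) (Kx k t \<omega> / Sx
         s t \<omega>))) \<partial>N)"
      by (rule markov_SK[OF that(1,2) sk(1) that(3)]) measurable
    also have "\<dots> = (\<integral>\<^sup>+\<omega>. indicator A \<omega> * (ennreal (Sx s t \<omega>) * ((ennreal (exp (\<mu>\<^sub>1 * d)) * ?c) * kernel d f (Kx k t \<omega>
      / Sx s t \<omega>))) \<partial>N)"
      unfolding kernel_cmult[OF that(4)] by (simp only: mult.assoc)
    finally show ?thesis unfolding sp discounted_kernel_def c by (simp only: mult.assoc)
  qed
  show "AE \<omega> in N. exp (- r * 0) * Sx s 0 \<omega> = s \<and> Kx k 0 \<omega> / Sx s 0 \<omega> = k / s"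
    using bm_paths by eventually_elim (simp add: Sx_def Kx_def)
  show "AE \<omega> in N. \<forall>t u. 0 \<le> t \<longrightarrow> (\<forall>n. t \<le> u n) \<longrightarrow> u \<longlonglongrightarrow> t \<longrightarrow>
      ennreal (exp (- r * t) * Sx s t \<omega>) * reward g (Kx k t \<omega> / Sx s t \<omega>)
      \<le> liminf (\<lambda>n. ennreal (exp (- r * u n) * Sx s (u n) \<omega>) * reward g (Kx k (u n) \<omega> / Sx s (u n) \<omega>))"
    using bm_paths
  proof eventually_elim
    fix \<omega> assume "continuous_on {0..} (\<lambda>t. B1 t \<omega>) \<and> continuous_on {0..} (\<lambda>t. B2 t \<omega>) \<and> B1 0 \<omega> = 0 \<and> B2 0 \<omega> = 0"
    then have c: "continuous_on {0..} (\<lambda>t. Sx s t \<omega>)" "continuous_on {0..} (\<lambda>t. Kx k t \<omega>)"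
      unfolding Sx_def Kx_def by (auto intro!: continuous_intros)
    have lim: "(\<lambda>n. Sx s (u n) \<omega>) \<longlonglongrightarrow> Sx s t \<omega>" "(\<lambda>n. Kx k (u n) \<omega>) \<longlonglongrightarrow> Kx k t \<omega>"
      if "0 \<le> t" "\<forall>n. t \<le> u n" "u \<longlonglongrightarrow> t" for t and u :: "nat \<Rightarrow> real"
      using that by (auto intro!: continuous_on_tendsto_compose[OF c(1)] continuous_on_tendsto_compose[OF c(2)]
        always_eventually intro: order_trans)
    show "\<forall>t u. 0 \<le> t \<longrightarrow> (\<forall>n. t \<le> u n) \<longrightarrow> u \<longlonglongrightarrow> t \<longrightarrow>
      ennreal (exp (- r * t) * Sx s t \<omega>) * reward g (Kx k t \<omega> / Sx s t \<omega>)
      \<le> liminf (\<lambda>n. ennreal (exp (- r * u n) * Sx s (u n) \<omega>) * reward g (Kx k (u n) \<omega> / Sx s (u n) \<omega>))"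
    proof (intro allI impI)
      fix t and u :: "nat \<Rightarrow> real" assume h: "0 \<le> t" "\<forall>n. t \<le> u n" "u \<longlonglongrightarrow> t"
      show "ennreal (exp (- r * t) * Sx s t \<omega>) * reward g (Kx k t \<omega> / Sx s t \<omega>)
        \<le> liminf (\<lambda>n. ennreal (exp (- r * u n) * Sx s (u n) \<omega>) * reward g (Kx k (u n) \<omega> / Sx s (u n) \<omega>))"
      proof (rule reward_lsc[OF g])
        show "(\<lambda>n. exp (- r * u n) * Sx s (u n) \<omega>) \<longlonglongrightarrow> exp (- r * t) * Sx s t \<omega>"
          by (intro tendsto_intros lim h)
        show "(\<lambda>n. Kx k (u n) \<omega> / Sx s (u n) \<omega>) \<longlonglongrightarrow> Kx k t \<omega> / Sx s t \<omega>"
          by (intro tendsto_intros lim h) (use positive(1)[OF sk(1), of t \<omega>] in simp)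
      qed (use positive(1)[OF sk(1)] positive(2)[OF sk(2)] in \<open>auto simp: less_imp_le\<close>)
    qed
  qed
qed

end

section \<open>The operators expressed through the common kernel\<close>

locale exchange_solution = exchange_reward M B1 B2 \<mu>\<^sub>1 \<mu>\<^sub>2 \<sigma>\<^sub>1 \<sigma>\<^sub>2 \<nu> r p F
  for M :: "'a measure" and B1 B2 and \<mu>\<^sub>1 \<mu>\<^sub>2 \<sigma>\<^sub>1 \<sigma>\<^sub>2 \<nu> r p and F +
  fixes S K Z :: "real \<Rightarrow> real \<Rightarrow> 'a \<Rightarrow> real"
  assumes S_sol: "0 < s \<Longrightarrow> AE \<omega> in N. \<forall>t\<ge>0. S s t \<omega> = Sx s t \<omega>"
    and K_sol: "0 < k \<Longrightarrow> AE \<omega> in N. \<forall>t\<ge>0. K k t \<omega> = Kx k t \<omega>"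
    and Z_sol: "0 < z \<Longrightarrow> AE \<omega> in N. \<forall>t\<ge>0. Z z t \<omega> = Zx z t \<omega>"
begin

lemma nn_integral_space_indicator: "(\<integral>\<^sup>+\<omega>. indicator (space M) \<omega> * f \<omega> \<partial>N) = (\<integral>\<^sup>+\<omega>. f \<omega> \<partial>N)"
  by (intro nn_integral_cong) simp

text \<open>The Markov property from time 0 on the sure event; \<open>t = 0\<close> is apart because
  a positive step is required there.\<close>

lemma law_Z:
  assumes t: "0 \<le> t" and f: "f \<in> borel_measurable borel"
  shows "(\<integral>\<^sup>+\<omega>. f (Zx z t \<omega>) \<partial>N) = kernel t f z"
proof -
  interpret N: prob_space N by (rule prob_space_N)
  have Z0: "AE \<omega> in N. Zx z 0 \<omega> = z" using bm_paths by eventually_elim (simp add: Zx_def)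
  have const: "(\<integral>\<^sup>+\<omega>. h (Zx z 0 \<omega>) \<partial>N) = h z" for h :: "real \<Rightarrow> ennreal"
  proof -
    have "AE \<omega> in N. h (Zx z 0 \<omega>) = h z" using Z0 by eventually_elim simp
    then have "(\<integral>\<^sup>+\<omega>. h (Zx z 0 \<omega>) \<partial>N) = (\<integral>\<^sup>+\<omega>. h z \<partial>N)" by (rule nn_integral_cong_AE)
    then show ?thesis using N.emeasure_space_1 by simp
  qed
  show ?thesis
  proof (cases "t = 0")
    case True
    then show ?thesis using const by (simp add: kernel_zero)
  next
    case False
    with t have "0 < t" by simp
    from markov_Z[OF order.refl this space_in_FF f, of z]
    have "(\<integral>\<^sup>+\<omega>. f (Zx z t \<omega>) \<partial>N) = (\<integral>\<^sup>+\<omega>. kernel t f (Zx z 0 \<omega>) \<partial>N)"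
      by (simp add: nn_integral_space_indicator)
    then show ?thesis using const by simp
  qed
qed

lemma law_SK:
  assumes t: "0 \<le> t" and s: "0 < s" and f: "f \<in> borel_measurable borel"
  shows "(\<integral>\<^sup>+\<omega>. ennreal (Sx s t \<omega>) * f (Kx k t \<omega> / Sx s t \<omega>) \<partial>N) = ennreal s * (ennreal (exp (\<mu>\<^sub>1 * t)) * kernel t f
    (k / s))"
proof -
  interpret N: prob_space N by (rule prob_space_N)
  have Z0: "AE \<omega> in N. Sx s 0 \<omega> = s \<and> Kx k 0 \<omega> = k" using bm_paths by eventually_elim (simp add: Sx_def Kx_def)
  have const: "(\<integral>\<^sup>+\<omega>. ennreal (Sx s 0 \<omega>) * h (Kx k 0 \<omega> / Sx s 0 \<omega>) \<partial>N) = ennreal s * h (k / s)" for h ::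
    "real \<Rightarrow> ennreal"
  proof -
    have "AE \<omega> in N. ennreal (Sx s 0 \<omega>) * h (Kx k 0 \<omega> / Sx s 0 \<omega>) = ennreal s * h (k / s)" using Z0
      by eventually_elim simp
    then have "(\<integral>\<^sup>+\<omega>. ennreal (Sx s 0 \<omega>) * h (Kx k 0 \<omega> / Sx s 0 \<omega>) \<partial>N) = (\<integral>\<^sup>+\<omega>. ennreal s * h (k / s) \<partial>N)"
      by (rule nn_integral_cong_AE)
    then show ?thesis using N.emeasure_space_1 by simp
  qed
  show ?thesis
  proof (cases "t = 0")
    case True
    then show ?thesis using const by (simp add: kernel_zero)
  next
    case False
    with t have "0 < t" by simp
    from markov_SK[OF order.refl this s space_in_FF f, of k]
    have "(\<integral>\<^sup>+\<omega>. ennreal (Sx s t \<omega>) * f (Kx k t \<omega> / Sx s t \<omega>) \<partial>N) =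
       (\<integral>\<^sup>+\<omega>. ennreal (Sx s 0 \<omega>) * (ennreal (exp (\<mu>\<^sub>1 * t)) * kernel t f (Kx k 0 \<omega> / Sx s 0 \<omega>)) \<partial>N)"
      by (simp add: nn_integral_space_indicator)
    also have "\<dots> = ennreal s * (ennreal (exp (\<mu>\<^sub>1 * t)) * kernel t f (k / s))"
      by (rule const[of "\<lambda>x. ennreal (exp (\<mu>\<^sub>1 * t)) * kernel t f x"])
    finally show ?thesis .
  qed
qed

lemma Pi_op_eq:
  assumes g: "continuous_on {0<..} g" and z: "0 < z"
  shows "Pi_op M F p r \<mu>\<^sub>1 Z g z = Pi_kernel g z"
  unfolding Pi_op_def Pi_kernel_def
proof (intro nn_integral_cong)
  fix t :: real
  have [measurable]: "gain p g \<in> borel_measurable borel" by (rule gain_measurable[OF g])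
  show "ennreal (exp (- (r - \<mu>\<^sub>1) * t)) * (\<integral>\<^sup>+\<omega>. ennreal (p * (1 + Z z t \<omega>) + (1 - p) * g (Z z t \<omega>)) \<partial>N) * indicator
    {0..} t =
    ennreal (exp (- (r - \<mu>\<^sub>1) * t)) * kernel t (\<lambda>z. ennreal (gain p g z)) z * indicator {0..} t"
  proof (cases "0 \<le> t")
    case True
    have "AE \<omega> in N. ennreal (p * (1 + Z z t \<omega>) + (1 - p) * g (Z z t \<omega>)) = ennreal (gain p g (Zx z t \<omega>))"
      using Z_sol[OF z] by eventually_elim (use True positive(3)[OF z] in \<open>simp add: gain_pos\<close>)
    then have "(\<integral>\<^sup>+\<omega>. ennreal (p * (1 + Z z t \<omega>) + (1 - p) * g (Z z t \<omega>)) \<partial>N) = (\<integral>\<^sup>+\<omega>. ennreal (gain p g (Zx z t \<omega>))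
      \<partial>N)"
      by (rule nn_integral_cong_AE)
    also have "\<dots> = kernel t (\<lambda>z. ennreal (gain p g z)) z"
      by (rule law_Z[OF True]) measurable
    finally show ?thesis by simp
  qed simp
qed

text \<open>For homogeneous \<open>w\<close> the integrand at time \<open>t\<close> is
  \<open>S\<close> times \<open>gain\<close> at \<open>K / S\<close>, so \<open>law_SK\<close>
  reduces the expectation to one dimension.\<close>

lemma Lambda_op_eq:
  assumes g: "continuous_on {0<..} g" and w: "\<And>s k. 0 < s \<Longrightarrow> 0 < k \<Longrightarrow> w (s, k) = s * g (k / s)"
    and sk: "0 < s" "0 < k"
  shows "Lambda_op M F p r S K w (s, k) = ennreal s * Pi_kernel g (k / s)"
proof -
  have [measurable]: "gain p g \<in> borel_measurable borel" by (rule gain_measurable[OF g])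
  have "Lambda_op M F p r S K w (s, k) = (\<integral>\<^sup>+t. ennreal s *
     (ennreal (exp (- (r - \<mu>\<^sub>1) * t)) * kernel t (\<lambda>z. ennreal (gain p g z)) (k / s) * indicator {0..} t)
       \<partial>interval_measure F)"
    unfolding Lambda_op_def prod.case
  proof (intro nn_integral_cong)
    fix t :: real
    show "ennreal (exp (- r * t)) * (\<integral>\<^sup>+\<omega>. ennreal (p * (S s t \<omega> + K k t \<omega>) + (1 - p) * w (S s t \<omega>, K k t \<omega>)) \<partial>N) *
      indicator {0..} t =
      ennreal s * (ennreal (exp (- (r - \<mu>\<^sub>1) * t)) * kernel t (\<lambda>z. ennreal (gain p g z)) (k / s) * indicator {0..} t)"
    proof (cases "0 \<le> t")
      case True
      have "AE \<omega> in N. ennreal (p * (S s t \<omega> + K k t \<omega>) + (1 - p) * w (S s t \<omega>, K k t \<omega>)) =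
         ennreal (Sx s t \<omega>) * ennreal (gain p g (Kx k t \<omega> / Sx s t \<omega>))"
        using S_sol[OF sk(1)] K_sol[OF sk(2)]
      proof eventually_elim
        fix \<omega> assume "\<forall>t\<ge>0. S s t \<omega> = Sx s t \<omega>" "\<forall>t\<ge>0. K k t \<omega> = Kx k t \<omega>"
        then have eq: "S s t \<omega> = Sx s t \<omega>" "K k t \<omega> = Kx k t \<omega>" using True by auto
        have pos: "0 < Sx s t \<omega>" "0 < Kx k t \<omega>" using positive sk by auto
        then have "p * (Sx s t \<omega> + Kx k t \<omega>) + (1 - p) * w (Sx s t \<omega>, Kx k t \<omega>) =
           Sx s t \<omega> * gain p g (Kx k t \<omega> / Sx s t \<omega>)"
          by (simp add: w gain_pos field_simps)
        then show "ennreal (p * (S s t \<omega> + K k t \<omega>) + (1 - p) * w (S s t \<omega>, K k t \<omega>)) =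
           ennreal (Sx s t \<omega>) * ennreal (gain p g (Kx k t \<omega> / Sx s t \<omega>))"
          unfolding eq using pos by (simp add: ennreal_mult')
      qed
      then have "(\<integral>\<^sup>+\<omega>. ennreal (p * (S s t \<omega> + K k t \<omega>) + (1 - p) * w (S s t \<omega>, K k t \<omega>)) \<partial>N) =
         (\<integral>\<^sup>+\<omega>. ennreal (Sx s t \<omega>) * ennreal (gain p g (Kx k t \<omega> / Sx s t \<omega>)) \<partial>N)"
        by (rule nn_integral_cong_AE)
      also have "\<dots> = ennreal s * (ennreal (exp (\<mu>\<^sub>1 * t)) * kernel t (\<lambda>z. ennreal (gain p g z)) (k / s))"
        by (rule law_SK[OF True sk(1), of "\<lambda>z. ennreal (gain p g z)"]) measurable
      finally have 1: "(\<integral>\<^sup>+\<omega>. ennreal (p * (S s t \<omega> + K k t \<omega>) + (1 - p) * w (S s t \<omega>, K k t \<omega>)) \<partial>N) =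
         ennreal s * (ennreal (exp (\<mu>\<^sub>1 * t)) * kernel t (\<lambda>z. ennreal (gain p g z)) (k / s))" .
      have e: "ennreal (exp (- r * t)) * (ennreal s * (ennreal (exp (\<mu>\<^sub>1 * t)) * x)) =
        ennreal s * (ennreal (exp (- (r - \<mu>\<^sub>1) * t)) * x)" for x
      proof -
        have "ennreal (exp (- (r - \<mu>\<^sub>1) * t)) = ennreal (exp (- r * t)) * ennreal (exp (\<mu>\<^sub>1 * t))"
          by (simp add: ennreal_mult'[symmetric] exp_add[symmetric] algebra_simps)
        then show ?thesis by (simp only: mult_ac)
      qed
      show ?thesis unfolding 1 e by (simp only: mult.assoc)
    qed simp
  qed
  also have "\<dots> = ennreal s * Pi_kernel g (k / s)"
    unfolding Pi_kernel_def by (rule nn_integral_cmult_pos[OF sk(1)])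
  finally show ?thesis .
qed

lemma Gamma_tilde_op_eq:
  assumes g: "continuous_on {0<..} g" "\<And>z. 0 < z \<Longrightarrow> 0 \<le> g z" and z: "0 < z"
  shows "Gamma_tilde_op M FF F p r \<mu>\<^sub>1 Z g z = (SUP m. bellman (discounted_kernel (1 / 2 ^ m)) (reward g) (m * 2 ^ m)
    z)"
proof -
  interpret W: weighted_markov M B1 B2 "\<lambda>t _. exp (- (r - \<mu>\<^sub>1) * t)" "Zx z" discounted_kernel "reward g" 1 z
    by (rule weighted_markov_Z[OF g z])
  have "(\<integral>\<^sup>+\<omega>. (if \<tau> \<omega> = \<infinity> then 0 else let t = enn2real (\<tau> \<omega>) in
          ennreal (exp (- (r - \<mu>\<^sub>1) * t)) * max 1 (Pi_op M F p r \<mu>\<^sub>1 Z g (Z z t \<omega>))) \<partial>N) =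
            (\<integral>\<^sup>+\<omega>. W.payoff \<tau> \<omega> \<partial>N)" for \<tau>
  proof (rule nn_integral_cong_AE)
    show "AE \<omega> in N. (if \<tau> \<omega> = \<infinity> then 0 else let t = enn2real (\<tau> \<omega>) in
          ennreal (exp (- (r - \<mu>\<^sub>1) * t)) * max 1 (Pi_op M F p r \<mu>\<^sub>1 Z g (Z z t \<omega>))) = W.payoff \<tau> \<omega>"
      using Z_sol[OF z]
    proof eventually_elim
      fix \<omega> assume Z: "\<forall>t\<ge>0. Z z t \<omega> = Zx z t \<omega>"
      have "Z z (enn2real (\<tau> \<omega>)) \<omega> = Zx z (enn2real (\<tau> \<omega>)) \<omega>" using Z by simp
      then show "(if \<tau> \<omega> = \<infinity> then 0 else let t = enn2real (\<tau> \<omega>) in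
          ennreal (exp (- (r - \<mu>\<^sub>1) * t)) * max 1 (Pi_op M F p r \<mu>\<^sub>1 Z g (Z z t \<omega>))) = W.payoff \<tau> \<omega>"
        unfolding W.payoff_def Let_def by (simp add: Pi_op_eq[OF g(1) positive(3)[OF z]] reward_def)
    qed
  qed
  then show ?thesis
    unfolding Gamma_tilde_op_def using W.optimal_stopping_value by simp
qed

text \<open>Since \<open>Lambda_op_eq\<close> holds at every positive point, in particular at
  \<open>(S, K)\<close> when stopped, the payoff is the discounted \<open>S\<close> times the
  one-dimensional reward of \<open>K / S\<close>. Both operators are then limits of the same Bellman
  recursions, up to the initial weight \<open>s\<close>.\<close>

lemma Gamma_op_eq:
  assumes g: "continuous_on {0<..} g" "\<And>z. 0 < z \<Longrightarrow> 0 \<le> g z"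
    and w: "\<And>s k. 0 < s \<Longrightarrow> 0 < k \<Longrightarrow> w (s, k) = s * g (k / s)" and sk: "0 < s" "0 < k"
  shows "Gamma_op M FF F p r S K w (s, k) = ennreal s * Gamma_tilde_op M FF F p r \<mu>\<^sub>1 Z g (k / s)"
proof -
  interpret W: weighted_markov M B1 B2 "\<lambda>t \<omega>. exp (- r * t) * Sx s t \<omega>" "\<lambda>t \<omega>. Kx k t \<omega> / Sx s t \<omega>" discounted_kernel
    "reward g" s "k / s"
    by (rule weighted_markov_SK[OF g sk])
  have "(\<integral>\<^sup>+\<omega>. (if \<tau> \<omega> = \<infinity> then 0 else let t = enn2real (\<tau> \<omega>) in
          ennreal (exp (- r * t)) * max (ennreal (S s t \<omega>)) (Lambda_op M F p r S K w (S s t \<omega>, K k t \<omega>))) \<partial>N) =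
            (\<integral>\<^sup>+\<omega>. W.payoff \<tau> \<omega> \<partial>N)" for \<tau>
  proof (rule nn_integral_cong_AE)
    show "AE \<omega> in N. (if \<tau> \<omega> = \<infinity> then 0 else let t = enn2real (\<tau> \<omega>) in
          ennreal (exp (- r * t)) * max (ennreal (S s t \<omega>)) (Lambda_op M F p r S K w (S s t \<omega>, K k t \<omega>))) =
            W.payoff \<tau> \<omega>"
      using S_sol[OF sk(1)] K_sol[OF sk(2)]
    proof eventually_elim
      fix \<omega> assume SK: "\<forall>t\<ge>0. S s t \<omega> = Sx s t \<omega>" "\<forall>t\<ge>0. K k t \<omega> = Kx k t \<omega>"
      define t where "t = enn2real (\<tau> \<omega>)"
      have eq: "S s t \<omega> = Sx s t \<omega>" "K k t \<omega> = Kx k t \<omega>" using SK by (auto simp: t_def)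
      have pos: "0 < Sx s t \<omega>" "0 < Kx k t \<omega>" using positive sk by auto
      have mx: "max (ennreal a) (ennreal a * x) = ennreal a * max 1 x" for a x
        using mult_left_mono[of 1 x "ennreal a"] mult_left_mono[of x 1 "ennreal a"]
        by (cases "1 \<le> x") (auto simp: max_def dest: antisym)
      have L: "Lambda_op M F p r S K w (Sx s t \<omega>, Kx k t \<omega>) = ennreal (Sx s t \<omega>) * Pi_kernel g (Kx k t \<omega> / Sx s t \<omega>)"
        by (rule Lambda_op_eq[OF g(1) _ pos]) (rule w)
      have "ennreal (exp (- r * t)) * max (ennreal (S s t \<omega>)) (Lambda_op M F p r S K w (S s t \<omega>, K k t \<omega>)) =
         ennreal (exp (- r * t) * Sx s t \<omega>) * reward g (Kx k t \<omega> / Sx s t \<omega>)"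
        unfolding eq L mx reward_def by (simp add: ennreal_mult' mult.assoc)
      then show "(if \<tau> \<omega> = \<infinity> then 0 else let t = enn2real (\<tau> \<omega>) in
          ennreal (exp (- r * t)) * max (ennreal (S s t \<omega>)) (Lambda_op M F p r S K w (S s t \<omega>, K k t \<omega>))) =
            W.payoff \<tau> \<omega>"
        unfolding W.payoff_def Let_def t_def[symmetric] by simp
    qed
  qed
  then have "Gamma_op M FF F p r S K w (s, k) = (SUP \<tau>\<in>{\<tau>. stopping_time FF \<tau>}. \<integral>\<^sup>+\<omega>. W.payoff \<tau> \<omega> \<partial>N)"
    unfolding Gamma_op_def by simp
  also have "\<dots> = (SUP m. ennreal s * bellman (discounted_kernel (1 / 2 ^ m)) (reward g) (m * 2 ^ m) (k / s))"
    by (rule W.optimal_stopping_value)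
  also have "\<dots> = ennreal s * Gamma_tilde_op M FF F p r \<mu>\<^sub>1 Z g (k / s)"
    using Gamma_tilde_op_eq[OF g, of "k / s"] sk by (simp add: SUP_mult_left_ennreal)
  finally show ?thesis .
qed

lemma Sx_scale: "c * Sx s t \<omega> = Sx (c * s) t \<omega>" and Kx_scale: "c * Kx k t \<omega> = Kx (c * k) t \<omega>"
  by (simp_all add: Sx_def Kx_def)

text \<open>The solutions started at \<open>c * s\<close> and \<open>c * k\<close> are almost surely
  \<open>c\<close> times those started at \<open>s\<close> and \<open>k\<close>. The function
  \<open>v\<close> is arbitrary here, so measurability of the integrand is unknown and constants are
  moved by \<open>nn_integral_cmult_pos\<close>.\<close>

lemma Lambda_op_scale:
  assumes c: "0 < c" and sk: "0 < s" "0 < k"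
  shows "Lambda_op M F p r S K (\<lambda>(s, k). (1 / c) * v (c * s, c * k)) (s, k) = ennreal (1 / c) * Lambda_op M F p r S K
    v (c * s, c * k)"
proof -
  have inner: "(\<integral>\<^sup>+\<omega>. ennreal (p * (S s t \<omega> + K k t \<omega>) + (1 - p) * ((1 / c) * v (c * S s t \<omega>, c * K k t \<omega>))) \<partial>N) =
    ennreal (1 / c) * (\<integral>\<^sup>+\<omega>. ennreal (p * (S (c * s) t \<omega> + K (c * k) t \<omega>) + (1 - p) * v (S (c * s) t \<omega>, K (c *
      k) t \<omega>)) \<partial>N)"
    if t: "0 \<le> t" for t
  proof -
    have cs: "0 < c * s" "0 < c * k" "0 < 1 / c" using c sk by auto
    have "AE \<omega> in N. ennreal (p * (S s t \<omega> + K k t \<omega>) + (1 - p) * ((1 / c) * v (c * S s t \<omega>, c * K k t \<omega>))) =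
       ennreal (1 / c) * ennreal (p * (S (c * s) t \<omega> + K (c * k) t \<omega>) + (1 - p) * v (S (c * s) t \<omega>, K (c * k) t \<omega>))"
      using S_sol[OF sk(1)] K_sol[OF sk(2)] S_sol[OF cs(1)] K_sol[OF cs(2)]
    proof eventually_elim
      fix \<omega> assume "\<forall>t\<ge>0. S s t \<omega> = Sx s t \<omega>" "\<forall>t\<ge>0. K k t \<omega> = Kx k t \<omega>"
        "\<forall>t\<ge>0. S (c * s) t \<omega> = Sx (c * s) t \<omega>" "\<forall>t\<ge>0. K (c * k) t \<omega> = Kx (c * k) t \<omega>"
      then have eq: "S (c * s) t \<omega> = c * S s t \<omega>" "K (c * k) t \<omega> = c * K k t \<omega>" using t
        by (auto simp: Sx_scale Kx_scale)
      have "p * (S s t \<omega> + K k t \<omega>) + (1 - p) * ((1 / c) * v (c * S s t \<omega>, c * K k t \<omega>)) =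
         (1 / c) * (p * (S (c * s) t \<omega> + K (c * k) t \<omega>) + (1 - p) * v (S (c * s) t \<omega>, K (c * k) t \<omega>))"
        unfolding eq using c by (simp add: field_simps)
      then show "ennreal (p * (S s t \<omega> + K k t \<omega>) + (1 - p) * ((1 / c) * v (c * S s t \<omega>, c * K k t \<omega>))) =
       ennreal (1 / c) * ennreal (p * (S (c * s) t \<omega> + K (c * k) t \<omega>) + (1 - p) * v (S (c * s) t \<omega>, K (c * k) t \<omega>))"
        using cs(3) by (simp only:) (rule ennreal_mult', simp)
    qed
    then show ?thesis unfolding nn_integral_cmult_pos[OF cs(3), symmetric] by (rule nn_integral_cong_AE)
  qed
  have c': "0 < 1 / c" using c by simp
  show ?thesis
    unfolding Lambda_op_def prod.case nn_integral_cmult_pos[OF c', symmetric]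
  proof (intro nn_integral_cong)
    fix t :: real
    show "ennreal (exp (- r * t)) * (\<integral>\<^sup>+\<omega>. ennreal (p * (S s t \<omega> + K k t \<omega>) + (1 - p) * ((1 / c) * v (c * S s t \<omega>, c *
      K k t \<omega>))) \<partial>N) * indicator {0..} t =
      ennreal (1 / c) * (ennreal (exp (- r * t)) * (\<integral>\<^sup>+\<omega>. ennreal (p * (S (c * s) t \<omega> + K (c * k) t \<omega>) + (1 - p) * v
        (S (c * s) t \<omega>, K (c * k) t \<omega>)) \<partial>N) * indicator {0..} t)"
      by (cases "0 \<le> t") (simp_all only: inner mult_ac, simp)
  qed
qed

text \<open>Proved on paths and for arbitrary \<open>v\<close>, since it has to yield the
  homogeneity of the fixed point, which \<open>Gamma_op_eq\<close> already presupposes.\<close>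

lemma Gamma_op_scale:
  assumes c: "0 < c" and sk: "0 < s" "0 < k"
  shows "Gamma_op M FF F p r S K (\<lambda>(s, k). (1 / c) * v (c * s, c * k)) (s, k) = ennreal (1 / c) * Gamma_op M FF F p r
    S K v (c * s, c * k)"
proof -
  have cs: "0 < c * s" "0 < c * k" "0 < 1 / c" using c sk by auto
  let ?w = "\<lambda>(s, k). (1 / c) * v (c * s, c * k)"
  have "(\<integral>\<^sup>+\<omega>. (if \<tau> \<omega> = \<infinity> then 0 else let t = enn2real (\<tau> \<omega>) in
          ennreal (exp (- r * t)) * max (ennreal (S s t \<omega>)) (Lambda_op M F p r S K ?w (S s t \<omega>, K k t \<omega>))) \<partial>N) =
      ennreal (1 / c) * (\<integral>\<^sup>+\<omega>. (if \<tau> \<omega> = \<infinity> then 0 else let t = enn2real (\<tau> \<omega>) in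
          ennreal (exp (- r * t)) * max (ennreal (S (c * s) t \<omega>)) (Lambda_op M F p r S K v (S (c * s) t \<omega>, K (c *
            k) t \<omega>))) \<partial>N)" for \<tau>
    unfolding nn_integral_cmult_pos[OF cs(3), symmetric]
  proof (rule nn_integral_cong_AE)
    show "AE \<omega> in N. (if \<tau> \<omega> = \<infinity> then 0 else let t = enn2real (\<tau> \<omega>) in
          ennreal (exp (- r * t)) * max (ennreal (S s t \<omega>)) (Lambda_op M F p r S K ?w (S s t \<omega>, K k t \<omega>))) =
      ennreal (1 / c) * (if \<tau> \<omega> = \<infinity> then 0 else let t = enn2real (\<tau> \<omega>) in
          ennreal (exp (- r * t)) * max (ennreal (S (c * s) t \<omega>)) (Lambda_op M F p r S K v (S (c * s) t \<omega>, K (c *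
            k) t \<omega>)))"
      using S_sol[OF sk(1)] K_sol[OF sk(2)] S_sol[OF cs(1)] K_sol[OF cs(2)]
    proof eventually_elim
      fix \<omega> assume SK: "\<forall>t\<ge>0. S s t \<omega> = Sx s t \<omega>" "\<forall>t\<ge>0. K k t \<omega> = Kx k t \<omega>"
        "\<forall>t\<ge>0. S (c * s) t \<omega> = Sx (c * s) t \<omega>" "\<forall>t\<ge>0. K (c * k) t \<omega> = Kx (c * k) t \<omega>"
      define t where "t = enn2real (\<tau> \<omega>)"
      have t: "0 \<le> t" by (simp add: t_def)
      have pos: "0 < S s t \<omega>" "0 < K k t \<omega>" using SK(1,2) t positive sk by auto
      have eq: "S (c * s) t \<omega> = c * S s t \<omega>" "K (c * k) t \<omega> = c * K k t \<omega>" using SK t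
        by (auto simp: Sx_scale Kx_scale)
      have mx: "max (ennreal (1 / c) * x) (ennreal (1 / c) * y) = ennreal (1 / c) * max x y" for x y
        using mult_left_mono[of x y "ennreal (1 / c)"] mult_left_mono[of y x "ennreal (1 / c)"]
        by (cases "x \<le> y") (auto simp: max_def dest: antisym)
      have S1: "ennreal (S s t \<omega>) = ennreal (1 / c) * ennreal (c * S s t \<omega>)"
        using c by (simp add: ennreal_mult'[symmetric])
      have "max (ennreal (S s t \<omega>)) (Lambda_op M F p r S K ?w (S s t \<omega>, K k t \<omega>)) =
        ennreal (1 / c) * max (ennreal (S (c * s) t \<omega>)) (Lambda_op M F p r S K v (S (c * s) t \<omega>, K (c * k) t \<omega>))"
        unfolding Lambda_op_scale[OF c pos] eq mx[symmetric] S1[symmetric] ..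
      then show "(if \<tau> \<omega> = \<infinity> then 0 else let t = enn2real (\<tau> \<omega>) in
          ennreal (exp (- r * t)) * max (ennreal (S s t \<omega>)) (Lambda_op M F p r S K ?w (S s t \<omega>, K k t \<omega>))) =
        ennreal (1 / c) * (if \<tau> \<omega> = \<infinity> then 0 else let t = enn2real (\<tau> \<omega>) in
          ennreal (exp (- r * t)) * max (ennreal (S (c * s) t \<omega>)) (Lambda_op M F p r S K v (S (c * s) t \<omega>, K (c *
            k) t \<omega>)))"
        unfolding Let_def t_def[symmetric] by (simp only: mult_ac) simp
    qed
  qed
  then show ?thesis unfolding Gamma_op_def prod.case by (simp only: SUP_mult_left_ennreal)
qed

end

section \<open>Growth classes under scaling, lifting and restriction\<close>

lemma A_plus_pair_scale:
  assumes v: "(v :: real \<times> real \<Rightarrow> real) \<in> A_plus" and c: "0 < c"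
  shows "(\<lambda>(s, k). (1 / c) * v (c * s, c * k)) \<in> A_plus"
proof -
  have vc: "continuous_on positive_orthant v" and v0: "\<And>x. x \<in> positive_orthant \<Longrightarrow> 0 \<le> v x"
    using v by (auto simp: A_plus_def)
  obtain B where B: "\<And>x. x \<in> positive_orthant \<Longrightarrow> \<bar>v x\<bar>\<^sup>2 / (1 + (norm x)\<^sup>2) \<le> B"
    using v by (auto simp: A_plus_def bdd_above_def)
  have sc: "c *\<^sub>R x \<in> positive_orthant" if "x \<in> positive_orthant" for x :: "real \<times> real"
    using that c by (auto simp: positive_orthant_pair)
  have eq: "(\<lambda>(s, k). (1 / c) * v (c * s, c * k)) = (\<lambda>x. (1 / c) * v (c *\<^sub>R x))" by auto
  have "0 \<le> B" using order_trans[OF _ B[of "(1, 1)"]] by (auto simp: positive_orthant_pair)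
  have "\<bar>(1 / c) * v (c *\<^sub>R x)\<bar>\<^sup>2 / (1 + (norm x)\<^sup>2) \<le> B * max (1 / c\<^sup>2) 1" if x: "x \<in> positive_orthant" for x
  proof -
    have "\<bar>v (c *\<^sub>R x)\<bar>\<^sup>2 \<le> B * (1 + c\<^sup>2 * (norm x)\<^sup>2)"
      using B[OF sc[OF x]] by (simp add: divide_le_eq add_pos_nonneg power_mult_distrib)
    then have "(1 / c\<^sup>2) * \<bar>v (c *\<^sub>R x)\<bar>\<^sup>2 \<le> (1 / c\<^sup>2) * (B * (1 + c\<^sup>2 * (norm x)\<^sup>2))"
      by (intro mult_left_mono) auto
    also have "\<dots> = B * (1 / c\<^sup>2 + (norm x)\<^sup>2)" using c by (simp add: field_simps)
    also have "\<dots> \<le> B * (max (1 / c\<^sup>2) 1 * (1 + (norm x)\<^sup>2))"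
    proof (intro mult_left_mono \<open>0 \<le> B\<close>)
      have "1 * (norm x)\<^sup>2 \<le> max (1 / c\<^sup>2) 1 * (norm x)\<^sup>2" by (intro mult_right_mono) auto
      then show "1 / c\<^sup>2 + (norm x)\<^sup>2 \<le> max (1 / c\<^sup>2) 1 * (1 + (norm x)\<^sup>2)" by (simp add: distrib_left)
    qed
    also have "(1 / c\<^sup>2) * \<bar>v (c *\<^sub>R x)\<bar>\<^sup>2 = \<bar>(1 / c) * v (c *\<^sub>R x)\<bar>\<^sup>2" by (simp add: power_divide)
    finally have "\<bar>(1 / c) * v (c *\<^sub>R x)\<bar>\<^sup>2 \<le> B * max (1 / c\<^sup>2) 1 * (1 + (norm x)\<^sup>2)" by (simp only: mult.assoc)
    then show ?thesis by (subst pos_divide_le_eq) (auto intro: add_pos_nonneg)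
  qed
  then have "bdd_above ((\<lambda>x. \<bar>(1 / c) * v (c *\<^sub>R x)\<bar>\<^sup>2 / (1 + (norm x)\<^sup>2)) ` positive_orthant)"
    by (rule bdd_aboveI2)
  moreover have "continuous_on positive_orthant (\<lambda>x. (1 / c) * v (c *\<^sub>R x))"
    by (intro continuous_intros continuous_on_compose2[OF vc]) (use sc in auto)
  ultimately show ?thesis
    unfolding eq A_plus_def using v0 sc c by auto
qed

text \<open>The growth bound survives with the same constant because s^2 (1 + (k / s)^2) = s^2 +
  k^2.\<close>

lemma A_plus_homogeneous:
  assumes g: "(g :: real \<Rightarrow> real) \<in> A_plus"
  shows "(\<lambda>(s, k). s * g (k / s)) \<in> A_plus"
proof -
  have gc: "continuous_on {0<..} g" and g0: "\<And>x. 0 < x \<Longrightarrow> 0 \<le> g x"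
    using g by (auto simp: A_plus_def positive_orthant_real)
  obtain B where B: "\<And>x. 0 < x \<Longrightarrow> \<bar>g x\<bar>\<^sup>2 / (1 + (norm x)\<^sup>2) \<le> B"
    using g by (auto simp: A_plus_def bdd_above_def positive_orthant_real)
  have "0 \<le> B" using order_trans[OF _ B[of 1]] by auto
  have bound: "\<bar>s * g (k / s)\<bar>\<^sup>2 / (1 + (norm (s, k))\<^sup>2) \<le> B" if "0 < s" "0 < k" for s k
  proof -
    have "\<bar>g (k / s)\<bar>\<^sup>2 \<le> B * (1 + (k / s)\<^sup>2)" using B[of "k / s"] that by (simp add: divide_le_eq add_pos_nonneg)
    then have "s\<^sup>2 * \<bar>g (k / s)\<bar>\<^sup>2 \<le> s\<^sup>2 * (B * (1 + (k / s)\<^sup>2))" by (intro mult_left_mono) auto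
    also have "\<dots> = B * (s\<^sup>2 + k\<^sup>2)" using that by (simp add: field_simps power_divide)
    also have "\<dots> \<le> B * (1 + (s\<^sup>2 + k\<^sup>2))" using \<open>0 \<le> B\<close> by (intro mult_left_mono) auto
    finally show ?thesis by (simp add: norm_Pair divide_le_eq add_pos_nonneg power_mult_distrib)
  qed
  have "continuous_on positive_orthant (\<lambda>x. fst x * g (snd x / fst x))"
    by (intro continuous_intros continuous_on_compose2[OF gc]) (auto simp: positive_orthant_pair)
  moreover have "(\<lambda>(s, k). s * g (k / s)) = (\<lambda>x. fst x * g (snd x / fst x))" by auto
  ultimately have "continuous_on positive_orthant (\<lambda>(s, k). s * g (k / s))" by simp
  moreover have "bdd_above ((\<lambda>x. \<bar>(\<lambda>(s, k). s * g (k / s)) x\<bar>\<^sup>2 / (1 + (norm x)\<^sup>2)) ` positive_orthant)"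
    using bound by (intro bdd_aboveI[of _ B]) (auto simp: positive_orthant_pair)
  ultimately show ?thesis unfolding A_plus_def using g0 by (auto simp: positive_orthant_pair)
qed

text \<open>The squared norm of \<open>(1, z)\<close> is 1 + z^2, and 1 + (1 + z^2) <= 2 (1 + z^2)
  yields the constant \<open>2 * B\<close>.\<close>

lemma A_plus_section:
  assumes v: "(v :: real \<times> real \<Rightarrow> real) \<in> A_plus" and u: "\<And>z. 0 < z \<Longrightarrow> u z = v (1, z)"
  shows "u \<in> A_plus"
proof -
  have vc: "continuous_on positive_orthant v" and v0: "\<And>x. x \<in> positive_orthant \<Longrightarrow> 0 \<le> v x"
    using v by (auto simp: A_plus_def)
  obtain B where B: "\<And>x. x \<in> positive_orthant \<Longrightarrow> \<bar>v x\<bar>\<^sup>2 / (1 + (norm x)\<^sup>2) \<le> B"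
    using v by (auto simp: A_plus_def bdd_above_def)
  have "0 \<le> B" using order_trans[OF _ B[of "(1, 1)"]] by (auto simp: positive_orthant_pair)
  have "continuous_on {0<..} (\<lambda>z. v (1, z))"
    by (intro continuous_on_compose2[OF vc] continuous_intros) (auto simp: positive_orthant_pair)
  then have "continuous_on {0<..} u" by (rule continuous_on_eq) (simp add: u)
  moreover have "\<bar>u z\<bar>\<^sup>2 / (1 + (norm z)\<^sup>2) \<le> 2 * B" if z: "0 < z" for z
  proof -
    have "\<bar>v (1, z)\<bar>\<^sup>2 \<le> B * (1 + (1 + z\<^sup>2))"
      using B[of "(1, z)"] z by (simp add: positive_orthant_pair norm_Pair divide_le_eq add_pos_nonneg)
    also have "\<dots> \<le> B * (2 * (1 + z\<^sup>2))" using \<open>0 \<le> B\<close> by (intro mult_left_mono) auto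
    also have "\<dots> = 2 * B * (1 + z\<^sup>2)" by (simp add: algebra_simps)
    finally show ?thesis using z pos_divide_le_eq[of "1 + z\<^sup>2" "(v (1, z))\<^sup>2" "2 * B"] by (simp add: u add_pos_nonneg)
  qed
  ultimately show ?thesis
    unfolding A_plus_def using v0 u by (auto simp: positive_orthant_real positive_orthant_pair bdd_above_def)
qed

section \<open>Reduction to one dimension\<close>

theorem proposition4p4:
  fixes M :: "'a measure" and B1 B2 W Bt :: "real \<Rightarrow> 'a \<Rightarrow> real"
    and \<FF> :: "ennreal \<Rightarrow> 'a measure"
    and \<mu>\<^sub>1 \<mu>\<^sub>2 \<sigma>\<^sub>1 \<sigma>\<^sub>2 \<nu> p r \<beta>\<^sub>1 \<beta>\<^sub>2 :: real and F :: "real \<Rightarrow> real"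
    and S K Z :: "real \<Rightarrow> real \<Rightarrow> 'a \<Rightarrow> real"
    and v :: "real \<times> real \<Rightarrow> real" and u :: "real \<Rightarrow> real"
  assumes "prob_space M"
    and "brownian_motion M B1" and "brownian_motion M B2" and "independent_processes M B1 B2"
    and \<FF>_def: "\<FF> = completed_filtration M B1 B2"
    and "0 < \<sigma>\<^sub>1" and "0 < \<sigma>\<^sub>2" and "-1 \<le> \<nu>" and "\<nu> \<le> 1" and "0 < p" and "p < 1"
    and "0 < r" and "r > \<mu>\<^sub>1 + \<sigma>\<^sub>1\<^sup>2 / 2" and "r > \<mu>\<^sub>2 + \<sigma>\<^sub>2\<^sup>2 / 2"
    and F_cdf: "\<exists>D. real_distribution D \<and> measure D {..<0} = 0 \<and> F = cdf D"
    and S_sde: "\<And>s. 0 < s \<Longrightarrow>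
          solves_SDE M \<FF> B1 (\<lambda>x. \<mu>\<^sub>1 * x) (\<lambda>x. \<sigma>\<^sub>1 * x) s (S s)"
    and W_def: "W = (\<lambda>t \<omega>. \<nu> * B1 t \<omega> + sqrt (1 - \<nu>\<^sup>2) * B2 t \<omega>)"
    and K_sde: "\<And>k. 0 < k \<Longrightarrow>
          solves_SDE M \<FF> W (\<lambda>x. \<mu>\<^sub>2 * x) (\<lambda>x. \<sigma>\<^sub>2 * x) k (K k)"
    and v_class: "v \<in> A_plus"
    and v_fixed: "\<And>s k. 0 < s \<Longrightarrow> 0 < k \<Longrightarrow> ennreal (v (s, k)) = Gamma_op M \<FF> F p r S K v (s, k)"
    and v_unique: "\<And>w. w \<in> A_plus \<Longrightarrow>
          (\<And>s k. 0 < s \<Longrightarrow> 0 < k \<Longrightarrow> ennreal (w (s, k)) = Gamma_op M \<FF> F p r S K w (s, k)) \<Longrightarrow>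
          (\<And>s k. 0 < s \<Longrightarrow> 0 < k \<Longrightarrow> w (s, k) = v (s, k))"
    and \<beta>\<^sub>1_def: "\<beta>\<^sub>1 = \<sigma>\<^sub>2 * \<nu> - \<sigma>\<^sub>1" and \<beta>\<^sub>2_def: "\<beta>\<^sub>2 = \<sigma>\<^sub>2 * sqrt (1 - \<nu>\<^sup>2)"
    and "\<beta>\<^sub>1\<^sup>2 + \<beta>\<^sub>2\<^sup>2 > 0"
    and Bt_def: "Bt = (\<lambda>t \<omega>. (\<beta>\<^sub>1 * B1 t \<omega> + \<beta>\<^sub>2 * B2 t \<omega>) / sqrt (\<beta>\<^sub>1\<^sup>2 + \<beta>\<^sub>2\<^sup>2))"
    and Z_sde: "\<And>z. 0 < z \<Longrightarrow>
          solves_SDE M \<FF> Bt (\<lambda>x. (\<mu>\<^sub>2 - \<mu>\<^sub>1) * x) (\<lambda>x. sqrt (\<beta>\<^sub>1\<^sup>2 + \<beta>\<^sub>2\<^sup>2) * x) z (Z z)"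
    and u_def: "\<And>k s. 0 < k \<Longrightarrow> 0 < s \<Longrightarrow> u (k / s) = v (1, k / s)"
  shows "u \<in> A_plus \<and>
         (\<forall>z>0. ennreal (u z) = Gamma_tilde_op M \<FF> F p r \<mu>\<^sub>1 Z u z) \<and>
         (\<forall>g\<in>A_plus. (\<forall>z>0. ennreal (g z) = Gamma_tilde_op M \<FF> F p r \<mu>\<^sub>1 Z g z) \<longrightarrow>
            (\<forall>z>0. g z = u z))"
proof -
  interpret bm_pair M B1 B2
    using assms(1-4) by (simp add: bm_pair_def bm_pair_axioms_def)
  have nu: "\<nu>\<^sup>2 \<le> 1" using \<open>-1 \<le> \<nu>\<close> \<open>\<nu> \<le> 1\<close> by (simp add: abs_square_le_1)
  interpret exchange_reward M B1 B2 \<mu>\<^sub>1 \<mu>\<^sub>2 \<sigma>\<^sub>1 \<sigma>\<^sub>2 \<nu> r p F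
    by unfold_locales (use nu \<open>0 < p\<close> \<open>p < 1\<close> F_cdf in auto)
  let ?c = "sqrt (\<beta>\<^sub>1\<^sup>2 + \<beta>\<^sub>2\<^sup>2)"
  have b: "b1 = \<beta>\<^sub>1" "b2 = \<beta>\<^sub>2" by (simp_all add: b1_def b2_def \<beta>\<^sub>1_def \<beta>\<^sub>2_def)
  have c: "0 < ?c" "?c\<^sup>2 = \<beta>\<^sub>1\<^sup>2 + \<beta>\<^sub>2\<^sup>2" using \<open>\<beta>\<^sub>1\<^sup>2 + \<beta>\<^sub>2\<^sup>2 > 0\<close> by auto
  have bmB: "filtered_bm N FF B1" using filtered_bm_combination[of 1 0] by simp
  have bmW: "filtered_bm N FF W" unfolding W_def by (rule filtered_bm_combination) (use nu in simp)
  \<comment> \<open>Normalising \<open>\<beta>\<^sub>1\<close> and \<open>\<beta>\<^sub>2\<close> to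
    a unit vector makes \<open>Bt\<close> an instance of
    \<open>filtered_bm_combination\<close>.\<close>
  have "(\<lambda>t \<omega>. \<beta>\<^sub>1 / ?c * B1 t \<omega> + \<beta>\<^sub>2 / ?c * B2 t \<omega>) = Bt"
    unfolding Bt_def by (simp add: add_divide_distrib)
  moreover have "(\<beta>\<^sub>1 / ?c)\<^sup>2 + (\<beta>\<^sub>2 / ?c)\<^sup>2 = 1"
    unfolding power_divide add_divide_distrib[symmetric] c(2) using \<open>\<beta>\<^sub>1\<^sup>2 + \<beta>\<^sub>2\<^sup>2 > 0\<close>
      by (intro divide_self) linarith
  ultimately have bmZ: "filtered_bm N FF Bt" using filtered_bm_combination[of "\<beta>\<^sub>1 / ?c" "\<beta>\<^sub>2 / ?c"] by simp
  have Bt: "?c * Bt t \<omega> = b1 * B1 t \<omega> + b2 * B2 t \<omega>" for t \<omega>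
    using c(1) by (simp add: Bt_def b)
  interpret exchange_solution M B1 B2 \<mu>\<^sub>1 \<mu>\<^sub>2 \<sigma>\<^sub>1 \<sigma>\<^sub>2 \<nu> r p F S K Z
  proof
    show "AE \<omega> in N. \<forall>t\<ge>0. S s t \<omega> = Sx s t \<omega>" if "0 < s" for s
      using linear_SDE_explicit[OF bmB S_sde[OF that, unfolded \<FF>_def]] by (simp add: Sx_def)
    show "AE \<omega> in N. \<forall>t\<ge>0. K k t \<omega> = Kx k t \<omega>" if "0 < k" for k
      using linear_SDE_explicit[OF bmW K_sde[OF that, unfolded \<FF>_def]] by (simp add: Kx_def W_def)
    show "AE \<omega> in N. \<forall>t\<ge>0. Z z t \<omega> = Zx z t \<omega>" if "0 < z" for z
      using linear_SDE_explicit[OF bmZ Z_sde[OF that, unfolded \<FF>_def]] unfolding Bt c(2) Zx_def drift_def b by simp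
  qed
  have u: "u z = v (1, z)" if "0 < z" for z using u_def[of z 1] that by simp
  have uA: "u \<in> A_plus" by (rule A_plus_section[OF v_class u])
  have hom: "v (s, k) = s * u (k / s)" if sk: "0 < s" "0 < k" for s k
  proof -
    \<comment> \<open>Scaling by \<open>1 / s\<close> carries \<open>(s, k)\<close> to
      \<open>(1, k / s)\<close>. The scaled function is again a fixed point, so uniqueness
      identifies it with \<open>v\<close>; at \<open>(s, k)\<close> this is the claimed
      homogeneity.\<close>
    let ?w = "\<lambda>(x, y). (1 / (1 / s)) * v ((1 / s) * x, (1 / s) * y)"
    have s: "0 < 1 / s" using sk by simp
    have "?w (s, k) = v (s, k)"
    proof (rule v_unique[OF A_plus_pair_scale[OF v_class s] _ sk])
      fix x y :: real assume xy: "0 < x" "0 < y"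
      then have pos: "0 < (1 / s) * x" "0 < (1 / s) * y" using s by auto
      show "ennreal (?w (x, y)) = Gamma_op M \<FF> F p r S K ?w (x, y)"
        unfolding \<FF>_def Gamma_op_scale[OF s xy] v_fixed[OF pos, unfolded \<FF>_def, symmetric] prod.case
        by (rule ennreal_mult') (use sk in simp)
    qed
    then show ?thesis using sk u[of "k / s"] by simp
  qed
  have nonneg: "continuous_on {0<..} g" "\<And>z. 0 < z \<Longrightarrow> 0 \<le> g z" if "g \<in> A_plus" for g :: "real \<Rightarrow> real"
    using that by (auto simp: A_plus_def positive_orthant_real)
  \<comment> \<open>The two-dimensional fixed point equation read at \<open>s = 1\<close>;
    \<open>hom\<close> is what makes \<open>Gamma_op_eq\<close> applicable to
    \<open>v\<close>.\<close>
  have "ennreal (u z) = Gamma_tilde_op M \<FF> F p r \<mu>\<^sub>1 Z u z" if z: "0 < z" for z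
    using Gamma_op_eq[OF nonneg[OF uA] hom, of 1 z] v_fixed[of 1 z] z u[OF z] by (simp add: \<FF>_def)
  moreover have "g z = u z"
    if g: "g \<in> A_plus" "\<forall>z>0. ennreal (g z) = Gamma_tilde_op M \<FF> F p r \<mu>\<^sub>1 Z g z" and z: "0 < z" for g z
  proof -
    \<comment> \<open>The homogeneous lift of \<open>g\<close> is a fixed point in two dimensions,
      so it equals \<open>v\<close>; restricting to \<open>s = 1\<close> gives back \<open>g\<close>
      and \<open>u\<close>.\<close>
    let ?w = "\<lambda>(s, k). s * g (k / s)"
    have "?w (1, z) = v (1, z)"
    proof (rule v_unique[OF A_plus_homogeneous[OF g(1)]])
      fix s k :: real assume sk: "0 < s" "0 < k"
      have "Gamma_op M \<FF> F p r S K ?w (s, k) = ennreal s * ennreal (g (k / s))"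
        using Gamma_op_eq[OF nonneg[OF g(1)], of ?w s k] sk g(2) by (simp add: \<FF>_def)
      then show "ennreal (?w (s, k)) = Gamma_op M \<FF> F p r S K ?w (s, k)"
        using sk by (simp add: ennreal_mult')
    qed (use z in auto)
    then show ?thesis using u[OF z] by simp
  qed
  ultimately show ?thesis using uA by blast
qed

end
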